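(* Let $d\in\{2,3\}$ and $m\in(d-6,d]$. Let $D\subset\mathbb R^d$ be a bounded domain and let $f$ be a centered microlocally isotropic Gaussian random field of order $-m$ in $D$ with strength $\mu$. Let $U\subset\mathbb R^d$ be a bounded domain with $\mathrm{dist}(D,U)=r_0>0$. For $k>0$ let $u(\cdot;k)$ be the solution (in the distribution sense) of $$\Delta^2u-k^4u=f\quad\text{in }\mathbb R^d,\qquad \lim_{r\to\infty}r^{\frac{d-1}2}\left(\partial_r u-\mathrm iku\right)=\lim_{r\to\infty}r^{\frac{d-1}2}\left(\partial_r\Delta u-\mathrm ik\Delta u\right)=0,\quad r=|x|.$$ Then for any $x\in U$ it holds almost surely that $$\lim_{T\to\infty}\frac1T\int_T^{2T}k^{m+7-d}|u(x;k)|^2\,dk=\frac1{16(2\pi)^{d-1}}\int_D\frac1{|x-\zeta|^{d-1}}\mu(\zeta)\,d\zeta=:T_d(x).$$ Moreover, the strength $\mu$ is uniquely determined by the data $\{T_d(x)\}_{x\in U}$; that is, if two strengths $\mu_1,\mu_2$ (nonnegative functions in $C_0^\infty(D)$) give the same function $T_d$ on $U$, then $\mu_1=\mu_2$.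
   Context: Microlocally isotropic Gaussian random field: a real-valued Gaussian random field $f$ (a random distribution, supported in $\overline D$) is microlocally isotropic of order $-m$ in $D$ if its covariance operator $\mathcal Q_f$, defined for centered $f$ by $\langle\mathcal Q_f\varphi,\psi\rangle=\mathbb E[\langle f,\varphi\rangle\langle f,\psi\rangle]$ for test functions $\varphi,\psi\in C_0^\infty(\mathbb R^d)$, is a classical pseudo-differential operator $$(\mathcal Q_f\varphi)(x)=\frac1{(2\pi)^d}\int_{\mathbb R^d}e^{\mathrm ix\cdot\xi}\sigma(x,\xi)\hat\varphi(\xi)\,d\xi,$$ with symbol $\sigma\in S^{-m}(\mathbb R^d\times\mathbb R^d)$, i.e. $\sigma\in C^\infty$ and $|\partial_\xi^\alpha\partial_x^\beta\sigma(x,\xi)|\le C_{\alpha,\beta}(1+|\xi|)^{-m-|\alpha|}$ for all multi-indices $\alpha,\beta$, whose principal symbol is $\mu(x)|\xi|^{-m}$ with $\mu\in C_0^\infty(D)$, $\mu\ge0$. The function $\mu$ is called the strength of $f$. Solution: for $x\notin\overline D$ the solution is given pointwise by $u(x;k)=-\int_D\Phi(x,y,k)f(y)\,dy$ (the pairing of the distribution $f$ with $\Phi(x,\cdot,k)$, which is smooth near $\overline D$), where $\Phi$ is the outgoing fundamental solution with $(\Delta^2-k^4)\Phi(\cdot,y,k)=-\delta(\cdot-y)$, namely $$\Phi(x,y,k)=-\frac{\mathrm i}{8k^2}\left(H_0^{(1)}(k|x-y|)-H_0^{(1)}(\mathrm ik|x-y|)\right)\ (d=2),\qquad \Phi(x,y,k)=-\frac{1}{8\pi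 k^2|x-y|}\left(e^{\mathrm ik|x-y|}-e^{-k|x-y|}\right)\ (d=3),$$ and $H_0^{(1)}$ is the Hankel function of the first kind of order $0$. *)

theory Defs
  imports "HOL-Probability.Probability"
begin

subsection \<open>Smooth functions, test functions and distributions\<close>

definition dir_deriv :: "'a::real_normed_vector \<Rightarrow> ('a \<Rightarrow> 'b::real_normed_vector) \<Rightarrow> 'a \<Rightarrow> 'b" where
  "dir_deriv v g = (\<lambda>x. frechet_derivative g (at x) v)"

text \<open>Multi-indices are lists of basis vectors; the order of the derivative is the length of the list.\<close>

definition iter_deriv :: "'a::real_normed_vector list \<Rightarrow> ('a \<Rightarrow> 'b::real_normed_vector) \<Rightarrow> 'a \<Rightarrow> 'b" where
  "iter_deriv bs g = foldr dir_deriv bs g"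

definition smooth_on :: "'a::euclidean_space set \<Rightarrow> ('a \<Rightarrow> 'b::real_normed_vector) \<Rightarrow> bool" where
  "smooth_on S g \<longleftrightarrow> (\<forall>bs. set bs \<subseteq> Basis \<longrightarrow> (\<forall>x\<in>S. iter_deriv bs g differentiable (at x)))"

definition laplacian :: "('a::euclidean_space \<Rightarrow> 'b::real_normed_vector) \<Rightarrow> 'a \<Rightarrow> 'b" where
  "laplacian g x = (\<Sum>b\<in>Basis. iter_deriv [b, b] g x)"

definition supp :: "('a::topological_space \<Rightarrow> 'b::zero) \<Rightarrow> 'a set" where
  "supp g = closure {x. g x \<noteq> 0}"

text \<open>\<open>test_fun D\<close> is the space of real functions of class \<open>C\<^sub>0\<^sup>\<infinity>(D)\<close>, extended by zero outside \<open>D\<close>.\<close>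

definition test_fun :: "'a::euclidean_space set \<Rightarrow> ('a \<Rightarrow> real) set" where
  "test_fun D = {\<phi>. smooth_on UNIV \<phi> \<and> compact (supp \<phi>) \<and> supp \<phi> \<subseteq> D}"

text \<open>Distributions on the whole space, given by their values on real test functions. With values in
  \<open>real\<close> these are the real distributions; with values in \<open>complex\<close> they are the complex distributions,
  whose complex linear extension to complex test functions is unique.\<close>

definition distribution :: "(('a::euclidean_space \<Rightarrow> real) \<Rightarrow> 'b::real_normed_vector) \<Rightarrow> bool" where
  "distribution F \<longleftrightarrow>
     (\<forall>\<phi>\<in>test_fun UNIV. \<forall>\<psi>\<in>test_fun UNIV. \<forall>a b.
        F (\<lambda>x. a * \<phi> x + b * \<psi> x) = a *\<^sub>R F \<phi> + b *\<^sub>R F \<psi>) \<and>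
     (\<forall>K. compact K \<longrightarrow> (\<exists>C N. \<forall>\<phi>\<in>test_fun UNIV. supp \<phi> \<subseteq> K \<longrightarrow>
        (\<forall>B. (\<forall>bs x. set bs \<subseteq> Basis \<and> length bs \<le> N \<longrightarrow> \<bar>iter_deriv bs \<phi> x\<bar> \<le> B)
             \<longrightarrow> norm (F \<phi>) \<le> C * B)))"

definition distribution_supported_in ::
  "'a::euclidean_space set \<Rightarrow> (('a \<Rightarrow> real) \<Rightarrow> 'b::real_normed_vector) \<Rightarrow> bool" where
  "distribution_supported_in K F \<longleftrightarrow> (\<forall>\<phi>\<in>test_fun UNIV. supp \<phi> \<inter> K = {} \<longrightarrow> F \<phi> = 0)"

text \<open>Pairing of a real distribution supported in the compact set \<open>K\<close> with a complex function \<open>g\<close> that is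
  smooth near \<open>K\<close>: \<open>g\<close> is first multiplied by a cutoff that equals 1 near \<open>K\<close> and is supported where
  \<open>g\<close> is smooth. The value does not depend on the cutoff.\<close>

definition is_cutoff :: "'a::euclidean_space set \<Rightarrow> ('a \<Rightarrow> complex) \<Rightarrow> ('a \<Rightarrow> real) \<Rightarrow> bool" where
  "is_cutoff K g h \<longleftrightarrow>
     (\<exists>S. open S \<and> smooth_on S g \<and> h \<in> test_fun S) \<and>
     (\<exists>V. open V \<and> K \<subseteq> V \<and> (\<forall>y\<in>V. h y = 1))"

definition pairing ::
  "'a::euclidean_space set \<Rightarrow> (('a \<Rightarrow> real) \<Rightarrow> real) \<Rightarrow> ('a \<Rightarrow> complex) \<Rightarrow> complex" where
  "pairing K F g = (let h = (SOME h. is_cutoff K g h)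
     in Complex (F (\<lambda>y. h y * Re (g y))) (F (\<lambda>y. h y * Im (g y))))"

subsection \<open>Classical symbols and pseudo-differential operators\<close>

text \<open>The symbol estimates of order \<open>s\<close>, for frequencies in \<open>\<Xi>\<close>; an argument of a symbol is the
  pair \<open>(x, \<xi>)\<close>, and \<open>as\<close> and \<open>bs\<close> are the multi-indices in \<open>\<xi>\<close> and in \<open>x\<close>.\<close>

definition symbol_bounds :: "'a::euclidean_space set \<Rightarrow> real \<Rightarrow> ('a \<times> 'a \<Rightarrow> complex) \<Rightarrow> bool" where
  "symbol_bounds \<Xi> s \<sigma> \<longleftrightarrow>
     (\<forall>as bs. set as \<subseteq> Basis \<and> set bs \<subseteq> Basis \<longrightarrow>
       (\<exists>C. \<forall>x. \<forall>\<xi>\<in>\<Xi>.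
          norm (iter_deriv (map (\<lambda>b. (0, b)) as @ map (\<lambda>b. (b, 0)) bs) \<sigma> (x, \<xi>))
            \<le> C * (1 + norm \<xi>) powr (s - real (length as))))"

definition symbol_class :: "real \<Rightarrow> ('a::euclidean_space \<times> 'a \<Rightarrow> complex) set" where
  "symbol_class s = {\<sigma>. smooth_on UNIV \<sigma> \<and> symbol_bounds UNIV s \<sigma>}"

text \<open>Classical (polyhomogeneous) symbols of order \<open>s\<close> with principal symbol \<open>p\<close>: there is an asymptotic
  expansion in terms \<open>a j\<close> positively homogeneous of degree \<open>s - j\<close> in \<open>\<xi>\<close>, with leading term \<open>p\<close>.
  Estimating the remainders for \<open>|\<xi>| \<ge> 1\<close> only replaces the usual excision of the singularity
  of \<open>a j\<close> at \<open>\<xi> = 0\<close>.\<close>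

definition classical_symbol ::
  "real \<Rightarrow> ('a::euclidean_space \<times> 'a \<Rightarrow> complex) \<Rightarrow> ('a \<times> 'a \<Rightarrow> complex) \<Rightarrow> bool" where
  "classical_symbol s p \<sigma> \<longleftrightarrow>
     \<sigma> \<in> symbol_class s \<and>
     (\<exists>a :: nat \<Rightarrow> 'a \<times> 'a \<Rightarrow> complex.
        (\<forall>j. smooth_on {(x, \<xi>). \<xi> \<noteq> 0} (a j)) \<and>
        (\<forall>j x \<xi> t. \<xi> \<noteq> 0 \<and> t > 0 \<longrightarrow>
           a j (x, t *\<^sub>R \<xi>) = complex_of_real (t powr (s - real j)) * a j (x, \<xi>)) \<and>
        (\<forall>N. symbol_bounds {\<xi>. 1 \<le> norm \<xi>} (s - real N) (\<lambda>z. \<sigma> z - (\<Sum>j<N. a j z))) \<and>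
        (\<forall>x \<xi>. \<xi> \<noteq> 0 \<longrightarrow> a 0 (x, \<xi>) = p (x, \<xi>)))"

definition fourier :: "('a::euclidean_space \<Rightarrow> real) \<Rightarrow> 'a \<Rightarrow> complex" where
  "fourier \<phi> \<xi> = (LINT x|lborel. exp (- \<i> * complex_of_real (x \<bullet> \<xi>)) * complex_of_real (\<phi> x))"

definition psido :: "('a::euclidean_space \<times> 'a \<Rightarrow> complex) \<Rightarrow> ('a \<Rightarrow> real) \<Rightarrow> 'a \<Rightarrow> complex" where
  "psido \<sigma> \<phi> x = complex_of_real (1 / (2 * pi) ^ DIM('a)) *
     (LINT \<xi>|lborel. exp (\<i> * complex_of_real (x \<bullet> \<xi>)) * \<sigma> (x, \<xi>) * fourier \<phi> \<xi>)"

subsection \<open>Microlocally isotropic Gaussian random fields\<close>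

text \<open>Constants count as (degenerate) Gaussian random variables.\<close>

definition gaussian_rv :: "'w measure \<Rightarrow> ('w \<Rightarrow> real) \<Rightarrow> bool" where
  "gaussian_rv M X \<longleftrightarrow> X \<in> borel_measurable M \<and>
     ((\<exists>c s. s > 0 \<and> distributed M lborel X (\<lambda>t. ennreal (normal_density c s t))) \<or>
      (\<exists>c. AE \<omega> in M. X \<omega> = c))"

text \<open>Every realization is a distribution, so a finite linear combination of pairings with test functions
  is again such a pairing; hence the Gaussian law of single pairings gives that of finite families.\<close>

definition gaussian_random_field ::
  "'w measure \<Rightarrow> ('w \<Rightarrow> ('a::euclidean_space \<Rightarrow> real) \<Rightarrow> real) \<Rightarrow> bool" where
  "gaussian_random_field M f \<longleftrightarrow> prob_space M \<and>
     (\<forall>\<omega>\<in>space M. distribution (f \<omega>)) \<and>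
     (\<forall>\<phi>\<in>test_fun UNIV. gaussian_rv M (\<lambda>\<omega>. f \<omega> \<phi>))"

definition centered_field ::
  "'w measure \<Rightarrow> ('w \<Rightarrow> ('a::euclidean_space \<Rightarrow> real) \<Rightarrow> real) \<Rightarrow> bool" where
  "centered_field M f \<longleftrightarrow> (\<forall>\<phi>\<in>test_fun UNIV. (LINT \<omega>|M. f \<omega> \<phi>) = 0)"

definition is_strength :: "'a::euclidean_space set \<Rightarrow> ('a \<Rightarrow> real) \<Rightarrow> bool" where
  "is_strength D \<mu> \<longleftrightarrow> \<mu> \<in> test_fun D \<and> (\<forall>x. 0 \<le> \<mu> x)"

text \<open>Centered fields, microlocally isotropic of order \<open>s\<close> (so \<open>s = - m\<close> in the usual notation).\<close>

definition centered_microlocally_isotropic ::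
  "'w measure \<Rightarrow> 'a::euclidean_space set \<Rightarrow> real \<Rightarrow> ('a \<Rightarrow> real) \<Rightarrow>
     ('w \<Rightarrow> ('a \<Rightarrow> real) \<Rightarrow> real) \<Rightarrow> bool" where
  "centered_microlocally_isotropic M D s \<mu> f \<longleftrightarrow>
     gaussian_random_field M f \<and> centered_field M f \<and>
     (\<forall>\<omega>\<in>space M. distribution_supported_in (closure D) (f \<omega>)) \<and>
     is_strength D \<mu> \<and>
     (\<exists>\<sigma>. classical_symbol s (\<lambda>(x, \<xi>). complex_of_real (\<mu> x * norm \<xi> powr s)) \<sigma> \<and>
        (\<forall>\<phi>\<in>test_fun UNIV. \<forall>\<psi>\<in>test_fun UNIV.
           complex_of_real (LINT \<omega>|M. f \<omega> \<phi> * f \<omega> \<psi>) =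
             (LINT x|lborel. psido \<sigma> \<phi> x * complex_of_real (\<psi> x))))"

subsection \<open>The outgoing fundamental solution\<close>

text \<open>\<open>J\<^sub>0\<close>, \<open>Y\<^sub>0\<close> and \<open>H\<^sub>0\<^sup>(\<^sup>1\<^sup>)\<close> through their power series, on the principal branch.\<close>

definition bessel_J0 :: "complex \<Rightarrow> complex" where
  "bessel_J0 z = (\<Sum>n. (-1) ^ n / (fact n)\<^sup>2 * (z / 2) ^ (2 * n))"

definition bessel_Y0 :: "complex \<Rightarrow> complex" where
  "bessel_Y0 z = 2 / complex_of_real pi *
     ((Ln (z / 2) + euler_mascheroni) * bessel_J0 z
      - (\<Sum>n. (-1) ^ n * harm n / (fact n)\<^sup>2 * (z / 2) ^ (2 * n)))"

definition hankel1_0 :: "complex \<Rightarrow> complex" where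
  "hankel1_0 z = bessel_J0 z + \<i> * bessel_Y0 z"

text \<open>Only dimensions 2 and 3 are meant; the last branch is the three-dimensional formula.\<close>

definition fund_sol :: "real \<Rightarrow> 'a::euclidean_space \<Rightarrow> 'a \<Rightarrow> complex" where
  "fund_sol k x y = (let r = norm (x - y) in
     if DIM('a) = 2
     then - (\<i> / complex_of_real (8 * k\<^sup>2)) *
            (hankel1_0 (complex_of_real (k * r)) - hankel1_0 (\<i> * complex_of_real (k * r)))
     else - (1 / complex_of_real (8 * pi * k\<^sup>2 * r)) *
            (exp (\<i> * complex_of_real (k * r)) - exp (- complex_of_real (k * r))))"

subsection \<open>The outgoing solution of the biharmonic wave equation\<close>

definition radiating :: "real \<Rightarrow> ('a::euclidean_space \<Rightarrow> complex) \<Rightarrow> bool" where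
  "radiating k v \<longleftrightarrow>
     ((\<lambda>x. complex_of_real (norm x powr ((real DIM('a) - 1) / 2)) *
           (dir_deriv (sgn x) v x - \<i> * complex_of_real k * v x)) \<longlongrightarrow> 0) at_infinity"

text \<open>\<open>T\<close> is the solution as a distribution on the whole space; \<open>u\<close> is the smooth function that represents
  it outside \<open>closure D\<close>. The pointwise values of \<open>u\<close> there are those of the volume potential. The radial
  derivative at \<open>x\<close> is the derivative in the direction \<open>sgn x = x / |x|\<close>.\<close>

definition outgoing_solution ::
  "'a::euclidean_space set \<Rightarrow> (('a \<Rightarrow> real) \<Rightarrow> real) \<Rightarrow> real \<Rightarrow>
     (('a \<Rightarrow> real) \<Rightarrow> complex) \<Rightarrow> ('a \<Rightarrow> complex) \<Rightarrow> bool" where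
  "outgoing_solution D F k T u \<longleftrightarrow>
     distribution T \<and>
     (\<forall>\<phi>\<in>test_fun UNIV.
        T (laplacian (laplacian \<phi>)) - complex_of_real (k ^ 4) * T \<phi> = complex_of_real (F \<phi>)) \<and>
     smooth_on (- closure D) u \<and>
     (\<forall>\<phi>\<in>test_fun (- closure D). T \<phi> = (LINT x|lborel. complex_of_real (\<phi> x) * u x)) \<and>
     radiating k u \<and> radiating k (laplacian u) \<and>
     (\<forall>x. x \<notin> closure D \<longrightarrow> u x = - pairing (closure D) F (\<lambda>y. fund_sol k x y))"

definition bounded_domain :: "'a::euclidean_space set \<Rightarrow> bool" where
  "bounded_domain D \<longleftrightarrow> open D \<and> connected D \<and> D \<noteq> {} \<and> bounded D"

definition T_data :: "'a::euclidean_space set \<Rightarrow> ('a \<Rightarrow> real) \<Rightarrow> 'a \<Rightarrow> real" where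
  "T_data D \<mu> x = 1 / (16 * (2 * pi) ^ (DIM('a) - 1)) *
     (LINT \<zeta>:D|lborel. 1 / norm (x - \<zeta>) ^ (DIM('a) - 1) * \<mu> \<zeta>)"

end

(* For x outside the closure of D the fundamental solution factors, up to a power of k, as
   exp(i k |x - y|) times an amplitude whose y-derivatives are bounded uniformly in k.  In the plane
   this rests on the representation of the Hankel function by the integral of
   exp(-w) w^(-1/2) (2 z + w)^(-1/2) over w > 0 (with z = -i k r for the propagating and z = k r for the
   evanescent wave), which is identified with the power series by uniqueness for Bessel's equation.

   Applying the covariance operator to such oscillating test functions needs no stationary phase: the
   principal symbol is isotropic and the phase has unit gradient, so the frequencies of the test
   function concentrate near the sphere |xi| = k, where the symbol is mu(y) k^(-m) up to lower order.
   Hence the rescaled data Y_k satisfy E(Y_k Y_l) = O(1/(1 + |k - l|) + 1/min(k, l)) and the sum of the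
   variances of their real and imaginary part tends to T_d(x).  Isserlis' formula bounds the variance of the integral
   of Y^2 over [1, T] by a multiple of T; Borel-Cantelli along T = n^2 and monotonicity in between give
   the almost sure limit of the averages.

   For uniqueness, repeated application of the Laplacian to the potential of g = mu_1 - mu_2 with kernel
   |x - z|^(1 - d) multiplies the kernel by non-zero multiples of |x - z|^(-2), so by density g is
   orthogonal to all functions of |x - z|; Gaussians in |x - z| and differentiation in x give all polynomials. *)
theory Submission
  imports Defs "HOL-Complex_Analysis.Complex_Analysis"
begin

text \<open>All constants must be uniform in k, so smoothness is treated for families
  (\<open>usmooth\<close>) in which wave numbers are indices, with closure rules in place of
  explicit derivatives. The amplitudes are uniformly smooth because \<open>k powr (4 - d)\<close>
  times Phi is a function of t = k r alone, r = |x - y|, built from functions whose n-th derivative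
  is O(t^(- p - n)), p = (d - 1) / 2: the k^n of the chain rule cancels. The evanescent part joins
  the same amplitude with the factor exp(- (1 + i) k r). The constant 1 / (16 (2 pi)^(d - 1)) is the
  square of the limit of t^p times the modulus of the propagating amplitude; the exponent m + 7 - d
  is m + 2 (p + 4 - d). Isserlis' formula is applied to real variables, so real and imaginary part
  are separate processes, and their variances are added because |exp(i k r)| = 1 then removes the
  oscillation. Realizations are only distributions: continuity in k, on which joint measurability
  rests, comes from Lipschitz bounds in the test function seminorms.\<close>

abbreviation cor :: "real \<Rightarrow> complex" where "cor \<equiv> complex_of_real"
abbreviation ei :: "real => complex" where "ei r \<equiv> exp (\<i> * complex_of_real r)"
abbreviation nnl (binder "NN " 10) where "nnl f \<equiv> nn_integral lborel f"

subsection \<open>Iterated derivatives\<close>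

lemma iter_deriv_Nil [simp]: "iter_deriv [] g = g"
 by (simp add: iter_deriv_def)

lemma iter_deriv_Cons: "iter_deriv (b # bs) g = dir_deriv b (iter_deriv bs g)"
 by (simp add: iter_deriv_def)

lemma iter_deriv_append: "iter_deriv (as @ bs) g = iter_deriv as (iter_deriv bs g)"
 by (simp add: iter_deriv_def)

lemma dir_deriv_eqI: "(g has_derivative g') (at x) ==> dir_deriv v g x = g' v"
 by (simp add: dir_deriv_def frechet_derivative_at[symmetric])

lemma has_derivative_dir_deriv:
 "g differentiable (at x) ==> (g has_derivative (\<lambda>v. dir_deriv v g x)) (at x)"
 by (simp add: dir_deriv_def frechet_derivative_works)

text \<open>\<open>frechet_derivative\<close> picks one among all derivatives at x. Two functions
  that agree near x have the same derivatives there, or both have none, so the choice is the same;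
  this keeps the rule free of side conditions when derivatives are iterated.\<close>

lemma dir_deriv_cong_open:
 assumes "open S" "x \<in> S" "\<And>y. y \<in> S ==> f y = g y"
 shows "dir_deriv v f x = dir_deriv v g x"
proof -
 have "(f has_derivative D) (at x) \<longleftrightarrow> (g has_derivative D) (at x)" for D
  using has_derivative_transform_within_open[OF _ assms(1,2), of f D UNIV g]
   has_derivative_transform_within_open[OF _ assms(1,2), of g D UNIV f] assms(3) by auto
 thus ?thesis
  by (simp add: dir_deriv_def frechet_derivative_def)
qed

lemma iter_deriv_cong_open:
 assumes "open S" "\<And>y. y \<in> S ==> f y = g y" "x \<in> S"
 shows "iter_deriv bs f x = iter_deriv bs g x"
 using assms(3)
proof (induction bs arbitrary: x)
 case (Cons b bs)
 thus ?case
  unfolding iter_deriv_Cons by (intro dir_deriv_cong_open[OF assms(1)]) auto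
qed (simp add: assms)

lemma differentiable_cong_open:
 assumes "open S" "x \<in> S" "\<And>y. y \<in> S ==> f y = g y" "f differentiable (at x)"
 shows "g differentiable (at x)"
 using assms has_derivative_transform_within_open[of f _ x UNIV S g]
 unfolding differentiable_def by metis

lemma dir_deriv_const [simp]: "dir_deriv v (\<lambda>_. c) = (\<lambda>_. 0)"
 by (rule ext, rule dir_deriv_eqI[THEN trans]) (auto intro: derivative_intros)

lemma iter_deriv_zero [simp]: "iter_deriv bs (\<lambda>_. 0) = (\<lambda>_. 0)"
 by (induction bs) (simp_all add: iter_deriv_Cons)

lemma smooth_on_iter:
 assumes "smooth_on S g" "set bs \<subseteq> Basis"
 shows "smooth_on S (iter_deriv bs g)"
 using assms unfolding smooth_on_def by (metis iter_deriv_append set_append Un_subset_iff)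

lemma smooth_on_dir: "smooth_on S g ==> b \<in> Basis ==> smooth_on S (dir_deriv b g)"
 using smooth_on_iter[of S g "[b]"] by (simp add: iter_deriv_Cons)

lemma smooth_on_differentiable: "smooth_on S g ==> x \<in> S ==> g differentiable (at x)"
 unfolding smooth_on_def by (metis empty_subsetI iter_deriv_Nil list.set(1))

lemma smooth_on_continuous: "smooth_on S g ==> continuous_on S g"
 by (meson continuous_at_imp_continuous_on differentiable_imp_continuous_within smooth_on_differentiable)

lemma smooth_on_cong:
 assumes "open S" "smooth_on S f" "\<And>y. y \<in> S ==> f y = g y"
 shows "smooth_on S g"
 unfolding smooth_on_def
proof (intro allI impI ballI)
 fix bs :: "'a list" and x
 assume "set bs \<subseteq> Basis" "x \<in> S"
 thus "iter_deriv bs g differentiable (at x)"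
  using differentiable_cong_open[OF assms(1), of x "iter_deriv bs f" "iter_deriv bs g"]
   iter_deriv_cong_open[OF assms(1), of f g] assms(2,3) unfolding smooth_on_def by blast
qed

lemma smooth_on_subset: "smooth_on S g ==> T \<subseteq> S ==> smooth_on T g"
 unfolding smooth_on_def by blast

text \<open>\<open>smooth_on\<close> is a condition at single points, so any cover will do.
  Smoothness of one function is always checked on small balls, where it can be read off from bounded
  families.\<close>

lemma smooth_on_local:
 assumes "\<And>x. x \<in> S ==> \<exists>V. x \<in> V \<and> smooth_on V g"
 shows "smooth_on S g"
 using assms unfolding smooth_on_def by blast

lemma supp_zero: "x \<notin> supp g ==> g x = 0"
 using closure_subset[of "{x. g x \<noteq> 0}"] by (auto simp: supp_def)

lemma closed_supp [simp]: "closed (supp g)"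
 by (simp add: supp_def)

lemma iter_deriv_outside_supp:
 assumes "x \<notin> supp g"
 shows "iter_deriv bs g x = 0"
proof -
 have "iter_deriv bs g x = iter_deriv bs (\<lambda>_. 0) x"
  by (rule iter_deriv_cong_open[of "- supp g"]) (use assms in \<open>simp_all add: supp_zero open_Compl\<close>)
 thus ?thesis by simp
qed

lemma supp_minimal: "closed K ==> (\<And>x. x \<notin> K ==> g x = 0) ==> supp g \<subseteq> K"
 unfolding supp_def by (rule closure_minimal) auto

lemma supp_mult: "supp (\<lambda>x. f x * g x :: 'b::real_normed_field) \<subseteq> supp f \<inter> supp g"
 unfolding supp_def by (intro Int_greatest closure_mono) auto

lemma compact_supp_subset: "compact K ==> supp g \<subseteq> K ==> compact (supp g)"
 using compact_Int_closed[of K "supp g"] by (simp add: Int_absorb1)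

subsection \<open>Uniformly smooth families\<close>

text \<open>The index is typically a wave number k, a pair (k, l) or a pair (k, xi), and C may
  depend on the multi-index only. No growth rate is recorded: powers of k are divided out before a
  family is formed.\<close>

definition usmooth ::
  "'a::euclidean_space set => 'i set => ('i => 'a => 'b::real_normed_vector) => bool" where
 "usmooth S I g \<longleftrightarrow> (\<forall>i\<in>I. smooth_on S (g i)) \<and>
  (\<forall>bs. set bs \<subseteq> Basis \<longrightarrow> (\<exists>C. \<forall>i\<in>I. \<forall>x\<in>S. norm (iter_deriv bs (g i) x) \<le> C))"

lemma usmooth_smooth: "usmooth S I g ==> i \<in> I ==> smooth_on S (g i)"
 unfolding usmooth_def by blast

lemma usmooth_bound:
 assumes "usmooth S I g" "set bs \<subseteq> Basis"
 obtains C where "C > 0" "\<And>i x. i \<in> I ==> x \<in> S ==> norm (iter_deriv bs (g i) x) \<le> C"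
proof -
 obtain C where "\<forall>i\<in>I. \<forall>x\<in>S. norm (iter_deriv bs (g i) x) \<le> C"
  using assms unfolding usmooth_def by blast
 thus thesis
  using that[of "max C 1"] by (simp add: le_max_iff_disj)
qed

lemma usmooth_bound0:
 assumes "usmooth S I g"
 obtains C where "C > 0" "\<And>i x. i \<in> I ==> x \<in> S ==> norm (g i x) \<le> C"
 using usmooth_bound[OF assms, of "[]"] by auto

lemma usmooth_diff: "usmooth S I g ==> i \<in> I ==> x \<in> S ==> g i differentiable (at x)"
 by (metis smooth_on_differentiable usmooth_smooth)

lemma usmooth_iter:
 assumes "usmooth S I g" "set bs \<subseteq> Basis"
 shows "usmooth S I (\<lambda>i. iter_deriv bs (g i))"
 unfolding usmooth_def
proof (intro conjI allI impI ballI)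
 show "smooth_on S (iter_deriv bs (g i))" if "i \<in> I" for i
  by (rule smooth_on_iter[OF usmooth_smooth[OF assms(1) that] assms(2)])
next
 fix as :: "'a list"
 assume "set as \<subseteq> Basis"
 hence "\<exists>C. \<forall>i\<in>I. \<forall>x\<in>S. norm (iter_deriv (as @ bs) (g i) x) \<le> C"
  using assms unfolding usmooth_def by (metis set_append Un_subset_iff)
 thus "\<exists>C. \<forall>i\<in>I. \<forall>x\<in>S. norm (iter_deriv as (iter_deriv bs (g i)) x) \<le> C"
  by (simp add: iter_deriv_append)
qed

lemma usmooth_dir:
 "usmooth S I g ==> b \<in> Basis ==> usmooth S I (\<lambda>i. dir_deriv b (g i))"
 using usmooth_iter[of S I g "[b]"] by (simp add: iter_deriv_Cons)

text \<open>Only first derivatives have to be computed: if a class R of bounded families is closed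
  under them on S, then every iterated derivative agrees on the open set S with some member of R,
  which supplies both differentiability and the uniform bound.\<close>

lemma usmooth_coinduct [consumes 2, case_names step]:
 assumes "open S" and "R g"
  and step: "\<And>g. R g ==> (\<forall>i\<in>I. \<forall>x\<in>S. g i differentiable (at x)) \<and>
   (\<exists>C. \<forall>i\<in>I. \<forall>x\<in>S. norm (g i x) \<le> C) \<and>
   (\<forall>b\<in>Basis. \<exists>g'. R g' \<and> (\<forall>i\<in>I. \<forall>x\<in>S. dir_deriv b (g i) x = g' i x))"
 shows "usmooth S I g"
proof -
 have key: "\<exists>g'. R g' \<and> (\<forall>i\<in>I. \<forall>x\<in>S. iter_deriv bs (g i) x = g' i x)" if "set bs \<subseteq> Basis" for bs :: "'a list"
  using that
 proof (induction bs)
  case Nil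
  thus ?case using assms(2) by auto
 next
  case (Cons b bs)
  then obtain g1 where g1: "R g1" "\<forall>i\<in>I. \<forall>x\<in>S. iter_deriv bs (g i) x = g1 i x"
   by auto
  obtain g2 where g2: "R g2" "\<forall>i\<in>I. \<forall>x\<in>S. dir_deriv b (g1 i) x = g2 i x"
   using step[OF g1(1)] Cons.prems by auto
  have "iter_deriv (b # bs) (g i) x = g2 i x" if "i \<in> I" "x \<in> S" for i x
   using dir_deriv_cong_open[OF assms(1) that(2), of "iter_deriv bs (g i)" "g1 i" b] g1 g2 that
   by (simp add: iter_deriv_Cons)
  thus ?case using g2 by auto
 qed
 show ?thesis
  unfolding usmooth_def smooth_on_def
 proof (intro conjI ballI allI impI)
  fix i and bs :: "'a list" and x assume *: "i \<in> I" "set bs \<subseteq> Basis" "x \<in> S"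
  then obtain g' where g': "R g'" "\<forall>i\<in>I. \<forall>x\<in>S. iter_deriv bs (g i) x = g' i x"
   using key by blast
  show "iter_deriv bs (g i) differentiable (at x)"
   using differentiable_cong_open[OF assms(1) *(3), of "g' i"] g' * step[OF g'(1)] by simp
 next
  fix bs :: "'a list" assume "set bs \<subseteq> Basis"
  then obtain g' where g': "R g'" "\<forall>i\<in>I. \<forall>x\<in>S. iter_deriv bs (g i) x = g' i x"
   using key by blast
  thus "\<exists>C. \<forall>i\<in>I. \<forall>x\<in>S. norm (iter_deriv bs (g i) x) \<le> C"
   using step[OF g'(1)] by simp
 qed
qed

text \<open>The last clause takes a whole tower F 0, F 1, ... because the derivative of F n (h x) is
  F (n + 1) (h x) times that of h, which lies in the class again. This replaces explicit formulas
  for higher derivatives of products and compositions.\<close>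

inductive smooth_alg ::
  "'a::euclidean_space set => 'i set => ('i => 'a => 'b::real_normed_field) => bool" for S I where
 base: "usmooth S I g ==> smooth_alg S I g"
| add: "smooth_alg S I g ==> smooth_alg S I h ==> smooth_alg S I (\<lambda>i x. g i x + h i x)"
| mult: "smooth_alg S I g ==> smooth_alg S I h ==> smooth_alg S I (\<lambda>i x. g i x * h i x)"
| comp: "usmooth S I h ==>
  (\<And>n i x. i \<in> I ==> x \<in> S ==> (F n i has_field_derivative F (Suc n) i (h i x)) (at (h i x))) ==>
  (\<And>n. \<exists>C. \<forall>i\<in>I. \<forall>x\<in>S. norm (F n i (h i x)) \<le> C) ==>
  smooth_alg S I (\<lambda>i x. F (n::nat) i (h i x))"

lemma smooth_alg_step:
 assumes "smooth_alg S I g"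
 shows "(\<forall>i\<in>I. \<forall>x\<in>S. g i differentiable (at x)) \<and>
   (\<exists>C. \<forall>i\<in>I. \<forall>x\<in>S. norm (g i x) \<le> C) \<and>
   (\<forall>b\<in>Basis. \<exists>g'. smooth_alg S I g' \<and> (\<forall>i\<in>I. \<forall>x\<in>S. dir_deriv b (g i) x = g' i x))"
 using assms
proof (induction rule: smooth_alg.induct)
 case (base g)
 then obtain C where "\<And>i x. i \<in> I ==> x \<in> S ==> norm (g i x) \<le> C" "C > 0"
  using usmooth_bound0 by metis
 moreover have "smooth_alg S I (\<lambda>i. dir_deriv b (g i))" if "b \<in> Basis" for b
  by (rule smooth_alg.base[OF usmooth_dir[OF base that]])
 ultimately show ?case
  using usmooth_diff[OF base] by blast
next
 case (add g h)
 obtain C D where "\<forall>i\<in>I. \<forall>x\<in>S. norm (g i x) \<le> C" "\<forall>i\<in>I. \<forall>x\<in>S. norm (h i x) \<le> D"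
  using add.IH by blast
 hence "\<forall>i\<in>I. \<forall>x\<in>S. norm (g i x + h i x) \<le> C + D"
  by (auto intro!: norm_triangle_le add_mono)
 moreover have "\<exists>g'. smooth_alg S I g' \<and> (\<forall>i\<in>I. \<forall>x\<in>S. dir_deriv b (\<lambda>x. g i x + h i x) x = g' i x)"
  if b: "b \<in> Basis" for b
 proof -
  obtain g1 h1 where 1: "smooth_alg S I g1" "smooth_alg S I h1"
   "\<forall>i\<in>I. \<forall>x\<in>S. dir_deriv b (g i) x = g1 i x" "\<forall>i\<in>I. \<forall>x\<in>S. dir_deriv b (h i) x = h1 i x"
   using add.IH b by blast
  have "dir_deriv b (\<lambda>x. g i x + h i x) x = g1 i x + h1 i x" if "i \<in> I" "x \<in> S" for i x
  proof -
   have "dir_deriv b (\<lambda>x. g i x + h i x) x = dir_deriv b (g i) x + dir_deriv b (h i) x"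
    by (rule dir_deriv_eqI) (use add.IH that in \<open>auto intro!: has_derivative_add has_derivative_dir_deriv\<close>)
   thus ?thesis using 1 that by simp
  qed
  thus ?thesis
   using smooth_alg.add[OF 1(1,2)] by blast
 qed
 ultimately show ?case
  using add.IH by (blast intro: differentiable_add)
next
 case (mult g h)
 obtain C D where CD: "\<forall>i\<in>I. \<forall>x\<in>S. norm (g i x) \<le> C" "\<forall>i\<in>I. \<forall>x\<in>S. norm (h i x) \<le> D"
  using mult.IH by blast
 hence "\<forall>i\<in>I. \<forall>x\<in>S. norm (g i x * h i x) \<le> C * D"
  by (auto simp: norm_mult intro!: mult_mono' order_trans[OF norm_ge_zero])
 moreover have "\<exists>g'. smooth_alg S I g' \<and> (\<forall>i\<in>I. \<forall>x\<in>S. dir_deriv b (\<lambda>x. g i x * h i x) x = g' i x)"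
  if b: "b \<in> Basis" for b
 proof -
  obtain g1 h1 where 1: "smooth_alg S I g1" "smooth_alg S I h1"
   "\<forall>i\<in>I. \<forall>x\<in>S. dir_deriv b (g i) x = g1 i x" "\<forall>i\<in>I. \<forall>x\<in>S. dir_deriv b (h i) x = h1 i x"
   using mult.IH b by blast
  have "dir_deriv b (\<lambda>x. g i x * h i x) x = g i x * h1 i x + g1 i x * h i x" if "i \<in> I" "x \<in> S" for i x
  proof -
   have "dir_deriv b (\<lambda>x. g i x * h i x) x = g i x * dir_deriv b (h i) x + dir_deriv b (g i) x * h i x"
    by (rule dir_deriv_eqI) (use mult.IH that in \<open>auto intro!: has_derivative_mult has_derivative_dir_deriv\<close>)
   thus ?thesis using 1 that by simp
  qed
  thus ?thesis
   using smooth_alg.add[OF smooth_alg.mult[OF mult.hyps(1) 1(2)] smooth_alg.mult[OF 1(1) mult.hyps(2)]] by blast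
 qed
 ultimately show ?case
  using mult.IH by (blast intro: differentiable_mult)
next
 case (comp h F n)
 have D: "((\<lambda>x. F n i (h i x)) has_derivative (\<lambda>v. F (Suc n) i (h i x) * dir_deriv v (h i) x)) (at x)"
  if "i \<in> I" "x \<in> S" for i x
  using diff_chain_at[OF has_derivative_dir_deriv[OF usmooth_diff[OF comp.hyps(1) that]]
   comp.hyps(2)[OF that, unfolded has_field_derivative_def]]
  by (simp add: o_def)
 have "\<exists>g'. smooth_alg S I g' \<and> (\<forall>i\<in>I. \<forall>x\<in>S. dir_deriv b (\<lambda>x. F n i (h i x)) x = g' i x)"
  if b: "b \<in> Basis" for b
 proof (intro exI conjI ballI)
  have "smooth_alg S I (\<lambda>i x. F (Suc n) i (h i x))"
   using comp.hyps by (intro smooth_alg.comp) auto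
  thus "smooth_alg S I (\<lambda>i x. F (Suc n) i (h i x) * dir_deriv b (h i) x)"
   by (rule smooth_alg.mult[OF _ smooth_alg.base[OF usmooth_dir[OF comp.hyps(1) b]]])
  show "dir_deriv b (\<lambda>x. F n i (h i x)) x = F (Suc n) i (h i x) * dir_deriv b (h i) x"
   if "i \<in> I" "x \<in> S" for i x
   by (rule dir_deriv_eqI[OF D[OF that]])
 qed
 thus ?case
  using D comp.hyps(3) unfolding differentiable_def by blast
qed

lemma usmooth_alg: "open S ==> smooth_alg S I g ==> usmooth S I g"
 by (rule usmooth_coinduct[where R="smooth_alg S I"]) (erule smooth_alg_step | assumption)+

lemma usmooth_add:
 fixes g h :: "'i => 'a::euclidean_space => 'b::real_normed_field"
 shows "open S ==> usmooth S I g ==> usmooth S I h ==> usmooth S I (\<lambda>i x. g i x + h i x)"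
 by (rule usmooth_alg[OF _ smooth_alg.add[OF smooth_alg.base smooth_alg.base]])

lemma usmooth_mult:
 fixes g h :: "'i => 'a::euclidean_space => 'b::real_normed_field"
 shows "open S ==> usmooth S I g ==> usmooth S I h ==> usmooth S I (\<lambda>i x. g i x * h i x)"
 by (rule usmooth_alg[OF _ smooth_alg.mult[OF smooth_alg.base smooth_alg.base]])

text \<open>F may depend on the index, and its bounds are required at the values
  \<open>h i x\<close> only; for the amplitudes these values keep away from the singularity at
  0.\<close>

lemma usmooth_comp:
 fixes h :: "'i => 'a::euclidean_space => 'b::real_normed_field"
 assumes "open S" "usmooth S I h"
  and "\<And>n i x. i \<in> I ==> x \<in> S ==> (F n i has_field_derivative F (Suc n) i (h i x)) (at (h i x))"
  and "\<And>n. \<exists>C. \<forall>i\<in>I. \<forall>x\<in>S. norm (F n i (h i x)) \<le> C"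
 shows "usmooth S I (\<lambda>i x. F (n::nat) i (h i x))"
 by (rule usmooth_alg[OF assms(1) smooth_alg.comp[where F=F and h=h, OF assms(2-4)]])

lemma usmooth_cong:
 assumes "open S" "usmooth S I g" "\<And>i x. i \<in> I ==> x \<in> S ==> g i x = h i x"
 shows "usmooth S I h"
proof -
 have "iter_deriv bs (h i) x = iter_deriv bs (g i) x" if "i \<in> I" "x \<in> S" for bs i x
  using iter_deriv_cong_open[OF assms(1), of "h i" "g i"] assms(3) that by auto
 thus ?thesis
  using assms smooth_on_cong[OF assms(1), of "g _" "h _"] unfolding usmooth_def by auto
qed

lemma usmooth_subset: "usmooth S I g ==> T \<subseteq> S ==> J \<subseteq> I ==> usmooth T J g"
 unfolding usmooth_def by (meson smooth_on_subset subsetD)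

lemma usmooth_reindex: "usmooth S I g ==> (\<And>j. j \<in> J ==> \<rho> j \<in> I) ==> usmooth S J (\<lambda>j. g (\<rho> j))"
 unfolding usmooth_def by meson

lemma usmooth_Un:
 assumes "usmooth S I g" "usmooth T I g"
 shows "usmooth (S \<union> T) I g"
 unfolding usmooth_def
proof (intro conjI allI impI ballI)
 show "smooth_on (S \<union> T) (g i)" if "i \<in> I" for i
  using assms that unfolding usmooth_def smooth_on_def by blast
next
 fix bs :: "'a list"
 assume bs: "set bs \<subseteq> Basis"
 obtain C D where "\<And>i x. i \<in> I ==> x \<in> S ==> norm (iter_deriv bs (g i) x) \<le> C"
  "\<And>i x. i \<in> I ==> x \<in> T ==> norm (iter_deriv bs (g i) x) \<le> D"
  using usmooth_bound[OF assms(1) bs] usmooth_bound[OF assms(2) bs] by metis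
 hence "\<forall>i\<in>I. \<forall>x\<in>S \<union> T. norm (iter_deriv bs (g i) x) \<le> max C D"
  by (auto simp: le_max_iff_disj)
 thus "\<exists>C. \<forall>i\<in>I. \<forall>x\<in>S \<union> T. norm (iter_deriv bs (g i) x) \<le> C" ..
qed

lemma usmooth_const:
 fixes c :: "'i => 'b::real_normed_vector" and S :: "'a::euclidean_space set"
 assumes "\<And>i. i \<in> I ==> norm (c i) \<le> C"
 shows "usmooth S I (\<lambda>i _. c i)"
 unfolding usmooth_def smooth_on_def
proof (intro conjI allI impI ballI)
 have *: "iter_deriv bs (\<lambda>_. c i) = (\<lambda>_. 0) \<or> iter_deriv bs (\<lambda>_::'a. c i) = (\<lambda>_. c i)" for bs i
  by (induction bs) (auto simp: iter_deriv_Cons)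
 show "iter_deriv bs (\<lambda>_. c i) differentiable at x" for i bs and x :: 'a
  using *[of bs i] by auto
 show "\<exists>C. \<forall>i\<in>I. \<forall>x\<in>S. norm (iter_deriv bs (\<lambda>_::'a. c i) x) \<le> C" for bs
 proof (intro exI[of _ "max C 0"] ballI)
  fix i x assume "i \<in> I"
  thus "norm (iter_deriv bs (\<lambda>_::'a. c i) x) \<le> max C 0"
   using *[of bs i] assms[of i] by auto
 qed
qed

lemma usmooth_cmult:
 fixes g :: "'i => 'a::euclidean_space => 'b::real_normed_field"
 assumes "open S" "usmooth S I g" "\<And>i. i \<in> I ==> norm (c i) \<le> C"
 shows "usmooth S I (\<lambda>i x. c i * g i x)"
 using usmooth_mult[OF assms(1) usmooth_const assms(2)] assms(3) by blast

lemma usmooth_minus: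
 fixes g :: "'i => 'a::euclidean_space => 'b::real_normed_field"
 shows "open S ==> usmooth S I g ==> usmooth S I (\<lambda>i x. - g i x)"
 using usmooth_cmult[of S I g "\<lambda>_. -1" 1] by simp

lemma usmooth_diff_fun:
 fixes g h :: "'i => 'a::euclidean_space => 'b::real_normed_field"
 shows "open S ==> usmooth S I g ==> usmooth S I h ==> usmooth S I (\<lambda>i x. g i x - h i x)"
 using usmooth_add[of S I g "\<lambda>i x. - h i x"] usmooth_minus[of S I h] by simp

lemma usmooth_sum:
 fixes g :: "'j => 'i => 'a::euclidean_space => 'b::real_normed_field"
 assumes "open S" "\<And>j. j \<in> J ==> usmooth S I (g j)"
 shows "usmooth S I (\<lambda>i x. \<Sum>j\<in>J. g j i x)"
proof (cases "finite J")
 case True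
 thus ?thesis
  using assms(2) by (induction J) (auto intro!: usmooth_add assms(1) usmooth_const[where C=0])
next
 case False
 thus ?thesis
  by (simp add: usmooth_const[where C=0])
qed

lemma dir_deriv_bounded_linear:
 assumes "bounded_linear L" "g differentiable (at x)"
 shows "dir_deriv b (\<lambda>x. L (g x)) x = L (dir_deriv b g x)"
 by (rule dir_deriv_eqI) (rule bounded_linear.has_derivative[OF assms(1) has_derivative_dir_deriv[OF assms(2)]])

lemma iter_deriv_bounded_linear:
 assumes "open S" "bounded_linear L" "smooth_on S g" "set bs \<subseteq> Basis" "x \<in> S"
 shows "iter_deriv bs (\<lambda>x. L (g x)) x = L (iter_deriv bs g x)"
 using assms(4,5)
proof (induction bs arbitrary: x)
 case (Cons b bs)
 have "iter_deriv (b # bs) (\<lambda>x. L (g x)) x = dir_deriv b (\<lambda>x. L (iter_deriv bs g x)) x"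
  unfolding iter_deriv_Cons using Cons by (intro dir_deriv_cong_open[OF assms(1)]) auto
 also have "\<dots> = L (iter_deriv (b # bs) g x)"
  unfolding iter_deriv_Cons using Cons.prems assms(3)
  by (intro dir_deriv_bounded_linear[OF assms(2)]) (auto simp: smooth_on_def)
 finally show ?case .
qed simp

lemma usmooth_bounded_linear:
 assumes "open S" "bounded_linear L" "usmooth S I g"
 shows "usmooth S I (\<lambda>i x. L (g i x))"
proof (rule usmooth_coinduct[where R="\<lambda>h. \<exists>g. usmooth S I g \<and> h = (\<lambda>i x. L (g i x))"])
 fix h assume "\<exists>g. usmooth S I g \<and> h = (\<lambda>i x. L (g i x))"
 then obtain g where g: "usmooth S I g" and h: "h = (\<lambda>i x. L (g i x))" by blast
 obtain C where C: "C > 0" "\<And>i x. i \<in> I ==> x \<in> S ==> norm (g i x) \<le> C"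
  using usmooth_bound0[OF g] by metis
 obtain K where K: "K > 0" "\<And>x. norm (L x) \<le> norm x * K"
  using bounded_linear.pos_bounded[OF assms(2)] by blast
 have "norm (h i x) \<le> C * K" if "i \<in> I" "x \<in> S" for i x
  using K C(2)[OF that] h by (meson K(2) mult_right_mono less_imp_le order_trans)
 moreover have "h i differentiable (at x)" if "i \<in> I" "x \<in> S" for i x
  unfolding h differentiable_def
  using bounded_linear.has_derivative[OF assms(2) has_derivative_dir_deriv[OF usmooth_diff[OF g that]]] by blast
 moreover have "dir_deriv b (h i) x = L (dir_deriv b (g i) x)" if "i \<in> I" "x \<in> S" for i x b
  unfolding h by (rule dir_deriv_bounded_linear[OF assms(2) usmooth_diff[OF g that]])
 ultimately show "(\<forall>i\<in>I. \<forall>x\<in>S. h i differentiable at x) \<and> (\<exists>C. \<forall>i\<in>I. \<forall>x\<in>S. norm (h i x) \<le> C) \<and>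
    (\<forall>b\<in>Basis. \<exists>g'. (\<exists>g. usmooth S I g \<and> g' = (\<lambda>i x. L (g i x))) \<and>
       (\<forall>i\<in>I. \<forall>x\<in>S. dir_deriv b (h i) x = g' i x))"
  using usmooth_dir[OF g] by (metis (no_types, lifting))
qed (use assms in auto)

lemma usmooth_of_real:
 "open S ==> usmooth S I g ==> usmooth S I (\<lambda>i x. of_real (g i x) :: 'b::real_normed_field)"
 by (rule usmooth_bounded_linear[OF _ bounded_linear_of_real])

lemma usmooth_linear:
 fixes L :: "'a::euclidean_space => 'b::real_normed_vector" and I :: "'i set"
 assumes "open S" "bounded S" "bounded_linear L"
 shows "usmooth S I (\<lambda>_ x. L x)"
\<comment> \<open>The constants belong to the invariant because the derivative of L along b is the
  constant L b.\<close>
proof (rule usmooth_coinduct[where R="\<lambda>h. h = (\<lambda>_ x. L x) \<or> (\<exists>c. h = (\<lambda>_ _. c))"])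
 fix h :: "'i => 'a => 'b"
 have D: "dir_deriv b L x = L b" "L differentiable (at x)" for b x
  using bounded_linear_imp_has_derivative[OF assms(3)] dir_deriv_eqI
  by (auto simp: differentiable_def intro!: dir_deriv_eqI)
 obtain C where C: "\<forall>x\<in>S. norm x \<le> C" "C > 0"
  using assms(2) bounded_pos by blast
 obtain K where K: "K > 0" "\<And>x. norm (L x) \<le> norm x * K"
  using bounded_linear.pos_bounded[OF assms(3)] by blast
 have "norm (L x) \<le> C * K" if "x \<in> S" for x
  using K C that by (meson K(2) mult_right_mono less_imp_le order_trans)
 moreover assume "h = (\<lambda>_ x. L x) \<or> (\<exists>c. h = (\<lambda>_ _. c))"
 ultimately show "(\<forall>i\<in>I. \<forall>x\<in>S. h i differentiable at x) \<and> (\<exists>C. \<forall>i\<in>I. \<forall>x\<in>S. norm (h i x) \<le> C) \<and>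
    (\<forall>b\<in>Basis. \<exists>g'. (g' = (\<lambda>_ x. L x) \<or> (\<exists>c. g' = (\<lambda>_ _. c))) \<and>
       (\<forall>i\<in>I. \<forall>x\<in>S. dir_deriv b (h i) x = g' i x))"
  using D by (elim disjE) auto
qed (use assms in auto)

lemma usmooth_inverse:
 fixes h :: "'i => 'a::euclidean_space => 'b::real_normed_field"
 assumes "open S" "usmooth S I h" "c > 0" "\<And>i x. i \<in> I ==> x \<in> S ==> c \<le> norm (h i x)"
 shows "usmooth S I (\<lambda>i x. inverse (h i x))"
proof -
 \<comment> \<open>The derivatives of 1 / z; where |z| >= c they are at most n! / c^(n + 1).\<close>
 define F :: "nat => 'i => 'b => 'b" where "F n i z = (-1)^n * fact n * inverse z ^ Suc n" for n i z
 have "usmooth S I (\<lambda>i x. F 0 i (h i x))"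
 proof (rule usmooth_comp[OF assms(1,2)])
  show "(F n i has_field_derivative F (Suc n) i (h i x)) (at (h i x))" if "i \<in> I" "x \<in> S" for n i x
  proof -
   have nz: "h i x \<noteq> 0" using assms(3,4) that by force
   show ?thesis
    unfolding F_def
    by (rule DERIV_cong[OF DERIV_cmult[OF DERIV_power_Suc[OF DERIV_inverse[OF nz]]]])
     (simp add: algebra_simps)
  qed
  show "\<exists>C. \<forall>i\<in>I. \<forall>x\<in>S. norm (F n i (h i x)) \<le> C" for n
  proof (intro exI ballI)
   fix i x assume *: "i \<in> I" "x \<in> S"
   have "norm (inverse (h i x)) \<le> inverse c"
    using assms(3,4) * by (simp add: norm_inverse le_imp_inverse_le)
   hence "norm (inverse (h i x)) ^ Suc n \<le> inverse c ^ Suc n"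
    by (intro power_mono) auto
   thus "norm (F n i (h i x)) \<le> fact n * inverse c ^ Suc n"
    unfolding F_def norm_mult norm_power by (simp add: norm_fact)
  qed
 qed
 thus ?thesis by (simp add: F_def)
qed

section \<open>Single smooth functions, products with cutoffs, powers of the distance\<close>

lemma smooth_on_usmooth:
 assumes "smooth_on S g" "compact K" "V \<subseteq> K" "K \<subseteq> S"
 shows "usmooth V I (\<lambda>_. g)"
 unfolding usmooth_def
proof (intro conjI allI impI ballI)
 show "smooth_on V g"
  using smooth_on_subset assms by blast
 fix bs :: "'a list" assume "set bs \<subseteq> Basis"
 hence "compact (iter_deriv bs g ` K)"
  using smooth_on_subset[OF smooth_on_iter[OF assms(1)] assms(4)]
  by (intro compact_continuous_image smooth_on_continuous assms)
 then obtain C where "\<forall>y\<in>iter_deriv bs g ` K. norm y \<le> C"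
  using compact_imp_bounded bounded_iff by metis
 thus "\<exists>C. \<forall>i\<in>I. \<forall>x\<in>V. norm (iter_deriv bs g x) \<le> C"
  using assms by blast
qed

text \<open>On a ball whose closure lies in S, a single smooth function is a bounded family indexed
  by \<open>()\<close>. Hence the calculus of \<open>smooth_on\<close> is inherited from that of
  \<open>usmooth\<close>.\<close>

lemma smooth_on_locally_unif:
 assumes "open S" "smooth_on S g" "smooth_on S h" "x \<in> S"
 obtains V where "open V" "x \<in> V" "V \<subseteq> S" "usmooth V {()} (\<lambda>_. g)" "usmooth V {()} (\<lambda>_. h)"
proof -
 obtain e where e: "e > 0" "cball x e \<subseteq> S"
  using assms open_contains_cball by blast
 show thesis
  by (rule that[of "ball x e"]) (use e ball_subset_cball in
   \<open>auto intro: smooth_on_usmooth[OF assms(2), of "cball x e"] smooth_on_usmooth[OF assms(3), of "cball x e"]\<close>)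
qed

lemma smooth_on_add:
 fixes f g :: "'a::euclidean_space => 'b::real_normed_field"
 assumes "open S" "smooth_on S f" "smooth_on S g"
 shows "smooth_on S (\<lambda>x. f x + g x)"
proof (rule smooth_on_local)
 fix x assume "x \<in> S"
 then obtain V where "open V" "x \<in> V" "V \<subseteq> S" "usmooth V {()} (\<lambda>_. f)" "usmooth V {()} (\<lambda>_. g)"
  using smooth_on_locally_unif[OF assms] by metis
 thus "\<exists>V. x \<in> V \<and> smooth_on V (\<lambda>x. f x + g x)"
  using usmooth_smooth[OF usmooth_add[of V "{()}" "\<lambda>_. f" "\<lambda>_. g"], of "()"] by auto
qed

lemma smooth_on_mult:
 fixes f g :: "'a::euclidean_space => 'b::real_normed_field"
 assumes "open S" "smooth_on S f" "smooth_on S g"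
 shows "smooth_on S (\<lambda>x. f x * g x)"
proof (rule smooth_on_local)
 fix x assume "x \<in> S"
 then obtain V where "open V" "x \<in> V" "V \<subseteq> S" "usmooth V {()} (\<lambda>_. f)" "usmooth V {()} (\<lambda>_. g)"
  using smooth_on_locally_unif[OF assms] by metis
 thus "\<exists>V. x \<in> V \<and> smooth_on V (\<lambda>x. f x * g x)"
  using usmooth_smooth[OF usmooth_mult[of V "{()}" "\<lambda>_. f" "\<lambda>_. g"], of "()"] by auto
qed

lemma smooth_on_const: "smooth_on S (\<lambda>_. c)"
 using usmooth_smooth[OF usmooth_const[of "{()}" "\<lambda>_. c" "norm c" S]] by simp

lemma smooth_on_prod:
 fixes f :: "'j => 'a::euclidean_space => 'b::real_normed_field"
 assumes "open S" "\<And>j. j \<in> J ==> smooth_on S (f j)"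
 shows "smooth_on S (\<lambda>x. \<Prod>j\<in>J. f j x)"
 using assms(2) by (induction J rule: infinite_finite_induct)
  (auto intro: smooth_on_const smooth_on_mult assms(1))

lemma smooth_on_bounded_linear:
 assumes "open S" "bounded_linear L" "smooth_on S g"
 shows "smooth_on S (\<lambda>x. L (g x))"
proof (rule smooth_on_local)
 fix x assume "x \<in> S"
 then obtain V where "open V" "x \<in> V" "V \<subseteq> S" "usmooth V {()} (\<lambda>_. g)" "usmooth V {()} (\<lambda>_. g)"
  using smooth_on_locally_unif[OF assms(1,3,3)] by metis
 thus "\<exists>V. x \<in> V \<and> smooth_on V (\<lambda>x. L (g x))"
  using usmooth_smooth[OF usmooth_bounded_linear[of V L "{()}" "\<lambda>_. g"], of "()"] assms(2) by auto
qed

text \<open>V and the complement of K are open and cover the space, and on the latter the family is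
  zero. This makes functions global that are controlled only on V, away from the singularity of the
  fundamental solution.\<close>

lemma usmooth_vanishing:
 assumes "compact K" "K \<subseteq> V" "open V" "usmooth V I g" "\<And>i y. i \<in> I ==> y \<notin> K ==> g i y = 0"
 shows "usmooth UNIV I g"
proof -
 have "usmooth (- K) I g"
  by (rule usmooth_cong[OF _ usmooth_const[where c="\<lambda>_. 0" and C=0]])
   (use assms in \<open>auto simp: compact_imp_closed open_Compl\<close>)
 hence "usmooth (V \<union> - K) I g"
  using usmooth_Un assms by blast
 moreover have "V \<union> - K = UNIV"
  using assms by blast
 ultimately show ?thesis by simp
qed

lemma usmooth_compact_supp:
 assumes "smooth_on UNIV \<kappa>" "compact (supp \<kappa>)"
 shows "usmooth UNIV I (\<lambda>_. \<kappa>)"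
proof -
 obtain R where R: "supp \<kappa> \<subseteq> ball 0 R"
  using compact_imp_bounded[OF assms(2)] bounded_subset_ballD by blast
 show ?thesis
  by (rule usmooth_vanishing[OF assms(2) R])
   (auto simp: supp_zero intro: smooth_on_usmooth[OF assms(1), of "cball 0 R"])
qed

lemma usmooth_cutoff:
 fixes \<kappa> :: "'a::euclidean_space => 'b::real_normed_field"
 assumes "smooth_on UNIV \<kappa>" "compact (supp \<kappa>)" "supp \<kappa> \<subseteq> V" "open V" "usmooth V I g"
 shows "usmooth UNIV I (\<lambda>i y. \<kappa> y * g i y)"
proof (rule usmooth_vanishing[OF assms(2-4)])
 show "usmooth V I (\<lambda>i y. \<kappa> y * g i y)"
  by (intro usmooth_mult assms usmooth_subset[OF usmooth_compact_supp[OF assms(1,2)]]) auto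
qed (simp add: supp_zero)

lemma smooth_on_cutoff:
 fixes \<kappa> g :: "'a::euclidean_space => 'b::real_normed_field"
 assumes "smooth_on UNIV \<kappa>" "supp \<kappa> \<subseteq> V" "open V" "smooth_on V g"
 shows "smooth_on UNIV (\<lambda>y. \<kappa> y * g y)"
proof (rule smooth_on_local)
 fix x
 show "\<exists>V. x \<in> V \<and> smooth_on V (\<lambda>y. \<kappa> y * g y)"
 proof (cases "x \<in> V")
  case True
  thus ?thesis
   using smooth_on_mult[OF assms(3) smooth_on_subset[OF assms(1)] assms(4)] by blast
 next
  case False
  have "smooth_on (- supp \<kappa>) (\<lambda>y. \<kappa> y * g y)"
   by (rule smooth_on_cong[OF _ smooth_on_const[where c=0]]) (simp_all add: supp_zero open_Compl)
  thus ?thesis using False assms by blast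
 qed
qed

lemma test_fun_cutoff:
 assumes "\<kappa> \<in> test_fun S" "open S" "smooth_on S g"
 shows "(\<lambda>y. \<kappa> y * g y) \<in> test_fun S"
proof -
 have "supp (\<lambda>y. \<kappa> y * g y) \<subseteq> supp \<kappa>"
  using supp_mult[of \<kappa> g] by blast
 thus ?thesis
  using assms smooth_on_cutoff[of \<kappa> S g] compact_supp_subset[of "supp \<kappa>"]
  unfolding test_fun_def by blast
qed

lemma test_fun_lincomb:
 assumes "\<phi> \<in> test_fun S" "\<psi> \<in> test_fun S"
 shows "(\<lambda>x. a * \<phi> x + b * \<psi> x) \<in> test_fun S"
proof -
 have *: "supp (\<lambda>x. a * \<phi> x + b * \<psi> x) \<subseteq> supp \<phi> \<union> supp \<psi>"
  by (rule supp_minimal) (auto simp: supp_zero)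
 moreover have "compact (supp \<phi> \<union> supp \<psi>)"
  using assms by (auto simp: test_fun_def)
 moreover have "smooth_on UNIV (\<lambda>x. a * \<phi> x + b * \<psi> x)"
  using assms by (intro smooth_on_add smooth_on_mult smooth_on_const) (auto simp: test_fun_def)
 ultimately show ?thesis
  using assms compact_supp_subset[of "supp \<phi> \<union> supp \<psi>"] unfolding test_fun_def by blast
qed

lemma test_fun_mono: "\<phi> \<in> test_fun S ==> S \<subseteq> T ==> \<phi> \<in> test_fun T"
 by (auto simp: test_fun_def)

lemma usmooth_powr:
 fixes h :: "'i => 'a::euclidean_space => real"
 assumes "open S" "usmooth S I h" "c > 0" "\<And>i x. i \<in> I ==> x \<in> S ==> c \<le> h i x"
 shows "usmooth S I (\<lambda>i x. h i x powr a)"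
proof -
 define F where "F n (i::'i) t = (\<Prod>j<n. a - real j) * t powr (a - real n)" for n i t
 obtain C where C: "\<And>i x. i \<in> I ==> x \<in> S ==> norm (h i x) \<le> C"
  using usmooth_bound0[OF assms(2)] by metis
 have "usmooth S I (\<lambda>i x. F 0 i (h i x))"
 proof (rule usmooth_comp[OF assms(1,2)])
  show "(F n i has_field_derivative F (Suc n) i (h i x)) (at (h i x))" if "i \<in> I" "x \<in> S" for n i x
  proof -
   have "h i x > 0" using assms(3,4) that by force
   hence "(F n i has_field_derivative
     ((\<Prod>j<n. a - real j) * ((a - real n) * h i x powr (a - real n - 1)))) (at (h i x))"
    unfolding F_def by (intro DERIV_cmult has_real_derivative_powr)
   thus ?thesis
    by (simp add: F_def algebra_simps)
  qed
  show "\<exists>B. \<forall>i\<in>I. \<forall>x\<in>S. norm (F n i (h i x)) \<le> B" for n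
  proof (intro exI ballI)
   fix i x assume *: "i \<in> I" "x \<in> S"
   have b: "c \<le> h i x" "h i x \<le> C" using assms(4)[OF *] C[OF *] by auto
   \<comment> \<open>The exponent a - n can have either sign, so the values at both ends of the
     range [c, C] are added.\<close>
   have "h i x powr (a - real n) \<le> c powr (a - real n) + C powr (a - real n)"
   proof (cases "a - real n \<ge> 0")
    case True
    hence "h i x powr (a - real n) \<le> C powr (a - real n)"
     using b assms(3) by (intro powr_mono2) auto
    thus ?thesis by (smt (verit) powr_ge_zero)
   next
    case False
    hence "h i x powr (a - real n) \<le> c powr (a - real n)"
     using b assms(3) by (intro powr_mono2') auto
    thus ?thesis by (smt (verit) powr_ge_zero)
   qed
   thus "norm (F n i (h i x)) \<le> \<bar>\<Prod>j<n. a - real j\<bar> * (c powr (a - real n) + C powr (a - real n))"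
    unfolding F_def by (simp add: abs_mult mult_left_mono)
  qed
 qed
 thus ?thesis
  using usmooth_cong[OF assms(1)] by (simp add: F_def)
qed

text \<open>Written as a power of a polynomial in the coordinates, the distance falls under
  \<open>usmooth_powr\<close>.\<close>

lemma norm_diff_eq_powr:
 "norm (y - x) = (\<Sum>b\<in>Basis. (y \<bullet> b - x \<bullet> b) * (y \<bullet> b - x \<bullet> b)) powr (1/2)"
proof -
 have "norm (y - x) = sqrt (\<Sum>b\<in>Basis. ((y - x) \<bullet> b)\<^sup>2)"
  by (simp add: norm_eq_sqrt_inner euclidean_inner[of "y - x" "y - x"] power2_eq_square)
 thus ?thesis
  by (simp add: powr_half_sqrt[symmetric] sum_nonneg inner_diff_left power2_eq_square)
qed

lemma usmooth_sqdist:
 assumes "open S" "bounded S"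
 shows "usmooth S I (\<lambda>_ y. \<Sum>b\<in>Basis. (y \<bullet> b - x \<bullet> b) * (y \<bullet> b - x \<bullet> b))"
 by (intro usmooth_sum usmooth_mult usmooth_diff_fun assms usmooth_const[where C="\<bar>x \<bullet> _\<bar>"]
   usmooth_linear bounded_linear_inner_left) auto

lemma usmooth_dist:
 assumes "open S" "bounded S" "\<rho> > 0" "\<And>y. y \<in> S ==> \<rho> \<le> norm (y - x)"
 shows "usmooth S I (\<lambda>_ y. norm (y - x))"
 unfolding norm_diff_eq_powr
proof (rule usmooth_powr[OF assms(1) usmooth_sqdist[OF assms(1,2)]])
 show "\<rho>\<^sup>2 \<le> (\<Sum>b\<in>Basis. (y \<bullet> b - x \<bullet> b) * (y \<bullet> b - x \<bullet> b))" if "y \<in> S" for y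
 proof -
  have "(norm (y - x))\<^sup>2 = (\<Sum>b\<in>Basis. (y \<bullet> b - x \<bullet> b) * (y \<bullet> b - x \<bullet> b))"
   unfolding power2_norm_eq_inner by (subst euclidean_inner) (simp add: inner_diff_left)
  thus ?thesis
   using power_mono[OF assms(4)[OF that], of 2] assms(3) by simp
 qed
qed (use assms in auto)

subsection \<open>Cutoff functions\<close>

text \<open>One term of the exponential series gives s^i <= i! exp s.\<close>

lemma poly_times_exp_bounded:
 fixes p :: "real poly"
 shows "\<exists>C. \<forall>s\<ge>0. \<bar>poly p s * exp (- s)\<bar> \<le> C"
proof (intro exI allI impI)
 fix s :: real assume s: "s \<ge> 0"
 have *: "s ^ i * exp (- s) \<le> fact i" for i
 proof -
  have "s ^ i / fact i \<le> exp s"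
  proof -
   have "(\<Sum>n\<in>{i}. s ^ n / fact n) \<le> (\<Sum>n. s ^ n / fact n)"
    using s by (intro sum_le_suminf) (auto simp: summable_exp field_simps exp_def
      intro: summable_exp_generic[of s, simplified] sums_summable[OF exp_converges[of s, unfolded scaleR_conv_of_real, simplified divide_inverse[symmetric]]])
   thus ?thesis
    by (simp add: exp_def divide_inverse mult.commute)
  qed
  thus ?thesis
   by (simp add: exp_minus field_simps)
 qed
 have "\<bar>poly p s * exp (- s)\<bar> = \<bar>\<Sum>i\<le>degree p. coeff p i * (s ^ i * exp (- s))\<bar>"
  by (simp add: poly_altdef sum_distrib_right mult.assoc)
 also have "\<dots> \<le> (\<Sum>i\<le>degree p. \<bar>coeff p i\<bar> * fact i)"
  by (rule order_trans[OF sum_abs]) (use s * in \<open>auto simp: abs_mult intro!: sum_mono mult_left_mono\<close>)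
 finally show "\<bar>poly p s * exp (- s)\<bar> \<le> (\<Sum>i\<le>degree p. \<bar>coeff p i\<bar> * fact i)" .
qed

lemma DERIV_zero_of_quadratic:
 fixes f :: "real => real"
 assumes "\<And>t. \<bar>f t\<bar> \<le> C * t\<^sup>2"
 shows "(f has_field_derivative 0) (at 0)"
proof -
 have f0: "f 0 = 0" using assms[of 0] by simp
 have "((\<lambda>h. (f (0 + h) - f 0) / h) \<longlongrightarrow> 0) (at 0)"
 proof (rule tendsto_0_le[where K=C and f="\<lambda>h. h"])
  show "eventually (\<lambda>h. norm ((f (0 + h) - f 0) / h) \<le> norm h * C) (at 0)"
  proof (rule eventually_mono[OF eventually_at_ball'[of 1 0 UNIV]])
   fix h :: real assume "h \<in> ball 0 1 \<and> h \<noteq> 0 \<and> h \<in> UNIV"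
   thus "norm ((f (0 + h) - f 0) / h) \<le> norm h * C"
    using assms[of h] f0 by (simp add: field_simps power2_eq_square abs_mult_self_eq)
  qed auto
 qed (rule tendsto_ident_at)
 thus ?thesis
  by (simp add: DERIV_def)
qed

text \<open>The derivative of p(1 / t) exp(- 1 / t) is s^2 (p(s) - p'(s)) exp(- s) at s = 1 / t,
  which is the recursion. Thus \<open>flat_exp n\<close> is the n-th derivative of exp(- 1 / t),
  extended by zero to t <= 0.\<close>

fun bump_poly :: "nat => real poly" where
 "bump_poly 0 = 1"
| "bump_poly (Suc n) = [:0, 0, 1:] * (bump_poly n - pderiv (bump_poly n))"

definition flat_exp :: "nat => real => real" where
 "flat_exp n t = (if t \<le> 0 then 0 else poly (bump_poly n) (1 / t) * exp (- (1 / t)))"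

lemma flat_exp_bounded: "\<exists>C. \<forall>t. \<bar>flat_exp n t\<bar> \<le> C"
proof -
 obtain C where C: "\<forall>s\<ge>0. \<bar>poly (bump_poly n) s * exp (- s)\<bar> \<le> C"
  using poly_times_exp_bounded by blast
 hence "0 \<le> C" by (meson abs_ge_zero order_refl order_trans)
 thus ?thesis using C by (intro exI[of _ C]) (auto simp: flat_exp_def)
qed

lemma DERIV_flat_exp: "(flat_exp n has_field_derivative flat_exp (Suc n) t) (at t)"
proof (cases t "0::real" rule: linorder_cases)
 case less
 have "((\<lambda>_. 0) has_field_derivative 0) (at t)" by simp
 hence "(flat_exp n has_field_derivative 0) (at t)"
  by (rule has_field_derivative_transform_within_open[of _ _ _ "{..<0}"]) (use less in \<open>auto simp: flat_exp_def\<close>)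
 thus ?thesis using less by (simp add: flat_exp_def)
next
 case equal
 \<comment> \<open>The extra factor s^2 = 1 / t^2 turns boundedness of polynomial times exp(- s)
   into |flat_exp n t| <= C t^2, hence into a zero derivative at 0.\<close>
 obtain C where C: "\<forall>s\<ge>0. \<bar>poly ([:0, 0, 1:] * bump_poly n) s * exp (- s)\<bar> \<le> C"
  using poly_times_exp_bounded by blast
 hence "0 \<le> C" by (meson abs_ge_zero order_refl order_trans)
 have "\<bar>flat_exp n t\<bar> \<le> C * t\<^sup>2" for t
 proof (cases "t \<le> 0")
  case False
  hence "\<bar>poly ([:0, 0, 1:] * bump_poly n) (1/t) * exp (- (1/t))\<bar> \<le> C"
   using C False by (metis divide_nonneg_pos linorder_not_le zero_le_one)
  also have "poly ([:0, 0, 1:] * bump_poly n) (1/t) * exp (- (1/t)) = flat_exp n t / t\<^sup>2"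
   using False by (simp add: flat_exp_def power2_eq_square)
  finally show ?thesis using False by (simp add: field_simps)
 qed (use \<open>0 \<le> C\<close> in \<open>auto simp: flat_exp_def\<close>)
 thus ?thesis
  using equal DERIV_zero_of_quadratic[of "flat_exp n" C] by (simp add: flat_exp_def[of "Suc n"])
next
 case greater
 have "((\<lambda>t. poly (bump_poly n) (1 / t) * exp (- (1 / t))) has_field_derivative flat_exp (Suc n) t) (at t)"
  using greater
  by (auto intro!: derivative_eq_intros DERIV_chain2[OF poly_DERIV] simp: flat_exp_def field_simps power2_eq_square)
 thus ?thesis
  by (rule has_field_derivative_transform_within_open[of _ _ _ "{0<..}"]) (use greater in \<open>auto simp: flat_exp_def\<close>)
qed

definition smooth_step :: "real => real" where
 "smooth_step t = flat_exp 0 t / (flat_exp 0 t + flat_exp 0 (1 - t))"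

lemma smooth_step_simps: "t \<le> 0 ==> smooth_step t = 0" "t \<ge> 1 ==> smooth_step t = 1"
 by (auto simp: smooth_step_def flat_exp_def)

lemma usmooth_smooth_step:
 assumes "open S" "usmooth S I h"
 shows "usmooth S I (\<lambda>i x. smooth_step (h i x))"
proof -
 have *: "usmooth S I (\<lambda>i x. flat_exp 0 (g i x))" if "usmooth S I g" for g :: "'b => 'a => real"
  using flat_exp_bounded
  by (intro usmooth_comp[OF assms(1) that, where F="\<lambda>n _. flat_exp n"] DERIV_flat_exp) (auto, blast)
 have h: "usmooth S I (\<lambda>i x. 1 - h i x)"
  using usmooth_diff_fun[OF assms(1) usmooth_const[where c="\<lambda>_. 1" and C=1] assms(2)] by simp
 \<comment> \<open>One of t and 1 - t is at least 1/2, and exp(- 1 / s) >= exp(- 2) for s >=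
   1/2.\<close>
 have lb: "exp (-2) \<le> flat_exp 0 t + flat_exp 0 (1 - t)" for t
 proof -
  have 1: "exp (-2) \<le> flat_exp 0 s" if "s \<ge> 1/2" for s
   using that by (auto simp: flat_exp_def field_simps)
  have 2: "0 \<le> flat_exp 0 s" for s
   by (auto simp: flat_exp_def)
  show ?thesis
   using 1[of t] 1[of "1 - t"] 2[of t] 2[of "1 - t"] by argo
 qed
 have "usmooth S I (\<lambda>i x. flat_exp 0 (h i x) * inverse (flat_exp 0 (h i x) + flat_exp 0 (1 - h i x)))"
  by (intro usmooth_mult usmooth_inverse[where c="exp (-2)"] usmooth_add assms * h)
   (use lb in \<open>auto intro: order_trans[OF lb abs_ge_self]\<close>)
 thus ?thesis
  by (simp add: smooth_step_def divide_inverse)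
qed

lemma bump_exists:
 fixes c :: "'a::euclidean_space"
 assumes "\<rho> > 0"
 obtains g :: "'a => real" where "smooth_on UNIV g" "\<And>y. y \<in> ball c \<rho> ==> g y = 1"
  "\<And>y. y \<notin> cball c (2 * \<rho>) ==> g y = 0"
proof
 define q where "q y = (\<Sum>b\<in>Basis. (y \<bullet> b - c \<bullet> b) * (y \<bullet> b - c \<bullet> b))" for y
 have q: "q y = (dist c y)\<^sup>2" for y
  unfolding dist_norm norm_minus_commute[of c] power2_norm_eq_inner q_def
  by (subst euclidean_inner) (simp add: inner_diff_left)
 \<comment> \<open>The argument is at least 1 for |y - c| <= rho and at most 0 for |y - c|^2 >= 2
   rho^2, in particular outside the ball of radius 2 rho.\<close>
 define g where "g y = smooth_step (2 - inverse (\<rho>\<^sup>2) * q y)" for y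
 have "smooth_on (ball 0 R) g" for R
 proof -
  have "usmooth (ball 0 R) {()} (\<lambda>_ y. smooth_step (2 - inverse (\<rho>\<^sup>2) * q y))"
   unfolding q_def
   by (intro usmooth_smooth_step usmooth_diff_fun usmooth_cmult[where C="inverse (\<rho>\<^sup>2)"]
     usmooth_const[where C=2] usmooth_sqdist) auto
  thus ?thesis
   unfolding g_def by (rule usmooth_smooth) simp
 qed
 thus "smooth_on UNIV g"
  by (intro smooth_on_local) (metis centre_in_ball dist_0_norm gt_ex mem_ball)
 show "g y = 1" if "y \<in> ball c \<rho>" for y
 proof -
  have "q y \<le> \<rho>\<^sup>2"
   unfolding q using that by (intro power_mono) auto
  thus ?thesis
   unfolding g_def using assms by (intro smooth_step_simps) (simp add: field_simps)
 qed
 show "g y = 0" if "y \<notin> cball c (2 * \<rho>)" for y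
 proof -
  have "(2 * \<rho>)\<^sup>2 \<le> q y"
   unfolding q using that assms by (intro power_mono) auto
  hence "2 * \<rho>\<^sup>2 \<le> q y"
   using zero_le_power2[of \<rho>] unfolding power_mult_distrib power2_eq_square by linarith
  thus ?thesis
   unfolding g_def using assms by (intro smooth_step_simps) (simp add: field_simps)
 qed
qed

lemma cutoff_exists:
 fixes K S :: "'a::euclidean_space set"
 assumes "compact K" "open S" "K \<subseteq> S"
 obtains h V where "h \<in> test_fun S" "open V" "K \<subseteq> V" "\<And>y. y \<in> V ==> h y = 1"
proof -
 have "\<exists>\<rho> g. \<rho> > 0 \<and> cball c (2 * \<rho>) \<subseteq> S \<and> smooth_on UNIV g \<and> (\<forall>y\<in>ball c \<rho>. g y = (1::real)) \<and>
   (\<forall>y. y \<notin> cball c (2 * \<rho>) \<longrightarrow> g y = 0)" if c: "c \<in> K" for c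
 proof -
  obtain e where e: "e > 0" "cball c e \<subseteq> S"
   using assms c open_contains_cball by blast
  obtain g :: "'a => real" where "smooth_on UNIV g" "\<And>y. y \<in> ball c (e/2) ==> g y = 1"
   "\<And>y. y \<notin> cball c (2 * (e/2)) ==> g y = 0"
   using bump_exists[of "e/2" c] e by auto
  thus ?thesis
   using e by (intro exI[of _ "e/2"] exI[of _ g]) auto
 qed
 hence "\<forall>c\<in>K. \<exists>\<rho> g. \<rho> > 0 \<and> cball c (2 * \<rho>) \<subseteq> S \<and> smooth_on UNIV g \<and> (\<forall>y\<in>ball c \<rho>. g y = (1::real)) \<and>
   (\<forall>y. y \<notin> cball c (2 * \<rho>) \<longrightarrow> g y = 0)" by blast
 then obtain \<rho> g where g: "\<And>c. c \<in> K ==> \<rho> c > 0" "\<And>c. c \<in> K ==> cball c (2 * \<rho> c) \<subseteq> S"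
  "\<And>c. c \<in> K ==> smooth_on UNIV (g c)" "\<And>c y. c \<in> K ==> y \<in> ball c (\<rho> c) ==> g c y = (1::real)"
  "\<And>c y. c \<in> K ==> y \<notin> cball c (2 * \<rho> c) ==> g c y = 0"
  unfolding bchoice_iff by blast
 obtain T where T: "T \<subseteq> K" "finite T" "K \<subseteq> (\<Union>c\<in>T. ball c (\<rho> c))"
  using compactE_image[OF assms(1), of K "\<lambda>c. ball c (\<rho> c)"] g(1) by force
 \<comment> \<open>1 minus the product of all 1 - g c: it is 1 where some bump is 1, and 0 where all
   bumps vanish.\<close>
 define h where "h y = 1 + (-1) * (\<Prod>c\<in>T. 1 + (-1) * g c y)" for y
 show thesis
 proof
  have sm: "smooth_on UNIV h"
   unfolding h_def using T g(3)
   by (intro smooth_on_add smooth_on_mult smooth_on_const smooth_on_prod) auto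
  have "supp h \<subseteq> (\<Union>c\<in>T. cball c (2 * \<rho> c))"
  proof (rule supp_minimal)
   show "h x = 0" if "x \<notin> (\<Union>c\<in>T. cball c (2 * \<rho> c))" for x
   proof -
    have "g c x = 0" if "c \<in> T" for c
     using g(5)[of c x] that T \<open>x \<notin> _\<close> by blast
    thus ?thesis by (simp add: h_def)
   qed
  qed (use T in auto)
  moreover have "compact (\<Union>c\<in>T. cball c (2 * \<rho> c))"
   using T by (intro compact_UN) auto
  ultimately show "h \<in> test_fun S"
   using sm compact_supp_subset g(2) T unfolding test_fun_def by blast
  show "h y = 1" if y: "y \<in> (\<Union>c\<in>T. ball c (\<rho> c))" for y
  proof -
   obtain c where c: "c \<in> T" "y \<in> ball c (\<rho> c)" using y by auto
   hence "1 + (-1) * g c y = 0" using g(4)[of c y] T by auto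
   hence "(\<Prod>c\<in>T. 1 + (-1) * g c y) = 0"
    using c T(2) by (meson prod_zero)
   thus ?thesis by (simp add: h_def)
  qed
 qed (use T in auto)
qed

subsection \<open>Integrals of smooth functions with compact support\<close>

text \<open>The condition is vanishing off a given set K instead of a condition on the support. For
  compact K it passes to derivatives with the same K, and one K serves a whole family, so that the
  measure of K can enter uniform constants.\<close>

definition csmooth :: "'a::euclidean_space set => ('a => 'b::real_normed_vector) => bool" where
 "csmooth K g \<longleftrightarrow> smooth_on UNIV g \<and> (\<forall>y. y \<notin> K \<longrightarrow> g y = 0)"

lemma csmooth_supp: "compact K ==> csmooth K g ==> supp g \<subseteq> K"
 by (rule supp_minimal) (auto simp: csmooth_def compact_imp_closed)

lemma csmooth_iter:
 assumes "compact K" "csmooth K g" "set bs \<subseteq> Basis"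
 shows "csmooth K (iter_deriv bs g)"
 using assms csmooth_supp[OF assms(1,2)] smooth_on_iter[of UNIV g bs] iter_deriv_outside_supp[of _ g bs]
 unfolding csmooth_def by blast

lemma csmooth_continuous: "csmooth K g ==> continuous_on UNIV g"
 by (simp add: csmooth_def smooth_on_continuous)

lemma csmooth_measurable [measurable_dest]: "csmooth K g ==> g \<in> borel_measurable borel"
 by (intro borel_measurable_continuous_onI csmooth_continuous)

lemma integrable_csupp:
 fixes g :: "'a::euclidean_space => 'b::{banach, second_countable_topology}"
 assumes "compact K" "continuous_on UNIV g" "\<And>y. y \<notin> K ==> g y = 0"
 shows "integrable lborel g"
proof -
 have "integrable lborel (\<lambda>x. indicator K x *\<^sub>R g x)"
  by (rule borel_integrable_compact[OF assms(1) continuous_on_subset[OF assms(2)]]) simp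
 moreover have "(\<lambda>x. indicator K x *\<^sub>R g x) = g"
  using assms(3) by (auto simp: indicator_def)
 ultimately show ?thesis by simp
qed

lemma integrable_csmooth:
 fixes g :: "'a::euclidean_space => 'b::{banach, second_countable_topology}"
 shows "compact K ==> csmooth K g ==> integrable lborel g"
 using integrable_csupp[of K g] csmooth_continuous[of K g] by (auto simp: csmooth_def)

text \<open>A non-integrable function has integral 0 by convention, and then only the right-hand
  side has to be non-negative; this spares integrability proofs for every Fourier integral that is
  merely estimated.\<close>

lemma norm_integral_csupp_le:
 fixes g :: "'a::euclidean_space => 'b::{banach, second_countable_topology}"
 assumes "compact K" "\<And>y. y \<in> K ==> norm (g y) \<le> B" "\<And>y. y \<notin> K ==> g y = 0"
 shows "norm (LBINT y. g y) \<le> B * measure lborel K"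
proof -
 have K: "K \<in> sets lborel" "emeasure lborel K < \<infinity>"
  using assms(1) emeasure_compact_finite by (auto intro: borel_closed compact_imp_closed)
 have K': "integrable lborel (indicator K :: 'a => real)"
  using K by (rule integrable_real_indicator)
 show ?thesis
 proof (cases "integrable lborel g")
  case True
  have "norm (LBINT y. g y) \<le> (LBINT y. norm (g y))"
   by (rule integral_norm_bound)
  also have "\<dots> \<le> (LBINT y. B * indicator K y)"
   by (intro integral_mono integrable_norm True integrable_mult_right K') (use assms in \<open>auto simp: indicator_def\<close>)
  finally show ?thesis using K by simp
 next
  case False
  have "0 \<le> B * measure lborel K"
  proof (cases "K = {}")
   case False
   thus ?thesis using assms(2) by (meson all_not_in_conv measure_nonneg mult_nonneg_nonneg norm_ge_zero order_trans)
  qed simp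
  thus ?thesis using False by (simp add: not_integrable_integral_eq)
 qed
qed

lemma has_vector_derivative_line:
 assumes "g differentiable (at (y + s *\<^sub>R b))"
 shows "((\<lambda>s. g (y + s *\<^sub>R b)) has_vector_derivative dir_deriv b g (y + s *\<^sub>R b)) (at s within T)"
proof -
 have "((\<lambda>s. y + s *\<^sub>R b) has_derivative (\<lambda>h. h *\<^sub>R b)) (at s within T)"
  by (auto intro!: derivative_eq_intros)
 from has_derivative_compose[OF this has_derivative_dir_deriv[OF assms]]
 have "((\<lambda>s. g (y + s *\<^sub>R b)) has_derivative (\<lambda>h. dir_deriv (h *\<^sub>R b) g (y + s *\<^sub>R b))) (at s within T)" .
 moreover have "dir_deriv (h *\<^sub>R b) g (y + s *\<^sub>R b) = h *\<^sub>R dir_deriv b g (y + s *\<^sub>R b)" for h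
  using linear_scale[OF has_derivative_linear[OF has_derivative_dir_deriv[OF assms]]] by blast
 ultimately show ?thesis
  by (simp add: has_vector_derivative_def)
qed

lemma norm_increment_le:
 fixes g :: "'a::euclidean_space => 'b::real_normed_vector"
 assumes "\<And>y. g differentiable (at y)" "\<And>y. norm (dir_deriv b g y) \<le> B" "0 \<le> t"
 shows "norm (g (y + t *\<^sub>R b) - g y) \<le> B * t"
proof -
 have "norm (g (y + t *\<^sub>R b) - g (y + 0 *\<^sub>R b)) \<le> B * norm (t - 0)"
 proof (rule differentiable_bound[where f="\<lambda>s. g (y + s *\<^sub>R b)"
    and f'="\<lambda>s h. h *\<^sub>R dir_deriv b g (y + s *\<^sub>R b)" and S="{0..t}"])
  fix s assume "s \<in> {0..t}"
  show "((\<lambda>s. g (y + s *\<^sub>R b)) has_derivative (\<lambda>h. h *\<^sub>R dir_deriv b g (y + s *\<^sub>R b))) (at s within {0..t})"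
   using has_vector_derivative_line[OF assms(1)] by (simp add: has_vector_derivative_def)
  show "onorm (\<lambda>h. h *\<^sub>R dir_deriv b g (y + s *\<^sub>R b)) \<le> B"
   by (rule onorm_le) (use mult_right_mono[OF assms(2) abs_ge_zero] in \<open>simp add: mult.commute\<close>)
 qed (use assms in auto)
 thus ?thesis using assms(3) by simp
qed

text \<open>By translation invariance the difference quotients along b have integral 0; they are
  dominated and converge to the derivative. The integrations by parts in several variables rest on
  this.\<close>

lemma integral_dir_deriv_eq_0:
 fixes g :: "'a::euclidean_space => 'b::{banach, second_countable_topology}"
 assumes "compact K" "csmooth K g" "b \<in> Basis"
 shows "(LBINT y. dir_deriv b g y) = 0"
proof -
 have g: "g differentiable (at y)" for y
  using assms(2) smooth_on_differentiable unfolding csmooth_def by blast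
 have D: "csmooth K (dir_deriv b g)"
  using csmooth_iter[OF assms(1,2), of "[b]"] assms(3) by (simp add: iter_deriv_Cons)
 have "compact (dir_deriv b g ` K)"
  by (intro compact_continuous_image continuous_on_subset[OF csmooth_continuous[OF D]] assms) simp
 then obtain B0 where B0: "\<forall>z\<in>dir_deriv b g ` K. norm z \<le> B0"
  using compact_imp_bounded bounded_iff by metis
 define B where "B = max B0 0"
 have B: "norm (dir_deriv b g y) \<le> B" for y
  using B0 D by (cases "y \<in> K") (auto simp: B_def csmooth_def le_max_iff_disj)
 obtain R where R: "\<And>y. y \<in> K ==> norm y \<le> R"
  using compact_imp_bounded[OF assms(1)] bounded_iff by metis
 define t where "t n = inverse (real (Suc n))" for n
 have t: "0 < t n" "t n \<le> 1" "t \<longlonglongrightarrow> 0" for n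
  using LIMSEQ_inverse_real_of_nat by (simp_all add: t_def[abs_def] inverse_le_1_iff)
 define q where "q n y = (1 / t n) *\<^sub>R (g (y + t n *\<^sub>R b) - g y)" for n y
 note [measurable] = csmooth_measurable[OF assms(2)] csmooth_measurable[OF D]
 have int_g: "integrable lborel g" by (rule integrable_csmooth[OF assms(1,2)])
 have shift: "integrable lborel (\<lambda>y. g (y + c))" "(LBINT y. g (y + c)) = (LBINT y. g y)" for c
 proof -
  have "integrable (distr lborel borel ((+) c)) g"
   using int_g by (simp add: lborel_distr_plus)
  thus "integrable lborel (\<lambda>y. g (y + c))"
   by (subst (asm) integrable_distr_eq) (auto simp: add.commute)
  have "(LINT y|distr lborel borel ((+) c). g y) = (LBINT y. g (c + y))"
   by (rule integral_distr) auto
  thus "(LBINT y. g (y + c)) = (LBINT y. g y)"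
   by (simp add: lborel_distr_plus add.commute)
 qed
 have "(\<lambda>n. LBINT y. q n y) \<longlonglongrightarrow> (LBINT y. dir_deriv b g y)"
 proof (rule integral_dominated_convergence[where w="\<lambda>y. B * indicator (cball 0 (R + 1)) y"])
  \<comment> \<open>The steps t n are at most 1 and b is a unit vector, so all quotients vanish
    outside the ball of radius R + 1.\<close>
  show "integrable lborel (\<lambda>y. B * indicator (cball 0 (R + 1)) y :: real)"
   by (intro integrable_mult_right integrable_real_indicator emeasure_compact_finite) auto
  show "AE y in lborel. norm (q n y) \<le> B * indicator (cball 0 (R + 1)) y" for n
  proof (rule AE_I2)
   fix y
   have "norm (g (y + t n *\<^sub>R b) - g y) \<le> B * t n"
    using norm_increment_le[OF g B] t(1)[of n] by (simp add: less_imp_le)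
   hence 1: "norm (q n y) \<le> B"
    using t(1)[of n] unfolding q_def norm_scaleR by (simp add: field_simps)
   show "norm (q n y) \<le> B * indicator (cball 0 (R + 1)) y"
   proof (cases "norm y \<le> R + 1")
    case False
    have "norm (t n *\<^sub>R b) \<le> 1" using t(1,2)[of n] assms(3) by simp
    hence "norm (y + t n *\<^sub>R b) > R" "norm y > R"
     using False norm_triangle_ineq4[of "y + t n *\<^sub>R b" "t n *\<^sub>R b"] by auto
    hence "g (y + t n *\<^sub>R b) = 0" "g y = 0"
     using R assms(2) unfolding csmooth_def by (meson linorder_not_le)+
    thus ?thesis using False by (simp add: q_def)
   qed (use 1 in simp)
  qed
  show "AE y in lborel. (\<lambda>n. q n y) \<longlonglongrightarrow> dir_deriv b g y"
  proof (rule AE_I2)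
   fix y
   have "((\<lambda>s. g (y + s *\<^sub>R b)) has_vector_derivative dir_deriv b g y) (at 0)"
    using has_vector_derivative_line[of g y 0 b UNIV] g by simp
   hence "((\<lambda>s. norm (g (y + s *\<^sub>R b) - g y - s *\<^sub>R dir_deriv b g y) / norm s) \<longlongrightarrow> 0) (at 0)"
    unfolding has_vector_derivative_def has_derivative_iff_norm by simp
   moreover have "eventually (\<lambda>s. norm (g (y + s *\<^sub>R b) - g y - s *\<^sub>R dir_deriv b g y) / norm s =
     norm ((1 / s) *\<^sub>R (g (y + s *\<^sub>R b) - g y) - dir_deriv b g y)) (at 0)"
    unfolding eventually_at_filter
   proof (intro always_eventually allI impI)
    fix s :: real assume "s \<noteq> 0"
    hence "(1 / s) *\<^sub>R (g (y + s *\<^sub>R b) - g y) - dir_deriv b g y =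
      (1 / s) *\<^sub>R (g (y + s *\<^sub>R b) - g y - s *\<^sub>R dir_deriv b g y)"
     by (simp add: scaleR_diff_right)
    thus "norm (g (y + s *\<^sub>R b) - g y - s *\<^sub>R dir_deriv b g y) / norm s =
     norm ((1 / s) *\<^sub>R (g (y + s *\<^sub>R b) - g y) - dir_deriv b g y)"
     by (simp only: norm_scaleR) (simp add: field_simps)
   qed
   ultimately have "((\<lambda>s. norm ((1 / s) *\<^sub>R (g (y + s *\<^sub>R b) - g y) - dir_deriv b g y)) \<longlongrightarrow> 0) (at 0)"
    by (rule Lim_transform_eventually)
   hence "((\<lambda>s. (1 / s) *\<^sub>R (g (y + s *\<^sub>R b) - g y)) \<longlongrightarrow> dir_deriv b g y) (at 0)"
    by (simp only: tendsto_norm_zero_iff LIM_zero_iff)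
   thus "(\<lambda>n. q n y) \<longlonglongrightarrow> dir_deriv b g y"
    unfolding q_def by (rule filterlim_compose)
     (use less_imp_neq[OF t(1)] in \<open>auto simp: filterlim_at t(3) intro!: always_eventually\<close>)
  qed
  show "q n \<in> borel_measurable lborel" for n
   unfolding q_def by measurable
 qed auto
 moreover have "(LBINT y. q n y) = 0" for n
  unfolding q_def using shift int_g by simp
 ultimately show ?thesis
  by (simp add: LIMSEQ_const_iff)
qed

subsection \<open>The Fourier transform\<close>

text \<open>\<open>fourier\<close> takes real functions only; waves and frozen symbols are
  complex.\<close>

definition ft :: "('a::euclidean_space => complex) => 'a => complex" where
 "ft g \<xi> = (LBINT y. exp (- \<i> * cor (y \<bullet> \<xi>)) * g y)"

lemma fourier_eq_ft: "fourier \<phi> = ft (\<lambda>y. cor (\<phi> y))"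
 by (simp add: fourier_def ft_def fun_eq_iff)

lemma norm_exp_i [simp]: "cmod (exp (- (\<i> * cor r))) = 1" "cmod (ei r) = 1"
 by (simp_all add: norm_exp_eq_Re)

lemma ft_measurable [measurable]:
 assumes [measurable]: "g \<in> borel_measurable borel"
 shows "ft g \<in> borel_measurable borel"
 unfolding ft_def[abs_def] by (intro lborel.borel_measurable_lebesgue_integral) measurable

lemma norm_ft_le:
 assumes "compact K" "\<And>y. y \<in> K ==> norm (g y) \<le> B" "\<And>y. y \<notin> K ==> g y = 0"
 shows "norm (ft g \<xi>) \<le> B * measure lborel K"
 unfolding ft_def by (rule norm_integral_csupp_le[OF assms(1)]) (use assms in \<open>auto simp: norm_mult\<close>)

lemma integrable_exp_mult:
 fixes g :: "'a::euclidean_space => complex"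
 assumes "integrable lborel g" "r \<in> borel_measurable borel"
 shows "integrable lborel (\<lambda>y. ei (r y) * g y)"
  "integrable lborel (\<lambda>y. exp (- (\<i> * cor (r y))) * g y)"
 by (rule Bochner_Integration.integrable_bound[OF assms(1)]; use assms in \<open>simp add: norm_mult\<close>)+

lemma dir_deriv_exp_mult:
 fixes g :: "'a::euclidean_space => complex"
 assumes "g differentiable (at y)"
 shows "dir_deriv b (\<lambda>y. exp (- \<i> * cor (y \<bullet> \<xi>)) * g y) y =
  exp (- \<i> * cor (y \<bullet> \<xi>)) * dir_deriv b g y
   - \<i> * cor (\<xi> \<bullet> b) * (exp (- \<i> * cor (y \<bullet> \<xi>)) * g y)"
proof -
 have "((\<lambda>y. - \<i> * cor (y \<bullet> \<xi>)) has_derivative (\<lambda>v. - \<i> * cor (v \<bullet> \<xi>))) (at y)"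
  by (auto intro!: derivative_eq_intros)
 hence "((\<lambda>y. exp (- \<i> * cor (y \<bullet> \<xi>))) has_derivative
  (\<lambda>v. exp (- \<i> * cor (y \<bullet> \<xi>)) * (- \<i> * cor (v \<bullet> \<xi>)))) (at y)"
  using has_derivative_compose[OF _ DERIV_exp[unfolded has_field_derivative_def]] by blast
 from has_derivative_mult[OF this has_derivative_dir_deriv[OF assms]]
 show ?thesis
  by (intro dir_deriv_eqI[THEN trans]) (auto simp: algebra_simps inner_commute)
qed

lemma smooth_on_exp_inner: "smooth_on UNIV (\<lambda>y. exp (- \<i> * cor (y \<bullet> \<xi>)))"
proof (rule smooth_on_local)
 fix x :: 'a
 have 1: "usmooth (ball x 1) {()} (\<lambda>_ y. cor (y \<bullet> \<xi>))"
  by (intro usmooth_of_real usmooth_linear bounded_linear_inner_left) auto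
 have "usmooth (ball x 1) {()} (\<lambda>_ y. (\<lambda>n (i::unit) z. (- \<i>) ^ n * exp (- \<i> * z)) 0 () (cor (y \<bullet> \<xi>)))"
 proof (rule usmooth_comp[OF _ 1])
  show "((\<lambda>z. (- \<i>) ^ n * exp (- \<i> * z)) has_field_derivative (- \<i>) ^ Suc n * exp (- \<i> * cor (y \<bullet> \<xi>)))
    (at (cor (y \<bullet> \<xi>)))" for n y
   by (auto intro!: derivative_eq_intros)
  show "\<exists>C. \<forall>i\<in>{()}. \<forall>y\<in>ball x 1. norm ((- \<i>) ^ n * exp (- \<i> * cor (y \<bullet> \<xi>))) \<le> C" for n
   by (intro exI[of _ 1]) (simp add: norm_mult norm_power)
 qed auto
 hence "smooth_on (ball x 1) (\<lambda>y. exp (- \<i> * cor (y \<bullet> \<xi>)))"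
  using usmooth_smooth by fastforce
 thus "\<exists>V. x \<in> V \<and> smooth_on V (\<lambda>y. exp (- \<i> * cor (y \<bullet> \<xi>)))"
  by (intro exI[of _ "ball x 1"]) auto
qed

text \<open>The derivative along b of exp(- i y.xi) g(y) has integral 0.\<close>

lemma ft_dir:
 assumes "compact K" "csmooth K g" "b \<in> Basis"
 shows "ft (dir_deriv b g) \<xi> = \<i> * cor (\<xi> \<bullet> b) * ft g \<xi>"
proof -
 define h where "h y = exp (- \<i> * cor (y \<bullet> \<xi>)) * g y" for y
 have g: "g differentiable (at y)" for y
  using assms(2) smooth_on_differentiable unfolding csmooth_def by blast
 have h: "csmooth K h"
  unfolding h_def csmooth_def using assms(2) smooth_on_mult[OF open_UNIV smooth_on_exp_inner]
  by (auto simp: csmooth_def)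
 have D: "csmooth K (dir_deriv b g)"
  using csmooth_iter[OF assms(1,2), of "[b]"] assms(3) by (simp add: iter_deriv_Cons)
 have "0 = (LBINT y. dir_deriv b h y)"
  using integral_dir_deriv_eq_0[OF assms(1) h assms(3)] by simp
 also have "\<dots> = (LBINT y. exp (- \<i> * cor (y \<bullet> \<xi>)) * dir_deriv b g y
   - \<i> * cor (\<xi> \<bullet> b) * (exp (- \<i> * cor (y \<bullet> \<xi>)) * g y))"
  unfolding h_def by (intro Bochner_Integration.integral_cong refl dir_deriv_exp_mult g)
 also have "\<dots> = ft (dir_deriv b g) \<xi> - \<i> * cor (\<xi> \<bullet> b) * ft g \<xi>"
  unfolding ft_def
  using integrable_exp_mult(2)[OF integrable_csmooth[OF assms(1) D], of "\<lambda>y. y \<bullet> \<xi>"]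
   integrable_exp_mult(2)[OF integrable_csmooth[OF assms(1,2)], of "\<lambda>y. y \<bullet> \<xi>"]
  by (subst Bochner_Integration.integral_diff) auto
 finally show ?thesis by simp
qed

lemma csmooth_laplacian:
 fixes g :: "'a::euclidean_space => 'b::real_normed_field"
 assumes "compact K" "csmooth K g"
 shows "csmooth K (laplacian g)"
proof -
 have *: "csmooth K (iter_deriv [b, b] g)" if "b \<in> Basis" for b
  using csmooth_iter[OF assms] that by simp
 have "smooth_on UNIV (\<lambda>x. \<Sum>b\<in>B. iter_deriv [b, b] g x)" if "B \<subseteq> Basis" for B
  using finite_subset[OF that finite_Basis] that
  by (induction B) (use * in \<open>auto intro!: smooth_on_const smooth_on_add simp: csmooth_def\<close>)
 thus ?thesis
  using * by (auto simp: csmooth_def laplacian_def[abs_def])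
qed

text \<open>On the Fourier side this is multiplication by a - |xi|^2. With a = -1 it yields decay of
  the transform; with a = k^2 it measures how far a frequency is from the sphere of radius
  k.\<close>

definition helmholtz :: "'b::real_normed_field => ('a::euclidean_space => 'b) => 'a => 'b" where
 "helmholtz a g = (\<lambda>y. laplacian g y + a * g y)"

lemma csmooth_helmholtz:
 assumes "compact K" "csmooth K g"
 shows "csmooth K (helmholtz a g)"
 unfolding csmooth_def helmholtz_def
proof (intro conjI allI impI)
 show "smooth_on UNIV (\<lambda>y. laplacian g y + a * g y)"
  using csmooth_laplacian[OF assms] assms(2)
  by (intro smooth_on_add smooth_on_mult smooth_on_const) (auto simp: csmooth_def)
 show "laplacian g y + a * g y = 0" if "y \<notin> K" for y
  using csmooth_laplacian[OF assms] assms(2) that by (simp add: csmooth_def)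
qed

lemma csmooth_helmholtz_pow: "compact K ==> csmooth K g ==> csmooth K ((helmholtz a ^^ j) g)"
 by (induction j) (auto intro: csmooth_helmholtz)

lemma sum_Basis_sq: "(\<Sum>b\<in>Basis. (\<xi> \<bullet> b)\<^sup>2) = (norm \<xi>)\<^sup>2"
 using euclidean_inner[of \<xi> \<xi>] by (simp add: power2_norm_eq_inner power2_eq_square[of "\<xi> \<bullet> _"])

lemma ft_laplacian:
 assumes "compact K" "csmooth K g"
 shows "ft (laplacian g) \<xi> = - cor ((norm \<xi>)\<^sup>2) * ft g \<xi>"
proof -
 have 1: "csmooth K (dir_deriv b g)" if "b \<in> Basis" for b
  using csmooth_iter[OF assms, of "[b]"] that by (simp add: iter_deriv_Cons)
 have 2: "integrable lborel (iter_deriv [b, b] g)" if "b \<in> Basis" for b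
  using csmooth_iter[OF assms, of "[b, b]"] that integrable_csmooth[OF assms(1)] by simp
 have "ft (laplacian g) \<xi> = (\<Sum>b\<in>Basis. ft (iter_deriv [b, b] g) \<xi>)"
  unfolding ft_def laplacian_def sum_distrib_left
  using integrable_exp_mult(2)[OF 2, of _ "\<lambda>y. y \<bullet> \<xi>"]
  by (subst Bochner_Integration.integral_sum) auto
 also have "\<dots> = (\<Sum>b\<in>Basis. - cor ((\<xi> \<bullet> b)\<^sup>2) * ft g \<xi>)"
 proof (intro sum.cong refl)
  fix b :: 'a assume b: "b \<in> Basis"
  have "ft (iter_deriv [b, b] g) \<xi> = \<i> * cor (\<xi> \<bullet> b) * (\<i> * cor (\<xi> \<bullet> b) * ft g \<xi>)"
   using ft_dir[OF assms(1) 1[OF b] b] ft_dir[OF assms b] by (simp add: iter_deriv_Cons)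
  also have "\<dots> = (\<i> * \<i>) * (cor (\<xi> \<bullet> b) * cor (\<xi> \<bullet> b)) * ft g \<xi>"
   by (simp only: mult_ac)
  finally show "ft (iter_deriv [b, b] g) \<xi> = - cor ((\<xi> \<bullet> b)\<^sup>2) * ft g \<xi>"
   by (simp add: power2_eq_square)
 qed
 also have "\<dots> = - cor (\<Sum>b\<in>Basis. (\<xi> \<bullet> b)\<^sup>2) * ft g \<xi>"
  by (simp add: sum_distrib_right sum_negf)
 also have "(\<Sum>b\<in>Basis. (\<xi> \<bullet> b)\<^sup>2) = (norm \<xi>)\<^sup>2"
  by (rule sum_Basis_sq)
 finally show ?thesis .
qed

lemma ft_helmholtz_pow:
 assumes "compact K" "csmooth K g"
 shows "ft ((helmholtz (cor a) ^^ j) g) \<xi> = (cor (a - (norm \<xi>)\<^sup>2)) ^ j * ft g \<xi>"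
proof (induction j)
 case (Suc j)
 define h where "h = (helmholtz (cor a) ^^ j) g"
 have h: "csmooth K h"
  unfolding h_def by (rule csmooth_helmholtz_pow[OF assms])
 have "ft ((helmholtz (cor a) ^^ Suc j) g) \<xi> = ft (laplacian h) \<xi> + cor a * ft h \<xi>"
  using integrable_exp_mult(2)[OF integrable_csmooth[OF assms(1) h], of "\<lambda>y. y \<bullet> \<xi>"]
   integrable_exp_mult(2)[OF integrable_csmooth[OF assms(1) csmooth_laplacian[OF assms(1) h]], of "\<lambda>y. y \<bullet> \<xi>"]
  by (simp add: helmholtz_def h_def[symmetric] ft_def distrib_left mult.left_commute[of _ "cor a"])
 thus ?case
  using ft_laplacian[OF assms(1) h] Suc by (simp add: h_def algebra_simps)
qed simp

lemma ft_decay: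
 assumes "compact K" "csmooth K g"
 obtains C where "C > 0" "\<And>\<xi>. norm (ft g \<xi>) \<le> C * inverse ((1 + (norm \<xi>)\<^sup>2) ^ N)"
proof -
 define h where "h = (helmholtz (cor (-1)) ^^ N) g"
 have h: "csmooth K h"
  unfolding h_def by (rule csmooth_helmholtz_pow[OF assms])
 have "compact (h ` K)"
  by (intro compact_continuous_image continuous_on_subset[OF csmooth_continuous[OF h]] assms) simp
 then obtain B where B: "\<forall>z\<in>h ` K. norm z \<le> B"
  using compact_imp_bounded bounded_iff by metis
 define C where "C = max 1 (B * measure lborel K)"
 have "norm (ft h \<xi>) \<le> C" for \<xi>
  using norm_ft_le[OF assms(1), of h B \<xi>] B h by (auto simp: C_def csmooth_def le_max_iff_disj)
 moreover have "norm (ft h \<xi>) = (1 + (norm \<xi>)\<^sup>2) ^ N * norm (ft g \<xi>)" for \<xi>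
 proof -
  have "norm (ft h \<xi>) = norm (cor (- 1 - (norm \<xi>)\<^sup>2)) ^ N * norm (ft g \<xi>)"
   unfolding h_def ft_helmholtz_pow[OF assms] norm_mult norm_power ..
  also have "norm (cor (- 1 - (norm \<xi>)\<^sup>2)) = 1 + (norm \<xi>)\<^sup>2"
   unfolding norm_of_real by (simp add: abs_if) (smt (verit) zero_le_power2)
  finally show ?thesis .
 qed
 moreover have "(1 + (norm \<xi>)\<^sup>2) ^ N > 0" for \<xi> :: 'a
  by (intro zero_less_power) (smt (verit) zero_le_power2)
 ultimately have "norm (ft g \<xi>) \<le> C * inverse ((1 + (norm \<xi>)\<^sup>2) ^ N)" for \<xi>
  by (simp add: field_simps)
 thus thesis
  using that[of C] by (simp add: C_def)
qed

subsection \<open>Products over the coordinates and the Gaussian\<close>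

lemma integral_prod_Basis:
 fixes g :: "'a::euclidean_space => real => 'b::{real_normed_field, banach, second_countable_topology}"
 assumes "\<And>b. b \<in> Basis ==> integrable lborel (g b)"
 shows "integrable lborel (\<lambda>y::'a. \<Prod>b\<in>Basis. g b (y \<bullet> b))"
  "(LBINT y. (\<Prod>b\<in>Basis. g b (y \<bullet> b))) = (\<Prod>b\<in>Basis. (LBINT s. g b s))"
proof -
 interpret product_sigma_finite "\<lambda>_::'a. lborel :: real measure" ..
 have [measurable]: "g b \<in> borel_measurable borel" if "b \<in> Basis" for b
  using assms[OF that] by simp
 have m: "(\<lambda>f. \<Sum>b\<in>Basis. f b *\<^sub>R b) \<in> measurable (PiM Basis (\<lambda>_. lborel)) (borel :: 'a measure)"
  by measurable
 have p: "(\<lambda>y::'a. \<Prod>b\<in>Basis. g b (y \<bullet> b)) \<in> borel_measurable borel"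
  by measurable
 have eq: "(\<Prod>b\<in>Basis. g b ((\<Sum>b\<in>Basis. f b *\<^sub>R b) \<bullet> b)) = (\<Prod>b\<in>Basis. g b (f b))" for f :: "'a => real"
  by (intro prod.cong refl) (simp add: inner_sum_left_Basis)
 show "integrable lborel (\<lambda>y::'a. \<Prod>b\<in>Basis. g b (y \<bullet> b))"
  by (subst lborel_eq, subst integrable_distr_eq[OF m p], subst eq)
   (rule product_integrable_prod[OF finite_Basis assms])
 show "(LBINT y. (\<Prod>b\<in>Basis. g b (y \<bullet> b))) = (\<Prod>b\<in>Basis. (LBINT s. g b s))"
  by (subst lborel_eq, subst integral_distr[OF m p], subst eq)
   (rule product_integral_prod[OF finite_Basis assms])
qed

text \<open>The product of the one-dimensional functions 1 / (1 + y_b^2) dominates, since |y_b| <=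
  |y| for each of the d coordinates. The exponent d is chosen for this comparison.\<close>

lemma integrable_inverse_1_plus_norm:
 "integrable lborel (\<lambda>y::'a::euclidean_space. inverse ((1 + (norm y)\<^sup>2) ^ DIM('a)))"
proof (rule Bochner_Integration.integrable_bound)
 have "integrable lborel (\<lambda>s::real. inverse (1 + s\<^sup>2))"
  using integrable_inverse_1_plus_square by (simp add: set_integrable_def)
 thus "integrable lborel (\<lambda>y::'a. \<Prod>b\<in>Basis. inverse (1 + (y \<bullet> b)\<^sup>2))"
  by (rule integral_prod_Basis(1))
 show "AE y in (lborel :: 'a measure). norm (inverse ((1 + (norm y)\<^sup>2) ^ DIM('a))) \<le> norm (\<Prod>b\<in>Basis. inverse (1 + (y \<bullet> b)\<^sup>2) :: real)"
 proof (rule AE_I2)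
  fix y :: 'a
  have pos: "0 < 1 + s\<^sup>2" for s :: real
   by (smt (verit) zero_le_power2)
  have "inverse ((1 + (norm y)\<^sup>2) ^ DIM('a)) = (\<Prod>b\<in>(Basis::'a set). inverse (1 + (norm y)\<^sup>2))"
   by (simp add: power_inverse)
  also have "\<dots> \<le> (\<Prod>b\<in>Basis. inverse (1 + (y \<bullet> b)\<^sup>2))"
  proof (intro prod_mono conjI)
   fix b :: 'a assume "b \<in> Basis"
   hence "(y \<bullet> b)\<^sup>2 \<le> (norm y)\<^sup>2"
    using Basis_le_norm[of b y] by (simp add: abs_le_square_iff[symmetric])
   thus "inverse (1 + (norm y)\<^sup>2) \<le> inverse (1 + (y \<bullet> b)\<^sup>2)"
    using pos by (intro le_imp_inverse_le) auto
  qed (use pos in \<open>simp add: less_imp_le\<close>)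
  finally show "norm (inverse ((1 + (norm y)\<^sup>2) ^ DIM('a))) \<le> norm (\<Prod>b\<in>Basis. inverse (1 + (y \<bullet> b)\<^sup>2) :: real)"
   using pos by (simp add: less_imp_le prod_nonneg)
 qed
qed measurable

text \<open>This is the characteristic function of the standard normal law, freed of the normalising
  constant.\<close>

lemma gaussian_1d:
 "integrable lborel (\<lambda>s. cor (exp (- s\<^sup>2 / 2)) * ei (w * s))"
 "(LBINT s. cor (exp (- s\<^sup>2 / 2)) * ei (w * s)) =
  cor (sqrt (2 * pi) * exp (- w\<^sup>2 / 2))"
proof -
 have n: "cor (exp (- s\<^sup>2 / 2)) * e = cor (sqrt (2 * pi)) * (e * cor (std_normal_density s))" for s e
  by (simp add: std_normal_density_def)
 have "integrable lborel (\<lambda>s. cor (std_normal_density s))"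
  by (intro integrable_of_real integrable_normal_density) simp
 from integrable_exp_mult(1)[OF this, of "\<lambda>s. w * s"]
 have i2: "integrable lborel (\<lambda>s. ei (w * s) * cor (std_normal_density s))"
  by simp
 thus "integrable lborel (\<lambda>s. cor (exp (- s\<^sup>2 / 2)) * ei (w * s))"
  unfolding n by (rule integrable_mult_right)
 have "char std_normal_distribution w = cor (exp (- w\<^sup>2 / 2))"
  by (simp add: char_std_normal_distribution)
 also have "char std_normal_distribution w = (LBINT s. ei (w * s) * cor (std_normal_density s))"
  unfolding char_def by (subst integral_density) (auto simp: normal_density_nonneg scaleR_conv_of_real mult.commute)
 finally show "(LBINT s. cor (exp (- s\<^sup>2 / 2)) * ei (w * s)) =
  cor (sqrt (2 * pi) * exp (- w\<^sup>2 / 2))"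
  unfolding n integral_mult_right_zero by simp
qed

definition gauss :: "'a::euclidean_space => complex" where
 "gauss \<xi> = cor (exp (- (norm \<xi>)\<^sup>2 / 2))"

lemma gauss_measurable [measurable]: "gauss \<in> borel_measurable borel"
 unfolding gauss_def[abs_def] by measurable

lemma gaussian_integral:
 fixes w :: "'a::euclidean_space"
 shows "integrable lborel (\<lambda>\<xi>. gauss \<xi> * ei (w \<bullet> \<xi>))"
  "(LBINT \<xi>. gauss \<xi> * ei (w \<bullet> \<xi>)) = cor (sqrt (2 * pi) ^ DIM('a)) * gauss w"
proof -
 have eq: "gauss \<xi> * ei (w \<bullet> \<xi>) =
  (\<Prod>b\<in>Basis. cor (exp (- (\<xi> \<bullet> b)\<^sup>2 / 2)) * ei ((w \<bullet> b) * (\<xi> \<bullet> b)))" for \<xi>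
 proof -
  have "gauss \<xi> = (\<Prod>b\<in>Basis. cor (exp (- (\<xi> \<bullet> b)\<^sup>2 / 2)))"
   unfolding gauss_def sum_Basis_sq[symmetric] of_real_prod[symmetric] exp_sum[OF finite_Basis, symmetric]
   by (simp add: sum_negf sum_divide_distrib)
  moreover have "ei (w \<bullet> \<xi>) = (\<Prod>b\<in>Basis. ei ((w \<bullet> b) * (\<xi> \<bullet> b)))"
   unfolding exp_sum[OF finite_Basis, symmetric] by (subst euclidean_inner) (simp add: sum_distrib_left)
  ultimately show ?thesis by (simp add: prod.distrib)
 qed
 show "integrable lborel (\<lambda>\<xi>. gauss \<xi> * ei (w \<bullet> \<xi>))"
  unfolding eq by (rule integral_prod_Basis(1)[OF gaussian_1d(1)])
 have "(LBINT \<xi>. gauss \<xi> * ei (w \<bullet> \<xi>)) =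
  (\<Prod>b\<in>(Basis::'a set). cor (sqrt (2 * pi) * exp (- (w \<bullet> b)\<^sup>2 / 2)))"
  unfolding eq by (subst integral_prod_Basis(2)[OF gaussian_1d(1)]) (simp only: gaussian_1d(2))
 also have "\<dots> = cor (sqrt (2 * pi) ^ DIM('a)) * gauss w"
  unfolding gauss_def sum_Basis_sq[symmetric] of_real_mult prod.distrib of_real_prod[symmetric] exp_sum[OF finite_Basis, symmetric]
  by (simp add: sum_negf sum_divide_distrib)
 finally show "(LBINT \<xi>. gauss \<xi> * ei (w \<bullet> \<xi>)) = cor (sqrt (2 * pi) ^ DIM('a)) * gauss w" .
qed

section \<open>Exchange of integrals, Fourier inversion and Plancherel's identity\<close>

lemma integral_affine_euclidean:
 fixes f :: "'a::euclidean_space => 'b::{banach, second_countable_topology}"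
 assumes [measurable]: "f \<in> borel_measurable borel" and "c \<noteq> 0"
 shows "(LBINT y. f y) = \<bar>c\<bar> ^ DIM('a) *\<^sub>R (LBINT y. f (t + c *\<^sub>R y))"
  "integrable lborel (\<lambda>y. f (t + c *\<^sub>R y)) \<longleftrightarrow> integrable lborel f"
proof -
 have L: "lborel = density (distr lborel borel (\<lambda>x. t + c *\<^sub>R x)) (\<lambda>_. ennreal (\<bar>c\<bar> ^ DIM('a)))"
  using lborel_affine[OF assms(2), of t] by (simp add: ennreal_power)
 show "(LBINT y. f y) = \<bar>c\<bar> ^ DIM('a) *\<^sub>R (LBINT y. f (t + c *\<^sub>R y))"
  by (subst L, subst integral_density) (auto simp: integral_distr)
 have "integrable lborel f \<longleftrightarrow> integrable lborel (\<lambda>y. \<bar>c\<bar> ^ DIM('a) *\<^sub>R f (t + c *\<^sub>R y))"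
  by (subst L, subst integrable_density) (auto simp: integrable_distr_eq)
 moreover have "integrable lborel (\<lambda>y. f (t + c *\<^sub>R y))"
  if "integrable lborel (\<lambda>y. \<bar>c\<bar> ^ DIM('a) *\<^sub>R f (t + c *\<^sub>R y))"
  using integrable_scaleR_right[OF that, of "inverse (\<bar>c\<bar> ^ DIM('a))"] assms(2) by simp
 ultimately show "integrable lborel (\<lambda>y. f (t + c *\<^sub>R y)) \<longleftrightarrow> integrable lborel f"
  using integrable_scaleR_right by blast
qed

lemma integrable_pair_mult:
 fixes f :: "'a::euclidean_space => complex" and g :: "'b::euclidean_space => complex"
 assumes "integrable lborel f" "integrable lborel g"
  and h: "h \<in> borel_measurable (borel \<Otimes>\<^sub>M borel)" "\<And>x y. norm (h (x, y)) \<le> C"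
 shows "integrable (lborel \<Otimes>\<^sub>M lborel) (\<lambda>(x, y). h (x, y) * (f x * g y))"
proof -
 have [measurable]: "f \<in> borel_measurable borel" "g \<in> borel_measurable borel"
  using assms(1,2) by auto
 note h(1)[measurable]
 have "integrable (lborel \<Otimes>\<^sub>M lborel) (\<lambda>(x, y). f x * g y)"
 proof (rule lborel_pair.Fubini_integrable)
  show "integrable lborel (\<lambda>x. LBINT y. norm (case (x, y) of (x, y) => f x * g y))"
   using assms(1) by (simp add: norm_mult)
 qed (use assms(2) in \<open>auto intro!: AE_I2\<close>)
 hence "integrable (lborel \<Otimes>\<^sub>M lborel) (\<lambda>z. C *\<^sub>R (case z of (x, y) => f x * g y))"
  by (rule integrable_scaleR_right)
 thus ?thesis
 proof (rule Bochner_Integration.integrable_bound)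
  show "AE z in lborel \<Otimes>\<^sub>M lborel. norm (case z of (x, y) => h (x, y) * (f x * g y))
    \<le> norm (C *\<^sub>R (case z of (x, y) => f x * g y))"
  proof (rule AE_I2, clarify)
   fix x :: 'a and y :: 'b
   have "norm (h (x, y)) \<le> \<bar>C\<bar>" using h(2)[of x y] by linarith
   thus "norm (h (x, y) * (f x * g y)) \<le> norm (C *\<^sub>R (f x * g y))"
    by (simp add: norm_mult mult_right_mono)
  qed
 qed measurable
qed

text \<open>Exchanges of integrals over position and frequency have this shape: a bounded kernel,
  mostly exp(i y.xi), against two integrable factors.\<close>

lemma fubini_mult:
 fixes f :: "'a::euclidean_space => complex" and g :: "'b::euclidean_space => complex"
 assumes "integrable lborel f" "integrable lborel g"
  and h: "h \<in> borel_measurable (borel \<Otimes>\<^sub>M borel)" "\<And>x y. norm (h (x, y)) \<le> C"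
 shows "(LBINT x. f x * (LBINT y. h (x, y) * g y)) = (LBINT y. g y * (LBINT x. h (x, y) * f x))"
proof -
 have "(LBINT x. f x * (LBINT y. h (x, y) * g y)) = (LBINT x. (LBINT y. h (x, y) * (f x * g y)))"
  by (simp add: mult.left_commute flip: integral_mult_right_zero)
 also have "\<dots> = (LBINT y. (LBINT x. h (x, y) * (f x * g y)))"
  by (rule lborel_pair.Fubini_integral[symmetric])
   (rule integrable_pair_mult[OF assms])
 also have "\<dots> = (LBINT y. g y * (LBINT x. h (x, y) * f x))"
  by (simp add: mult.left_commute mult.commute flip: integral_mult_right_zero)
 finally show ?thesis .
qed

text \<open>A symbol may grow like a power of |xi|. The decay of the transform is taken with M + d
  powers, M to absorb the growth and d for integrability.\<close>

lemma integrable_weight_ft: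
 assumes "compact K" "csmooth K \<phi>" and [measurable]: "w \<in> borel_measurable borel"
  and "\<And>\<xi>. norm (w \<xi>) \<le> cw * (1 + (norm \<xi>)\<^sup>2) ^ M"
 shows "integrable lborel (\<lambda>\<xi>::'a::euclidean_space. w \<xi> * ft \<phi> \<xi>)"
proof -
 note csmooth_measurable[OF assms(2), measurable]
 obtain C where C: "C > 0" "\<And>\<xi>. norm (ft \<phi> \<xi>) \<le> C * inverse ((1 + (norm \<xi>)\<^sup>2) ^ (M + DIM('a)))"
  using ft_decay[OF assms(1,2)] by metis
 show ?thesis
 proof (rule Bochner_Integration.integrable_bound)
  show "integrable lborel (\<lambda>\<xi>::'a. (cw * C) * inverse ((1 + (norm \<xi>)\<^sup>2) ^ DIM('a)))"
   by (intro integrable_mult_right integrable_inverse_1_plus_norm)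
  show "AE \<xi> in lborel. norm (w \<xi> * ft \<phi> \<xi>) \<le> norm (cw * C * inverse ((1 + (norm \<xi>)\<^sup>2) ^ DIM('a)))"
  proof (rule AE_I2)
   fix \<xi> :: 'a
   have p: "0 < 1 + (norm \<xi>)\<^sup>2"
    by (smt (verit) zero_le_power2)
   have "norm (w \<xi> * ft \<phi> \<xi>) \<le> (cw * (1 + (norm \<xi>)\<^sup>2) ^ M) * (C * inverse ((1 + (norm \<xi>)\<^sup>2) ^ (M + DIM('a))))"
    unfolding norm_mult by (rule mult_mono[OF assms(4) C(2)]) (use assms(4)[of \<xi>] norm_ge_zero order_trans in \<open>auto, blast\<close>)
   also have "\<dots> = cw * C * inverse ((1 + (norm \<xi>)\<^sup>2) ^ DIM('a))"
    using p by (simp add: power_add field_simps)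
   finally show "norm (w \<xi> * ft \<phi> \<xi>) \<le> norm (cw * C * inverse ((1 + (norm \<xi>)\<^sup>2) ^ DIM('a)))"
    by simp
  qed
 qed measurable
qed

lemma integrable_ft: "compact K ==> csmooth K \<phi> ==> integrable lborel (ft \<phi>)"
 using integrable_weight_ft[of K \<phi> "\<lambda>_. 1" 1 0] by simp

lemma gauss_simps: "norm (gauss \<xi>) \<le> 1" "gauss (- \<xi>) = gauss \<xi>"
 by (auto simp: gauss_def)

lemma gauss_scale_tendsto:
 assumes "t \<longlonglongrightarrow> 0"
 shows "(\<lambda>n. gauss (t n *\<^sub>R \<xi>)) \<longlonglongrightarrow> 1"
proof -
 have "(\<lambda>n. cor (exp (- (norm (t n *\<^sub>R \<xi>))\<^sup>2 / 2))) \<longlonglongrightarrow> cor (exp (- (norm (0 *\<^sub>R \<xi>))\<^sup>2 / 2))"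
  using assms by (intro tendsto_intros) auto
 thus ?thesis by (simp add: gauss_def)
qed

lemma gaussian_scaled:
 fixes w :: "'a::euclidean_space"
 assumes "t > 0"
 shows "integrable lborel (\<lambda>\<xi>. gauss (t *\<^sub>R \<xi>) * ei (w \<bullet> \<xi>))"
  "(LBINT \<xi>. gauss (t *\<^sub>R \<xi>) * ei (w \<bullet> \<xi>)) =
   cor (inverse t ^ DIM('a) * sqrt (2 * pi) ^ DIM('a)) * gauss (inverse t *\<^sub>R w)"
proof -
 define f where "f \<xi> = gauss (t *\<^sub>R \<xi>) * ei (w \<bullet> \<xi>)" for \<xi> :: 'a
 have f: "f \<in> borel_measurable borel"
  unfolding f_def by measurable
 have *: "f (0 + inverse t *\<^sub>R \<xi>) = gauss \<xi> * ei ((inverse t *\<^sub>R w) \<bullet> \<xi>)" for \<xi>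
  using assms by (simp add: f_def)
 show "integrable lborel (\<lambda>\<xi>. gauss (t *\<^sub>R \<xi>) * ei (w \<bullet> \<xi>))"
  using integral_affine_euclidean(2)[OF f, of "inverse t" 0] assms gaussian_integral(1)[of "inverse t *\<^sub>R w"]
  unfolding * by (simp add: f_def[abs_def])
 show "(LBINT \<xi>. gauss (t *\<^sub>R \<xi>) * ei (w \<bullet> \<xi>)) =
   cor (inverse t ^ DIM('a) * sqrt (2 * pi) ^ DIM('a)) * gauss (inverse t *\<^sub>R w)"
  using integral_affine_euclidean(1)[OF f, of "inverse t" 0] assms gaussian_integral(2)[of "inverse t *\<^sub>R w"]
  unfolding * by (simp add: f_def[abs_def] scaleR_conv_of_real)
qed

text \<open>A factor gauss(t xi) makes the double integral absolutely convergent. Integrated over xi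
  it becomes an approximate identity of width t around y, and t tends to 0 in both forms of the
  integral by dominated convergence.\<close>

theorem ft_inversion:
 fixes \<phi> :: "'a::euclidean_space => complex"
 assumes "compact K" "csmooth K \<phi>"
 shows "(LBINT \<xi>. ei (y \<bullet> \<xi>) * ft \<phi> \<xi>) = cor ((2 * pi) ^ DIM('a)) * \<phi> y"
proof -
 define t where "t n = inverse (real (Suc n))" for n
 have t: "0 < t n" for n by (simp add: t_def)
 have t0: "t \<longlonglongrightarrow> 0"
  using LIMSEQ_inverse_real_of_nat by (simp add: t_def[abs_def])
 note [measurable] = csmooth_measurable[OF assms(2)]
 define I where "I n = (LBINT \<xi>. gauss (t n *\<^sub>R \<xi>) * (ei (y \<bullet> \<xi>) * ft \<phi> \<xi>))" for n
 define S where "S = cor (sqrt (2 * pi) ^ DIM('a))"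
 have "I \<longlonglongrightarrow> (LBINT \<xi>. ei (y \<bullet> \<xi>) * ft \<phi> \<xi>)"
  unfolding I_def
 proof (rule integral_dominated_convergence[where w="\<lambda>\<xi>. norm (ft \<phi> \<xi>)"])
  show "AE \<xi> in lborel. (\<lambda>n. gauss (t n *\<^sub>R \<xi>) * (ei (y \<bullet> \<xi>) * ft \<phi> \<xi>))
    \<longlonglongrightarrow> ei (y \<bullet> \<xi>) * ft \<phi> \<xi>"
   using tendsto_mult_right[OF gauss_scale_tendsto[OF t0]] by (intro AE_I2) fastforce
  show "AE \<xi> in lborel. norm (gauss (t n *\<^sub>R \<xi>) * (ei (y \<bullet> \<xi>) * ft \<phi> \<xi>)) \<le> norm (ft \<phi> \<xi>)" for n
   by (intro AE_I2) (simp add: norm_mult mult_left_le_one_le gauss_simps)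
 qed (use integrable_ft[OF assms] in \<open>auto intro: integrable_norm\<close>)
 moreover have "I \<longlonglongrightarrow> cor ((2 * pi) ^ DIM('a)) * \<phi> y"
 proof -
  have I: "I n = S * (LBINT v. \<phi> (y + t n *\<^sub>R v) * gauss v)" for n
  proof -
   have g: "integrable lborel (\<lambda>\<xi>::'a. gauss (t n *\<^sub>R \<xi>))"
    using gaussian_scaled(1)[OF t[of n], of 0] by simp
   have "I n = (LBINT \<xi>. gauss (t n *\<^sub>R \<xi>) * (LBINT z. ei ((y - z) \<bullet> \<xi>) * \<phi> z))"
    unfolding I_def ft_def
    by (simp add: inner_diff_left right_diff_distrib exp_diff exp_minus divide_inverse mult.assoc
      flip: integral_mult_right_zero)
   also have "\<dots> = (LBINT z. \<phi> z * (LBINT \<xi>. ei ((y - z) \<bullet> \<xi>) * gauss (t n *\<^sub>R \<xi>)))"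
    using fubini_mult[OF g integrable_csmooth[OF assms],
      of "\<lambda>(\<xi>, z). ei ((y - z) \<bullet> \<xi>)" 1] by simp
   also have "\<dots> = (LBINT z. \<phi> z * (cor (inverse (t n) ^ DIM('a)) * S * gauss (inverse (t n) *\<^sub>R (y - z))))"
    using gaussian_scaled(2)[OF t[of n], where 'a='a] by (simp add: S_def mult.commute[of "exp _"])
   also have "\<dots> = \<bar>t n\<bar> ^ DIM('a) *\<^sub>R (LBINT v. \<phi> (y + t n *\<^sub>R v) *
     (cor (inverse (t n) ^ DIM('a)) * S * gauss (inverse (t n) *\<^sub>R (y - (y + t n *\<^sub>R v)))))"
    using t[of n] by (intro integral_affine_euclidean(1)) auto
   also have "\<dots> = \<bar>t n\<bar> ^ DIM('a) *\<^sub>R (LBINT v. (cor (inverse (t n) ^ DIM('a)) * S) *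
     (\<phi> (y + t n *\<^sub>R v) * gauss v))"
    using t[of n] by (simp add: gauss_simps mult_ac)
   also have "\<dots> = (cor (\<bar>t n\<bar> ^ DIM('a)) * cor (inverse (t n) ^ DIM('a))) * S *
     (LBINT v. \<phi> (y + t n *\<^sub>R v) * gauss v)"
    unfolding integral_mult_right_zero by (simp add: scaleR_conv_of_real mult.assoc)
   also have "cor (\<bar>t n\<bar> ^ DIM('a)) * cor (inverse (t n) ^ DIM('a)) = 1"
    using t[of n] by (simp add: power_inverse flip: of_real_mult)
   finally show ?thesis by simp
  qed
  have "(\<lambda>n. LBINT v. \<phi> (y + t n *\<^sub>R v) * gauss v) \<longlonglongrightarrow> (LBINT v. \<phi> y * gauss (v::'a))"
  proof -
   have "compact (\<phi> ` K)"
    by (intro compact_continuous_image continuous_on_subset[OF csmooth_continuous[OF assms(2)]] assms) simp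
   then obtain B0 where B0: "\<forall>z\<in>\<phi> ` K. norm z \<le> B0"
    using compact_imp_bounded bounded_iff by metis
   define B where "B = max B0 0"
   have B: "norm (\<phi> z) \<le> B" for z
    using B0 assms(2) by (cases "z \<in> K") (auto simp: B_def csmooth_def le_max_iff_disj)
   show ?thesis
   proof (rule integral_dominated_convergence[where w="\<lambda>v::'a. B * norm (gauss v)"])
    show "AE v in lborel. (\<lambda>n. \<phi> (y + t n *\<^sub>R v) * gauss v) \<longlonglongrightarrow> \<phi> y * gauss v"
    proof (rule AE_I2)
     fix v :: 'a
     have c: "isCont \<phi> y"
      using csmooth_continuous[OF assms(2)] continuous_on_eq_continuous_at open_UNIV by blast
     have "(\<lambda>n. y + t n *\<^sub>R v) \<longlonglongrightarrow> y + 0 *\<^sub>R v"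
      by (intro tendsto_intros t0)
     hence "(\<lambda>n. \<phi> (y + t n *\<^sub>R v)) \<longlonglongrightarrow> \<phi> y"
      using isCont_tendsto_compose[OF c] by simp
     thus "(\<lambda>n. \<phi> (y + t n *\<^sub>R v) * gauss v) \<longlonglongrightarrow> \<phi> y * gauss v"
      by (intro tendsto_intros)
    qed
    show "AE v in lborel. norm (\<phi> (y + t n *\<^sub>R v) * gauss v) \<le> B * norm (gauss v)" for n
     by (intro AE_I2) (simp add: norm_mult mult_right_mono B)
    show "integrable lborel (\<lambda>v::'a. B * norm (gauss v))"
     using gaussian_integral(1)[of "0::'a"] by (intro integrable_mult_right integrable_norm) simp
   qed measurable
  qed
  hence "I \<longlonglongrightarrow> S * (LBINT v. \<phi> y * gauss (v::'a))"
   unfolding I by (intro tendsto_intros)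
  moreover have "(LBINT v. \<phi> y * gauss (v::'a)) = \<phi> y * S"
  proof -
   have "gauss (0::'a) = 1" by (simp add: gauss_def)
   thus ?thesis
    using gaussian_integral(2)[of "0::'a"] unfolding integral_mult_right_zero S_def by simp
  qed
  moreover have "S * S = cor ((2 * pi) ^ DIM('a))"
  proof -
   have "S * S = cor ((sqrt (2 * pi) * sqrt (2 * pi)) ^ DIM('a))"
    unfolding S_def power_mult_distrib of_real_mult ..
   thus ?thesis by simp
  qed
  moreover have "S * (\<phi> y * S) = (S * S) * \<phi> y"
   by (simp only: mult_ac)
  ultimately show ?thesis
   by (simp only:)
 qed
 ultimately show ?thesis
  using LIMSEQ_unique by blast
qed

lemma cnj_ft: "cnj (ft g \<xi>) = (LBINT y. ei (y \<bullet> \<xi>) * cnj (g y))"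
proof -
 have "cnj (ft g \<xi>) = (LBINT y. cnj (exp (- \<i> * cor (y \<bullet> \<xi>)) * g y))"
  unfolding ft_def by (rule integral_bounded_linear'[OF bounded_linear_cnj bounded_linear_cnj, symmetric]) simp
 thus ?thesis by (simp add: exp_cnj)
qed

text \<open>Conjugating one factor and exchanging integrals reduces the identity to the inversion
  formula.\<close>

lemma plancherel:
 fixes \<psi> :: "'a::euclidean_space => complex"
 assumes "compact K" "csmooth K \<psi>"
 shows "integrable lborel (\<lambda>\<xi>. (norm (ft \<psi> \<xi>))\<^sup>2)"
  "(LBINT \<xi>. (norm (ft \<psi> \<xi>))\<^sup>2) = (2 * pi) ^ DIM('a) * (LBINT y. (norm (\<psi> y))\<^sup>2)"
proof -
 have c: "csmooth K (\<lambda>y. cnj (\<psi> y))"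
  using assms(2) smooth_on_bounded_linear[OF open_UNIV bounded_linear_cnj] by (auto simp: csmooth_def)
 note [measurable] = csmooth_measurable[OF assms(2)]
 have [measurable]: "cnj \<in> borel_measurable borel"
  by (intro borel_measurable_continuous_onI continuous_intros)
 obtain C where C: "C > 0" "\<And>\<xi>. norm (ft \<psi> \<xi>) \<le> C * inverse ((1 + (norm \<xi>)\<^sup>2) ^ 0)"
  using ft_decay[OF assms] by metis
 have "integrable lborel (\<lambda>\<xi>. norm (cnj (ft \<psi> \<xi>) * ft \<psi> \<xi>))"
  by (intro integrable_norm integrable_weight_ft[OF assms, where cw=C and M=0]) (use C in auto)
 thus "integrable lborel (\<lambda>\<xi>. (norm (ft \<psi> \<xi>))\<^sup>2)"
  by (simp add: norm_mult power2_eq_square)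
 have "cor (LBINT \<xi>. (norm (ft \<psi> \<xi>))\<^sup>2) =
   (LBINT \<xi>. ft \<psi> \<xi> * (LBINT y. ei (y \<bullet> \<xi>) * cnj (\<psi> y)))"
  unfolding cnj_ft[symmetric] complex_norm_square[symmetric] integral_complex_of_real[symmetric] by (rule refl)
 also have "\<dots> = (LBINT y. cnj (\<psi> y) * (LBINT \<xi>. ei (y \<bullet> \<xi>) * ft \<psi> \<xi>))"
  using fubini_mult[OF integrable_ft[OF assms] integrable_csmooth[OF assms(1) c],
    of "\<lambda>(\<xi>, y). ei (y \<bullet> \<xi>)" 1] by simp
 also have "\<dots> = (LBINT y. cor ((2 * pi) ^ DIM('a) * (norm (\<psi> y))\<^sup>2))"
  unfolding ft_inversion[OF assms]
  by (intro Bochner_Integration.integral_cong refl) (simp add: complex_norm_square[symmetric] mult_ac del: of_real_power)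
 also have "\<dots> = cor ((2 * pi) ^ DIM('a) * (LBINT y. (norm (\<psi> y))\<^sup>2))"
  unfolding integral_complex_of_real integral_mult_right_zero ..
 finally show "(LBINT \<xi>. (norm (ft \<psi> \<xi>))\<^sup>2) = (2 * pi) ^ DIM('a) * (LBINT y. (norm (\<psi> y))\<^sup>2)"
  by (simp only: of_real_eq_iff)
qed

lemma nn_integral_ft_sq_le:
 fixes \<psi> :: "'a::euclidean_space => complex"
 assumes "compact K" "csmooth K \<psi>" "\<And>y. norm (\<psi> y) \<le> B"
 shows "(NN \<xi>. ennreal ((norm (ft \<psi> \<xi>))\<^sup>2)) \<le> ennreal ((2 * pi) ^ DIM('a) * (B\<^sup>2 * measure lborel K))"
proof -
 have "norm (LBINT y. (norm (\<psi> y))\<^sup>2) \<le> B\<^sup>2 * measure lborel K"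
  by (rule norm_integral_csupp_le[OF assms(1)]) (use assms(2,3) in \<open>auto simp: csmooth_def intro: power_mono\<close>)
 hence "(LBINT \<xi>. (norm (ft \<psi> \<xi>))\<^sup>2) \<le> (2 * pi) ^ DIM('a) * (B\<^sup>2 * measure lborel K)"
  unfolding plancherel(2)[OF assms(1,2)] by (intro mult_left_mono) auto
 thus ?thesis
  by (subst nn_integral_eq_integral[OF plancherel(1)[OF assms(1,2)]]) (auto intro: ennreal_leI)
qed

subsection \<open>Symbols with frozen frequency\<close>

text \<open>An x-multi-index of a symbol is a list of basis vectors (b, 0) of the product space; it
  acts on the slice at fixed xi as the multi-index b.\<close>

lemma iter_deriv_slice:
 fixes F :: "'a::euclidean_space \<times> 'b::euclidean_space => 'c::real_normed_vector"
 assumes "open S" "smooth_on S F" "set bs \<subseteq> Basis" "(y, \<xi>) \<in> S"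
 shows "iter_deriv bs (\<lambda>y. F (y, \<xi>)) y = iter_deriv (map (\<lambda>b. (b, 0)) bs) F (y, \<xi>)"
  and "iter_deriv bs (\<lambda>y. F (y, \<xi>)) differentiable (at y)"
proof -
 have op: "open {y. (y, \<xi>) \<in> S}"
  using open_vimage[OF assms(1), of "\<lambda>y. (y, \<xi>)"] by (simp add: vimage_def continuous_intros)
 have B: "set (map (\<lambda>b. (b, 0)) bs) \<subseteq> (Basis :: ('a \<times> 'b) set)" if "set bs \<subseteq> Basis" for bs :: "'a list"
  using that by (auto simp: Basis_prod_def)
 have D: "((\<lambda>y. iter_deriv (map (\<lambda>b. (b, 0)) bs) F (y, \<xi>)) has_derivative
   (\<lambda>h. dir_deriv (h, 0) (iter_deriv (map (\<lambda>b. (b, 0)) bs) F) (y, \<xi>))) (at y)"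
  if "set bs \<subseteq> Basis" "(y, \<xi>) \<in> S" for bs :: "'a list" and y
 proof -
  have "iter_deriv (map (\<lambda>b. (b, 0)) bs) F differentiable (at (y, \<xi>))"
   using assms(2) B[OF that(1)] that(2) unfolding smooth_on_def by blast
  moreover have "((\<lambda>y. (y, \<xi>)) has_derivative (\<lambda>h. (h, 0))) (at y)"
   by (rule has_derivative_Pair[OF has_derivative_ident has_derivative_const])
  ultimately show ?thesis
   using has_derivative_compose has_derivative_dir_deriv by blast
 qed
 have eq: "iter_deriv bs (\<lambda>y. F (y, \<xi>)) y = iter_deriv (map (\<lambda>b. (b, 0)) bs) F (y, \<xi>)"
  if "set bs \<subseteq> Basis" "(y, \<xi>) \<in> S" for bs y
  using that
 proof (induction bs arbitrary: y)
  case (Cons b bs)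
  have "iter_deriv (b # bs) (\<lambda>y. F (y, \<xi>)) y = dir_deriv b (\<lambda>y. iter_deriv (map (\<lambda>b. (b, 0)) bs) F (y, \<xi>)) y"
   unfolding iter_deriv_Cons using Cons by (intro dir_deriv_cong_open[OF op]) auto
  also have "\<dots> = iter_deriv (map (\<lambda>b. (b, 0)) (b # bs)) F (y, \<xi>)"
   using D[of bs y] Cons.prems by (simp add: iter_deriv_Cons dir_deriv_eqI)
  finally show ?case .
 qed simp
 show "iter_deriv bs (\<lambda>y. F (y, \<xi>)) y = iter_deriv (map (\<lambda>b. (b, 0)) bs) F (y, \<xi>)"
  using eq assms by blast
 show "iter_deriv bs (\<lambda>y. F (y, \<xi>)) differentiable (at y)"
  by (rule differentiable_cong_open[OF op, of _ "\<lambda>y. iter_deriv (map (\<lambda>b. (b, 0)) bs) F (y, \<xi>)"])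
   (use eq assms D differentiable_def in \<open>auto, blast\<close>)
qed

text \<open>The frequency moves into the index, and the symbol becomes a family of functions of the
  position alone, to which Fourier decay in the position can be applied. The factor c normalises the
  size (1 + |p i|)^t.\<close>

lemma usmooth_symbol:
 fixes \<tau> :: "'a::euclidean_space \<times> 'a => complex"
 assumes "symbol_bounds \<Xi> t \<tau>" "open \<Xi>'" "\<Xi> \<subseteq> \<Xi>'" "smooth_on {(y, \<xi>). \<xi> \<in> \<Xi>'} \<tau>"
  and "\<And>i. i \<in> I ==> p i \<in> \<Xi>"
  and "\<And>i. i \<in> I ==> norm (c i) * (1 + norm (p i)) powr t \<le> B"
 shows "usmooth UNIV I (\<lambda>i y. c i * \<tau> (y, p i))"
proof -
 have op: "open {(y::'a, \<xi>). \<xi> \<in> \<Xi>'}"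
 proof -
  have "{(y::'a, \<xi>). \<xi> \<in> \<Xi>'} = UNIV \<times> \<Xi>'" by auto
  thus ?thesis using assms(2) by (simp add: open_Times)
 qed
 have sm: "smooth_on UNIV (\<lambda>y. \<tau> (y, p i))" if "i \<in> I" for i
  unfolding smooth_on_def
  using iter_deriv_slice(2)[OF op assms(4), of _ _ "p i"] assms(3,5) that by blast
 show ?thesis
  unfolding usmooth_def
 proof (intro conjI allI impI ballI)
  show "smooth_on UNIV (\<lambda>y. c i * \<tau> (y, p i))" if "i \<in> I" for i
   using sm[OF that] by (intro smooth_on_mult smooth_on_const) auto
  fix bs :: "'a list" assume bs: "set bs \<subseteq> Basis"
  obtain C where C: "\<And>y \<xi>. \<xi> \<in> \<Xi> ==>
    norm (iter_deriv (map (\<lambda>b. (b, 0)) bs) \<tau> (y, \<xi>)) \<le> C * (1 + norm \<xi>) powr t"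
   using assms(1)[unfolded symbol_bounds_def, rule_format, of "[]" bs] bs by auto
  show "\<exists>C. \<forall>i\<in>I. \<forall>y\<in>UNIV. norm (iter_deriv bs (\<lambda>y. c i * \<tau> (y, p i)) y) \<le> C"
  proof (intro exI ballI)
   fix i y assume i: "i \<in> I"
   have "iter_deriv bs (\<lambda>y. c i * \<tau> (y, p i)) y = c i * iter_deriv bs (\<lambda>y. \<tau> (y, p i)) y"
    by (rule iter_deriv_bounded_linear[OF open_UNIV bounded_linear_mult_right sm[OF i] bs]) simp
   also have "iter_deriv bs (\<lambda>y. \<tau> (y, p i)) y = iter_deriv (map (\<lambda>b. (b, 0)) bs) \<tau> (y, p i)"
    using assms(3) assms(5)[OF i] by (intro iter_deriv_slice(1)[OF op assms(4) bs]) auto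
   finally have "norm (iter_deriv bs (\<lambda>y. c i * \<tau> (y, p i)) y) \<le> norm (c i) * (C * (1 + norm (p i)) powr t)"
    using C[OF assms(5)[OF i]] by (simp add: norm_mult mult_left_mono)
   also have "\<dots> = C * (norm (c i) * (1 + norm (p i)) powr t)"
    by simp
   also have "\<dots> \<le> \<bar>C\<bar> * B"
    by (rule mult_mono) (use assms(6)[OF i] in auto)
   finally show "norm (iter_deriv bs (\<lambda>y. c i * \<tau> (y, p i)) y) \<le> \<bar>C\<bar> * B" .
  qed
 qed
qed

lemma usmooth_index_Un:
 assumes "usmooth S I g" "usmooth S J g"
 shows "usmooth S (I \<union> J) g"
 unfolding usmooth_def
proof (intro conjI allI impI ballI)
 show "smooth_on S (g i)" if "i \<in> I \<union> J" for i
  using assms that unfolding usmooth_def by blast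
 fix bs :: "'a list"
 assume bs: "set bs \<subseteq> Basis"
 obtain C D where "\<And>i x. i \<in> I ==> x \<in> S ==> norm (iter_deriv bs (g i) x) \<le> C"
  "\<And>i x. i \<in> J ==> x \<in> S ==> norm (iter_deriv bs (g i) x) \<le> D"
  using usmooth_bound[OF assms(1) bs] usmooth_bound[OF assms(2) bs] by metis
 hence "\<forall>i\<in>I \<union> J. \<forall>x\<in>S. norm (iter_deriv bs (g i) x) \<le> max C D"
  by (auto simp: le_max_iff_disj)
 thus "\<exists>C. \<forall>i\<in>I \<union> J. \<forall>x\<in>S. norm (iter_deriv bs (g i) x) \<le> C" ..
qed

section \<open>An isotropic symbol compared with its value on the sphere of radius k\<close>

text \<open>The comparison is two-sided because t may have either sign: a <= b w serves t >= 0, and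
  b <= a w serves t < 0.\<close>

lemma peetre:
 fixes a b w t :: real
 assumes "0 < a" "0 < b" "1 \<le> w" "a \<le> b * w" "b \<le> a * w"
 shows "a powr t \<le> w powr \<bar>t\<bar> * b powr t"
proof (cases "t \<ge> 0")
 case True
 hence "a powr t \<le> (b * w) powr t"
  using assms by (intro powr_mono2) auto
 thus ?thesis using assms True by (simp add: powr_mult mult.commute)
next
 case False
 have "a powr t \<le> (b / w) powr t"
  using assms False by (intro powr_mono2') (auto simp: field_simps)
 also have "\<dots> = w powr \<bar>t\<bar> * b powr t"
  using assms False by (simp add: powr_divide powr_minus field_simps)
 finally show ?thesis .
qed

text \<open>The mean value theorem gives |s| z^(s - 1) |a - k| with z between a and k.
  \<open>peetre\<close> replaces z by k at the cost of a power of w = 1 + |a - k|, and |a - k| <= w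
  accounts for the summand 1 in the exponent.\<close>

lemma powr_diff_le:
 fixes a k s :: real
 assumes "1 \<le> a" "1 \<le> k"
 shows "\<bar>a powr s - k powr s\<bar> \<le> \<bar>s\<bar> * k powr (s - 1) * (1 + \<bar>a - k\<bar>) powr (\<bar>s - 1\<bar> + 1)"
proof -
 define w where "w = 1 + \<bar>a - k\<bar>"
 have w: "1 \<le> w" by (simp add: w_def)
 have "norm (a powr s - k powr s) \<le> (\<bar>s\<bar> * (w powr \<bar>s - 1\<bar> * k powr (s - 1))) * norm (a - k)"
 proof (rule field_differentiable_bound[where S="closed_segment a k"])
  fix z assume "z \<in> closed_segment a k"
  then consider "a \<le> z" "z \<le> k" | "k \<le> z" "z \<le> a"
   unfolding closed_segment_eq_real_ivl by (cases "a \<le> k") simp_all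
  hence z: "\<bar>z - k\<bar> \<le> \<bar>a - k\<bar>" "1 \<le> z"
   using assms by (cases; linarith)+
  thus "((\<lambda>z. z powr s) has_field_derivative s * z powr (s - 1)) (at z within closed_segment a k)"
   by (intro has_field_derivative_at_within[OF has_real_derivative_powr]) linarith
  have "z \<le> k + \<bar>a - k\<bar>" "k \<le> z + \<bar>a - k\<bar>" using z by auto
  moreover have "\<bar>a - k\<bar> * 1 \<le> \<bar>a - k\<bar> * k" "\<bar>a - k\<bar> * 1 \<le> \<bar>a - k\<bar> * z"
   using assms z by (intro mult_left_mono; simp)+
  ultimately have "z \<le> k * w" "k \<le> z * w"
   by (simp_all add: w_def algebra_simps)
  hence "z powr (s - 1) \<le> w powr \<bar>s - 1\<bar> * k powr (s - 1)"
   using assms z w by (intro peetre) auto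
  thus "norm (s * z powr (s - 1)) \<le> \<bar>s\<bar> * (w powr \<bar>s - 1\<bar> * k powr (s - 1))"
   by (simp add: abs_mult mult_left_mono)
 qed auto
 also have "\<dots> \<le> (\<bar>s\<bar> * (w powr \<bar>s - 1\<bar> * k powr (s - 1))) * w"
  by (intro mult_left_mono) (auto simp: w_def)
 also have "\<dots> = \<bar>s\<bar> * k powr (s - 1) * w powr (\<bar>s - 1\<bar> + 1)"
  using w by (simp add: powr_add mult_ac)
 finally show ?thesis by (simp add: w_def)
qed

text \<open>Near the sphere \<open>|\<xi>| = k\<close> an isotropic principal symbol is almost the constant \<open>\<mu> y * k powr s\<close>; away from
 it the power of \<open>1 + | |\<xi>| - k |\<close> absorbs everything.\<close>

definition sph_weight :: "real => nat => real \<times> 'a::real_normed_vector => real" where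
 "sph_weight s J = (\<lambda>(k, \<xi>). k powr (s - 1) * (1 + \<bar>norm \<xi> - k\<bar>) ^ J)"

text \<open>Split at |xi| = 1. For |xi| >= 1 the difference is sigma - a 0, of order s - 1, plus
  \<open>\<mu>\<close> times |xi|^s - k^s, which \<open>powr_diff_le\<close> controls. For |xi| < 1
  one has 1 + ||xi| - k| >= k, so the weight is at least k^(s - 1 + J) and both terms are bounded
  separately.\<close>

lemma classical_symbol_freeze:
 fixes \<mu> :: "'a::euclidean_space => real"
 assumes cs: "classical_symbol s (\<lambda>(x, \<xi>). cor (\<mu> x * norm \<xi> powr s)) \<sigma>"
  and \<mu>: "\<mu> \<in> test_fun UNIV" and J: "\<bar>s\<bar> + 2 \<le> real J"
 shows "usmooth UNIV {(k, \<xi>). 1 \<le> k} (\<lambda>(k, \<xi>) y. cor (inverse (sph_weight s J (k, \<xi>))) *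
  (\<sigma> (y, \<xi>) - cor (\<mu> y * k powr s)))"
proof -
 define N where "N = (sph_weight s J :: real \<times> 'a => real)"
 have N0: "0 < N (k, \<xi>)" if "1 \<le> k" for k \<xi>
  using that by (auto simp: N_def sph_weight_def intro!: mult_pos_pos zero_less_power)
 define I1 where "I1 = {(k::real, \<xi>::'a). 1 \<le> k \<and> 1 \<le> norm \<xi>}"
 define I2 where "I2 = {(k::real, \<xi>::'a). 1 \<le> k \<and> norm \<xi> < 1}"
 obtain a where a: "\<forall>j. smooth_on {(x, \<xi>). \<xi> \<noteq> 0} (a j)"
  "\<forall>n. symbol_bounds {\<xi>. 1 \<le> norm \<xi>} (s - real n) (\<lambda>z. \<sigma> z - (\<Sum>j<n. a j z))"
  "\<And>x \<xi>. \<xi> \<noteq> 0 ==> a (0::nat) (x, \<xi>) = cor (\<mu> x * norm \<xi> powr s)"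
  and \<sigma>: "smooth_on UNIV \<sigma>" "symbol_bounds UNIV s \<sigma>"
  using cs unfolding classical_symbol_def symbol_class_def by auto
 have sm\<mu>: "usmooth UNIV I (\<lambda>_ y. cor (\<mu> y))" for I :: "(real \<times> 'a) set"
  using \<mu> by (intro usmooth_of_real usmooth_compact_supp) (auto simp: test_fun_def)
 have ge1: "1 \<le> 1 + \<bar>norm \<xi> - k\<bar>" for \<xi> :: 'a and k by simp
 \<comment> \<open>The exponents that occur are |s - 1| and |s - 1| + 1, both at most |s| + 2; hence
   the lower bound on J.\<close>
 have pw: "(1 + \<bar>norm \<xi> - k\<bar>) powr p \<le> (1 + \<bar>norm \<xi> - k\<bar>) ^ J" if "p \<le> \<bar>s\<bar> + 2" for \<xi> :: 'a and k p
  using powr_mono[OF _ ge1[of \<xi> k], of p "real J"] that J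
  by (simp add: powr_realpow[symmetric])
 have cn: "norm (cor (inverse (N (k, \<xi>)))) = inverse (N (k, \<xi>))" if "1 \<le> k" for k \<xi>
  using N0[OF that, of \<xi>] unfolding norm_of_real by simp
 have "usmooth UNIV I1 (\<lambda>i y. cor (inverse (N i)) * (\<sigma> (y, snd i) - a 0 (y, snd i)))"
 proof (rule usmooth_symbol[where \<Xi>="{\<xi>. 1 \<le> norm \<xi>}" and \<Xi>'="- {0}" and B="4 powr \<bar>s - 1\<bar>" and t="s - 1" and p=snd
    and c="\<lambda>i. cor (inverse (N i))"
    and \<tau>="\<lambda>z. \<sigma> z - a 0 z"])
  show "symbol_bounds {\<xi>. 1 \<le> norm \<xi>} (s - 1) (\<lambda>z. \<sigma> z - a 0 z)"
   using a(2)[rule_format, of 1] by simp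
  have "open (UNIV \<times> (- {0}) :: ('a \<times> 'a) set)" by (intro open_Times) auto
  moreover have eq: "UNIV \<times> (- {0}) = {(x::'a, \<xi>::'a). \<xi> \<noteq> 0}" by auto
  ultimately have "smooth_on {(x, \<xi>). \<xi> \<noteq> 0} (\<lambda>z. \<sigma> z + (- 1) * a 0 z)"
   by (intro smooth_on_add smooth_on_mult smooth_on_const smooth_on_subset[OF \<sigma>(1)] a(1)[rule_format]) auto
  thus "smooth_on {(y, \<xi>). \<xi> \<in> - {0}} (\<lambda>z. \<sigma> z - a 0 z)"
   by simp
  fix i assume "i \<in> I1"
  then obtain k \<xi> where i: "i = (k, \<xi>)" "1 \<le> k" "1 \<le> norm \<xi>" by (auto simp: I1_def)
  thus "snd i \<in> {\<xi>. 1 \<le> norm \<xi>}" by simp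
  define w where "w = 1 + \<bar>norm \<xi> - k\<bar>"
  have "\<bar>norm \<xi> - k\<bar> * 1 \<le> \<bar>norm \<xi> - k\<bar> * k" "\<bar>norm \<xi> - k\<bar> * 1 \<le> \<bar>norm \<xi> - k\<bar> * norm \<xi>"
   using i by (intro mult_left_mono; simp)+
  moreover have "0 \<le> norm \<xi> * \<bar>norm \<xi> - k\<bar>" by simp
  moreover have "k * (2 * w) = 2 * k + 2 * (\<bar>norm \<xi> - k\<bar> * k)"
   "(1 + norm \<xi>) * (2 * w) = 2 + 2 * norm \<xi> + 2 * \<bar>norm \<xi> - k\<bar> + 2 * (norm \<xi> * \<bar>norm \<xi> - k\<bar>)"
   by (simp_all add: w_def algebra_simps)
  moreover have "norm \<xi> \<le> k + \<bar>norm \<xi> - k\<bar>" "k \<le> norm \<xi> + \<bar>norm \<xi> - k\<bar>" by linarith+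
  \<comment> \<open>The factor 2 pays for comparing 1 + |xi|, instead of |xi|, with k.\<close>
  ultimately have "1 + norm \<xi> \<le> k * (2 * w)" "k \<le> (1 + norm \<xi>) * (2 * w)"
   using i(2,3) by linarith+
  hence "(1 + norm \<xi>) powr (s - 1) \<le> (2 * w) powr \<bar>s - 1\<bar> * k powr (s - 1)"
   using i by (intro peetre) (auto simp: w_def intro: add_pos_nonneg)
  also have "\<dots> = 2 powr \<bar>s - 1\<bar> * (w powr \<bar>s - 1\<bar> * k powr (s - 1))"
   by (subst powr_mult) (simp_all add: w_def)
  also have "\<dots> \<le> 4 powr \<bar>s - 1\<bar> * (w ^ J * k powr (s - 1))"
   using pw[of "\<bar>s - 1\<bar>" \<xi> k] unfolding w_def
   by (intro mult_mono powr_mono2 mult_right_mono) auto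
  finally show "norm (cor (inverse (N i))) * (1 + norm (snd i)) powr (s - 1) \<le> 4 powr \<bar>s - 1\<bar>"
   using N0[OF i(2), of \<xi>] unfolding i(1) cn[OF i(2)]
   by (simp add: N_def sph_weight_def w_def field_simps)
 next
  show "open (- {0::'a})" by (simp add: open_Compl)
  show "{\<xi>. 1 \<le> norm \<xi>} \<subseteq> - {0::'a}" by (auto simp del: norm_eq_zero)
 qed
 moreover have "usmooth UNIV I1 (\<lambda>i y. cor (inverse (N i) * (norm (snd i) powr s - fst i powr s)) * cor (\<mu> y))"
 proof (rule usmooth_cmult[OF open_UNIV sm\<mu>, where C="\<bar>s\<bar>"])
  fix i assume "i \<in> I1"
  then obtain k \<xi> where i: "i = (k, \<xi>)" "1 \<le> k" "1 \<le> norm \<xi>" by (auto simp: I1_def)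
  have "\<bar>norm \<xi> powr s - k powr s\<bar> \<le> \<bar>s\<bar> * k powr (s - 1) * (1 + \<bar>norm \<xi> - k\<bar>) powr (\<bar>s - 1\<bar> + 1)"
   by (rule powr_diff_le) (use i in auto)
  also have "\<dots> \<le> \<bar>s\<bar> * k powr (s - 1) * (1 + \<bar>norm \<xi> - k\<bar>) ^ J"
   by (intro mult_left_mono pw) auto
  finally show "norm (cor (inverse (N i) * (norm (snd i) powr s - fst i powr s))) \<le> \<bar>s\<bar>"
   using N0[OF i(2), of \<xi>] i unfolding norm_of_real
   by (simp add: abs_mult N_def sph_weight_def field_simps)
 qed
 ultimately have "usmooth UNIV I1 (\<lambda>i y. cor (inverse (N i)) * (\<sigma> (y, snd i) - a 0 (y, snd i)) +
   cor (inverse (N i) * (norm (snd i) powr s - fst i powr s)) * cor (\<mu> y))"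
  by (rule usmooth_add[OF open_UNIV])
 hence 1: "usmooth UNIV I1 (\<lambda>i y. cor (inverse (N i)) * (\<sigma> (y, snd i) - cor (\<mu> y * fst i powr s)))"
 proof (rule usmooth_cong[OF open_UNIV])
  fix i y assume "i \<in> I1"
  hence "snd i \<noteq> 0" by (auto simp: I1_def)
  thus "cor (inverse (N i)) * (\<sigma> (y, snd i) - a 0 (y, snd i)) +
    cor (inverse (N i) * (norm (snd i) powr s - fst i powr s)) * cor (\<mu> y) =
    cor (inverse (N i)) * (\<sigma> (y, snd i) - cor (\<mu> y * fst i powr s))"
   by (simp add: a(3) algebra_simps)
 qed
 have big: "k powr r \<le> N (k, \<xi>)" if k: "1 \<le> k" and \<xi>: "norm \<xi> < 1" and r: "r \<le> s \<or> r \<le> 0" for k r \<xi>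
 proof -
  have "k \<le> 1 + \<bar>norm \<xi> - k\<bar>" using \<xi> by linarith
  hence "k ^ J \<le> (1 + \<bar>norm \<xi> - k\<bar>) ^ J"
   using k by (intro power_mono) linarith+
  hence 1: "k powr (s - 1) * k ^ J \<le> N (k, \<xi>)"
   unfolding N_def sph_weight_def prod.case by (rule mult_left_mono) simp
  have "r \<le> s - 1 + real J" using r J by linarith
  hence "k powr r \<le> k powr (s - 1 + real J)"
   using k by (rule powr_mono)
  also have "\<dots> = k powr (s - 1) * k ^ J"
   using k by (simp add: powr_add powr_realpow)
  finally show ?thesis using 1 by linarith
 qed
 have "usmooth UNIV I2 (\<lambda>i y. cor (inverse (N i)) * \<sigma> (y, snd i))"
 proof (rule usmooth_symbol[OF \<sigma>(2) open_UNIV, where p=snd and c="\<lambda>i. cor (inverse (N i))"])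
  fix i assume "i \<in> I2"
  then obtain k \<xi> where i: "i = (k, \<xi>)" "1 \<le> k" "norm \<xi> < 1" by (auto simp: I2_def)
  have "(1 + norm \<xi>) powr s \<le> 2 powr \<bar>s\<bar> * 1 powr s"
   using i(3) norm_ge_zero[of \<xi>] by (intro peetre) (auto intro: add_pos_nonneg)
  moreover have "1 \<le> N (k, \<xi>)"
   using big[OF i(2,3), of 0] i by simp
  ultimately show "norm (cor (inverse (N i))) * (1 + norm (snd i)) powr s \<le> 2 powr \<bar>s\<bar>"
   using mult_mono[of "inverse (N (k, \<xi>))" 1 "(1 + norm \<xi>) powr s" "2 powr \<bar>s\<bar>"] unfolding i(1) cn[OF i(2)]
   by (simp add: inverse_le_1_iff)
 qed (use \<sigma>(1) in \<open>auto simp: case_prod_unfold\<close>)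
 moreover have "usmooth UNIV I2 (\<lambda>i y. cor (- inverse (N i) * fst i powr s) * cor (\<mu> y))"
 proof (rule usmooth_cmult[OF open_UNIV sm\<mu>, where C=1])
  fix i assume "i \<in> I2"
  then obtain k \<xi> where i: "i = (k, \<xi>)" "1 \<le> k" "norm \<xi> < 1" by (auto simp: I2_def)
  show "norm (cor (- inverse (N i) * fst i powr s)) \<le> 1"
   using big[OF i(2,3), of s] N0[OF i(2), of \<xi>] unfolding i(1) norm_of_real
   by (simp add: abs_mult field_simps)
 qed
 ultimately have "usmooth UNIV I2 (\<lambda>i y. cor (inverse (N i)) * \<sigma> (y, snd i) +
   cor (- inverse (N i) * fst i powr s) * cor (\<mu> y))"
  by (rule usmooth_add[OF open_UNIV])
 hence 2: "usmooth UNIV I2 (\<lambda>i y. cor (inverse (N i)) * (\<sigma> (y, snd i) - cor (\<mu> y * fst i powr s)))"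
  by (rule usmooth_cong[OF open_UNIV]) (simp add: algebra_simps)
 have "I1 \<union> I2 = {(k, \<xi>). 1 \<le> k}" by (auto simp: I1_def I2_def)
 with usmooth_index_Un[OF 1 2] show ?thesis
  by (simp add: N_def case_prod_unfold)
qed

subsection \<open>The covariance of oscillating test functions\<close>

lemma ft_decay_uniform:
 fixes g :: "'i => 'a::euclidean_space => complex"
 assumes "compact K" "usmooth UNIV I g" "\<And>i y. i \<in> I ==> y \<notin> K ==> g i y = 0"
 obtains C where "C > 0" "\<And>i \<xi>. i \<in> I ==> norm (ft (g i) \<xi>) \<le> C * inverse ((1 + (norm \<xi>)\<^sup>2) ^ N)"
proof -
 have cs: "csmooth K (g i)" if "i \<in> I" for i
  using usmooth_smooth[OF assms(2) that] assms(3)[OF that] by (simp add: csmooth_def)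
 have H: "usmooth UNIV I (\<lambda>i. (helmholtz (cor (-1)) ^^ j) (g i))" for j
 proof (induction j)
  case (Suc j)
  have "usmooth UNIV I (\<lambda>i y. (\<Sum>b\<in>Basis. iter_deriv [b, b] ((helmholtz (cor (-1)) ^^ j) (g i)) y)
   + cor (-1) * (helmholtz (cor (-1)) ^^ j) (g i) y)"
   by (intro usmooth_add usmooth_sum usmooth_iter[OF Suc] usmooth_cmult[OF open_UNIV Suc, where C=1]) auto
  moreover have "(helmholtz (cor (-1)) ^^ Suc j) (g i) =
   (\<lambda>y. (\<Sum>b\<in>Basis. iter_deriv [b, b] ((helmholtz (cor (-1)) ^^ j) (g i)) y)
   + cor (-1) * (helmholtz (cor (-1)) ^^ j) (g i) y)" for i
   unfolding funpow.simps o_def by (subst helmholtz_def) (simp add: laplacian_def)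
  ultimately show ?case by (simp only:)
 qed (use assms(2) in simp)
 obtain B where B: "B > 0" "\<And>i y. i \<in> I ==> norm ((helmholtz (cor (-1)) ^^ N) (g i) y) \<le> B"
  using usmooth_bound0[OF H[of N]] by (metis UNIV_I)
 define C where "C = max 1 (B * measure lborel K)"
 have "norm (ft (g i) \<xi>) \<le> C * inverse ((1 + (norm \<xi>)\<^sup>2) ^ N)" if i: "i \<in> I" for i \<xi>
 proof -
  define h where "h = (helmholtz (cor (-1)) ^^ N) (g i)"
  have h: "csmooth K h"
   unfolding h_def by (rule csmooth_helmholtz_pow[OF assms(1) cs[OF i]])
  have "norm (ft h \<xi>) \<le> B * measure lborel K"
   by (rule norm_ft_le[OF assms(1)]) (use B(2)[OF i] h in \<open>auto simp: csmooth_def h_def\<close>)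
  moreover have "norm (ft h \<xi>) = (1 + (norm \<xi>)\<^sup>2) ^ N * norm (ft (g i) \<xi>)"
  proof -
   have "norm (ft h \<xi>) = norm (cor (- 1 - (norm \<xi>)\<^sup>2)) ^ N * norm (ft (g i) \<xi>)"
    unfolding h_def ft_helmholtz_pow[OF assms(1) cs[OF i]] norm_mult norm_power ..
   also have "norm (cor (- 1 - (norm \<xi>)\<^sup>2)) = 1 + (norm \<xi>)\<^sup>2"
    unfolding norm_of_real by (simp add: abs_if) (smt (verit) zero_le_power2)
   finally show ?thesis .
  qed
  moreover have "(1 + (norm \<xi>)\<^sup>2) ^ N > 0"
   by (intro zero_less_power) (smt (verit) zero_le_power2)
  ultimately show ?thesis
   by (simp add: C_def field_simps)
 qed
 thus thesis
  using that[of C] by (simp add: C_def)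
qed

text \<open>Since |k^2 - |xi|^2| = ||xi| - k| (k + |xi|) >= k ||xi| - k|, the J-th Helmholtz power
  of phi divided by k^J controls ||xi| - k|^J times the transform. Plancherel bounds this term and
  the unweighted one by the same quantity; each carries the factor 2 * 4^J.\<close>

lemma frequency_localisation:
 fixes \<phi> :: "'a::euclidean_space => complex"
 assumes "compact K" "csmooth K \<phi>" "1 \<le> k" "\<And>y. norm (\<phi> y) \<le> B"
  and "\<And>y. norm ((helmholtz (cor (k\<^sup>2)) ^^ J) \<phi> y) \<le> B * k ^ J"
 shows "(NN \<xi>. ennreal (((1 + \<bar>norm \<xi> - k\<bar>) ^ J * norm (ft \<phi> \<xi>))\<^sup>2))
  \<le> ennreal (4 * 4 ^ J * ((2 * pi) ^ DIM('a) * (B\<^sup>2 * measure lborel K)))"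
proof -
 define h where "h = (helmholtz (cor (k\<^sup>2)) ^^ J) \<phi>"
 define A where "A = (2 * pi) ^ DIM('a) * (B\<^sup>2 * measure lborel K)"
 have A: "0 \<le> A" by (simp add: A_def)
 have h: "csmooth K h"
  unfolding h_def by (rule csmooth_helmholtz_pow[OF assms(1,2)])
 have bound: "((1 + \<bar>norm \<xi> - k\<bar>) ^ J * norm (ft \<phi> \<xi>))\<^sup>2 \<le>
   (2 * 4 ^ J) * (norm (ft \<phi> \<xi>))\<^sup>2 + (2 * 4 ^ J) * (inverse (k ^ J) ^ 2 * (norm (ft h \<xi>))\<^sup>2)" for \<xi>
 proof -
  define d where "d = \<bar>norm \<xi> - k\<bar>"
  have d: "0 \<le> d" by (simp add: d_def)
  have "(1 + d) ^ J \<le> (2 * max 1 d) ^ J"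
   using d by (intro power_mono) auto
  also have "\<dots> \<le> 2 ^ J * (1 + d ^ J)"
   using d by (auto simp: power_mult_distrib max_def intro: zero_le_power)
  finally have 1: "(1 + d) ^ J * norm (ft \<phi> \<xi>) \<le> 2 ^ J * (norm (ft \<phi> \<xi>) + d ^ J * norm (ft \<phi> \<xi>))"
   by (metis (no_types, opaque_lifting) distrib_right mult.assoc mult_1 mult_right_mono norm_ge_zero)
  have "d * k \<le> \<bar>k\<^sup>2 - (norm \<xi>)\<^sup>2\<bar>"
  proof -
   have "\<bar>k\<^sup>2 - (norm \<xi>)\<^sup>2\<bar> = d * (k + norm \<xi>)"
    using assms(3) by (simp add: d_def power2_eq_square square_diff_square_factored abs_mult abs_minus_commute mult.commute)
   thus ?thesis using d by (simp add: mult_left_mono)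
  qed
  hence "(d * k) ^ J * norm (ft \<phi> \<xi>) \<le> \<bar>k\<^sup>2 - (norm \<xi>)\<^sup>2\<bar> ^ J * norm (ft \<phi> \<xi>)"
   using d assms(3) by (intro mult_right_mono power_mono) auto
  also have "\<dots> = norm (ft h \<xi>)"
   unfolding h_def ft_helmholtz_pow[OF assms(1,2)] norm_mult norm_power norm_of_real ..
  finally have 2: "d ^ J * norm (ft \<phi> \<xi>) \<le> inverse (k ^ J) * norm (ft h \<xi>)"
   using assms(3) by (simp add: power_mult_distrib field_simps)
  have "(1 + d) ^ J * norm (ft \<phi> \<xi>) \<le> 2 ^ J * (norm (ft \<phi> \<xi>) + inverse (k ^ J) * norm (ft h \<xi>))"
   by (rule order_trans[OF 1]) (intro mult_left_mono add_left_mono 2; simp)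
  hence "((1 + d) ^ J * norm (ft \<phi> \<xi>))\<^sup>2 \<le> (2 ^ J * (norm (ft \<phi> \<xi>) + inverse (k ^ J) * norm (ft h \<xi>)))\<^sup>2"
   using d by (intro power_mono) auto
  also have "\<dots> = 4 ^ J * (norm (ft \<phi> \<xi>) + inverse (k ^ J) * norm (ft h \<xi>))\<^sup>2"
  proof -
   have "((2::real) ^ J)\<^sup>2 = 4 ^ J" by (simp add: power_mult[symmetric] mult.commute[of J] power_mult)
   thus ?thesis by (simp only: power_mult_distrib)
  qed
  also have "\<dots> \<le> 4 ^ J * (2 * (norm (ft \<phi> \<xi>))\<^sup>2 + 2 * (inverse (k ^ J) * norm (ft h \<xi>))\<^sup>2)"
   using sum_squares_bound[of "norm (ft \<phi> \<xi>)" "inverse (k ^ J) * norm (ft h \<xi>)"]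
   by (intro mult_left_mono) (auto simp: power2_sum)
  finally show ?thesis
   by (simp add: d_def power_mult_distrib algebra_simps)
 qed
 note [measurable] = csmooth_measurable[OF assms(2)] csmooth_measurable[OF h]
 have "(NN \<xi>. ennreal (((1 + \<bar>norm \<xi> - k\<bar>) ^ J * norm (ft \<phi> \<xi>))\<^sup>2)) \<le>
  (NN \<xi>. ennreal (2 * 4 ^ J) * ennreal ((norm (ft \<phi> \<xi>))\<^sup>2) +
    ennreal (2 * 4 ^ J * inverse (k ^ J) ^ 2) * ennreal ((norm (ft h \<xi>))\<^sup>2))"
 proof (rule nn_integral_mono)
  fix \<xi> :: 'a
  show "ennreal (((1 + \<bar>norm \<xi> - k\<bar>) ^ J * norm (ft \<phi> \<xi>))\<^sup>2) \<le> ennreal (2 * 4 ^ J) * ennreal ((norm (ft \<phi> \<xi>))\<^sup>2) +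
    ennreal (2 * 4 ^ J * inverse (k ^ J) ^ 2) * ennreal ((norm (ft h \<xi>))\<^sup>2)"
   by (rule order_trans[OF ennreal_leI[OF bound[of \<xi>]]])
    (simp add: ennreal_mult''[symmetric] ennreal_plus[symmetric] mult.assoc del: ennreal_plus)
 qed
 also have "\<dots> = ennreal (2 * 4 ^ J) * (NN \<xi>. ennreal ((norm (ft \<phi> \<xi>))\<^sup>2)) +
    ennreal (2 * 4 ^ J * inverse (k ^ J) ^ 2) * (NN \<xi>. ennreal ((norm (ft h \<xi>))\<^sup>2))"
  by (subst nn_integral_add) (auto simp: nn_integral_cmult)
 also have "\<dots> \<le> ennreal (2 * 4 ^ J) * ennreal A +
    ennreal (2 * 4 ^ J * inverse (k ^ J) ^ 2) * ennreal ((2 * pi) ^ DIM('a) * ((B * k ^ J)\<^sup>2 * measure lborel K))"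
  unfolding A_def
  by (intro add_mono mult_left_mono nn_integral_ft_sq_le assms h assms(5)[folded h_def]) auto
 also have "\<dots> = ennreal (2 * 4 ^ J * A + 2 * 4 ^ J * inverse (k ^ J) ^ 2 * ((2 * pi) ^ DIM('a) * ((B * k ^ J)\<^sup>2 * measure lborel K)))"
  using A by (simp add: ennreal_mult'' ennreal_plus)
 also have "2 * 4 ^ J * inverse (k ^ J) ^ 2 * ((2 * pi) ^ DIM('a) * ((B * k ^ J)\<^sup>2 * measure lborel K)) = 2 * 4 ^ J * A"
  using assms(3) by (simp add: A_def power_mult_distrib field_simps)
 finally show ?thesis
  by (simp add: A_def algebra_simps)
qed

text \<open>The bound is brought into the form that \<open>integrable_weight_ft\<close> asks for,
  with a natural exponent M >= s.\<close>

lemma symbol_growth: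
 assumes "symbol_bounds UNIV s \<sigma>"
 obtains C M where "C > 0" "\<And>y \<xi>. norm (\<sigma> (y, \<xi>)) \<le> C * (1 + (norm \<xi>)\<^sup>2) ^ M"
proof -
 obtain C0 where C0: "\<And>y \<xi>. norm (\<sigma> (y, \<xi>)) \<le> C0 * (1 + norm \<xi>) powr s"
  using assms[unfolded symbol_bounds_def, rule_format, of "[]" "[]"] by auto
 define M where "M = nat \<lceil>\<bar>s\<bar>\<rceil>"
 have M: "s \<le> real M" unfolding M_def by linarith
 define C where "C = max 1 C0 * 2 ^ M"
 have "norm (\<sigma> (y, \<xi>)) \<le> C * (1 + (norm \<xi>)\<^sup>2) ^ M" for y \<xi>
 proof -
  have "(1 + norm \<xi>) powr s \<le> (1 + norm \<xi>) powr real M"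
   using M by (intro powr_mono) auto
  also have "\<dots> = (1 + norm \<xi>) ^ M"
   by (intro powr_realpow) (auto intro: add_pos_nonneg)
  also have "\<dots> \<le> (2 * (1 + (norm \<xi>)\<^sup>2)) ^ M"
  proof (intro power_mono)
   have "1 + n \<le> 2 * (1 + n\<^sup>2)" for n :: real
   proof -
    have "2 * n \<le> n\<^sup>2 + 1" "0 \<le> n\<^sup>2"
     using sum_squares_bound[of n 1] by simp_all
    thus ?thesis by argo
   qed
   thus "1 + norm \<xi> \<le> 2 * (1 + (norm \<xi>)\<^sup>2)" .
  qed auto
  finally have 1: "(1 + norm \<xi>) powr s \<le> 2 ^ M * (1 + (norm \<xi>)\<^sup>2) ^ M"
   unfolding power_mult_distrib .
  have "norm (\<sigma> (y, \<xi>)) \<le> max 1 C0 * (1 + norm \<xi>) powr s"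
   by (rule order_trans[OF C0]) (simp add: mult_right_mono)
  also have "\<dots> \<le> max 1 C0 * (2 ^ M * (1 + (norm \<xi>)\<^sup>2) ^ M)"
   by (rule mult_left_mono[OF 1]) simp
  finally show ?thesis by (simp add: C_def mult.assoc)
 qed
 thus thesis using that[of C M] by (simp add: C_def)
qed

text \<open>No stationary phase is needed: since the principal symbol is isotropic, it is enough that the
 frequencies of \<open>\<phi>\<close> concentrate, in \<open>L\<^sup>2\<close>, near the sphere of radius \<open>k\<close>.\<close>

theorem psido_pairing_asymptotic:
 fixes \<mu> :: "'a::euclidean_space => real"
 assumes cs: "classical_symbol s (\<lambda>(x, \<xi>). cor (\<mu> x * norm \<xi> powr s)) \<sigma>"
  and \<mu>: "\<mu> \<in> test_fun UNIV" and J: "\<bar>s\<bar> + 2 \<le> real J" and K: "compact K"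
 obtains C where "\<And>k B \<phi> \<psi>. 1 \<le> k ==> csmooth K \<phi> ==> csmooth K \<psi> ==> (\<And>y. \<bar>\<phi> y\<bar> \<le> B) ==> (\<And>y. \<bar>\<psi> y\<bar> \<le> B) ==>
   (\<And>y. norm ((helmholtz (cor (k\<^sup>2)) ^^ J) (\<lambda>y. cor (\<phi> y)) y) \<le> B * k ^ J) ==>
   norm ((LBINT x. psido \<sigma> \<phi> x * cor (\<psi> x)) - cor (k powr s * (LBINT x. \<mu> x * \<phi> x * \<psi> x)))
    \<le> C * B\<^sup>2 * k powr (s - 1)"
proof -
 have \<sigma>: "smooth_on UNIV \<sigma>" "symbol_bounds UNIV s \<sigma>"
  using cs by (auto simp: classical_symbol_def symbol_class_def)
 have \<sigma>m [measurable]: "\<sigma> \<in> borel_measurable borel"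
  using smooth_on_continuous[OF \<sigma>(1)] by (rule borel_measurable_continuous_onI)
 have \<mu>m [measurable]: "\<mu> \<in> borel_measurable borel"
  using \<mu> by (auto simp: test_fun_def intro!: borel_measurable_continuous_onI smooth_on_continuous)
 obtain Cs M where Cs: "Cs > 0" "\<And>y \<xi>. norm (\<sigma> (y, \<xi>)) \<le> Cs * (1 + (norm \<xi>)\<^sup>2) ^ M"
  using symbol_growth[OF \<sigma>(2)] by metis
 obtain \<kappa> :: "'a => real" and V where \<kappa>: "\<kappa> \<in> test_fun UNIV" "open V" "K \<subseteq> V" "\<And>y. y \<in> V ==> \<kappa> y = 1"
  using cutoff_exists[OF K open_UNIV] by auto
 define L where "L = supp \<kappa>"
 have L: "compact L" "\<And>y. y \<notin> L ==> \<kappa> y = 0"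
  using \<kappa>(1) by (auto simp: L_def test_fun_def supp_zero)
 define N where "N = (sph_weight s J :: real \<times> 'a => real)"
 have N: "N (k, \<xi>) = k powr (s - 1) * (1 + \<bar>norm \<xi> - k\<bar>) ^ J" for k \<xi>
  by (simp add: N_def sph_weight_def)
 have N0: "0 < N (k, \<xi>)" if "1 \<le> k" for k \<xi>
  using that by (auto simp: N intro!: mult_pos_pos zero_less_power)
 define e where "e k y \<xi> = \<sigma> (y, \<xi>) - cor (\<mu> y * k powr s)" for k y \<xi>
 define g where "g i y = cor (\<kappa> y) * (cor (inverse (N i)) * e (fst i) y (snd i))" for i y
 have g: "usmooth UNIV {(k, \<xi>). 1 \<le> k} g"
 proof -
  have U1: "usmooth UNIV {(k, \<xi>). 1 \<le> k} (\<lambda>i y. cor (inverse (N i)) * e (fst i) y (snd i))"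
   using classical_symbol_freeze[OF cs \<mu> J] by (simp add: N_def e_def case_prod_unfold)
  have U2: "usmooth UNIV {(k, \<xi>). 1 \<le> k} (\<lambda>_ y. cor (\<kappa> y))"
   using \<kappa>(1) by (intro usmooth_of_real usmooth_compact_supp) (auto simp: test_fun_def)
  show ?thesis
   unfolding g_def by (rule usmooth_mult[OF open_UNIV U2 U1])
 qed
 have gz: "g i y = 0" if "y \<notin> L" for i y
  using L(2)[OF that] by (simp add: g_def)
 obtain Cg where Cg: "Cg > 0" "\<And>i \<eta>. i \<in> {(k, \<xi>). 1 \<le> k} ==> norm (ft (g i) \<eta>) \<le> Cg * inverse ((1 + (norm \<eta>)\<^sup>2) ^ DIM('a))"
  using ft_decay_uniform[OF L(1) g gz, where N="DIM('a)"] by blast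
 define a where "a \<eta> = inverse ((1 + (norm \<eta>)\<^sup>2) ^ DIM('a))" for \<eta> :: 'a
 have a0: "0 \<le> a \<eta>" for \<eta>
  unfolding a_def by (intro inverse_nonnegative_iff_nonnegative[THEN iffD2] zero_le_power) (smt (verit) zero_le_power2)
 have [measurable]: "a \<in> borel_measurable borel"
  unfolding a_def[abs_def] by measurable
 define A where "A = (LBINT \<eta>. a \<eta>)"
 have A: "(NN \<eta>. ennreal (a \<eta>)) = ennreal A" "0 \<le> A"
  unfolding A_def using a0 integrable_inverse_1_plus_norm[where 'a='a]
  by (auto simp: a_def[abs_def] intro!: nn_integral_eq_integral)
 define P where "P = (2 * pi) ^ DIM('a)"
 have P: "P > 0" by (simp add: P_def)
 define C where "C = inverse P * inverse P * Cg * A * (4 * 4 ^ J * P * measure lborel K + P * measure lborel K)"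
 show thesis
 proof (rule that[of C])
  fix k B :: real and \<phi> \<psi> :: "'a => real"
  assume k: "1 \<le> k" and \<phi>r: "csmooth K \<phi>" and \<psi>r: "csmooth K \<psi>" and B\<phi>: "\<And>y. \<bar>\<phi> y\<bar> \<le> B" and B\<psi>: "\<And>y. \<bar>\<psi> y\<bar> \<le> B"
   and BJ: "\<And>y. norm ((helmholtz (cor (k\<^sup>2)) ^^ J) (\<lambda>y. cor (\<phi> y)) y) \<le> B * k ^ J"
  define \<Phi> where "\<Phi> y = cor (\<phi> y)" for y
  define \<Psi> where "\<Psi> y = cor (\<psi> y)" for y
  have cs\<Phi>: "csmooth K \<Phi>" "csmooth K \<Psi>"
   using \<phi>r \<psi>r unfolding csmooth_def \<Phi>_def[abs_def] \<Psi>_def[abs_def]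
   by (auto intro!: smooth_on_bounded_linear[OF open_UNIV bounded_linear_of_real])
  note [measurable] = csmooth_measurable[OF cs\<Phi>(1)] csmooth_measurable[OF cs\<Phi>(2)]
  define F where "F = ft \<Phi>"
  have Fm [measurable]: "F \<in> borel_measurable borel" unfolding F_def by measurable
  \<comment> \<open>By Fourier inversion, multiplication by \<open>\<mu>\<close> k^s is the operator
    with a symbol independent of xi, so e is the symbol of the error. After an exchange of integrals
    the error is the integral of F E, divided by P.\<close>
  define E where "E \<xi> = (LBINT y. ei (y \<bullet> \<xi>) * e k y \<xi> * \<Psi> y)" for \<xi>
  have int\<sigma>: "integrable lborel (\<lambda>\<xi>. ei (y \<bullet> \<xi>) * \<sigma> (y, \<xi>) * F \<xi>)" for y
   unfolding F_def by (rule integrable_weight_ft[OF K cs\<Phi>(1)]) (use Cs(2) in \<open>auto simp: norm_mult\<close>)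
  have int1: "integrable lborel (\<lambda>\<xi>. ei (y \<bullet> \<xi>) * F \<xi>)" for y
   unfolding F_def by (rule integrable_weight_ft[OF K cs\<Phi>(1), where cw=1 and M=0]) auto
  have 1: "psido \<sigma> \<phi> y - cor (\<mu> y * k powr s) * \<Phi> y =
    cor (inverse P) * (LBINT \<xi>. ei (y \<bullet> \<xi>) * e k y \<xi> * F \<xi>)" for y
  proof -
   have "(LBINT \<xi>. ei (y \<bullet> \<xi>) * e k y \<xi> * F \<xi>) =
    (LBINT \<xi>. ei (y \<bullet> \<xi>) * \<sigma> (y, \<xi>) * F \<xi>
     - cor (\<mu> y * k powr s) * (ei (y \<bullet> \<xi>) * F \<xi>))"
    by (intro Bochner_Integration.integral_cong refl) (simp add: e_def algebra_simps)
   also have "\<dots> = (LBINT \<xi>. ei (y \<bullet> \<xi>) * \<sigma> (y, \<xi>) * F \<xi>)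
     - cor (\<mu> y * k powr s) * (LBINT \<xi>. ei (y \<bullet> \<xi>) * F \<xi>)"
    using int\<sigma> int1 by (subst Bochner_Integration.integral_diff) (auto simp del: of_real_mult)
   also have "(LBINT \<xi>. ei (y \<bullet> \<xi>) * F \<xi>) = cor P * \<Phi> y"
    unfolding F_def P_def by (rule ft_inversion[OF K cs\<Phi>(1)])
   finally have eq: "(LBINT \<xi>. ei (y \<bullet> \<xi>) * e k y \<xi> * F \<xi>) =
     (LBINT \<xi>. ei (y \<bullet> \<xi>) * \<sigma> (y, \<xi>) * F \<xi>)
     - cor P * (cor (\<mu> y * k powr s) * \<Phi> y)"
    by (simp only: mult_ac)
   have ip: "cor (inverse P) * (cor P * z) = z" for z
    using P by (simp add: mult.assoc[symmetric] flip: of_real_mult)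
   have pd: "psido \<sigma> \<phi> y = cor (inverse P) * (LBINT \<xi>. ei (y \<bullet> \<xi>) * \<sigma> (y, \<xi>) * F \<xi>)"
    by (simp add: psido_def fourier_eq_ft F_def \<Phi>_def[abs_def] P_def divide_inverse)
   show ?thesis
    unfolding pd eq right_diff_distrib ip ..
  qed
  have e_le: "norm (e k y \<xi>) \<le> (Cs + \<bar>\<mu> y * k powr s\<bar>) * (1 + (norm \<xi>)\<^sup>2) ^ M" for y \<xi>
  proof -
   have "1 \<le> (1 + (norm \<xi>)\<^sup>2) ^ M" by (intro one_le_power) simp
   hence "\<bar>\<mu> y * k powr s\<bar> * 1 \<le> \<bar>\<mu> y * k powr s\<bar> * (1 + (norm \<xi>)\<^sup>2) ^ M"
    by (rule mult_left_mono) simp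
   thus ?thesis
    using norm_triangle_ineq4[of "\<sigma> (y, \<xi>)" "cor (\<mu> y * k powr s)"] Cs(2)[of y \<xi>]
    unfolding e_def norm_of_real distrib_right by linarith
  qed
  obtain Cm where Cm: "\<And>y. \<bar>\<mu> y\<bar> \<le> Cm"
  proof -
   have "usmooth UNIV {()} (\<lambda>_. \<mu>)"
    using \<mu> by (intro usmooth_compact_supp) (auto simp: test_fun_def)
   thus ?thesis
    using usmooth_bound0 that by (metis UNIV_I insertI1 real_norm_def)
  qed
  \<comment> \<open>A bound for e that is uniform in y. Dividing e by it gives the bounded kernel h
    for \<open>fubini_mult\<close>, and the rapidly decaying F absorbs w.\<close>
  define w where "w \<xi> = (Cs + Cm * k powr s) * (1 + (norm \<xi>)\<^sup>2) ^ M" for \<xi> :: 'a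
  have Cm0: "0 \<le> Cm" using Cm[of 0] by linarith
  have w0: "0 < w \<xi>" for \<xi>
   unfolding w_def using Cs(1) Cm0
   by (intro mult_pos_pos zero_less_power add_pos_nonneg mult_nonneg_nonneg) auto
  have e_w: "norm (e k y \<xi>) \<le> w \<xi>" for y \<xi>
  proof (rule order_trans[OF e_le])
   show "(Cs + \<bar>\<mu> y * k powr s\<bar>) * (1 + (norm \<xi>)\<^sup>2) ^ M \<le> w \<xi>"
    unfolding w_def abs_mult using Cm[of y]
    by (intro mult_right_mono add_left_mono) (auto intro!: mult_right_mono zero_le_power)
  qed
  have [measurable]: "w \<in> borel_measurable borel" unfolding w_def[abs_def] by measurable
  have intw: "integrable lborel (\<lambda>\<xi>. cor (w \<xi>) * F \<xi>)"
   unfolding F_def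
  proof (rule integrable_weight_ft[OF K cs\<Phi>(1), where cw="Cs + Cm * k powr s" and M=M])
   show "norm (cor (w \<xi>)) \<le> (Cs + Cm * k powr s) * (1 + (norm \<xi>)\<^sup>2) ^ M" for \<xi>
    unfolding norm_of_real using w0[of \<xi>] by (simp add: w_def)
  qed measurable
  have [measurable]: "(\<lambda>z. e k (fst z) (snd z)) \<in> borel_measurable (borel \<Otimes>\<^sub>M borel)"
   unfolding e_def by measurable
  have int\<Psi>: "integrable lborel \<Psi>" by (rule integrable_csmooth[OF K cs\<Phi>(2)])
  define h where "h z = ei (fst z \<bullet> snd z) * e k (fst z) (snd z) * cor (inverse (w (snd z)))" for z
  have hm: "h \<in> borel_measurable (borel \<Otimes>\<^sub>M borel)" unfolding h_def[abs_def] by measurable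
  have hb: "norm (h (y, \<xi>)) \<le> 1" for y \<xi>
   using e_w[of y \<xi>] w0[of \<xi>] unfolding h_def norm_mult norm_of_real by (simp add: field_simps)
  have he: "h (y, \<xi>) * (cor (w \<xi>) * F \<xi>) = ei (y \<bullet> \<xi>) * e k y \<xi> * F \<xi>" for y \<xi>
   using w0[of \<xi>] by (simp add: h_def)
  have intpsi: "integrable lborel (\<lambda>y. \<Psi> y * (LBINT \<xi>. h (y, \<xi>) * (cor (w \<xi>) * F \<xi>)))"
  proof -
   have "integrable (lborel \<Otimes>\<^sub>M lborel) (\<lambda>(y, \<xi>). h (y, \<xi>) * (\<Psi> y * (cor (w \<xi>) * F \<xi>)))"
    by (rule integrable_pair_mult[OF int\<Psi> intw hm hb])
   from lborel_pair.integrable_fst[OF this]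
   show ?thesis by (simp add: mult.left_commute flip: integral_mult_right_zero)
  qed
  have int\<mu>: "integrable lborel (\<lambda>y. cor (\<mu> y * k powr s) * \<Phi> y * \<Psi> y)"
  proof (rule integrable_csupp[OF K])
   have "continuous_on UNIV \<mu>" using \<mu> by (auto simp: test_fun_def intro: smooth_on_continuous)
   thus "continuous_on UNIV (\<lambda>y. cor (\<mu> y * k powr s) * \<Phi> y * \<Psi> y)"
    using csmooth_continuous[OF cs\<Phi>(1)] csmooth_continuous[OF cs\<Phi>(2)] by (intro continuous_intros)
  qed (use cs\<Phi> in \<open>auto simp: csmooth_def\<close>)
  have eqint: "psido \<sigma> \<phi> y * \<Psi> y = cor (inverse P) * (\<Psi> y * (LBINT \<xi>. h (y, \<xi>) * (cor (w \<xi>) * F \<xi>)))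
    + cor (\<mu> y * k powr s) * \<Phi> y * \<Psi> y" for y
   using 1[of y] unfolding he by (simp add: algebra_simps)
  have "(LBINT x. psido \<sigma> \<phi> x * cor (\<psi> x)) =
   (LBINT y. cor (inverse P) * (\<Psi> y * (LBINT \<xi>. h (y, \<xi>) * (cor (w \<xi>) * F \<xi>)))
    + cor (\<mu> y * k powr s) * \<Phi> y * \<Psi> y)"
   unfolding eqint[symmetric] by (simp add: \<Psi>_def)
  also have "\<dots> = cor (inverse P) * (LBINT y. \<Psi> y * (LBINT \<xi>. h (y, \<xi>) * (cor (w \<xi>) * F \<xi>)))
    + (LBINT y. cor (\<mu> y * k powr s) * \<Phi> y * \<Psi> y)"
   using intpsi int\<mu> by (subst Bochner_Integration.integral_add) (auto simp del: of_real_mult)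
  also have "(LBINT y. cor (\<mu> y * k powr s) * \<Phi> y * \<Psi> y) =
    cor (k powr s * (LBINT x. \<mu> x * \<phi> x * \<psi> x))"
  proof -
   have "(LBINT y. cor (\<mu> y * k powr s) * \<Phi> y * \<Psi> y) =
     (LBINT y. cor (k powr s * (\<mu> y * \<phi> y * \<psi> y)))"
    by (intro Bochner_Integration.integral_cong refl) (simp add: \<Phi>_def \<Psi>_def mult_ac)
   thus ?thesis by (simp only: integral_complex_of_real integral_mult_right_zero)
  qed
  also have "(LBINT y. \<Psi> y * (LBINT \<xi>. h (y, \<xi>) * (cor (w \<xi>) * F \<xi>))) =
   (LBINT \<xi>. (cor (w \<xi>) * F \<xi>) * (LBINT y. h (y, \<xi>) * \<Psi> y))"
   by (rule fubini_mult[OF int\<Psi> intw hm hb])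
  also have "\<dots> = (LBINT \<xi>. F \<xi> * E \<xi>)"
  proof (intro Bochner_Integration.integral_cong refl)
   fix \<xi>
   have "cor (w \<xi>) * (LBINT y. h (y, \<xi>) * \<Psi> y) = E \<xi>"
    unfolding E_def integral_mult_right_zero[symmetric]
    by (intro Bochner_Integration.integral_cong refl) (use w0[of \<xi>] in \<open>simp add: h_def\<close>)
   thus "cor (w \<xi>) * F \<xi> * (LBINT y. h (y, \<xi>) * \<Psi> y) = F \<xi> * E \<xi>"
    by (simp add: mult_ac)
  qed
  finally have main: "(LBINT x. psido \<sigma> \<phi> x * cor (\<psi> x)) - cor (k powr s * (LBINT x. \<mu> x * \<phi> x * \<psi> x))
    = cor (inverse P) * (LBINT \<xi>. F \<xi> * E \<xi>)"
   by simp
  have \<Phi>\<Psi>: "norm (\<Phi> y) \<le> B" "norm (\<Psi> y) \<le> B"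
   "norm ((helmholtz (cor (k\<^sup>2)) ^^ J) \<Phi> y) \<le> B * k ^ J" for y
   using B\<phi>[of y] B\<psi>[of y] BJ[of y] by (simp_all only: \<Phi>_def[abs_def] \<Psi>_def norm_of_real)
  define R where "R \<xi> = norm (ft \<Psi> \<xi>)" for \<xi>
  have [measurable]: "R \<in> borel_measurable borel" unfolding R_def[abs_def] by measurable
  define W where "W \<xi> = (1 + \<bar>norm \<xi> - k\<bar>) ^ J * norm (F \<xi>)" for \<xi>
  have [measurable]: "W \<in> borel_measurable borel" unfolding W_def[abs_def] by measurable
  have W0: "0 \<le> W \<xi>" for \<xi> unfolding W_def by (intro mult_nonneg_nonneg zero_le_power) auto
  \<comment> \<open>Inverting the transform of g exhibits E as N (k, xi) times a convolution of ft g
    with ft Psi. The growing factor N will be given to F, whose frequencies are localised near the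
    sphere, while ft g is integrable uniformly in k and xi.\<close>
  have E: "E \<xi> = cor (N (k, \<xi>) * inverse P) * (LBINT \<eta>. ft (g (k, \<xi>)) \<eta> * ft \<Psi> (- \<xi> - \<eta>))" for \<xi>
  proof -
   have cg: "csmooth L (g (k, \<xi>))"
    using usmooth_smooth[OF g, of "(k, \<xi>)"] k L(2) by (auto simp: csmooth_def g_def)
   have ee: "e k y \<xi> * \<Psi> y = cor (N (k, \<xi>)) * (g (k, \<xi>) y * \<Psi> y)" for y
   proof (cases "y \<in> K")
    case True
    hence "\<kappa> y = 1" using \<kappa> by blast
    thus ?thesis using N0[OF k, of \<xi>] by (simp add: g_def)
   qed (use cs\<Phi>(2) in \<open>simp add: csmooth_def\<close>)
   have gi: "g (k, \<xi>) y = cor (inverse P) * (LBINT \<eta>. ei (y \<bullet> \<eta>) * ft (g (k, \<xi>)) \<eta>)" for y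
    using ft_inversion[OF L(1) cg, of y, folded P_def] P by simp
   have int_e: "integrable lborel (\<lambda>y. ei (y \<bullet> \<xi>) * \<Psi> y)"
    by (rule integrable_exp_mult(1)[OF int\<Psi>]) simp
   have "E \<xi> = (LBINT y. cor (N (k, \<xi>) * inverse P) * ((ei (y \<bullet> \<xi>) * \<Psi> y) *
      (LBINT \<eta>. ei (y \<bullet> \<eta>) * ft (g (k, \<xi>)) \<eta>)))"
    unfolding E_def by (intro Bochner_Integration.integral_cong refl) (simp only: mult.assoc ee, subst gi, simp add: mult_ac)
   also have "\<dots> = cor (N (k, \<xi>) * inverse P) * (LBINT y. (ei (y \<bullet> \<xi>) * \<Psi> y) *
      (LBINT \<eta>. ei (y \<bullet> \<eta>) * ft (g (k, \<xi>)) \<eta>))"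
    by (rule integral_mult_right_zero)
   also have "(LBINT y. (ei (y \<bullet> \<xi>) * \<Psi> y) *
      (LBINT \<eta>. ei (y \<bullet> \<eta>) * ft (g (k, \<xi>)) \<eta>)) =
     (LBINT \<eta>. ft (g (k, \<xi>)) \<eta> * (LBINT y. ei (y \<bullet> \<eta>) * (ei (y \<bullet> \<xi>) * \<Psi> y)))"
    using fubini_mult[OF int_e integrable_ft[OF L(1) cg], of "\<lambda>(y, \<eta>). ei (y \<bullet> \<eta>)" 1] by simp
   also have "\<dots> = (LBINT \<eta>. ft (g (k, \<xi>)) \<eta> * ft \<Psi> (- \<xi> - \<eta>))"
   proof -
    have "ei (y \<bullet> \<eta>) * (ei (y \<bullet> \<xi>) * \<Psi> y) =
      exp (- \<i> * cor (y \<bullet> (- \<xi> - \<eta>))) * \<Psi> y" for y \<eta>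
    proof -
     have "\<i> * cor (y \<bullet> \<eta>) + \<i> * cor (y \<bullet> \<xi>) = - \<i> * cor (y \<bullet> (- \<xi> - \<eta>))"
      by (simp add: inner_diff_right algebra_simps)
     thus ?thesis
      by (simp only: mult.assoc[symmetric] exp_add[symmetric])
    qed
    thus ?thesis by (simp only: ft_def[of \<Psi>])
   qed
   finally show ?thesis .
  qed
  \<comment> \<open>W R <= W^2 + R^2 takes the place of the Cauchy-Schwarz inequality: each square
    can be integrated over xi on its own, R^2 after a reflection and translation, and both integrals
    are O(B^2).\<close>
  have FE: "ennreal (norm (F \<xi> * E \<xi>)) \<le> ennreal (k powr (s - 1) * inverse P * Cg) *
    (NN \<eta>. ennreal (a \<eta> * ((W \<xi>)\<^sup>2 + (R (- \<xi> - \<eta>))\<^sup>2)))" for \<xi>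
  proof -
   have "norm (F \<xi> * E \<xi>) = (k powr (s - 1) * inverse P) * (W \<xi> * norm (LBINT \<eta>. ft (g (k, \<xi>)) \<eta> * ft \<Psi> (- \<xi> - \<eta>)))"
    unfolding E norm_mult norm_of_real using N0[OF k, of \<xi>] P by (simp add: N W_def abs_mult power_abs mult_ac)
   hence 1: "ennreal (norm (F \<xi> * E \<xi>)) = ennreal (k powr (s - 1) * inverse P) * (ennreal (W \<xi>) *
     ennreal (norm (LBINT \<eta>. ft (g (k, \<xi>)) \<eta> * ft \<Psi> (- \<xi> - \<eta>))))"
    using P W0 by (simp add: ennreal_mult'')
   have "ennreal (norm (LBINT \<eta>. ft (g (k, \<xi>)) \<eta> * ft \<Psi> (- \<xi> - \<eta>))) \<le>
     (NN \<eta>. ennreal (norm (ft (g (k, \<xi>)) \<eta> * ft \<Psi> (- \<xi> - \<eta>))))"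
   proof (cases "integrable lborel (\<lambda>\<eta>. ft (g (k, \<xi>)) \<eta> * ft \<Psi> (- \<xi> - \<eta>))")
    case True
    thus ?thesis by (rule integral_norm_bound_ennreal)
   qed (simp add: not_integrable_integral_eq)
   also have "\<dots> \<le> (NN \<eta>. ennreal Cg * ennreal (a \<eta> * R (- \<xi> - \<eta>)))"
   proof (rule nn_integral_mono)
    fix \<eta>
    have "norm (ft (g (k, \<xi>)) \<eta> * ft \<Psi> (- \<xi> - \<eta>)) \<le> (Cg * a \<eta>) * R (- \<xi> - \<eta>)"
     unfolding norm_mult R_def a_def using Cg(2)[of "(k, \<xi>)" \<eta>] k by (intro mult_right_mono) auto
    hence "ennreal (norm (ft (g (k, \<xi>)) \<eta> * ft \<Psi> (- \<xi> - \<eta>))) \<le> ennreal (Cg * (a \<eta> * R (- \<xi> - \<eta>)))"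
     by (intro ennreal_leI) (simp add: mult.assoc)
    thus "ennreal (norm (ft (g (k, \<xi>)) \<eta> * ft \<Psi> (- \<xi> - \<eta>))) \<le> ennreal Cg * ennreal (a \<eta> * R (- \<xi> - \<eta>))"
     using Cg(1) by (simp add: ennreal_mult' less_imp_le)
   qed
   also have "\<dots> = ennreal Cg * (NN \<eta>. ennreal (a \<eta> * R (- \<xi> - \<eta>)))"
    by (rule nn_integral_cmult) measurable
   finally have 2: "ennreal (norm (LBINT \<eta>. ft (g (k, \<xi>)) \<eta> * ft \<Psi> (- \<xi> - \<eta>))) \<le>
     ennreal Cg * (NN \<eta>. ennreal (a \<eta> * R (- \<xi> - \<eta>)))" .
   have 3: "ennreal (W \<xi>) * (ennreal Cg * (NN \<eta>. ennreal (a \<eta> * R (- \<xi> - \<eta>)))) =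
     ennreal Cg * (NN \<eta>. ennreal (W \<xi>) * ennreal (a \<eta> * R (- \<xi> - \<eta>)))"
    by (subst nn_integral_cmult) (auto simp: mult_ac)
   have 4: "(NN \<eta>. ennreal (W \<xi>) * ennreal (a \<eta> * R (- \<xi> - \<eta>))) \<le>
     (NN \<eta>. ennreal (a \<eta> * ((W \<xi>)\<^sup>2 + (R (- \<xi> - \<eta>))\<^sup>2)))"
   proof (rule nn_integral_mono)
    fix \<eta>
    have "0 \<le> W \<xi> * R (- \<xi> - \<eta>)"
     using W0[of \<xi>] by (simp add: R_def)
    moreover have "2 * (W \<xi> * R (- \<xi> - \<eta>)) \<le> (W \<xi>)\<^sup>2 + (R (- \<xi> - \<eta>))\<^sup>2"
     using sum_squares_bound[of "W \<xi>" "R (- \<xi> - \<eta>)"] by (simp only: mult.assoc)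
    ultimately have "W \<xi> * R (- \<xi> - \<eta>) \<le> (W \<xi>)\<^sup>2 + (R (- \<xi> - \<eta>))\<^sup>2"
     by linarith
    from mult_left_mono[OF this a0[of \<eta>]]
    have "W \<xi> * (a \<eta> * R (- \<xi> - \<eta>)) \<le> a \<eta> * ((W \<xi>)\<^sup>2 + (R (- \<xi> - \<eta>))\<^sup>2)"
     by (simp add: mult.left_commute)
    thus "ennreal (W \<xi>) * ennreal (a \<eta> * R (- \<xi> - \<eta>)) \<le> ennreal (a \<eta> * ((W \<xi>)\<^sup>2 + (R (- \<xi> - \<eta>))\<^sup>2))"
     using W0 by (simp add: ennreal_mult'[symmetric] ennreal_leI)
   qed
   have "ennreal (norm (F \<xi> * E \<xi>)) \<le> ennreal (k powr (s - 1) * inverse P) *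
     (ennreal (W \<xi>) * (ennreal Cg * (NN \<eta>. ennreal (a \<eta> * R (- \<xi> - \<eta>)))))"
    unfolding 1 by (intro mult_left_mono 2) auto
   also have "\<dots> \<le> ennreal (k powr (s - 1) * inverse P) * (ennreal Cg *
     (NN \<eta>. ennreal (a \<eta> * ((W \<xi>)\<^sup>2 + (R (- \<xi> - \<eta>))\<^sup>2))))"
    unfolding 3 by (intro mult_left_mono 4) auto
   also have "\<dots> = ennreal (k powr (s - 1) * inverse P * Cg) *
     (NN \<eta>. ennreal (a \<eta> * ((W \<xi>)\<^sup>2 + (R (- \<xi> - \<eta>))\<^sup>2)))"
    using P Cg(1) by (subst (2) ennreal_mult'') (auto simp: mult.assoc less_imp_le)
   finally show ?thesis .
  qed
  have "ennreal (norm (LBINT \<xi>. F \<xi> * E \<xi>)) \<le> (NN \<xi>. ennreal (norm (F \<xi> * E \<xi>)))"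
  proof (cases "integrable lborel (\<lambda>\<xi>. F \<xi> * E \<xi>)")
   case True
   thus ?thesis by (rule integral_norm_bound_ennreal)
  qed (simp add: not_integrable_integral_eq)
  also have "\<dots> \<le> (NN \<xi>. ennreal (k powr (s - 1) * inverse P * Cg) *
    (NN \<eta>. ennreal (a \<eta> * ((W \<xi>)\<^sup>2 + (R (- \<xi> - \<eta>))\<^sup>2))))"
   by (rule nn_integral_mono) (rule FE)
  also have "\<dots> = ennreal (k powr (s - 1) * inverse P * Cg) *
    (NN \<xi>. (NN \<eta>. ennreal (a \<eta> * ((W \<xi>)\<^sup>2 + (R (- \<xi> - \<eta>))\<^sup>2))))"
   by (rule nn_integral_cmult) measurable
  also have "(NN \<xi>. (NN \<eta>. ennreal (a \<eta> * ((W \<xi>)\<^sup>2 + (R (- \<xi> - \<eta>))\<^sup>2)))) =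
    (NN \<eta>. (NN \<xi>. ennreal (a \<eta> * ((W \<xi>)\<^sup>2 + (R (- \<xi> - \<eta>))\<^sup>2))))"
   by (rule lborel_pair.Fubini') measurable
  also have "\<dots> \<le> (NN \<eta>. ennreal (a \<eta>) * ennreal (B\<^sup>2 * (4 * 4 ^ J * P * measure lborel K + P * measure lborel K)))"
  proof (rule nn_integral_mono)
   fix \<eta>
   have "(NN \<xi>. ennreal (a \<eta> * ((W \<xi>)\<^sup>2 + (R (- \<xi> - \<eta>))\<^sup>2))) =
     ennreal (a \<eta>) * ((NN \<xi>. ennreal ((W \<xi>)\<^sup>2)) + (NN \<xi>. ennreal ((R (- \<xi> - \<eta>))\<^sup>2)))"
    using a0[of \<eta>] by (simp add: ennreal_mult' nn_integral_cmult nn_integral_add)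
   also have "(NN \<xi>. ennreal ((R (- \<xi> - \<eta>))\<^sup>2)) = (NN \<xi>. ennreal ((R \<xi>)\<^sup>2))"
   proof -
    have L: "lborel = density (distr lborel borel (\<lambda>x::'a. - \<eta> + (-1) *\<^sub>R x)) (\<lambda>_. 1)"
     using lborel_affine[of "-1" "- \<eta>"] by simp
    have "(NN \<xi>. ennreal ((R \<xi>)\<^sup>2)) = (NN \<xi>. ennreal ((R (- \<eta> + (-1) *\<^sub>R \<xi>))\<^sup>2))"
     by (subst L) (simp add: nn_integral_density nn_integral_distr)
    thus ?thesis by (simp add: algebra_simps)
   qed
   also have "ennreal (a \<eta>) * ((NN \<xi>. ennreal ((W \<xi>)\<^sup>2)) + (NN \<xi>. ennreal ((R \<xi>)\<^sup>2)))
    \<le> ennreal (a \<eta>) * (ennreal (4 * 4 ^ J * (P * (B\<^sup>2 * measure lborel K))) + ennreal (P * (B\<^sup>2 * measure lborel K)))"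
    unfolding W_def R_def F_def P_def
    by (intro mult_left_mono add_mono frequency_localisation[OF K cs\<Phi>(1) k] nn_integral_ft_sq_le[OF K cs\<Phi>(2)] \<Phi>\<Psi>)
     auto
   also have "ennreal (4 * 4 ^ J * (P * (B\<^sup>2 * measure lborel K))) + ennreal (P * (B\<^sup>2 * measure lborel K)) =
     ennreal (B\<^sup>2 * (4 * 4 ^ J * P * measure lborel K + P * measure lborel K))"
    using P by (subst ennreal_plus[symmetric]) (auto simp: algebra_simps)
   finally show "(NN \<xi>. ennreal (a \<eta> * ((W \<xi>)\<^sup>2 + (R (- \<xi> - \<eta>))\<^sup>2))) \<le>
     ennreal (a \<eta>) * ennreal (B\<^sup>2 * (4 * 4 ^ J * P * measure lborel K + P * measure lborel K))" .
  qed
  also have "\<dots> = ennreal A * ennreal (B\<^sup>2 * (4 * 4 ^ J * P * measure lborel K + P * measure lborel K))"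
   by (subst nn_integral_multc) (auto simp: A)
  finally have "ennreal (norm (LBINT \<xi>. F \<xi> * E \<xi>)) \<le>
    ennreal (k powr (s - 1) * inverse P * Cg * (A * (B\<^sup>2 * (4 * 4 ^ J * P * measure lborel K + P * measure lborel K))))"
   using P Cg(1) A(2) by (simp add: ennreal_mult' mult_left_mono less_imp_le)
  hence "norm (LBINT \<xi>. F \<xi> * E \<xi>) \<le>
    k powr (s - 1) * inverse P * Cg * (A * (B\<^sup>2 * (4 * 4 ^ J * P * measure lborel K + P * measure lborel K)))"
   by (subst (asm) ennreal_le_iff) (use P Cg(1) A(2) in \<open>auto intro!: mult_nonneg_nonneg add_nonneg_nonneg\<close>)
  hence "inverse P * norm (LBINT \<xi>. F \<xi> * E \<xi>) \<le> C * B\<^sup>2 * k powr (s - 1)"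
   using mult_left_mono[of "norm (LBINT \<xi>. F \<xi> * E \<xi>)" _ "inverse P"] P by (simp add: C_def mult_ac)
  thus "norm ((LBINT x. psido \<sigma> \<phi> x * cor (\<psi> x)) - cor (k powr s * (LBINT x. \<mu> x * \<phi> x * \<psi> x)))
    \<le> C * B\<^sup>2 * k powr (s - 1)"
   unfolding main norm_mult norm_of_real using P by simp
 qed
qed

subsection \<open>Outgoing waves\<close>

lemma csmooth_vanishing:
 assumes "compact K" "K \<subseteq> V" "open V" "smooth_on V g" "\<And>y. y \<notin> K ==> g y = 0"
 shows "csmooth K g"
proof -
 have "smooth_on (- K) g"
  by (rule smooth_on_cong[OF _ smooth_on_const[where c=0]]) (use assms in \<open>auto simp: compact_imp_closed open_Compl\<close>)
 hence "smooth_on UNIV g"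
  using assms(2,4) unfolding smooth_on_def by blast
 thus ?thesis using assms(5) by (simp add: csmooth_def)
qed

lemma iter_deriv_vanishing:
 assumes "closed K" "\<And>y. y \<notin> K ==> g y = 0" "y \<notin> K"
 shows "iter_deriv bs g y = 0"
proof -
 have "iter_deriv bs g y = iter_deriv bs (\<lambda>_. 0) y"
  by (rule iter_deriv_cong_open[of "- K"]) (use assms in \<open>auto simp: open_Compl\<close>)
 thus ?thesis by simp
qed

lemma dir_deriv_mult:
 fixes f g :: "'a::euclidean_space => 'b::real_normed_field"
 assumes "f differentiable (at y)" "g differentiable (at y)"
 shows "dir_deriv b (\<lambda>y. f y * g y) y = f y * dir_deriv b g y + dir_deriv b f y * g y"
 by (rule dir_deriv_eqI[THEN trans, OF has_derivative_mult[OF assms[THEN has_derivative_dir_deriv]]]) simp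

lemma dir_deriv_add:
 assumes "f differentiable (at y)" "g differentiable (at y)"
 shows "dir_deriv b (\<lambda>y. f y + g y) y = dir_deriv b f y + dir_deriv b g y"
 by (rule dir_deriv_eqI[THEN trans, OF has_derivative_add[OF assms[THEN has_derivative_dir_deriv]]]) simp

text \<open>x is the observation point, V a bounded region at distance at least rho from it, where
  the phase |y - x| has bounded derivatives of all orders, and K a compact subset of V off which the
  amplitudes vanish.\<close>

locale annulus =
 fixes x :: "'a::euclidean_space" and V K :: "'a set" and \<rho> :: real
 assumes V: "open V" "bounded V" and \<rho>: "0 < \<rho>" "\<And>y. y \<in> V ==> \<rho> \<le> norm (y - x)"
  and K: "compact K" "K \<subseteq> V"
begin

definition rc :: "'a => complex" where "rc y = cor (norm (y - x))"

definition wave :: "real => ('a => complex) => 'a => complex" where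
 "wave t g y = exp (\<i> * cor t * rc y) * g y"

lemma norm_wave: "norm (wave t g y) = norm (g y)"
 by (simp add: wave_def norm_mult rc_def norm_exp_eq_Re)

lemma usmooth_rc: "usmooth V I (\<lambda>_. rc)"
 unfolding rc_def[abs_def] by (intro usmooth_of_real usmooth_dist[OF V \<rho>] V)

lemma rc_differentiable: "y \<in> V ==> rc differentiable (at y)"
 using usmooth_diff[OF usmooth_rc[of "{()}"]] by simp

lemma eikonal:
 assumes "y \<in> V"
 shows "(\<Sum>b\<in>Basis. dir_deriv b rc y * dir_deriv b rc y) = 1"
proof -
 have nz: "y - x \<noteq> 0" using \<rho>(2)[OF assms] \<rho>(1) by auto
 have "((\<lambda>y. y - x) has_derivative (\<lambda>h. h)) (at y)"
  by (auto intro!: derivative_eq_intros)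
 from has_derivative_compose[OF this has_derivative_norm[OF nz]]
 have "((\<lambda>y. norm (y - x)) has_derivative (\<lambda>h. h \<bullet> sgn (y - x))) (at y)" .
 from has_derivative_compose[OF this bounded_linear_imp_has_derivative[OF bounded_linear_of_real]]
 have "dir_deriv b rc y = cor (sgn (y - x) \<bullet> b)" for b
  unfolding rc_def[abs_def] by (subst inner_commute) (rule dir_deriv_eqI)
 hence "(\<Sum>b\<in>Basis. dir_deriv b rc y * dir_deriv b rc y) = cor (\<Sum>b\<in>Basis. (sgn (y - x) \<bullet> b)\<^sup>2)"
  by (simp add: power2_eq_square)
 also have "\<dots> = 1"
  unfolding sum_Basis_sq using nz by (simp add: norm_sgn)
 finally show ?thesis .
qed

lemma smooth_exp_rc: "smooth_on V (\<lambda>y. exp (\<i> * cor t * rc y))"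
proof -
 have "usmooth V {()} (\<lambda>i y. (\<lambda>n (i::unit) z. (\<i> * cor t) ^ n * exp (\<i> * cor t * z)) 0 i (rc y))"
 proof (rule usmooth_comp[OF V(1) usmooth_rc])
  show "((\<lambda>z. (\<i> * cor t) ^ n * exp (\<i> * cor t * z)) has_field_derivative
    (\<i> * cor t) ^ Suc n * exp (\<i> * cor t * rc y)) (at (rc y))" for n y
   by (auto intro!: derivative_eq_intros)
  show "\<exists>C. \<forall>i\<in>{()}. \<forall>y\<in>V. norm ((\<i> * cor t) ^ n * exp (\<i> * cor t * rc y)) \<le> C" for n
   by (intro exI[of _ "\<bar>t\<bar> ^ n"]) (simp add: norm_mult norm_power rc_def norm_exp_eq_Re)
 qed
 thus ?thesis
  using usmooth_smooth[of V "{()}" _ "()"] by simp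
qed

lemma smooth_wave: "smooth_on V g ==> smooth_on V (wave t g)"
 unfolding wave_def[abs_def] by (rule smooth_on_mult[OF V(1) smooth_exp_rc])

lemma dir_deriv_wave:
 assumes "y \<in> V" "smooth_on V g"
 shows "dir_deriv b (wave t g) y = wave t (\<lambda>y. \<i> * cor t * dir_deriv b rc y * g y + dir_deriv b g y) y"
proof -
 have E: "dir_deriv b (\<lambda>y. exp (\<i> * cor t * rc y)) y =
   exp (\<i> * cor t * rc y) * (\<i> * cor t * dir_deriv b rc y)"
 proof (rule dir_deriv_eqI)
  have "((\<lambda>y. \<i> * cor t * rc y) has_derivative (\<lambda>v. \<i> * cor t * dir_deriv v rc y)) (at y)"
   by (intro has_derivative_mult_right has_derivative_dir_deriv rc_differentiable assms)
  thus "((\<lambda>y. exp (\<i> * cor t * rc y)) has_derivative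
   (\<lambda>v. exp (\<i> * cor t * rc y) * (\<i> * cor t * dir_deriv v rc y))) (at y)"
   using has_derivative_compose[OF _ DERIV_exp[unfolded has_field_derivative_def]] by blast
 qed
 have "dir_deriv b (wave t g) y = exp (\<i> * cor t * rc y) * dir_deriv b g y +
   dir_deriv b (\<lambda>y. exp (\<i> * cor t * rc y)) y * g y"
  unfolding wave_def[abs_def]
  by (rule dir_deriv_mult) (use assms smooth_exp_rc smooth_on_differentiable in blast)+
 thus ?thesis
  unfolding E wave_def by (simp add: algebra_simps)
qed

lemma smooth_rc: "smooth_on V rc"
 using usmooth_smooth[OF usmooth_rc[of "{()}"], of "()"] by simp

text \<open>The terms with t^2 cancel by the eikonal equation, so the Helmholtz operator costs one
  power of t instead of two.\<close>

lemma laplacian_wave: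
 assumes "y \<in> V" "smooth_on V g"
 shows "laplacian (wave t g) y + cor (t\<^sup>2) * wave t g y = wave t (\<lambda>y.
   cor t * (2 * \<i> * (\<Sum>b\<in>Basis. dir_deriv b rc y * dir_deriv b g y) + \<i> * laplacian rc y * g y) + laplacian g y) y"
proof -
 define h where "h b y = \<i> * cor t * dir_deriv b rc y * g y + dir_deriv b g y" for b y
 have sm: "smooth_on V (h b)" if "b \<in> Basis" for b
  unfolding h_def[abs_def] using that assms
  by (intro smooth_on_add smooth_on_mult smooth_on_const smooth_on_dir smooth_rc V)
 have d: "dir_deriv b rc differentiable (at y)" "dir_deriv b g differentiable (at y)" "g differentiable (at y)"
  if "b \<in> Basis" for b
  using smooth_on_differentiable[OF smooth_on_dir[OF _ that]] smooth_rc assms smooth_on_differentiable by blast+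
 have dh: "dir_deriv b (h b) y = \<i> * cor t * (dir_deriv b rc y * dir_deriv b g y + dir_deriv b (dir_deriv b rc) y * g y)
   + dir_deriv b (dir_deriv b g) y" if b: "b \<in> Basis" for b
 proof -
  have m: "(\<lambda>y. dir_deriv b rc y * g y) differentiable (at y)"
   using d[OF b] by (intro differentiable_mult)
  have "dir_deriv b (h b) y = dir_deriv b (\<lambda>y. \<i> * cor t * (dir_deriv b rc y * g y)) y + dir_deriv b (dir_deriv b g) y"
   unfolding h_def mult.assoc
   by (rule dir_deriv_add) (use d[OF b] m in \<open>auto intro!: differentiable_mult\<close>)
  also have "dir_deriv b (\<lambda>y. \<i> * cor t * (dir_deriv b rc y * g y)) y =
    \<i> * cor t * dir_deriv b (\<lambda>y. dir_deriv b rc y * g y) y"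
   by (rule dir_deriv_bounded_linear[OF bounded_linear_mult_right m])
  also have "dir_deriv b (\<lambda>y. dir_deriv b rc y * g y) y = dir_deriv b rc y * dir_deriv b g y + dir_deriv b (dir_deriv b rc) y * g y"
   by (rule dir_deriv_mult) (use d[OF b] in auto)
  finally show ?thesis .
 qed
 have 2: "iter_deriv [b, b] (wave t g) y = wave t (\<lambda>y. \<i> * cor t * dir_deriv b rc y * h b y + dir_deriv b (h b) y) y"
  if b: "b \<in> Basis" for b
 proof -
  have "dir_deriv b (dir_deriv b (wave t g)) y = dir_deriv b (wave t (h b)) y"
   by (rule dir_deriv_cong_open[OF V(1) assms(1)]) (unfold h_def, rule dir_deriv_wave[OF _ assms(2)])
  thus ?thesis
   using dir_deriv_wave[OF assms(1) sm[OF b]] by (simp add: iter_deriv_Cons)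
 qed
 define e where "e = exp (\<i> * cor t * rc y)"
 have "laplacian (wave t g) y = (\<Sum>b\<in>Basis. e * (- (cor (t\<^sup>2)) * g y * (dir_deriv b rc y * dir_deriv b rc y)
  + cor t * (2 * \<i> * (dir_deriv b rc y * dir_deriv b g y)) + cor t * \<i> * g y * iter_deriv [b, b] rc y + iter_deriv [b, b] g y))"
  unfolding laplacian_def
 proof (intro sum.cong refl)
  fix b :: 'a assume b: "b \<in> Basis"
  have ii: "\<i> * (\<i> * z) = - z" for z by (simp flip: mult.assoc)
  show "iter_deriv [b, b] (wave t g) y = e * (- (cor (t\<^sup>2)) * g y * (dir_deriv b rc y * dir_deriv b rc y)
  + cor t * (2 * \<i> * (dir_deriv b rc y * dir_deriv b g y)) + cor t * \<i> * g y * iter_deriv [b, b] rc y + iter_deriv [b, b] g y)"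
   unfolding 2[OF b] wave_def dh[OF b] e_def[symmetric] h_def
   by (simp add: iter_deriv_Cons algebra_simps power2_eq_square ii)
 qed
 also have "\<dots> = e * (- (cor (t\<^sup>2)) * g y * (\<Sum>b\<in>Basis. dir_deriv b rc y * dir_deriv b rc y)
  + cor t * (2 * \<i> * (\<Sum>b\<in>Basis. dir_deriv b rc y * dir_deriv b g y)) + cor t * \<i> * g y * laplacian rc y + laplacian g y)"
  by (simp only: sum.distrib sum_distrib_left[symmetric] laplacian_def)
 finally show ?thesis
  unfolding eikonal[OF assms(1)] wave_def e_def[symmetric] by (simp add: algebra_simps)
qed

text \<open>Uniform bounds are asked for on V, where the phase is smooth; vanishing off K makes them
  global.\<close>

definition amplitude :: "'i set => ('i => 'a => complex) => bool" where
 "amplitude I b \<longleftrightarrow> usmooth V I b \<and> (\<forall>i\<in>I. \<forall>y. y \<notin> K \<longrightarrow> b i y = 0)"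

lemma csmooth_wave: "amplitude I b ==> i \<in> I ==> csmooth K (wave t (b i))"
 by (rule csmooth_vanishing[OF K V(1) smooth_wave]) (auto simp: amplitude_def wave_def usmooth_def)

lemma helmholtz_scale:
 fixes g :: "'a => complex"
 assumes "csmooth K g"
 shows "(helmholtz a ^^ j) (\<lambda>y. c * g y) = (\<lambda>y. c * (helmholtz a ^^ j) g y)"
proof (induction j)
 case (Suc j)
 have cs: "smooth_on UNIV ((helmholtz a ^^ j) g)"
  using csmooth_helmholtz_pow[OF K(1) assms] by (simp add: csmooth_def)
 have "laplacian (\<lambda>y. c * (helmholtz a ^^ j) g y) y = c * laplacian ((helmholtz a ^^ j) g) y" for y
  unfolding laplacian_def sum_distrib_left
  by (intro sum.cong refl iter_deriv_bounded_linear[OF open_UNIV bounded_linear_mult_right cs]) auto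
 hence "helmholtz a (\<lambda>y. c * (helmholtz a ^^ j) g y) = (\<lambda>y. c * helmholtz a ((helmholtz a ^^ j) g) y)"
  by (simp add: helmholtz_def algebra_simps)
 thus ?case
  using Suc by simp
qed simp

text \<open>After division by k the second-order term carries 1 / k <= 1, so the new amplitude is
  again uniformly smooth for k >= 1 and the step can be iterated.\<close>

lemma helmholtz_wave:
 assumes "amplitude {1..} b"
 obtains b' where "amplitude {1..} b'"
  "\<And>k. 1 \<le> k ==> helmholtz (cor (k\<^sup>2)) (wave k (b k)) = (\<lambda>y. cor k * wave k (b' k) y)"
proof -
 \<comment> \<open>The value off V is set to 0: derivatives of the phase are under control on V
   only, while the identity is claimed on the whole space.\<close>
 define b' where "b' k y = (if y \<in> V then 2 * \<i> * (\<Sum>v\<in>Basis. dir_deriv v rc y * dir_deriv v (b k) y) + \<i> * laplacian rc y * b k y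
   + cor (inverse k) * laplacian (b k) y else 0)" for k y
 have b: "usmooth V {1..} b" and bK: "\<And>k y. 1 \<le> k ==> y \<notin> K ==> b k y = 0"
  using assms by (auto simp: amplitude_def)
 have z: "iter_deriv bs (b k) y = 0" if "1 \<le> k" "y \<notin> K" for bs k y
  by (rule iter_deriv_vanishing[OF compact_imp_closed[OF K(1)] bK]) (use that in auto)
 have "usmooth V {1..} (\<lambda>k y. \<i> * 2 * (\<Sum>v\<in>Basis. dir_deriv v rc y * dir_deriv v (b k) y) + \<i> * laplacian rc y * b k y
   + cor (inverse k) * laplacian (b k) y)"
  unfolding laplacian_def
  by (intro usmooth_add usmooth_mult usmooth_sum usmooth_iter usmooth_dir usmooth_rc b V
    usmooth_const[where C=1] usmooth_const[where C=2])
   (auto simp: norm_inverse inverse_le_1_iff)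
 hence "usmooth V {1..} b'"
  by (rule usmooth_cong[OF V(1)]) (simp add: b'_def)
 moreover have "b' k y = 0" if "1 \<le> k" "y \<notin> K" for k y
  using z[OF that, of "[]"] z[OF that, of "[_]"] z[OF that, of "[_, _]"]
  by (simp add: b'_def laplacian_def iter_deriv_Cons)
 ultimately have amp: "amplitude {1..} b'"
  by (simp add: amplitude_def)
 show thesis
 proof (rule that[OF amp], rule ext)
  fix k :: real and y assume k: "1 \<le> k"
  show "helmholtz (cor (k\<^sup>2)) (wave k (b k)) y = cor k * wave k (b' k) y"
  proof (cases "y \<in> V")
   case True
   have "helmholtz (cor (k\<^sup>2)) (wave k (b k)) y = wave k (\<lambda>y.
    cor k * (2 * \<i> * (\<Sum>v\<in>Basis. dir_deriv v rc y * dir_deriv v (b k) y) + \<i> * laplacian rc y * b k y) + laplacian (b k) y) y"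
    unfolding helmholtz_def by (rule laplacian_wave[OF True]) (use b k in \<open>auto simp: usmooth_def\<close>)
   also have "\<dots> = cor k * wave k (b' k) y"
    using True k by (simp add: wave_def b'_def algebra_simps)
   finally show ?thesis .
  next
   case False
   hence yK: "y \<notin> K" using K by blast
   have "iter_deriv bs (wave k (b k)) y = 0" for bs
    by (rule iter_deriv_vanishing[OF compact_imp_closed[OF K(1)] _ yK]) (use bK k in \<open>simp add: wave_def\<close>)
   from this[of "[_, _]"] this[of "[]"] show ?thesis
    using False by (simp add: helmholtz_def laplacian_def wave_def b'_def)
  qed
 qed
qed

lemma amplitude_bound:
 assumes "amplitude I b"
 obtains C where "C > 0" "\<And>i y. i \<in> I ==> norm (b i y) \<le> C"
proof -
 obtain C where C: "C > 0" "\<And>i y. i \<in> I ==> y \<in> V ==> norm (b i y) \<le> C"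
  using assms usmooth_bound0[of V I b] by (metis amplitude_def)
 have "norm (b i y) \<le> C" if "i \<in> I" for i y
 proof (cases "y \<in> V")
  case False
  hence "b i y = 0" using assms that K(2) unfolding amplitude_def by blast
  thus ?thesis using C(1) by simp
 qed (use C(2) that in simp)
 thus thesis using that C by blast
qed

text \<open>Each application costs exactly one factor k, which is the growth that
  \<open>frequency_localisation\<close> tolerates.\<close>

lemma helmholtz_wave_bound:
 assumes "amplitude {1..} b"
 obtains C where "C > 0"
  "\<And>k y. 1 \<le> k ==> norm ((helmholtz (cor (k\<^sup>2)) ^^ j) (wave k (b k)) y) \<le> C * k ^ j"
proof -
 have "\<exists>b'. amplitude {1..} b' \<and> (\<forall>k\<ge>1. (helmholtz (cor (k\<^sup>2)) ^^ j) (wave k (b k)) =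
   (\<lambda>y. cor (k ^ j) * wave k (b' k) y))"
  using assms
 proof (induction j arbitrary: b)
  case 0
  thus ?case by (intro exI[of _ b]) auto
 next
  case (Suc j)
  obtain b1 where b1: "amplitude {1..} b1"
   "\<And>k. 1 \<le> k ==> helmholtz (cor (k\<^sup>2)) (wave k (b k)) = (\<lambda>y. cor k * wave k (b1 k) y)"
   using helmholtz_wave[OF Suc.prems] by metis
  obtain b2 where b2: "amplitude {1..} b2" "\<forall>k\<ge>1. (helmholtz (cor (k\<^sup>2)) ^^ j) (wave k (b1 k)) =
   (\<lambda>y. cor (k ^ j) * wave k (b2 k) y)"
   using Suc.IH[OF b1(1)] by blast
  have "(helmholtz (cor (k\<^sup>2)) ^^ Suc j) (wave k (b k)) = (\<lambda>y. cor (k ^ Suc j) * wave k (b2 k) y)"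
   if k: "1 \<le> k" for k
  proof -
   have "(helmholtz (cor (k\<^sup>2)) ^^ Suc j) (wave k (b k)) =
     (helmholtz (cor (k\<^sup>2)) ^^ j) (\<lambda>y. cor k * wave k (b1 k) y)"
    unfolding funpow_Suc_right o_def b1(2)[OF k] ..
   also have "\<dots> = (\<lambda>y. cor k * (helmholtz (cor (k\<^sup>2)) ^^ j) (wave k (b1 k)) y)"
    by (rule helmholtz_scale[OF csmooth_wave[OF b1(1)]]) (use k in simp)
   finally show ?thesis
    using b2(2) k by (simp add: fun_eq_iff mult.assoc)
  qed
  thus ?case using b2(1) by blast
 qed
 then obtain b' where b': "amplitude {1..} b'" "\<And>k. 1 \<le> k ==> (helmholtz (cor (k\<^sup>2)) ^^ j) (wave k (b k)) =
   (\<lambda>y. cor (k ^ j) * wave k (b' k) y)" by blast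
 obtain C where C: "C > 0" "\<And>k y. k \<in> {1..} ==> norm (b' k y) \<le> C"
  using amplitude_bound[OF b'(1)] by metis
 show thesis
 proof (rule that[OF C(1)])
  fix k :: real and y assume k: "1 \<le> k"
  show "norm ((helmholtz (cor (k\<^sup>2)) ^^ j) (wave k (b k)) y) \<le> C * k ^ j"
   unfolding b'(2)[OF k] norm_mult norm_wave norm_of_real
   using C(2)[of k y] k by (simp add: abs_mult mult.commute mult_left_mono)
 qed
qed

text \<open>One integration by parts along the radial field. The divergence of exp(i t r) c grad r
  has integral 0, and it equals i t exp(i t r) c, because |grad r| = 1, plus exp(i t r) times the
  divergence of c grad r, which is an amplitude again.\<close>

lemma oscillatory_decay:
 assumes "amplitude I c"
 obtains C where "C > 0" "\<And>i t. i \<in> I ==> (1 + \<bar>t\<bar>) * norm (LBINT y. wave t (c i) y) \<le> C"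
proof -
 have c: "usmooth V I c" and cK: "\<And>i y. i \<in> I ==> y \<notin> K ==> c i y = 0"
  using assms by (auto simp: amplitude_def)
 define g where "g v i y = (if y \<in> V then dir_deriv v rc y * c i y else 0)" for v i y
 have g: "amplitude I (g v)" if v: "v \<in> Basis" for v
 proof -
  have "usmooth V I (\<lambda>i y. dir_deriv v rc y * c i y)"
   by (intro usmooth_mult usmooth_dir usmooth_rc c V v)
  hence "usmooth V I (g v)"
   by (rule usmooth_cong[OF V(1)]) (simp add: g_def)
  thus ?thesis using cK by (simp add: amplitude_def g_def)
 qed
 define d where "d i y = (\<Sum>v\<in>Basis. dir_deriv v (g v i) y)" for i y
 have gz: "dir_deriv v (g v i) y = 0" if "v \<in> Basis" "i \<in> I" "y \<notin> K" for v i y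
  using iter_deriv_vanishing[OF compact_imp_closed[OF K(1)], of "g v i" y "[v]"] g[OF that(1)] that
  by (simp add: amplitude_def iter_deriv_Cons)
 have d: "amplitude I d"
 proof -
  have "usmooth V I (\<lambda>i y. \<Sum>v\<in>Basis. dir_deriv v (g v i) y)"
   by (intro usmooth_sum usmooth_dir V) (use g in \<open>auto simp: amplitude_def\<close>)
  thus ?thesis
   using gz by (auto simp: amplitude_def d_def[abs_def])
 qed
 obtain C1 where C1: "C1 > 0" "\<And>i y. i \<in> I ==> norm (d i y) \<le> C1"
  using amplitude_bound[OF d] by metis
 obtain C2 where C2: "C2 > 0" "\<And>i y. i \<in> I ==> norm (c i y) \<le> C2"
  using amplitude_bound[OF assms] by metis
 show thesis
 proof (rule that[of "max 1 ((C1 + C2) * measure lborel K)"])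
  fix i t assume i: "i \<in> I"
  have cw: "csmooth K (wave t (c i))" "csmooth K (wave t (d i))"
   by (rule csmooth_wave[OF _ i], rule assms d)+
  have gw: "csmooth K (wave t (g v i))" if "v \<in> Basis" for v
   by (rule csmooth_wave[OF g[OF that] i])
  have int: "integrable lborel (wave t (c i))" "integrable lborel (wave t (d i))"
   using integrable_csmooth[OF K(1)] cw by blast+
  have "0 = (LBINT y. (\<Sum>v\<in>Basis. dir_deriv v (wave t (g v i)) y))"
  proof -
   have "integrable lborel (dir_deriv v (wave t (g v i)))" if "v \<in> Basis" for v
    using integrable_csmooth[OF K(1) csmooth_iter[OF K(1) gw[OF that], of "[v]"]] that by (simp add: iter_deriv_Cons)
   thus ?thesis
    using integral_dir_deriv_eq_0[OF K(1) gw] by (subst Bochner_Integration.integral_sum) auto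
  qed
  also have "\<dots> = (LBINT y. \<i> * cor t * wave t (c i) y + wave t (d i) y)"
  proof (intro Bochner_Integration.integral_cong refl)
   fix y
   show "(\<Sum>v\<in>Basis. dir_deriv v (wave t (g v i)) y) = \<i> * cor t * wave t (c i) y + wave t (d i) y"
   proof (cases "y \<in> V")
    case True
    have "(\<Sum>v\<in>Basis. dir_deriv v (wave t (g v i)) y) = (\<Sum>v\<in>Basis. exp (\<i> * cor t * rc y) *
      (\<i> * cor t * c i y * (dir_deriv v rc y * dir_deriv v rc y) + dir_deriv v (g v i) y))"
    proof (intro sum.cong refl)
     fix v :: 'a assume v: "v \<in> Basis"
     have "smooth_on V (g v i)" using g[OF v] i by (auto simp: amplitude_def usmooth_def)
     from dir_deriv_wave[OF True this]
     show "dir_deriv v (wave t (g v i)) y = exp (\<i> * cor t * rc y) *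
      (\<i> * cor t * c i y * (dir_deriv v rc y * dir_deriv v rc y) + dir_deriv v (g v i) y)"
      using True by (simp add: wave_def g_def mult_ac)
    qed
    also have "\<dots> = exp (\<i> * cor t * rc y) *
      (\<i> * cor t * c i y * (\<Sum>v\<in>Basis. dir_deriv v rc y * dir_deriv v rc y) + d i y)"
     by (simp only: d_def sum.distrib sum_distrib_left[symmetric])
    finally show ?thesis
     unfolding eikonal[OF True] by (simp add: wave_def algebra_simps)
   next
    case False
    hence yK: "y \<notin> K" using K by blast
    have "dir_deriv v (wave t (g v i)) y = 0" if "v \<in> Basis" for v
     using csmooth_iter[OF K(1) gw[OF that], of "[v]"] that yK by (simp add: csmooth_def iter_deriv_Cons)
    moreover have "wave t (c i) y = 0" "wave t (d i) y = 0"
     using cw yK by (auto simp: csmooth_def)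
    ultimately show ?thesis by simp
   qed
  qed
  also have "\<dots> = \<i> * cor t * (LBINT y. wave t (c i) y) + (LBINT y. wave t (d i) y)"
   using int by (subst Bochner_Integration.integral_add) auto
  finally have "norm (\<i> * cor t * (LBINT y. wave t (c i) y)) = norm (LBINT y. wave t (d i) y)"
   by (metis add_eq_0_iff norm_minus_cancel)
  moreover have "norm (LBINT y. wave t (d i) y) \<le> C1 * measure lborel K"
   by (rule norm_integral_csupp_le[OF K(1)]) (use C1(2)[OF i] cw in \<open>auto simp: norm_wave csmooth_def\<close>)
  ultimately have "\<bar>t\<bar> * norm (LBINT y. wave t (c i) y) \<le> C1 * measure lborel K"
   by (simp add: norm_mult)
  moreover have "norm (LBINT y. wave t (c i) y) \<le> C2 * measure lborel K"
   by (rule norm_integral_csupp_le[OF K(1)]) (use C2(2)[OF i] cw in \<open>auto simp: norm_wave csmooth_def\<close>)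
  ultimately show "(1 + \<bar>t\<bar>) * norm (LBINT y. wave t (c i) y) \<le> max 1 ((C1 + C2) * measure lborel K)"
   by (simp add: algebra_simps le_max_iff_disj)
 qed simp
qed

end

subsection \<open>The integral representation of the Hankel function\<close>

text \<open>One statement serves the real parameter of the Gamma integral and the complex variable
  of the Macdonald integral. The mean value inequality on the ball dominates the difference
  quotients by B.\<close>

lemma integral_field_deriv:
 fixes F F' :: "'k::{real_normed_field, banach, second_countable_topology} => 'x => 'k"
 assumes r: "r > 0"
  and F: "\<And>z w. z \<in> ball z0 r ==> w \<in> space M ==> ((\<lambda>z. F z w) has_field_derivative F' z w) (at z)"
  and B: "\<And>z w. z \<in> ball z0 r ==> w \<in> space M ==> norm (F' z w) \<le> B w" "integrable M B"
  and int: "\<And>z. z \<in> ball z0 r ==> integrable M (F z)" and m: "F' z0 \<in> borel_measurable M"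
 shows "((\<lambda>z. LINT w|M. F z w) has_field_derivative (LINT w|M. F' z0 w)) (at z0)"
proof -
 have "(\<lambda>n. ((LINT w|M. F (z0 + h n) w) - (LINT w|M. F z0 w)) / h n) \<longlonglongrightarrow> (LINT w|M. F' z0 w)"
  if h: "\<And>n. h n \<noteq> 0" "h \<longlonglongrightarrow> 0" for h :: "nat => 'k"
 proof -
  obtain n0 where n0: "\<And>n. n \<ge> n0 ==> norm (h n) < r"
   using tendstoD[OF h(2) r] unfolding eventually_sequentially dist_norm by auto
  have hn: "z0 + h (n + n0) \<in> ball z0 r" for n
   using n0[of "n + n0"] by (simp add: dist_norm)
  have z0: "z0 \<in> ball z0 r" using r by simp
  have "(\<lambda>n. LINT w|M. (F (z0 + h (n + n0)) w - F z0 w) / h (n + n0)) \<longlonglongrightarrow> (LINT w|M. F' z0 w)"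
  proof (rule integral_dominated_convergence[where w=B])
   show "AE w in M. (\<lambda>n. (F (z0 + h (n + n0)) w - F z0 w) / h (n + n0)) \<longlonglongrightarrow> F' z0 w"
   proof (rule AE_I2)
    fix w assume w: "w \<in> space M"
    have "((\<lambda>d. (F (z0 + d) w - F z0 w) / d) \<longlongrightarrow> F' z0 w) (at 0)"
     using F[OF z0 w] by (simp add: DERIV_def)
    moreover have "filterlim (\<lambda>n. h (n + n0)) (at 0) sequentially"
     using h LIMSEQ_ignore_initial_segment[OF h(2), of n0] by (simp add: filterlim_at)
    ultimately show "(\<lambda>n. (F (z0 + h (n + n0)) w - F z0 w) / h (n + n0)) \<longlonglongrightarrow> F' z0 w"
     by (rule filterlim_compose)
   qed
   show "AE w in M. norm ((F (z0 + h (n + n0)) w - F z0 w) / h (n + n0)) \<le> B w" for n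
   proof (rule AE_I2)
    fix w assume w: "w \<in> space M"
    have "norm (F (z0 + h (n + n0)) w - F z0 w) \<le> B w * norm (z0 + h (n + n0) - z0)"
     by (rule field_differentiable_bound[where S="ball z0 r" and f="\<lambda>z. F z w" and f'="\<lambda>z. F' z w"])
      (use F w B hn[of n] z0 in \<open>auto intro: has_field_derivative_at_within\<close>)
    thus "norm ((F (z0 + h (n + n0)) w - F z0 w) / h (n + n0)) \<le> B w"
     using h(1)[of "n + n0"] by (simp add: norm_divide field_simps)
   qed
   show "(\<lambda>w. (F (z0 + h (n + n0)) w - F z0 w) / h (n + n0)) \<in> borel_measurable M" for n
    using borel_measurable_integrable[OF int[OF hn]] borel_measurable_integrable[OF int[OF z0]]
    by (intro borel_measurable_divide borel_measurable_diff) auto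
  qed (use B(2) m in auto)
  moreover have "(LINT w|M. (F (z0 + h (n + n0)) w - F z0 w) / h (n + n0)) =
    ((LINT w|M. F (z0 + h (n + n0)) w) - (LINT w|M. F z0 w)) / h (n + n0)" for n
   by (subst integral_divide_zero) (simp add: Bochner_Integration.integral_diff[OF int[OF hn] int[OF z0]])
  ultimately have "(\<lambda>n. ((LINT w|M. F (z0 + h (n + n0)) w) - (LINT w|M. F z0 w)) / h (n + n0)) \<longlonglongrightarrow> (LINT w|M. F' z0 w)"
   by (simp only:)
  thus ?thesis
   by (rule LIMSEQ_offset[where k=n0])
 qed
 hence "((\<lambda>d. ((LINT w|M. F (z0 + d) w) - (LINT w|M. F z0 w)) / d) \<longlongrightarrow> (LINT w|M. F' z0 w)) (at 0)"
  unfolding tendsto_at_iff_sequentially by (auto simp: o_def)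
 thus ?thesis by (simp add: DERIV_def)
qed

section \<open>Gamma integrals and Euler's constant\<close>

lemma gamma_integrable:
 assumes "s > (0::real)"
 shows "integrable lborel (\<lambda>t. indicator {0<..} t * (t powr (s - 1) * exp (- t)))"
  "(LBINT t. indicator {0<..} t * (t powr (s - 1) * exp (- t))) = Gamma s"
proof -
 have e: "(NN t. ennreal (indicator {0<..} t * (t powr (s - 1) * exp (- t)))) = ennreal (Gamma s)"
  unfolding Gamma_conv_nn_integral_real[OF assms]
  by (intro nn_integral_cong) (auto simp: indicator_def exp_minus divide_inverse)
 show "integrable lborel (\<lambda>t. indicator {0<..} t * (t powr (s - 1) * exp (- t)))"
  by (rule integrableI_nn_integral_finite[OF _ _ e]) (use Gamma_real_pos[OF assms] in \<open>auto simp: less_imp_le\<close>)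
 show "(LBINT t. indicator {0<..} t * (t powr (s - 1) * exp (- t))) = Gamma s"
  by (rule integral_eq_nn_integral[THEN trans]) (use e Gamma_real_pos[OF assms] in \<open>auto simp: less_imp_le\<close>)
qed

lemma FTC_half_line:
 fixes F f :: "real => 'a::euclidean_space"
 assumes "\<And>w. 0 < w ==> (F has_vector_derivative f w) (at w)" "\<And>w. 0 < w ==> isCont f w"
  and "integrable lborel (\<lambda>w. indicator {0<..} w *\<^sub>R f w)"
  and "(F \<longlongrightarrow> A) (at_right 0)" "(F \<longlongrightarrow> B) at_top"
 shows "(LBINT w. indicator {0<..} w *\<^sub>R f w) = B - A"
proof -
 have "einterval (ereal 0) \<infinity> = {0<..}"
  by (auto simp: einterval_def)
 moreover have "((F \<circ> real_of_ereal) \<longlongrightarrow> A) (at_right (ereal 0))" "((F \<circ> real_of_ereal) \<longlongrightarrow> B) (at_left \<infinity>)"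
  using assms(4,5) by (simp_all only: ereal_tendsto_simps)
 ultimately have "(LBINT x=ereal 0..\<infinity>. f x) = B - A"
  using assms by (intro interval_integral_FTC_integrable) (auto simp: set_integrable_def)
 thus ?thesis
  by (simp only: interval_integral_to_infinity_eq set_lebesgue_integral_def)
qed

text \<open>This is Gamma'(1), found by differentiating the Gamma integral under the integral sign.
  Through it Euler's constant enters the behaviour of the Macdonald function at 0.\<close>

lemma integral_exp_ln: "(LBINT w. indicator {0<..} w * (ln w * exp (- w))) = (- euler_mascheroni :: real)"
 and integrable_exp_ln: "integrable lborel (\<lambda>w. indicator {0<..} w * (ln w * exp (- w)) :: real)"
proof -
 define F where "F s w = indicator {0<..} w * (w powr (s - 1) * exp (- w))" for s w :: real
 define F' where "F' s w = indicator {0<..} w * (ln w * w powr (s - 1) * exp (- w))" for s w :: real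
 \<comment> \<open>With a = w^(1/4) and |s - 1| < 1/4, both |ln w| / 4 and w^(s - 1) are at most a +
   1 / a, and 4 (a + 1 / a)^2 <= 8 (a^2 + 1 / a^2); the squares are w^(1/2) and w^(- 1/2).\<close>
 define B where "B w = indicator {0<..} w * (w powr (1/2 - 1) * exp (- w)) * 8 + indicator {0<..} w * (w powr (3/2 - 1) * exp (- w)) * 8" for w :: real
 have B: "integrable lborel B"
  unfolding B_def by (intro Bochner_Integration.integrable_add integrable_mult_left gamma_integrable) auto
 have bound: "norm (F' s w) \<le> B w" if "\<bar>s - 1\<bar> < 1/4" for s w
 proof (cases "w > 0")
  case True
  define a where "a = w powr (1/4)"
  have a: "a > 0" "w powr (-(1/4)) = inverse a" "w powr (1/2) = a\<^sup>2" "w powr (-(1/2)) = (inverse a)\<^sup>2"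
   using True by (simp_all add: a_def powr_minus powr_power[symmetric] power2_eq_square powr_add[symmetric] flip: powr_minus)
  have "\<bar>ln w\<bar> \<le> 4 * (a + inverse a)"
  proof -
   have "ln w = 4 * ln a" using True by (simp add: a_def ln_powr)
   moreover have "ln a \<le> a" "- ln a \<le> inverse a"
    using ln_le_minus_one[of a] ln_le_minus_one[of "inverse a"] a(1) by (auto simp: ln_inverse)
   ultimately show ?thesis using a(1) by (simp add: abs_le_iff) (smt (verit) positive_imp_inverse_positive)
  qed
  moreover have "w powr (s - 1) \<le> a + inverse a"
  proof (cases "w \<ge> 1")
   case w1: True
   have "w powr (s - 1) \<le> w powr (1/4)" using that w1 by (intro powr_mono) linarith+
   thus ?thesis using a by (simp add: a_def[symmetric]) (smt (verit) positive_imp_inverse_positive)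
  next
   case False
   have "w powr (s - 1) \<le> w powr (-(1/4))" using that False True by (intro powr_mono') linarith+
   thus ?thesis using a by simp
  qed
  ultimately have "\<bar>ln w\<bar> * w powr (s - 1) \<le> (4 * (a + inverse a)) * (a + inverse a)"
   by (intro mult_mono) (use a in auto)
  also have "\<dots> \<le> 8 * (a\<^sup>2 + (inverse a)\<^sup>2)"
   using sum_squares_bound[of a "inverse a"] by (simp add: power2_eq_square algebra_simps)
  finally have "\<bar>ln w\<bar> * w powr (s - 1) * exp (- w) \<le> 8 * (a\<^sup>2 + (inverse a)\<^sup>2) * exp (- w)"
   by (rule mult_right_mono) simp
  thus ?thesis
   using True a by (simp add: F'_def B_def abs_mult algebra_simps)
 qed (simp add: F'_def B_def)
 have "((\<lambda>s. LBINT w. F s w) has_field_derivative (LBINT w. F' 1 w)) (at 1)"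
 proof (rule integral_field_deriv[where r="1/4" and B=B])
  show "((\<lambda>s. F s w) has_field_derivative F' s w) (at s)" for s w
   unfolding F_def F'_def by (cases "w > 0") (auto intro!: derivative_eq_intros)
  show "norm (F' s w) \<le> B w" if "s \<in> ball 1 (1/4)" for s w
   using that by (intro bound) (simp add: dist_real_def abs_minus_commute)
  show "integrable lborel (F s)" if "s \<in> ball 1 (1/4)" for s
  proof -
   have "0 < s" using that unfolding mem_ball dist_real_def by linarith
   thus ?thesis unfolding F_def by (rule gamma_integrable)
  qed
  show "F' 1 \<in> borel_measurable lborel" unfolding F'_def by measurable
 qed (use B in auto)
 moreover have "((\<lambda>s. LBINT w. F s w) has_field_derivative - euler_mascheroni) (at 1)"
 proof -
  have "(Gamma has_field_derivative (- euler_mascheroni :: real)) (at 1)"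
   using has_field_derivative_Gamma[of "1::real" UNIV] by simp
  thus ?thesis
  proof (rule has_field_derivative_transform_within_open[where S="{0<..}"])
   fix s :: real assume "s \<in> {0<..}"
   thus "Gamma s = (LBINT w. F s w)" unfolding F_def by (subst gamma_integrable(2)) auto
  qed auto
 qed
 ultimately have e: "(LBINT w. F' 1 w) = - euler_mascheroni" by (rule DERIV_unique)
 have eq: "F' 1 w = indicator {0<..} w * (ln w * exp (- w))" for w
  by (simp add: F'_def indicator_def)
 show "(LBINT w. indicator {0<..} w * (ln w * exp (- w))) = (- euler_mascheroni :: real)"
  using e by (simp only: eq)
 show "integrable lborel (\<lambda>w. indicator {0<..} w * (ln w * exp (- w)) :: real)"
 proof (rule Bochner_Integration.integrable_bound[OF B])
  have "norm (indicator {0<..} w * (ln w * exp (- w))) \<le> norm (B w)" for w :: real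
   using bound[of 1 w] unfolding eq by auto
  thus "AE w in lborel. norm (indicator {0<..} w * (ln w * exp (- w)) :: real) \<le> norm (B w)"
   by blast
 qed measurable
qed

section \<open>The Macdonald function as an integral over the half-line\<close>

definition slit :: "complex set" where "slit = - \<real>\<^sub>\<le>\<^sub>0"

lemma slit_iff: "z \<in> slit \<longleftrightarrow> Im z \<noteq> 0 \<or> 0 < Re z"
 by (auto simp: slit_def complex_nonpos_Reals_iff)

lemma open_slit: "open slit"
 unfolding slit_def by (simp add: open_Compl)

text \<open>Near z0 the points 2 z + w with w > 0 stay off the cut and away from 0, through the
  imaginary part if z0 is not real and through the real part otherwise. This dominates the integrand
  and its z-derivative.\<close>

lemma slit_uniform:
 assumes "z0 \<in> slit"
 obtains r \<delta> where "r > 0" "\<delta> > 0" "\<And>z w. z \<in> ball z0 r ==> 0 < w ==> 2 * z + cor w \<in> slit \<and> \<delta> \<le> norm (2 * z + cor w)"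
proof (cases "Im z0 = 0")
 case False
 show thesis
 proof (rule that[of "\<bar>Im z0\<bar> / 2" "\<bar>Im z0\<bar>"])
  fix z w assume "z \<in> ball z0 (\<bar>Im z0\<bar> / 2)" "0 < (w::real)"
  hence "\<bar>Im (z0 - z)\<bar> < \<bar>Im z0\<bar> / 2"
   using abs_Im_le_cmod[of "z0 - z"] by (simp add: dist_norm)
  hence "\<bar>Im z0\<bar> \<le> \<bar>2 * Im z\<bar>" "Im z \<noteq> 0" unfolding minus_complex.simps by linarith+
  thus "2 * z + cor w \<in> slit \<and> \<bar>Im z0\<bar> \<le> norm (2 * z + cor w)"
   using abs_Im_le_cmod[of "2 * z + cor w"] by (simp add: slit_iff)
 qed (use False in auto)
next
 case True
 hence R: "0 < Re z0" using assms by (simp add: slit_iff)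
 show thesis
 proof (rule that[of "Re z0 / 2" "Re z0"])
  fix z w assume "z \<in> ball z0 (Re z0 / 2)" "0 < (w::real)"
  hence "\<bar>Re (z0 - z)\<bar> < Re z0 / 2" "0 < w"
   using abs_Re_le_cmod[of "z0 - z"] by (auto simp: dist_norm)
  hence "Re z0 \<le> 2 * Re z + w" unfolding minus_complex.simps by linarith
  thus "2 * z + cor w \<in> slit \<and> Re z0 \<le> norm (2 * z + cor w)"
   using complex_Re_le_cmod[of "2 * z + cor w"] R by (simp add: slit_iff)
 qed (use R in auto)
qed

text \<open>\<open>exp (- z) * mac 0 z\<close> is the Macdonald function \<open>K\<^sub>0\<close>, and \<open>mac n\<close> is, up to a constant factor, the
 \<open>n\<close>-th derivative of \<open>mac 0\<close>.\<close>

definition mac_exp :: "nat => complex" where "mac_exp n = cor (- (1 / 2) - real n)"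

definition mac_ker :: "nat => complex => real => complex" where
 "mac_ker n z w = indicator {0<..} w *\<^sub>R (cor (w powr (1/2 - 1) * exp (- w)) * (2 * z + cor w) powr mac_exp n)"

definition mac :: "nat => complex => complex" where
 "mac n z = (LBINT w. mac_ker n z w)"

lemma norm_mac_ker_le:
 assumes "0 < \<delta>" "0 < w ==> \<delta> \<le> norm (2 * z + cor w)"
 shows "norm (mac_ker n z w) \<le> \<delta> powr (- (1 / 2) - real n) * (indicator {0<..} w * (w powr (1/2 - 1) * exp (- w)))"
proof (cases "0 < w")
 case True
 have "norm ((2 * z + cor w) powr mac_exp n) = norm (2 * z + cor w) powr (- (1 / 2) - real n)"
  unfolding mac_exp_def by (subst norm_powr_real_powr') auto
 also have "\<dots> \<le> \<delta> powr (- (1 / 2) - real n)"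
  using assms True by (intro powr_mono2') auto
 finally show ?thesis
  using True by (simp add: mac_ker_def norm_mult abs_mult mult.commute mult_left_mono)
qed (simp add: mac_ker_def)

lemma mac_ker_measurable [measurable]: "mac_ker n z \<in> borel_measurable borel"
 unfolding mac_ker_def[abs_def] by measurable

lemma mac_ker_integrable:
 assumes "0 < \<delta>" "\<And>w. 0 < w ==> \<delta> \<le> norm (2 * z + cor w)"
 shows "integrable lborel (mac_ker n z)"
proof (rule Bochner_Integration.integrable_bound)
 show "integrable lborel (\<lambda>w. \<delta> powr (- (1 / 2) - real n) * (indicator {0<..} w * (w powr (1/2 - 1) * exp (- w))))"
  by (intro integrable_mult_right gamma_integrable) simp
 show "AE w in lborel. norm (mac_ker n z w) \<le> norm (\<delta> powr (- (1 / 2) - real n) * (indicator {0<..} w * (w powr (1/2 - 1) * exp (- w))))"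
  by (intro AE_I2 order_trans[OF norm_mac_ker_le[OF assms]]) auto
qed measurable

lemma mac_bound:
 assumes "0 < \<delta>" "\<And>w. 0 < w ==> \<delta> \<le> norm (2 * z + cor w)"
 shows "norm (mac n z) \<le> sqrt pi * \<delta> powr (- (1 / 2) - real n)"
proof -
 have "norm (mac n z) \<le> (LBINT w. norm (mac_ker n z w))"
  unfolding mac_def by (rule integral_norm_bound)
 also have "\<dots> \<le> (LBINT w. \<delta> powr (- (1 / 2) - real n) * (indicator {0<..} w * (w powr (1/2 - 1) * exp (- w))))"
  by (intro integral_mono integrable_norm mac_ker_integrable[OF assms] integrable_mult_right gamma_integrable norm_mac_ker_le assms) auto
 also have "\<dots> = sqrt pi * \<delta> powr (- (1 / 2) - real n)"
  unfolding integral_mult_right_zero by (subst gamma_integrable(2)) (auto simp: Gamma_one_half_real)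
 finally show ?thesis .
qed

text \<open>The factor 2 n + 1 is 2 (1/2 + n), from the inner derivative 2 and the exponent - 1/2 -
  n.\<close>

lemma mac_deriv:
 assumes "z0 \<in> slit"
 shows "(mac n has_field_derivative - of_nat (2 * n + 1) * mac (Suc n) z0) (at z0)"
proof -
 obtain r \<delta> where r: "r > 0" "\<delta> > 0" and rd: "\<And>z w. z \<in> ball z0 r ==> 0 < w ==> 2 * z + cor w \<in> slit \<and> \<delta> \<le> norm (2 * z + cor w)"
  using slit_uniform[OF assms] by metis
 have "((\<lambda>z. LBINT w. mac_ker n z w) has_field_derivative (LBINT w. - of_nat (2 * n + 1) * mac_ker (Suc n) z0 w)) (at z0)"
 proof (rule integral_field_deriv[OF r(1), where B="\<lambda>w. real (2 * n + 1) * (\<delta> powr (- (1 / 2) - real (Suc n)) * (indicator {0<..} w * (w powr (1/2 - 1) * exp (- w))))"])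
  fix z w assume z: "z \<in> ball z0 r"
  show "((\<lambda>z. mac_ker n z w) has_field_derivative - of_nat (2 * n + 1) * mac_ker (Suc n) z w) (at z)"
  proof (cases "0 < w")
   case True
   have ns: "2 * z + cor w \<notin> \<real>\<^sub>\<le>\<^sub>0" using rd[OF z True] by (simp add: slit_def)
   have "((\<lambda>z. 2 * z + cor w) has_field_derivative 2) (at z)"
    by (auto intro!: derivative_eq_intros)
   from DERIV_chain2[OF has_field_derivative_powr[OF ns, of "mac_exp n"] this]
   have "((\<lambda>z. (2 * z + cor w) powr mac_exp n) has_field_derivative
     mac_exp n * (2 * z + cor w) powr (mac_exp n - 1) * 2) (at z)" .
   moreover have "mac_exp n - 1 = mac_exp (Suc n)" "mac_exp n * 2 = - of_nat (2 * n + 1)"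
    by (simp_all add: mac_exp_def)
   ultimately have D: "((\<lambda>z. (2 * z + cor w) powr mac_exp n) has_field_derivative
     - of_nat (2 * n + 1) * (2 * z + cor w) powr mac_exp (Suc n)) (at z)"
    by (metis (no_types, lifting) mult.assoc mult.commute)
   show ?thesis
    using DERIV_cmult[OF D, of "cor (w powr (1/2 - 1) * exp (- w))"] True
    by (simp add: mac_ker_def mult_ac)
  qed (simp add: mac_ker_def)
  have "norm (mac_ker (Suc n) z w) \<le> \<delta> powr (- (1 / 2) - real (Suc n)) * (indicator {0<..} w * (w powr (1/2 - 1) * exp (- w)))"
   by (rule norm_mac_ker_le[OF r(2)]) (use rd z in blast)
  thus "norm (- of_nat (2 * n + 1) * mac_ker (Suc n) z w) \<le> real (2 * n + 1) * (\<delta> powr (- (1 / 2) - real (Suc n)) * (indicator {0<..} w * (w powr (1/2 - 1) * exp (- w))))"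
   unfolding norm_mult norm_minus_cancel norm_of_nat by (rule mult_left_mono) simp
 next
  show "integrable lborel (\<lambda>w. real (2 * n + 1) * (\<delta> powr (- (1 / 2) - real (Suc n)) * (indicator {0<..} w * (w powr (1/2 - 1) * exp (- w)))))"
   by (intro integrable_mult_right gamma_integrable) simp
  show "integrable lborel (mac_ker n z)" if "z \<in> ball z0 r" for z
   by (rule mac_ker_integrable[OF r(2)]) (use rd that in blast)
 qed measurable
 thus ?thesis
  unfolding mac_def[abs_def] integral_mult_right_zero .
qed

lemma mac_integrable: "z \<in> slit ==> integrable lborel (mac_ker n z)"
proof -
 assume "z \<in> slit"
 then obtain r \<delta> where r: "r > 0" "\<delta> > 0" and rd: "\<And>z' w. z' \<in> ball z r ==> 0 < w ==> 2 * z' + cor w \<in> slit \<and> \<delta> \<le> norm (2 * z' + cor w)"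
  using slit_uniform by metis
 show ?thesis
  by (rule mac_ker_integrable[OF r(2)]) (use rd[of z] r in simp)
qed

lemma slit_lower_bound:
 assumes "z \<in> slit"
 obtains \<delta> where "\<delta> > 0" "\<And>w. 0 < w ==> 2 * z + cor w \<in> slit" "\<And>w. 0 < w ==> \<delta> \<le> norm (2 * z + cor w)"
proof -
 obtain r \<delta> where "r > 0" "\<delta> > 0" and "\<And>z' w. z' \<in> ball z r ==> 0 < w ==> 2 * z' + cor w \<in> slit \<and> \<delta> \<le> norm (2 * z' + cor w)"
  using slit_uniform[OF assms] by metis
 thus thesis using that[of \<delta>] by (metis centre_in_ball)
qed

text \<open>The combined integrand is the w-derivative of exp(- w) w^(1/2) (2 z + w)^(- 3/2), which
  vanishes at 0 and at infinity. The relation is the modified Bessel equation for exp(- z) mac 0 z,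
  divided by exp(- z).\<close>

lemma mac_recurrence:
 assumes z: "z \<in> slit"
 shows "3 * z * mac 2 z + (2 * z - 1) * mac 1 z - mac 0 z = 0"
proof -
 obtain \<delta> where \<delta>: "\<delta> > 0" "\<And>w. 0 < w ==> 2 * z + cor w \<in> slit" "\<And>w. 0 < w ==> \<delta> \<le> norm (2 * z + cor w)"
  using slit_lower_bound[OF z] by metis
 define h where "h w = cor (exp (- w) * w powr (1/2)) * (2 * z + cor w) powr mac_exp 1" for w
 define h' where "h' w = cor (w powr (1/2 - 1) * exp (- w)) *
  (3 * z * (2 * z + cor w) powr mac_exp 2 + (2 * z - 1) * (2 * z + cor w) powr mac_exp 1
   - (2 * z + cor w) powr mac_exp 0)" for w
 have e: "indicator {0<..} w *\<^sub>R h' w = 3 * z * mac_ker 2 z w + (2 * z - 1) * mac_ker 1 z w - mac_ker 0 z w" for w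
  by (auto simp: mac_ker_def h'_def indicator_def algebra_simps)
 have i: "integrable lborel (mac_ker n z)" for n by (rule mac_integrable[OF z])
 have "(LBINT w. indicator {0<..} w *\<^sub>R h' w) = 0 - 0"
 proof (rule FTC_half_line[where F=h])
  fix w :: real assume w: "0 < w"
  define s where "s = 2 * z + cor w"
  have s: "s \<notin> \<real>\<^sub>\<le>\<^sub>0" "s \<noteq> 0" using \<delta>(2)[OF w] by (auto simp: slit_def s_def)
  have p: "s powr mac_exp 0 = s\<^sup>2 * s powr mac_exp 2" "s powr mac_exp 1 = s * s powr mac_exp 2"
   "mac_exp 1 * s powr (mac_exp 1 - 1) = - (3/2) * s powr mac_exp 2"
  proof -
   have "s powr (mac_exp 2 + of_nat 2) = s powr mac_exp 2 * s ^ 2"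
    unfolding powr_add powr_nat'[of s 2, OF disjI1[OF s(2)]] ..
   thus "s powr mac_exp 0 = s\<^sup>2 * s powr mac_exp 2" by (simp add: mac_exp_def)
   have "s powr (mac_exp 2 + 1) = s powr mac_exp 2 * s" using s by (simp add: powr_add)
   thus "s powr mac_exp 1 = s * s powr mac_exp 2" by (simp add: mac_exp_def)
   show "mac_exp 1 * s powr (mac_exp 1 - 1) = - (3/2) * s powr mac_exp 2" by (simp add: mac_exp_def)
  qed
  have "((\<lambda>w. (2 * z + cor w) powr mac_exp 1) has_vector_derivative mac_exp 1 * s powr (mac_exp 1 - 1)) (at w)"
  proof -
   have "((\<lambda>w. 2 * z + cor w) has_vector_derivative 1) (at w)"
    by (auto intro!: derivative_eq_intros)
   from field_vector_diff_chain_at[OF this, of "\<lambda>s. s powr mac_exp 1"] has_field_derivative_powr[OF s(1), of "mac_exp 1"]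
   show ?thesis by (simp add: s_def o_def)
  qed
  moreover have "((\<lambda>w. cor (exp (- w) * w powr (1/2))) has_vector_derivative
    cor (- exp (- w) * w powr (1/2) + exp (- w) * (1/2 * w powr (1/2 - 1)))) (at w)"
   by (rule has_vector_derivative_of_real) (use w in \<open>auto intro!: derivative_eq_intros simp: has_real_derivative_iff_has_vector_derivative[symmetric] powr_diff\<close>)
  ultimately have D: "(h has_vector_derivative (cor (exp (- w) * w powr (1/2)) * (mac_exp 1 * s powr (mac_exp 1 - 1)) +
    cor (- exp (- w) * w powr (1/2) + exp (- w) * (1/2 * w powr (1/2 - 1))) * s powr mac_exp 1)) (at w)"
   unfolding h_def s_def by (intro has_vector_derivative_mult)
  have w2: "w powr (1/2) = w * w powr (1/2 - 1)"
   using w by (metis add.commute diff_add_cancel mult.commute powr_add powr_one less_eq_real_def)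
  have "cor (exp (- w) * w powr (1/2)) * (mac_exp 1 * s powr (mac_exp 1 - 1)) +
    cor (- exp (- w) * w powr (1/2) + exp (- w) * (1/2 * w powr (1/2 - 1))) * s powr mac_exp 1
   = cor (w powr (1/2 - 1) * exp (- w)) * s powr mac_exp 2 * (- (3/2) * of_real w + (1/2 - of_real w) * s)"
   unfolding p w2 by (simp add: algebra_simps)
  \<comment> \<open>Here w is replaced by s - 2 z.\<close>
  also have "- (3/2) * of_real w + (1/2 - of_real w) * s = 3 * z + (2 * z - 1) * s - s\<^sup>2"
   by (simp add: s_def power2_eq_square algebra_simps)
  also have "cor (w powr (1/2 - 1) * exp (- w)) * s powr mac_exp 2 * (3 * z + (2 * z - 1) * s - s\<^sup>2) = h' w"
   unfolding h'_def s_def[symmetric] p by (simp add: algebra_simps power2_eq_square)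
  finally show "(h has_vector_derivative h' w) (at w)" using D by simp
  show "isCont h' w"
   unfolding h'_def using s w by (intro continuous_intros) (auto simp: s_def complex_nonpos_Reals_iff)
 next
  show "integrable lborel (\<lambda>w. indicator {0<..} w *\<^sub>R h' w)"
   unfolding e by (intro Bochner_Integration.integrable_add Bochner_Integration.integrable_diff integrable_mult_right i)
  have b: "norm (h w) \<le> \<delta> powr (- 1/2 - 1) * (exp (- w) * w powr (1/2))" if "0 < w" for w
  proof -
   have "norm ((2 * z + cor w) powr mac_exp 1) = norm (2 * z + cor w) powr (- 1/2 - 1)"
    unfolding mac_exp_def by (subst norm_powr_real_powr') auto
   also have "\<dots> \<le> \<delta> powr (- 1/2 - 1)"
    using \<delta> that by (intro powr_mono2') auto
   finally show ?thesis by (simp add: h_def norm_mult mult.commute mult_left_mono)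
  qed
  show "(h \<longlongrightarrow> 0) (at_right 0)"
  proof (rule Lim_null_comparison)
   show "\<forall>\<^sub>F w in at_right 0. norm (h w) \<le> \<delta> powr (- 1/2 - 1) * (exp (- w) * w powr (1/2))"
    using b by (auto simp: eventually_at_right_less intro!: eventually_mono[OF eventually_at_right_less])
   show "((\<lambda>w. \<delta> powr (- 1/2 - 1) * (exp (- w) * w powr (1/2))) \<longlongrightarrow> 0) (at_right (0::real))"
    by (rule tendsto_mult_right_zero) real_asymp
  qed
  show "(h \<longlongrightarrow> 0) at_top"
  proof (rule Lim_null_comparison)
   show "\<forall>\<^sub>F w in at_top. norm (h w) \<le> \<delta> powr (- 1/2 - 1) * (exp (- w) * w powr (1/2))"
    using b by (auto intro!: eventually_mono[OF eventually_gt_at_top[of 0]])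
   show "((\<lambda>w. \<delta> powr (- 1/2 - 1) * (exp (- w) * w powr (1/2))) \<longlongrightarrow> 0) (at_top :: real filter)"
    by (rule tendsto_mult_right_zero) real_asymp
  qed
 qed
 also have "(LBINT w. indicator {0<..} w *\<^sub>R h' w) = 3 * z * mac 2 z + (2 * z - 1) * mac 1 z - mac 0 z"
  unfolding e mac_def
  by (subst Bochner_Integration.integral_diff Bochner_Integration.integral_add integral_mult_right_zero;
    (intro Bochner_Integration.integrable_add integrable_mult_right i)?)+ simp
 finally show ?thesis by simp
qed

definition mac_sol :: "complex => complex" where "mac_sol z = exp (- z) * mac 0 z"

text \<open>The modified Bessel equation is kept as a first-order system u' = v / z, v' = z u with v
  = z u', so that two solutions can be compared without second derivatives.\<close>

lemma mac_sol_deriv: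
 assumes "z \<in> slit"
 shows "(mac_sol has_field_derivative - exp (- z) * (mac 0 z + mac 1 z)) (at z)"
  "((\<lambda>z. - z * exp (- z) * (mac 0 z + mac 1 z)) has_field_derivative z * mac_sol z) (at z)"
proof -
 have d: "(mac 0 has_field_derivative - mac 1 z) (at z)" "(mac 1 has_field_derivative - 3 * mac 2 z) (at z)"
  using mac_deriv[OF assms, of 0] mac_deriv[OF assms, of 1] by (simp_all add: numeral_2_eq_2)
 show "(mac_sol has_field_derivative - exp (- z) * (mac 0 z + mac 1 z)) (at z)"
  unfolding mac_sol_def by (rule derivative_eq_intros d refl)+ (simp add: algebra_simps)
 show "((\<lambda>z. - z * exp (- z) * (mac 0 z + mac 1 z)) has_field_derivative z * mac_sol z) (at z)"
 proof (rule DERIV_cong)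
  show "((\<lambda>z. - z * exp (- z) * (mac 0 z + mac 1 z)) has_field_derivative
   (- z * exp (- z)) * (- mac 1 z + - 3 * mac 2 z) + (- exp (- z) + z * exp (- z)) * (mac 0 z + mac 1 z)) (at z)"
   by (rule derivative_eq_intros d refl)+ (simp add: algebra_simps)
  have "(- z * exp (- z)) * (- mac 1 z + - 3 * mac 2 z) + (- exp (- z) + z * exp (- z)) * (mac 0 z + mac 1 z)
   - z * mac_sol z = exp (- z) * (3 * z * mac 2 z + (2 * z - 1) * mac 1 z - mac 0 z)"
   by (simp add: mac_sol_def algebra_simps)
  thus "(- z * exp (- z)) * (- mac 1 z + - 3 * mac 2 z) + (- exp (- z) + z * exp (- z)) * (mac 0 z + mac 1 z) = z * mac_sol z"
   unfolding mac_recurrence[OF assms] by simp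
 qed
qed

section \<open>The Macdonald function as a power series with a logarithm\<close>

definition entire_sum :: "(nat => complex) => complex => complex" where
 "entire_sum c q = (\<Sum>n. c n * q ^ n)"

text \<open>The second claim concerns the operator sending f to (q f')', whose coefficients are (n +
  1)^2 c (n + 1). For q = z^2 / 4 this is u'' + u' / z, the differential part of Bessel's
  equation.\<close>

lemma entire_sum_deriv:
 assumes "\<And>q. summable (\<lambda>n. c n * q ^ n)"
 shows "(entire_sum c has_field_derivative entire_sum (diffs c) q) (at q)"
  "((\<lambda>q. q * entire_sum (diffs c) q) has_field_derivative entire_sum (\<lambda>n. (of_nat (Suc n))\<^sup>2 * c (Suc n)) q) (at q)"
proof -
 show "(entire_sum c has_field_derivative entire_sum (diffs c) q) (at q)"
  unfolding entire_sum_def[abs_def] by (rule termdiffs_strong_converges_everywhere[OF assms])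
 have s: "(\<lambda>n. of_nat n * c n * q ^ n) sums (q * entire_sum (diffs c) q)" for q
 proof -
  have "summable (\<lambda>n. diffs c n * q ^ n)" by (rule termdiff_converges_all[OF assms])
  from sums_mult[OF diffs_equiv[OF this], of q]
  have "(\<lambda>n. q * (of_nat n * c n * q ^ (n - Suc 0))) sums (q * entire_sum (diffs c) q)"
   by (simp add: entire_sum_def)
  moreover have "q * (of_nat n * c n * q ^ (n - Suc 0)) = of_nat n * c n * q ^ n" for n
   by (cases n) (auto simp: mult_ac)
  ultimately show ?thesis by simp
 qed
 have e: "q * entire_sum (diffs c) q = (\<Sum>n. (of_nat n * c n) * q ^ n)" for q
  using s[of q] by (simp add: sums_iff)
 show "((\<lambda>q. q * entire_sum (diffs c) q) has_field_derivative entire_sum (\<lambda>n. (of_nat (Suc n))\<^sup>2 * c (Suc n)) q) (at q)"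
  unfolding e using termdiffs_strong_converges_everywhere[of "\<lambda>n. of_nat n * c n" q] s
  by (simp add: entire_sum_def diffs_def power2_eq_square mult_ac sums_iff)
qed

text \<open>In q = z^2 / 4, \<open>bessel_P\<close> is the series of I_0, and of J_0 at - q;
  \<open>bessel_R\<close> is the series that accompanies the logarithm in the second
  solution.\<close>

definition bessel_P :: "nat => complex" where "bessel_P n = inverse ((fact n)\<^sup>2)"
definition bessel_R :: "nat => complex" where "bessel_R n = harm n * inverse ((fact n)\<^sup>2)"

lemma bessel_PR_summable: "summable (\<lambda>n. bessel_P n * q ^ n)" "summable (\<lambda>n. bessel_R n * q ^ n)"
proof -
 have s: "summable (\<lambda>n. norm q ^ n / fact n)"
  using summable_exp[of "norm q"] by (simp add: divide_inverse mult.commute)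
 have h: "norm (harm n :: complex) \<le> real n" for n
  unfolding harm_def
  by (rule order_trans[OF norm_sum], rule order_trans[OF sum_mono[where g="\<lambda>_. 1"]]) (auto simp: norm_inverse inverse_le_1_iff)
 have f: "real n \<le> fact n" "(1::real) \<le> fact n" for n
  using of_nat_mono[OF fact_ge_self[of n], where 'a=real] by (simp_all add: fact_ge_1)
 show "summable (\<lambda>n. bessel_P n * q ^ n)"
 proof (rule summable_comparison_test'[OF s])
  fix n show "norm (bessel_P n * q ^ n) \<le> norm q ^ n / fact n"
   using mult_right_mono[OF f(2)[of n], of "norm q ^ n"]
   by (simp add: bessel_P_def norm_mult norm_power norm_inverse norm_divide field_simps power2_eq_square mult_left_mono)
 qed
 show "summable (\<lambda>n. bessel_R n * q ^ n)"
 proof (rule summable_comparison_test'[OF s])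
  fix n show "norm (bessel_R n * q ^ n) \<le> norm q ^ n / fact n"
   using mult_right_mono[OF order_trans[OF h f(1)[of n]], of "norm q ^ n / (fact n)\<^sup>2"]
   by (simp add: bessel_R_def norm_mult norm_power norm_inverse norm_divide field_simps power2_eq_square)
 qed
qed

text \<open>The extra term comes from harm (n + 1) = harm n + 1 / (n + 1); in Bessel's equation it
  compensates the contribution of the logarithm.\<close>

lemma bessel_PR_deriv:
 "((\<lambda>q. q * entire_sum (diffs bessel_P) q) has_field_derivative entire_sum bessel_P q) (at q)"
 "((\<lambda>q. q * entire_sum (diffs bessel_R) q) has_field_derivative entire_sum bessel_R q + entire_sum (diffs bessel_P) q) (at q)"
proof -
 have "(of_nat (Suc n))\<^sup>2 * bessel_P (Suc n) = bessel_P n" for n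
  by (simp add: bessel_P_def power_mult_distrib del: of_nat_Suc)
 thus "((\<lambda>q. q * entire_sum (diffs bessel_P) q) has_field_derivative entire_sum bessel_P q) (at q)"
  using entire_sum_deriv(2)[OF bessel_PR_summable(1)] by (simp del: of_nat_Suc)
 have "(of_nat (Suc n))\<^sup>2 * bessel_R (Suc n) = bessel_R n + diffs bessel_P n" for n
  by (simp add: bessel_R_def bessel_P_def diffs_def harm_Suc power_mult_distrib field_simps power2_eq_square del: of_nat_Suc)
 moreover have "(\<Sum>n. (bessel_R n + diffs bessel_P n) * q ^ n) = entire_sum bessel_R q + entire_sum (diffs bessel_P) q" for q
  unfolding entire_sum_def
  by (subst suminf_add[OF bessel_PR_summable(2) termdiff_converges_all[OF bessel_PR_summable(1)]]) (simp add: algebra_simps)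
 ultimately show "((\<lambda>q. q * entire_sum (diffs bessel_R) q) has_field_derivative entire_sum bessel_R q + entire_sum (diffs bessel_P) q) (at q)"
  using entire_sum_deriv(2)[OF bessel_PR_summable(2)] by (simp add: entire_sum_def del: of_nat_Suc)
qed

text \<open>The classical expansion of K_0 at 0.\<close>

definition neumann_sol :: "complex => complex" where
 "neumann_sol z = - (Ln (z / 2) + euler_mascheroni) * entire_sum bessel_P (z\<^sup>2 / 4) + entire_sum bessel_R (z\<^sup>2 / 4)"

text \<open>z times the derivative of \<open>neumann_sol\<close>, the second component of the
  first-order system.\<close>

definition neumann_d :: "complex => complex" where
 "neumann_d z = - entire_sum bessel_P (z\<^sup>2 / 4)
   - 2 * (Ln (z / 2) + euler_mascheroni) * (z\<^sup>2 / 4 * entire_sum (diffs bessel_P) (z\<^sup>2 / 4))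
   + 2 * (z\<^sup>2 / 4 * entire_sum (diffs bessel_R) (z\<^sup>2 / 4))"

lemma neumann_sol_deriv:
 assumes "z \<in> slit"
 shows "(neumann_sol has_field_derivative neumann_d z / z) (at z)"
  "(neumann_d has_field_derivative z * neumann_sol z) (at z)"
proof -
 have z: "z / 2 \<notin> \<real>\<^sub>\<le>\<^sub>0" "z \<noteq> 0"
  using assms by (auto simp: slit_def complex_nonpos_Reals_iff)
 have q: "((\<lambda>z. z\<^sup>2 / 4) has_field_derivative z / 2) (at z)"
  by (auto intro!: derivative_eq_intros)
 have L: "((\<lambda>z. Ln (z / 2) + euler_mascheroni) has_field_derivative 1 / z) (at z)"
  using z by (auto intro!: derivative_eq_intros simp: field_simps)
 note P = DERIV_chain2[OF entire_sum_deriv(1)[OF bessel_PR_summable(1)] q]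
 note R = DERIV_chain2[OF entire_sum_deriv(1)[OF bessel_PR_summable(2)] q]
 note P1 = DERIV_chain2[OF bessel_PR_deriv(1) q]
 note R1 = DERIV_chain2[OF bessel_PR_deriv(2) q]
 show "(neumann_sol has_field_derivative neumann_d z / z) (at z)"
  unfolding neumann_sol_def[abs_def]
  by (rule DERIV_cong[OF DERIV_add[OF DERIV_mult[OF DERIV_minus[OF L] P] R]])
   (use z in \<open>simp add: neumann_d_def field_simps power2_eq_square\<close>)
 show "(neumann_d has_field_derivative z * neumann_sol z) (at z)"
  unfolding neumann_d_def[abs_def]
  by (rule DERIV_cong[OF DERIV_add[OF DERIV_diff[OF DERIV_minus[OF P] DERIV_mult[OF DERIV_cmult[OF L, of 2] P1]] DERIV_cmult[OF R1, of 2]]])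
   (use z in \<open>simp add: neumann_sol_def field_simps power2_eq_square\<close>)
qed

section \<open>Uniqueness for Bessel's equation at its singular point\<close>

text \<open>The other solutions of the equation grow like a logarithm at \<open>0\<close>.\<close>

lemma real_ode_upper:
 fixes f g :: "real => real"
 assumes f: "\<And>x. 0 < x ==> (f has_real_derivative g x / x) (at x)"
  and g: "\<And>x. 0 < x ==> (g has_real_derivative x * f x) (at x)"
  and S: "\<And>x. 0 < x ==> x < e ==> \<bar>f x\<bar> \<le> S" and x: "0 < x" "x < e"
 shows "g x \<le> S * x\<^sup>2"
proof (rule ccontr)
 assume "\<not> g x \<le> S * x\<^sup>2"
 define c where "c = g x - S * x\<^sup>2"
 have c: "c > 0" using \<open>\<not> g x \<le> S * x\<^sup>2\<close> by (simp add: c_def)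
 have S0: "S \<ge> 0" using S[OF x] by linarith
 \<comment> \<open>As |g'| <= S x on (0, x), g varies there by at most S x^2 and stays above c > 0.
   Then f' is at least c over its argument, which forces logarithmic growth of f at 0.\<close>
 have gt: "c \<le> g t" if t: "0 < t" "t < x" for t
 proof -
  obtain \<xi> where \<xi>: "t < \<xi>" "\<xi> < x" "g x - g t = (x - t) * (\<xi> * f \<xi>)"
   using MVT2[OF t(2), of g "\<lambda>x. x * f x"] g t by force
  have "\<bar>(x - t) * (\<xi> * f \<xi>)\<bar> \<le> x * (x * S)"
   unfolding abs_mult using \<xi> t S[of \<xi>] x S0 by (intro mult_mono) auto
  thus ?thesis using \<xi>(3) unfolding c_def power2_eq_square by (simp add: mult.assoc mult.left_commute[of S] mult.commute[of x S])
 qed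
 \<comment> \<open>Chosen so that c ln(x / t) = 2 S + 1, more than the oscillation 2 S of f
   permits.\<close>
 define t where "t = x * exp (- (2 * S + 1) / c)"
 have t: "0 < t" "t < x" using x c S0 by (simp_all add: t_def divide_neg_pos)
 define k where "k y = f y - c * ln y" for y
 have "\<exists>\<xi>. t < \<xi> \<and> \<xi> < x \<and> k x - k t = (x - t) * (g \<xi> / \<xi> - c / \<xi>)"
  using f t unfolding k_def by (intro MVT2) (auto intro!: derivative_eq_intros simp: divide_inverse)
 then obtain \<xi> where \<xi>: "t < \<xi>" "\<xi> < x" "k x - k t = (x - t) * (g \<xi> / \<xi> - c / \<xi>)" by blast
 have "0 \<le> (x - t) * (g \<xi> / \<xi> - c / \<xi>)"
  using gt[of \<xi>] \<xi> t by (intro mult_nonneg_nonneg) (auto simp: divide_right_mono)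
 hence "c * (ln x - ln t) \<le> f x - f t"
  using \<xi>(3) by (simp add: k_def algebra_simps)
 moreover have "c * (ln x - ln t) = 2 * S + 1"
  using x c by (simp add: t_def ln_mult)
 ultimately show False using S[OF x] S[of t] t x by linarith
qed

text \<open>A bound S for |f| near 0 improves itself: |g| <= S t^2 gives |f'| <= S t, and
  integrating from 0, where f tends to 0, gives |f| <= S x^2 <= S / 4 for x <= 1/2. Iteration leaves
  only f = 0.\<close>

lemma real_ode_unique:
 fixes f g :: "real => real"
 assumes f: "\<And>x. 0 < x ==> (f has_real_derivative g x / x) (at x)"
  and g: "\<And>x. 0 < x ==> (g has_real_derivative x * f x) (at x)"
  and lim: "(f \<longlongrightarrow> 0) (at_right 0)"
 shows "\<exists>e>0. \<forall>x. 0 < x \<and> x < e \<longrightarrow> f x = 0"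
proof -
 have "\<forall>\<^sub>F x in at_right 0. \<bar>f x\<bar> < 1" using tendstoD[OF lim, of 1] by (simp add: dist_real_def)
 then obtain e0 where e0: "e0 > 0" "\<And>x. 0 < x ==> x < e0 ==> \<bar>f x\<bar> < 1"
  unfolding eventually_at_right_field by auto
 define e where "e = min e0 (1/2)"
 have e: "0 < e" "e \<le> 1/2" "e \<le> e0" using e0 by (auto simp: e_def)
 have step: "\<bar>f x\<bar> \<le> S / 4" if S: "\<And>x. 0 < x ==> x < e ==> \<bar>f x\<bar> \<le> S" and x: "0 < x" "x < e" for S x
 proof -
  have S0: "S \<ge> 0" using S[OF x] by linarith
  have gS: "\<bar>g t\<bar> \<le> S * t\<^sup>2" if "0 < t" "t < e" for t
  proof -
   have "g t \<le> S * t\<^sup>2" by (rule real_ode_upper[OF f g S that])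
   moreover have "- g t \<le> S * t\<^sup>2"
    by (rule real_ode_upper[where f="\<lambda>x. - f x" and g="\<lambda>x. - g x" and e=e])
     (use f g S that in \<open>auto intro!: derivative_eq_intros\<close>)
   ultimately show ?thesis by linarith
  qed
  have "\<bar>f x\<bar> \<le> S * x\<^sup>2 + \<bar>f t\<bar>" if t: "0 < t" "t < x" for t
  proof -
   obtain \<xi> where \<xi>: "t < \<xi>" "\<xi> < x" "f x - f t = (x - t) * (g \<xi> / \<xi>)"
    using MVT2[OF t(2), of f "\<lambda>x. g x / x"] f t by force
   have "\<bar>g \<xi> / \<xi>\<bar> \<le> S * x"
   proof -
    have "\<bar>g \<xi>\<bar> / \<xi> \<le> S * \<xi>\<^sup>2 / \<xi>" using gS[of \<xi>] \<xi> t x by (intro divide_right_mono) auto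
    also have "\<dots> \<le> S * x" using \<xi> t S0 by (simp add: power2_eq_square mult_left_mono)
    finally show ?thesis using \<xi> t by simp
   qed
   hence "\<bar>(x - t) * (g \<xi> / \<xi>)\<bar> \<le> x * (S * x)"
    unfolding abs_mult using t x by (intro mult_mono) auto
   hence "\<bar>f x - f t\<bar> \<le> S * x\<^sup>2"
    unfolding \<xi>(3) by (simp only: power2_eq_square mult.left_commute[of S])
   thus ?thesis by linarith
  qed
  hence ev: "\<forall>\<^sub>F t in at_right 0. \<bar>f x\<bar> \<le> S * x\<^sup>2 + \<bar>f t\<bar>"
   using x unfolding eventually_at_right_field by blast
  have "((\<lambda>t. S * x\<^sup>2 + \<bar>f t\<bar>) \<longlongrightarrow> S * x\<^sup>2 + 0) (at_right 0)"
   using tendsto_add[OF tendsto_const tendsto_rabs[OF lim]] by simp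
  from tendsto_lowerbound[OF this ev] have "\<bar>f x\<bar> \<le> S * x\<^sup>2" by simp
  also have "\<dots> \<le> S * (1/2)\<^sup>2" using x e S0 by (intro mult_left_mono power_mono) auto
  finally show ?thesis by (simp add: power2_eq_square)
 qed
 have "\<forall>x. 0 < x \<and> x < e \<longrightarrow> \<bar>f x\<bar> \<le> (1/4) ^ n" for n
 proof (induction n)
  case 0 thus ?case using e0 e by (auto simp: less_imp_le)
 next
  case (Suc n) thus ?case using step[of "(1/4) ^ n"] by auto
 qed
 moreover have "(\<lambda>n. (1/4 :: real) ^ n) \<longlonglongrightarrow> 0" by (rule LIMSEQ_power_zero) simp
 ultimately have "\<bar>f x\<bar> \<le> 0" if "0 < x" "x < e" for x
  using that by (intro LIMSEQ_le_const[where X="\<lambda>n. (1/4 :: real) ^ n"]) auto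
 thus ?thesis using e(1) by auto
qed

section \<open>The integral representation near 0\<close>

text \<open>For x, w > 0 this is ln x plus arcosh(1 + w / x), a primitive of (w^2 + 2 x w)^(- 1/2)
  in w. The summand ln x is kept inside so that the limit as x tends to 0 is finite, namely ln(2
  w).\<close>

definition arcosh_ker :: "real => real => real" where
 "arcosh_ker x w = ln (w + x + sqrt (w\<^sup>2 + 2 * x * w))"

lemma arcosh_ker_bounds:
 assumes "0 < w" "0 < x"
 shows "ln x \<le> arcosh_ker x w" "ln w \<le> arcosh_ker x w" "arcosh_ker x w \<le> ln (2 * (w + x))"
proof -
 have p: "0 < w\<^sup>2 + 2 * x * w" using assms by (simp add: add_pos_pos)
 have "sqrt (w\<^sup>2 + 2 * x * w) \<le> sqrt ((w + x)\<^sup>2)"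
  by (rule real_sqrt_le_mono) (simp add: power2_eq_square algebra_simps)
 hence "sqrt (w\<^sup>2 + 2 * x * w) \<le> w + x" using assms by simp
 thus "ln x \<le> arcosh_ker x w" "ln w \<le> arcosh_ker x w" "arcosh_ker x w \<le> ln (2 * (w + x))"
  using assms p real_sqrt_gt_zero[OF p] unfolding arcosh_ker_def by (smt (verit) ln_mono)+
qed

lemma arcosh_ker_deriv:
 assumes "0 < w" "0 < x"
 shows "(arcosh_ker x has_real_derivative 1 / sqrt (w\<^sup>2 + 2 * x * w)) (at w)"
proof -
 define s where "s = sqrt (w\<^sup>2 + 2 * x * w)"
 have p: "0 < w\<^sup>2 + 2 * x * w" using assms by (simp add: add_pos_pos)
 have s: "s > 0" using p by (simp add: s_def)
 have "((\<lambda>w. w + x + sqrt (w\<^sup>2 + 2 * x * w)) has_real_derivative 1 + inverse s / 2 * (2 * w + 2 * x)) (at w)"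
  using p unfolding s_def by (auto intro!: derivative_eq_intros)
 moreover have "(ln has_real_derivative 1 / (w + x + s)) (at (w + x + sqrt (w\<^sup>2 + 2 * x * w)))"
  unfolding s_def[symmetric] using s assms by (intro DERIV_ln_divide) simp
 ultimately have "(arcosh_ker x has_real_derivative 1 / (w + x + s) * (1 + inverse s / 2 * (2 * w + 2 * x))) (at w)"
  unfolding arcosh_ker_def[abs_def] by (rule DERIV_chain2[rotated])
 moreover have "1 / (w + x + s) * (1 + inverse s / 2 * (2 * w + 2 * x)) = 1 / s"
  using s assms by (simp add: divide_simps)
 ultimately show ?thesis by (simp add: s_def)
qed

lemma integrable_exp_real: "integrable lborel (\<lambda>w::real. indicator {0<..} w * exp (- w))"
 "(LBINT w. indicator {0<..} w * exp (- w)) = (1::real)"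
 "integrable lborel (\<lambda>w::real. indicator {0<..} w * (w * exp (- w)))"
proof -
 have e: "indicator {0<..} w * exp (- w) = indicator {0<..} w * (w powr (1 - 1) * exp (- w))" for w :: real
  by (auto simp: indicator_def)
 show "integrable lborel (\<lambda>w::real. indicator {0<..} w * exp (- w))"
  unfolding e by (rule gamma_integrable) simp
 show "(LBINT w. indicator {0<..} w * exp (- w)) = (1::real)"
  unfolding e by (subst gamma_integrable(2)) auto
 have e': "indicator {0<..} w * (w * exp (- w)) = indicator {0<..} w * (w powr (2 - 1) * exp (- w))" for w :: real
  by (auto simp: indicator_def)
 show "integrable lborel (\<lambda>w::real. indicator {0<..} w * (w * exp (- w)))"
  unfolding e' by (rule gamma_integrable) simp
qed

lemma arcosh_ker_measurable [measurable]: "arcosh_ker x \<in> borel_measurable borel"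
 unfolding arcosh_ker_def[abs_def] by measurable

text \<open>The bound does not depend on x in (0, 1], as dominated convergence for x tending to 0
  requires.\<close>

lemma arcosh_ker_dominated:
 assumes "0 < x" "x \<le> 1"
 shows "norm (indicator {0<..} w * (arcosh_ker x w * exp (- w))) \<le>
  norm (indicator {0<..} w * (ln w * exp (- w))) + (2 * (indicator {0<..} w * (w * exp (- w))) + indicator {0<..} w * exp (- w))"
proof (cases "0 < w")
 case True
 have "ln (2 * (w + x)) \<le> 2 * w + 1"
  using ln_le_minus_one[of "2 * (w + x)"] True assms by simp
 hence "\<bar>arcosh_ker x w\<bar> \<le> \<bar>ln w\<bar> + 2 * w + 1"
  using arcosh_ker_bounds[OF True assms(1)] True by linarith
 hence "\<bar>arcosh_ker x w\<bar> * exp (- w) \<le> (\<bar>ln w\<bar> + 2 * w + 1) * exp (- w)"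
  by (rule mult_right_mono) simp
 thus ?thesis using True by (simp add: abs_mult algebra_simps)
qed simp

lemma arcosh_ker_integrable:
 assumes "0 < x" "x \<le> 1"
 shows "integrable lborel (\<lambda>w. indicator {0<..} w * (arcosh_ker x w * exp (- w)))"
proof (rule Bochner_Integration.integrable_bound)
 show "integrable lborel (\<lambda>w. norm (indicator {0<..} w * (ln w * exp (- w))) +
   (2 * (indicator {0<..} w * (w * exp (- w))) + indicator {0<..} w * exp (- w :: real)))"
  by (intro Bochner_Integration.integrable_add integrable_norm integrable_exp_ln integrable_mult_right integrable_exp_real)
 show "AE w in lborel. norm (indicator {0<..} w * (arcosh_ker x w * exp (- w))) \<le>
   norm (norm (indicator {0<..} w * (ln w * exp (- w))) + (2 * (indicator {0<..} w * (w * exp (- w))) + indicator {0<..} w * exp (- w)))"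
  using order_trans[OF arcosh_ker_dominated[OF assms] abs_ge_self] by (intro AE_I2) (simp only: real_norm_def)
qed measurable

text \<open>Integration by parts with the primitive \<open>arcosh_ker x w - ln x\<close>, which
  vanishes at w = 0. It isolates the logarithmic singularity.\<close>

lemma mac_real:
 assumes x: "0 < x" "x \<le> 1"
 shows "mac 0 (cor x) = cor ((LBINT w. indicator {0<..} w * (arcosh_ker x w * exp (- w))) - ln x)"
proof -
 define f where "f w = indicator {0<..} w * (exp (- w) * (1 / sqrt (w\<^sup>2 + 2 * x * w)))" for w :: real
 have f: "mac_ker 0 (cor x) w = cor (f w)" for w
 proof (cases "0 < w")
  case True
  hence p: "0 < 2 * x + w" using x by simp
  have "(2 * cor x + cor w) powr mac_exp 0 = cor (2 * x + w) powr cor (- (1/2))"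
   by (simp add: mac_exp_def)
  also have "\<dots> = cor ((2 * x + w) powr (- (1/2)))"
   using p by (subst powr_of_real) auto
  finally have "mac_ker 0 (cor x) w = cor (w powr (- (1/2)) * (2 * x + w) powr (- (1/2)) * exp (- w))"
   using True by (simp add: mac_ker_def)
  also have "w powr (- (1/2)) * (2 * x + w) powr (- (1/2)) = (w\<^sup>2 + 2 * x * w) powr (- (1/2))"
   using True p by (subst powr_mult[symmetric]) (auto simp: power2_eq_square algebra_simps)
  also have "\<dots> = 1 / sqrt (w\<^sup>2 + 2 * x * w)"
   using True x by (subst powr_minus, subst powr_half_sqrt) (auto simp: divide_inverse)
  finally have "mac_ker 0 (cor x) w = cor (1 / sqrt (w\<^sup>2 + 2 * x * w) * exp (- w))" .
  moreover have "f w = 1 / sqrt (w\<^sup>2 + 2 * x * w) * exp (- w)" using True by (simp add: f_def)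
  ultimately show ?thesis by (simp only:)
 qed (simp add: mac_ker_def f_def)
 have fi: "integrable lborel f"
  using mac_integrable[of "cor x" 0] x unfolding f complex_of_real_integrable_eq by (simp add: slit_iff)
 have gi: "integrable lborel (\<lambda>w. indicator {0<..} w * ((arcosh_ker x w - ln x) * exp (- w)))"
  using Bochner_Integration.integrable_diff[OF arcosh_ker_integrable[OF x] integrable_mult_right[OF integrable_exp_real(1), of "ln x"]]
  by (simp add: algebra_simps)
 have D: "((\<lambda>w. exp (- w) * (arcosh_ker x w - ln x)) has_real_derivative
   exp (- w) * (1 / sqrt (w\<^sup>2 + 2 * x * w)) - (arcosh_ker x w - ln x) * exp (- w)) (at w)" if "0 < w" for w
  by (rule derivative_eq_intros arcosh_ker_deriv refl that x)+ (simp add: algebra_simps)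
 have i: "indicator {0<..} w *\<^sub>R (exp (- w) * (1 / sqrt (w\<^sup>2 + 2 * x * w)) - (arcosh_ker x w - ln x) * exp (- w))
  = f w - indicator {0<..} w * ((arcosh_ker x w - ln x) * exp (- w))" for w
  by (simp add: f_def algebra_simps)
 have "(LBINT w. indicator {0<..} w *\<^sub>R (exp (- w) * (1 / sqrt (w\<^sup>2 + 2 * x * w)) - (arcosh_ker x w - ln x) * exp (- w))) = 0 - 0"
 proof (rule FTC_half_line[where F="\<lambda>w. exp (- w) * (arcosh_ker x w - ln x)"])
  fix w :: real assume w: "0 < w"
  have p: "0 < w\<^sup>2 + 2 * x * w" using w x by (simp add: add_pos_pos)
  show "((\<lambda>w. exp (- w) * (arcosh_ker x w - ln x)) has_vector_derivative
   exp (- w) * (1 / sqrt (w\<^sup>2 + 2 * x * w)) - (arcosh_ker x w - ln x) * exp (- w)) (at w)"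
   using D[OF w] by (simp add: has_real_derivative_iff_has_vector_derivative)
  have "isCont (arcosh_ker x) w" using arcosh_ker_deriv[OF w x(1)] by (rule DERIV_isCont)
  thus "isCont (\<lambda>w. exp (- w) * (1 / sqrt (w\<^sup>2 + 2 * x * w)) - (arcosh_ker x w - ln x) * exp (- w)) w"
   using p by (intro continuous_intros) auto
 next
  show "integrable lborel (\<lambda>w. indicator {0<..} w *\<^sub>R (exp (- w) * (1 / sqrt (w\<^sup>2 + 2 * x * w)) - (arcosh_ker x w - ln x) * exp (- w)))"
   unfolding i by (rule Bochner_Integration.integrable_diff[OF fi gi])
  have b: "norm (exp (- w) * (arcosh_ker x w - ln x)) \<le> exp (- w) * (ln (2 * (w + x)) - ln x)" if "0 < w" for w
   using arcosh_ker_bounds[OF that x(1)] by (simp add: abs_mult)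
  have "isCont (\<lambda>w. exp (- w) * (arcosh_ker x w - ln x)) 0"
   unfolding arcosh_ker_def using x by (intro continuous_intros) auto
  hence "((\<lambda>w. exp (- w) * (arcosh_ker x w - ln x)) \<longlongrightarrow> exp (- 0) * (arcosh_ker x 0 - ln x)) (at_right 0)"
   by (simp add: isCont_def filterlim_at_split)
  thus "((\<lambda>w. exp (- w) * (arcosh_ker x w - ln x)) \<longlongrightarrow> 0) (at_right 0)"
   by (simp add: arcosh_ker_def)
  show "((\<lambda>w. exp (- w) * (arcosh_ker x w - ln x)) \<longlongrightarrow> 0) at_top"
  proof (rule Lim_null_comparison)
   show "\<forall>\<^sub>F w in at_top. norm (exp (- w) * (arcosh_ker x w - ln x)) \<le> exp (- w) * (ln (2 * (w + x)) - ln x)"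
    using b by (auto intro!: eventually_mono[OF eventually_gt_at_top[of 0]] simp del: real_norm_def)
   show "((\<lambda>w. exp (- w) * (ln (2 * (w + x)) - ln x)) \<longlongrightarrow> 0) at_top"
    by real_asymp
  qed
 qed
 hence "(LBINT w. f w) = (LBINT w. indicator {0<..} w * ((arcosh_ker x w - ln x) * exp (- w)))"
  unfolding i Bochner_Integration.integral_diff[OF fi gi] by simp
 also have "\<dots> = (LBINT w. indicator {0<..} w * (arcosh_ker x w * exp (- w)) - ln x * (indicator {0<..} w * exp (- w)))"
  by (simp add: algebra_simps)
 also have "\<dots> = (LBINT w. indicator {0<..} w * (arcosh_ker x w * exp (- w))) - ln x"
  by (subst Bochner_Integration.integral_diff[OF arcosh_ker_integrable[OF x] integrable_mult_right[OF integrable_exp_real(1)]])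
   (simp add: integrable_exp_real)
 finally show ?thesis
  unfolding mac_def f integral_complex_of_real by (simp only:)
qed

lemma LIMSEQ_at_right_I:
 fixes f :: "real => 'a::metric_space"
 assumes "\<And>h. (\<And>n. 0 < h n) ==> (\<And>n. h n \<le> 1) ==> h \<longlonglongrightarrow> 0 ==> (\<lambda>n. f (h n)) \<longlonglongrightarrow> L"
 shows "(f \<longlongrightarrow> L) (at_right 0)"
 unfolding tendsto_at_iff_sequentially
proof (intro allI impI)
 fix h :: "nat => real" assume h: "\<forall>i. h i \<in> {0<..} - {0}" "h \<longlonglongrightarrow> 0"
 obtain n0 where n0: "\<And>n. n \<ge> n0 ==> \<bar>h n\<bar> < 1"
  using tendstoD[OF h(2), of 1] unfolding eventually_sequentially dist_real_def by auto
 have "(\<lambda>n. f (h (n + n0))) \<longlonglongrightarrow> L"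
  using h n0 LIMSEQ_ignore_initial_segment[OF h(2), of n0] by (intro assms) (auto simp: less_imp_le abs_less_iff)
 thus "(f \<circ> h) \<longlonglongrightarrow> L" by (simp add: o_def LIMSEQ_offset)
qed

text \<open>In the limit the integral is that of ln(2 w) exp(- w), which is ln 2 minus Euler's
  constant, and ln 2 cancels against ln(x / 2).\<close>

lemma mac_at_0:
 "((\<lambda>x. mac 0 (cor x) + cor (ln (x / 2))) \<longlongrightarrow> - euler_mascheroni) (at_right 0)"
proof (rule LIMSEQ_at_right_I)
 fix h :: "nat => real" assume h: "\<And>n. 0 < h n" "\<And>n. h n \<le> 1" "h \<longlonglongrightarrow> 0"
 have "(\<lambda>n. LBINT w. indicator {0<..} w * (arcosh_ker (h n) w * exp (- w))) \<longlonglongrightarrow>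
   (LBINT w. indicator {0<..} w * (ln (2 * w) * exp (- w)))"
 proof (rule integral_dominated_convergence[where w="\<lambda>w. norm (indicator {0<..} w * (ln w * exp (- w))) +
    (2 * (indicator {0<..} w * (w * exp (- w))) + indicator {0<..} w * exp (- w))"])
  show "integrable lborel (\<lambda>w. norm (indicator {0<..} w * (ln w * exp (- w))) +
    (2 * (indicator {0<..} w * (w * exp (- w))) + indicator {0<..} w * exp (- w :: real)))"
   by (intro Bochner_Integration.integrable_add integrable_norm integrable_exp_ln integrable_mult_right integrable_exp_real)
  show "AE w in lborel. norm (indicator {0<..} w * (arcosh_ker (h n) w * exp (- w))) \<le> norm (indicator {0<..} w * (ln w * exp (- w))) +
    (2 * (indicator {0<..} w * (w * exp (- w))) + indicator {0<..} w * exp (- w))" for n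
   by (intro AE_I2 arcosh_ker_dominated h)
  have "(\<lambda>n. indicator {0<..} w * (arcosh_ker (h n) w * exp (- w))) \<longlonglongrightarrow> indicator {0<..} w * (ln (2 * w) * exp (- w))" for w
  proof (cases "0 < w")
   case True
   have "isCont (\<lambda>x. arcosh_ker x w) 0"
    unfolding arcosh_ker_def using True by (intro continuous_intros) auto
   hence "(\<lambda>n. arcosh_ker (h n) w) \<longlonglongrightarrow> arcosh_ker 0 w"
    by (rule isCont_tendsto_compose) (rule h)
   thus ?thesis
    using True by (intro tendsto_intros) (simp add: arcosh_ker_def)
  qed simp
  thus "AE w in lborel. (\<lambda>n. indicator {0<..} w * (arcosh_ker (h n) w * exp (- w))) \<longlonglongrightarrow> indicator {0<..} w * (ln (2 * w) * exp (- w))"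
   by simp
 qed measurable
 also have "(LBINT w. indicator {0<..} w * (ln (2 * w) * exp (- w :: real))) =
  (LBINT w. ln 2 * (indicator {0<..} w * exp (- w :: real)) + indicator {0<..} w * (ln w * exp (- w)))"
  by (intro Bochner_Integration.integral_cong) (auto simp: indicator_def ln_mult_pos distrib_right simp del: ln_mult)
 also have "\<dots> = (LBINT w. ln 2 * (indicator {0<..} w * exp (- w :: real))) + (LBINT w. indicator {0<..} w * (ln w * exp (- w)))"
  by (intro Bochner_Integration.integral_add integrable_mult_right integrable_exp_real(1) integrable_exp_ln)
 also have "\<dots> = ln 2 - (euler_mascheroni :: real)"
  by (simp add: integrable_exp_real integral_exp_ln)
 finally have "(\<lambda>n. cor ((LBINT w. indicator {0<..} w * (arcosh_ker (h n) w * exp (- w))) - ln 2))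
   \<longlonglongrightarrow> cor (ln 2 - euler_mascheroni - ln 2)"
  by (intro tendsto_intros)
 moreover have "mac 0 (cor (h n)) + cor (ln (h n / 2)) =
   cor ((LBINT w. indicator {0<..} w * (arcosh_ker (h n) w * exp (- w))) - ln 2)" for n
  unfolding mac_real[OF h(1,2)] using h(1)[of n] by (simp add: ln_div)
 ultimately show "(\<lambda>n. mac 0 (cor (h n)) + cor (ln (h n / 2))) \<longlonglongrightarrow> - euler_mascheroni"
  by (simp add: of_real_euler_mascheroni)
qed

text \<open>The factor exp(- x) changes the expansion only by (1 - exp(- x)) ln(x / 2), which tends
  to 0.\<close>

lemma mac_sol_at_0:
 "((\<lambda>x. mac_sol (cor x) + cor (ln (x / 2))) \<longlongrightarrow> - euler_mascheroni) (at_right 0)"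
proof -
 have "((\<lambda>x. cor (exp (- x)) * (mac 0 (cor x) + cor (ln (x / 2))) +
   cor ((1 - exp (- x)) * ln (x / 2))) \<longlongrightarrow> of_real (exp (- 0)) * (- euler_mascheroni) + of_real 0) (at_right 0)"
 proof (intro tendsto_add tendsto_mult mac_at_0 tendsto_of_real)
  show "((\<lambda>x. (1 - exp (- x)) * ln (x / 2)) \<longlongrightarrow> 0) (at_right (0::real))" by real_asymp
  show "((\<lambda>x::real. exp (- x)) \<longlongrightarrow> exp (- 0)) (at_right 0)" by (intro tendsto_intros)
 qed
 thus ?thesis by (simp add: mac_sol_def exp_of_real[symmetric] algebra_simps del: of_real_minus) (simp add: algebra_simps)
qed

text \<open>The logarithm remains with the factor P(x^2 / 4) - 1, which is o(x) since its derivative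
  in x vanishes at 0, and x ln x tends to 0.\<close>

lemma neumann_sol_at_0:
 "((\<lambda>x. neumann_sol (cor x) + cor (ln (x / 2))) \<longlongrightarrow> - euler_mascheroni) (at_right 0)"
proof -
 define P where "P = entire_sum bessel_P"
 define R where "R = entire_sum bessel_R"
 have P0: "P 0 = 1" and R0: "R 0 = 0"
  by (simp_all add: P_def R_def entire_sum_def powser_zero bessel_P_def bessel_R_def harm_def)
 have c: "isCont (\<lambda>x::real. F ((cor x)\<^sup>2 / 4)) 0" if "F = P \<or> F = R" for F
 proof -
  have "isCont F ((cor 0)\<^sup>2 / 4)"
   using that entire_sum_deriv(1)[OF bessel_PR_summable(1)] entire_sum_deriv(1)[OF bessel_PR_summable(2)]
   by (auto simp: P_def R_def intro: DERIV_isCont)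
  thus ?thesis by (intro isCont_o2[where f="\<lambda>x. (cor x)\<^sup>2 / 4" and g=F] continuous_intros) auto
 qed
 have cP: "((\<lambda>x. P ((cor x)\<^sup>2 / 4)) \<longlongrightarrow> 1) (at_right 0)"
  and cR: "((\<lambda>x. R ((cor x)\<^sup>2 / 4)) \<longlongrightarrow> 0) (at_right 0)"
  using c[of P] c[of R] P0 R0 by (auto simp: isCont_def intro: tendsto_within_subset)
 have m1: "((\<lambda>x. (P ((cor x)\<^sup>2 / 4) - 1) / cor x) \<longlongrightarrow> 0) (at_right 0)"
 proof -
  have "((\<lambda>z. z\<^sup>2 / 4) has_field_derivative 0) (at (0::complex))" by (auto intro!: derivative_eq_intros)
  from DERIV_chain2[OF entire_sum_deriv(1)[OF bessel_PR_summable(1)] this]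
  have "((\<lambda>z. P (z\<^sup>2 / 4)) has_field_derivative 0) (at 0)" by (simp add: P_def)
  hence "((\<lambda>h. (P (h\<^sup>2 / 4) - 1) / h) \<longlongrightarrow> 0) (at 0)" using P0 by (simp add: DERIV_def)
  moreover have "filterlim cor (at 0) (at_right 0)"
   by (auto simp: filterlim_at eventually_at_filter intro!: tendsto_eq_intros)
  ultimately show ?thesis by (rule filterlim_compose)
 qed
 have m2: "((\<lambda>x. cor (x * ln (x / 2))) \<longlongrightarrow> of_real 0) (at_right 0)"
  by (intro tendsto_intros) real_asymp
 have "((\<lambda>x. R ((cor x)\<^sup>2 / 4) - euler_mascheroni * P ((cor x)\<^sup>2 / 4)
   - ((P ((cor x)\<^sup>2 / 4) - 1) / cor x) * cor (x * ln (x / 2))) \<longlongrightarrow> 0 - euler_mascheroni * 1 - 0 * of_real 0) (at_right 0)"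
  by (intro tendsto_diff tendsto_mult tendsto_const cP cR m1 m2)
 moreover have "\<forall>\<^sub>F x in at_right 0. R ((cor x)\<^sup>2 / 4) - euler_mascheroni * P ((cor x)\<^sup>2 / 4)
   - ((P ((cor x)\<^sup>2 / 4) - 1) / cor x) * cor (x * ln (x / 2)) = neumann_sol (cor x) + cor (ln (x / 2))"
  proof (rule eventually_mono[OF eventually_at_right_less])
   fix x :: real assume x: "0 < x"
   hence "Ln (cor x / 2) = cor (ln (x / 2))"
    using Ln_of_real[of "x / 2"] by simp
   thus "R ((cor x)\<^sup>2 / 4) - euler_mascheroni * P ((cor x)\<^sup>2 / 4)
   - ((P ((cor x)\<^sup>2 / 4) - 1) / cor x) * cor (x * ln (x / 2)) = neumann_sol (cor x) + cor (ln (x / 2))"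
    using x by (simp add: neumann_sol_def P_def R_def scaleR_conv_of_real field_simps)
  qed
 ultimately show ?thesis by (simp add: Lim_transform_eventually)
qed

section \<open>Identification of the two forms and the Hankel function on the two axes\<close>

text \<open>On the positive axis both solutions are - ln(x / 2) minus Euler's constant up to o(1),
  so their difference tends to 0, vanishes on a small interval (0, e) and, by analytic continuation,
  on the whole slit plane.\<close>

lemma mac_sol_eq_neumann_sol:
 assumes "z \<in> slit"
 shows "mac_sol z = neumann_sol z"
proof -
 define E where "E z = mac_sol z - neumann_sol z" for z
 define V where "V z = - z * exp (- z) * (mac 0 z + mac 1 z) - neumann_d z" for z
 have nz: "z \<noteq> 0" if "z \<in> slit" for z using that by (auto simp: slit_iff)
 have dE: "(E has_field_derivative V z / z) (at z)" if "z \<in> slit" for z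
  unfolding E_def[abs_def] V_def
  by (rule DERIV_cong[OF DERIV_diff[OF mac_sol_deriv(1)[OF that] neumann_sol_deriv(1)[OF that]]])
   (use nz[OF that] in \<open>simp add: field_simps\<close>)
 have dV: "(V has_field_derivative z * E z) (at z)" if "z \<in> slit" for z
  unfolding E_def V_def[abs_def]
  by (rule DERIV_cong[OF DERIV_diff[OF mac_sol_deriv(2)[OF that] neumann_sol_deriv(2)[OF that]]])
   (simp add: algebra_simps)
 have lim: "((\<lambda>x. E (cor x)) \<longlongrightarrow> 0) (at_right 0)"
  using tendsto_diff[OF mac_sol_at_0 neumann_sol_at_0] by (simp add: E_def)
 have sl: "cor x \<in> slit" if "0 < x" for x using that by (simp add: slit_iff)
 \<comment> \<open>L stands for Re or Im, since the uniqueness statement is about real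
   functions.\<close>
 have part: "\<exists>e>0. \<forall>x. 0 < x \<and> x < e \<longrightarrow> L (E (cor x)) = 0"
  if L: "bounded_linear L" "\<And>c z. L (cor c * z) = c * L z" for L :: "complex => real"
 proof (rule real_ode_unique)
  have ch: "((\<lambda>x. L (G (cor x))) has_real_derivative L g) (at x)"
   if "(G has_field_derivative g) (at (cor x))" for G g x
  proof -
   have "((\<lambda>x. G (cor x)) has_vector_derivative g) (at x)"
    using has_vector_derivative_real_field[OF that, of UNIV] by simp
   from bounded_linear.has_vector_derivative[OF L(1) this] show ?thesis
    by (simp add: has_real_derivative_iff_has_vector_derivative)
  qed
  fix x :: real assume x: "0 < x"
  have "L (V (cor x) / cor x) = L (V (cor x)) / x"
   using L(2)[of "1 / x" "V (cor x)"] by (simp add: divide_inverse mult.commute)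
  thus "((\<lambda>x. L (E (cor x))) has_real_derivative L (V (cor x)) / x) (at x)"
   using ch[OF dE[OF sl[OF x]]] by simp
  show "((\<lambda>x. L (V (cor x))) has_real_derivative x * L (E (cor x))) (at x)"
   using ch[OF dV[OF sl[OF x]]] by (simp add: L(2))
 next
  show "((\<lambda>x. L (E (cor x))) \<longlongrightarrow> 0) (at_right 0)"
   using bounded_linear.tendsto_zero[OF L(1) lim] .
 qed
 obtain e1 e2 where e: "e1 > 0" "e2 > 0" "\<And>x. 0 < x ==> x < e1 ==> Re (E (cor x)) = 0"
   "\<And>x. 0 < x ==> x < e2 ==> Im (E (cor x)) = 0"
  using part[OF bounded_linear_Re] part[OF bounded_linear_Im] by auto
 define e where "e = min e1 e2"
 have e0: "e > 0" "\<And>x. 0 < x ==> x < e ==> E (cor x) = 0"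
  using e by (auto simp: e_def complex_eq_iff)
 have "E z = 0"
 proof (rule analytic_continuation[of E slit "cor ` {0<..<e}" "cor (e / 2)"])
  show "E holomorphic_on slit"
   by (rule holomorphic_on_open[THEN iffD2, OF open_slit]) (use dE in blast)
  show "connected slit"
  proof (rule starlike_imp_connected)
   have "slit = - (cor ` {..0})" by (auto simp: slit_def nonpos_Reals_def)
   thus "starlike slit" using starlike_slotted_complex_plane_left[of 0] by simp
  qed
  show "cor (e / 2) islimpt cor ` {0<..<e}"
  proof (rule islimpt_approachable[THEN iffD2], intro allI impI)
   fix d :: real assume d: "d > 0"
   define t where "t = min (d / 2) (e / 4)"
   have "dist (cor (e / 2 + t)) (cor (e / 2)) < d"
    unfolding dist_of_real using d e0(1) by (simp add: t_def dist_real_def)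
   moreover have "e / 2 + t \<in> {0<..<e}" "e / 2 + t \<noteq> e / 2" using d e0(1) by (auto simp: t_def)
   ultimately show "\<exists>x'\<in>cor ` {0<..<e}. x' \<noteq> cor (e / 2) \<and> dist x' (cor (e / 2)) < d"
    by (metis image_eqI of_real_eq_iff)
  qed
  show "cor (e / 2) \<in> slit" using e0 by (intro sl) simp
 qed (use open_slit e0 assms sl in auto)
 thus ?thesis by (simp add: E_def)
qed

text \<open>The relation H_0(z) = 2 / (pi i) K_0(- i z); the term i pi / 2 in the logarithm produces
  the summand J_0. The hypothesis is the compatibility of principal branches, which holds for z = x
  and z = i x with x > 0, the two arguments in \<open>fund_sol\<close>.\<close>

lemma hankel_eq_neumann:
 assumes "Ln (- \<i> * z / 2) = Ln (z / 2) - \<i> * cor pi / 2"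
 shows "hankel1_0 z = - (2 * \<i> / cor pi) * neumann_sol (- \<i> * z)"
proof -
 have q: "(- \<i> * z)\<^sup>2 / 4 = - ((z / 2)\<^sup>2)" by (simp add: power_mult_distrib power_divide)
 have pw: "(- ((z / 2)\<^sup>2)) ^ n = (-1) ^ n * (z / 2) ^ (2 * n)" for n
  by (subst power_minus) (simp add: power_mult)
 have J: "entire_sum bessel_P (- ((z / 2)\<^sup>2)) = bessel_J0 z"
  unfolding entire_sum_def bessel_J0_def pw
  by (rule suminf_cong) (simp add: bessel_P_def field_simps)
 have R: "entire_sum bessel_R (- ((z / 2)\<^sup>2)) = (\<Sum>n. (-1) ^ n * harm n / (fact n)\<^sup>2 * (z / 2) ^ (2 * n))"
  unfolding entire_sum_def pw
  by (rule suminf_cong) (simp add: bessel_R_def field_simps)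
 show ?thesis
  unfolding hankel1_0_def bessel_Y0_def R[symmetric] J[symmetric] neumann_sol_def q assms
  by (simp add: field_simps)
qed

lemma hankel_real: "x > 0 ==> hankel1_0 (cor x) =
  - (2 * \<i> / cor pi) * (ei x * mac 0 (- \<i> * cor x))"
proof -
 assume x: "x > 0"
 have "Ln (cor (x / 2) * - \<i>) = cor (ln (x / 2)) + Ln (- \<i>)"
  using x by (subst Ln_times_of_real) (simp_all add: Ln_of_real del: of_real_divide)
 hence "Ln (- \<i> * cor x / 2) = Ln (cor x / 2) - \<i> * cor pi / 2"
  using Ln_of_real[of "x / 2"] x by (simp add: mult.commute del: Ln_of_real)
 from hankel_eq_neumann[OF this] show ?thesis
  using mac_sol_eq_neumann_sol[of "- \<i> * cor x"] x by (simp add: mac_sol_def slit_iff)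
qed

lemma hankel_imag: "x > 0 ==> hankel1_0 (\<i> * cor x) =
  - (2 * \<i> / cor pi) * (exp (- cor x) * mac 0 (cor x))"
proof -
 assume x: "x > 0"
 have "Ln (cor (x / 2) * \<i>) = cor (ln (x / 2)) + Ln \<i>"
  using x by (subst Ln_times_of_real) (simp_all add: Ln_of_real del: of_real_divide)
 hence "Ln (- \<i> * (\<i> * cor x) / 2) = Ln (\<i> * cor x / 2) - \<i> * cor pi / 2"
  using Ln_of_real[of "x / 2"] x by (simp add: mult.commute del: Ln_of_real)
 from hankel_eq_neumann[OF this] show ?thesis
  using mac_sol_eq_neumann_sol[of "cor x"] x by (simp add: mac_sol_def slit_iff)
qed

subsection \<open>The amplitude of the fundamental solution\<close>

text \<open>\<open>A n\<close> is the \<open>n\<close>-th derivative of \<open>A 0\<close>, which behaves like a symbol of order \<open>- p\<close> on the positive axis.\<close>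

definition symbol_tower :: "real => (nat => complex => complex) => bool" where
 "symbol_tower p A \<longleftrightarrow> (\<forall>n. \<forall>t>0. (A n has_field_derivative A (Suc n) (cor t)) (at (cor t))) \<and>
  (\<forall>n. \<exists>C. \<forall>t>0. norm (A n (cor t)) \<le> C * t powr (- p - real n))"

lemma symbol_tower_deriv:
 "symbol_tower p A ==> 0 < t ==> (A n has_field_derivative A (Suc n) (cor t)) (at (cor t))"
 by (simp add: symbol_tower_def)

lemma exp_tower: "((\<lambda>z. c ^ n * exp (c * z)) has_field_derivative c ^ Suc n * exp (c * z)) (at (z::complex))"
 by (auto intro!: derivative_eq_intros)

context annulus
begin

text \<open>The n-th derivative of A 0 (k r) in r is k^n A n (k r), and the bound (k r)^(- p - n)
  cancels k^p k^n exactly. What remains is a non-positive power of r >= rho.\<close>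

lemma usmooth_tower:
 assumes A: "symbol_tower p A" and p: "0 \<le> p"
 shows "usmooth V {1..} (\<lambda>k y. cor (k powr p) * A 0 (cor k * rc y))"
proof -
 define F where "F n k z = cor (k powr p * k ^ n) * A n (cor k * z)" for n k z
 have "usmooth V {1..} (\<lambda>k y. F 0 k (rc y))"
 proof (rule usmooth_comp[OF V(1) usmooth_rc])
  fix n and k :: real and y assume k: "k \<in> {1..}" and y: "y \<in> V"
  have "0 < k * norm (y - x)" using k \<rho>(2)[OF y] \<rho>(1) by (intro mult_pos_pos) auto
  from symbol_tower_deriv[OF A this, of n]
  have "(A n has_field_derivative A (Suc n) (cor k * rc y)) (at (cor k * rc y))"
   by (simp add: rc_def)
  from DERIV_cmult[OF DERIV_chain2[OF this DERIV_cmult_Id], of "cor (k powr p * k ^ n)"]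
  show "(F n k has_field_derivative F (Suc n) k (rc y)) (at (rc y))"
   unfolding F_def by (simp add: mult_ac)
 next
  fix n
  obtain C where C: "\<And>t. t > 0 ==> norm (A n (cor t)) \<le> C * t powr (- p - real n)"
   using A unfolding symbol_tower_def by metis
  have C0: "C \<ge> 0" using order_trans[OF norm_ge_zero C[of 1]] by simp
  show "\<exists>C. \<forall>k\<in>{1..}. \<forall>y\<in>V. norm (F n k (rc y)) \<le> C"
  proof (intro exI ballI)
   fix k :: real and y assume k: "k \<in> {1..}" and y: "y \<in> V"
   define r where "r = norm (y - x)"
   have r: "\<rho> \<le> r" "0 < r" using \<rho>(2)[OF y] \<rho>(1) by (auto simp: r_def)
   have "norm (F n k (rc y)) = k powr p * k ^ n * norm (A n (cor (k * r)))"
    using k by (simp add: F_def rc_def r_def norm_mult norm_power abs_mult)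
   also have "\<dots> \<le> k powr p * k ^ n * (C * (k * r) powr (- p - real n))"
    using k r by (intro mult_left_mono C) auto
   also have "\<dots> = C * r powr (- p - real n)"
    using k r by (simp add: powr_mult powr_diff powr_minus powr_realpow field_simps)
   also have "\<dots> \<le> C * \<rho> powr (- p - real n)"
    using r \<rho>(1) p C0 by (intro mult_left_mono powr_mono2') auto
   finally show "norm (F n k (rc y)) \<le> C * \<rho> powr (- p - real n)" .
  qed
 qed
 thus ?thesis
  by (rule usmooth_cong[OF V(1)]) (simp add: F_def)
qed

text \<open>Each derivative in r brings a factor k, and the exponential absorbs all of them because
  r >= rho and Re c < 0.\<close>

lemma usmooth_exp_decay:
 assumes c: "Re c < 0"
 shows "usmooth V {1..} (\<lambda>k y. exp (c * (cor k * rc y)))"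
proof -
 define F where "F n k z = (c * cor k) ^ n * exp (c * cor k * z)" for n k z
 have "usmooth V {1..} (\<lambda>k y. F 0 k (rc y))"
 proof (rule usmooth_comp[OF V(1) usmooth_rc])
  show "(F n k has_field_derivative F (Suc n) k (rc y)) (at (rc y))" for n k y
   unfolding F_def by (rule exp_tower)
 next
  fix n
  have "\<exists>C. \<forall>s\<ge>0. \<bar>s ^ n * exp (- s)\<bar> \<le> (C::real)"
   using poly_times_exp_bounded[of "monom 1 n"] by (simp only: poly_monom mult_1)
  then obtain C :: real where C: "\<And>s. s \<ge> 0 ==> \<bar>s ^ n * exp (- s)\<bar> \<le> C" by blast
  define s where "s = - Re c * \<rho>"
  have s: "s > 0" using c \<rho>(1) by (simp add: s_def mult_neg_pos)
  show "\<exists>C. \<forall>k\<in>{1..}. \<forall>y\<in>V. norm (F n k (rc y)) \<le> C"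
  proof (intro exI ballI)
   fix k :: real and y assume k: "k \<in> {1..}" and y: "y \<in> V"
   have "Re (c * cor k * rc y) \<le> - (s * k)"
   proof -
    have "(- Re c * k) * \<rho> \<le> (- Re c * k) * norm (y - x)"
     using \<rho>(2)[OF y] c k by (intro mult_left_mono) (auto simp: mult_nonpos_nonneg)
    thus ?thesis by (simp add: s_def rc_def mult_ac)
   qed
   hence "norm (F n k (rc y)) \<le> (norm c * k) ^ n * exp (- (s * k))"
    using k unfolding F_def norm_mult norm_exp_eq_Re norm_power by (intro mult_mono) auto
   also have "\<dots> = (norm c / s) ^ n * ((s * k) ^ n * exp (- (s * k)))"
    using s by (simp add: power_mult_distrib field_simps)
   also have "\<dots> \<le> (norm c / s) ^ n * C"
    using C[of "s * k"] s k by (intro mult_left_mono) auto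
   finally show "norm (F n k (rc y)) \<le> (norm c / s) ^ n * C" .
  qed
 qed
 thus ?thesis
  by (rule usmooth_cong[OF V(1)]) (simp add: F_def mult.assoc)
qed

text \<open>The second condition says that g is Lipschitz in k with respect to all test function
  seminorms, after a cutoff; a distribution then turns it into a Lipschitz function of k.\<close>

definition lipschitz_family :: "real set => (real => 'a => complex) => bool" where
 "lipschitz_family J g \<longleftrightarrow> usmooth V J g \<and>
  usmooth V {(k, l). k \<in> J \<and> l \<in> J \<and> k \<noteq> l} (\<lambda>(k, l) y. (g k y - g l y) / cor (k - l))"

lemma lipschitz_family_mult:
 assumes "lipschitz_family J g" "lipschitz_family J h"
 shows "lipschitz_family J (\<lambda>k y. g k y * h k y)"
proof -
 let ?P = "{(k, l). k \<in> J \<and> l \<in> J \<and> k \<noteq> l}"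
 have g: "usmooth V J g" "usmooth V ?P (\<lambda>(k, l) y. (g k y - g l y) / cor (k - l))"
  and h: "usmooth V J h" "usmooth V ?P (\<lambda>(k, l) y. (h k y - h l y) / cor (k - l))"
  using assms by (auto simp: lipschitz_family_def)
 have "usmooth V ?P (\<lambda>i. g (fst i))" "usmooth V ?P (\<lambda>i. h (snd i))"
  by (rule usmooth_reindex[OF g(1)], auto) (rule usmooth_reindex[OF h(1)], auto)
 from usmooth_add[OF V(1) usmooth_mult[OF V(1) this(1) h(2)] usmooth_mult[OF V(1) this(2) g(2)]]
 have "usmooth V ?P (\<lambda>(k, l) y. (g k y * h k y - g l y * h l y) / cor (k - l))"
  by (rule usmooth_cong[OF V(1)]) (auto simp: divide_inverse algebra_simps)
 thus ?thesis
  unfolding lipschitz_family_def by (simp add: usmooth_mult[OF V(1) g(1) h(1)])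
qed

lemma lipschitz_family_diff:
 assumes "lipschitz_family J g" "lipschitz_family J h"
 shows "lipschitz_family J (\<lambda>k y. g k y - h k y)"
proof -
 let ?P = "{(k, l). k \<in> J \<and> l \<in> J \<and> k \<noteq> l}"
 have g: "usmooth V J g" "usmooth V ?P (\<lambda>(k, l) y. (g k y - g l y) / cor (k - l))"
  and h: "usmooth V J h" "usmooth V ?P (\<lambda>(k, l) y. (h k y - h l y) / cor (k - l))"
  using assms by (auto simp: lipschitz_family_def)
 from usmooth_diff_fun[OF V(1) g(2) h(2)]
 have "usmooth V ?P (\<lambda>(k, l) y. (g k y - h k y - (g l y - h l y)) / cor (k - l))"
  by (rule usmooth_cong[OF V(1)]) (auto simp: divide_inverse algebra_simps)
 thus ?thesis
  unfolding lipschitz_family_def by (simp add: usmooth_diff_fun[OF V(1) g(1) h(1)])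
qed

text \<open>For k in a compact interval, k r ranges over a compact part of the positive axis, where
  continuity of the A n gives every bound. The difference quotient in k is estimated by the mean
  value inequality along the segment from l to k.\<close>

lemma lipschitz_family_tower:
 assumes a: "0 < a"
  and A: "\<And>n t. 0 < t ==> (A n has_field_derivative A (Suc n) (cor t)) (at (cor t))"
 shows "lipschitz_family {a..b} (\<lambda>k y. A 0 (cor k * rc y))"
proof -
 obtain R where R: "\<And>y. y \<in> V ==> norm (rc y) \<le> R" "R > 0"
  using usmooth_bound0[OF usmooth_rc[of "{()}"]] by (metis singletonI)
 have "\<exists>C. \<forall>t\<in>{a * \<rho>..b * R}. norm (A n (cor t)) \<le> C" for n
 proof -
  have "continuous_on {a * \<rho>..b * R} (\<lambda>t. A n (cor t))"
  proof (intro continuous_at_imp_continuous_on ballI)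
   fix t assume "t \<in> {a * \<rho>..b * R}"
   hence "0 < t" using mult_pos_pos[OF a \<rho>(1)] by auto
   show "isCont (\<lambda>t. A n (cor t)) t"
    by (rule isCont_o2[OF isCont_of_real[OF continuous_ident] DERIV_isCont[OF A[OF \<open>0 < t\<close>]]])
  qed
  hence "bounded ((\<lambda>t. A n (cor t)) ` {a * \<rho>..b * R})"
   by (intro compact_imp_bounded compact_continuous_image) auto
  thus ?thesis by (auto simp: bounded_iff)
 qed
 then obtain C where C: "\<And>n t. a * \<rho> \<le> t ==> t \<le> b * R ==> norm (A n (cor t)) \<le> C n"
  by (metis atLeastAtMost_iff)
 have Cb: "norm (A n (cor k * rc y)) \<le> C n" "0 < k" "0 < norm (y - x)" "norm (y - x) \<le> R" "0 \<le> C n"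
  if "k \<in> {a..b}" "y \<in> V" for n k y
 proof -
  show k: "0 < k" using that a by auto
  have r: "\<rho> \<le> norm (y - x)" "norm (y - x) \<le> R" using \<rho>(2)[OF that(2)] R(1)[OF that(2)] by (auto simp: rc_def)
  show "0 < norm (y - x)" "norm (y - x) \<le> R" using r \<rho>(1) by auto
  have "a * \<rho> \<le> k * norm (y - x)" "k * norm (y - x) \<le> b * R"
   using r that(1) a \<rho>(1) k by (auto intro!: mult_mono)
  thus "norm (A n (cor k * rc y)) \<le> C n"
   using C[of "k * norm (y - x)" n] by (simp add: rc_def)
  thus "0 \<le> C n" using norm_ge_zero order_trans by blast
 qed
 have dA: "((\<lambda>z. A n (cor k * z)) has_field_derivative cor k * A (Suc n) (cor k * rc y)) (at (rc y))"
  "((\<lambda>z. A n (z * rc y)) has_field_derivative rc y * A (Suc n) (cor k * rc y)) (at (cor k))"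
  if "k \<in> {a..b}" "y \<in> V" for n k y
 proof -
  have "0 < k * norm (y - x)" using Cb[OF that] by simp
  from A[OF this, of n]
  have D: "(A n has_field_derivative A (Suc n) (cor k * rc y)) (at (cor k * rc y))"
   by (simp add: rc_def)
  show "((\<lambda>z. A n (cor k * z)) has_field_derivative cor k * A (Suc n) (cor k * rc y)) (at (rc y))"
   using DERIV_chain2[OF D DERIV_cmult_Id] by (simp add: mult.commute)
  show "((\<lambda>z. A n (z * rc y)) has_field_derivative rc y * A (Suc n) (cor k * rc y)) (at (cor k))"
   using DERIV_chain2[OF D DERIV_cmult_right[OF DERIV_ident]] by (simp add: mult.commute)
 qed
 define F where "F n k z = cor k ^ n * A n (cor k * z)" for n k z
 have dF: "(F n k has_field_derivative F (Suc n) k (rc y)) (at (rc y))" if "k \<in> {a..b}" "y \<in> V" for n k y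
  unfolding F_def using DERIV_cmult[OF dA(1)[OF that, of n], of "cor k ^ n"] by (simp add: mult_ac)
 have 1: "usmooth V {a..b} (\<lambda>k y. F 0 k (rc y))"
 proof (rule usmooth_comp[OF V(1) usmooth_rc])
  show "(F n k has_field_derivative F (Suc n) k (rc y)) (at (rc y))" if "k \<in> {a..b}" "y \<in> V" for n k y
   by (rule dF[OF that])
 next
  fix n
  show "\<exists>C. \<forall>k\<in>{a..b}. \<forall>y\<in>V. norm (F n k (rc y)) \<le> C"
  proof (intro exI ballI)
   fix k y assume ky: "k \<in> {a..b}" "y \<in> V"
   thus "norm (F n k (rc y)) \<le> b ^ n * C n"
    using Cb(1)[OF ky, of n] Cb(2)[OF ky] by (auto simp: F_def norm_mult norm_power intro!: mult_mono power_mono)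
  qed
 qed
 \<comment> \<open>The r-derivatives of the difference quotient in k: the tower runs in r, while the
   bounds come from the derivative in k.\<close>
 define H where "H n i z = (F n (fst i) z - F n (snd i) z) / cor (fst i - snd i)" for n :: nat and i z
 have 2: "usmooth V {(k, l). k \<in> {a..b} \<and> l \<in> {a..b} \<and> k \<noteq> l} (\<lambda>i y. H 0 i (rc y))"
 proof (rule usmooth_comp[OF V(1) usmooth_rc])
  fix n and i :: "real \<times> real" and y assume i: "i \<in> {(k, l). k \<in> {a..b} \<and> l \<in> {a..b} \<and> k \<noteq> l}" and y: "y \<in> V"
  show "(H n i has_field_derivative H (Suc n) i (rc y)) (at (rc y))"
   unfolding H_def by (rule DERIV_cdivide[OF DERIV_diff[OF dF dF]]) (use i y in auto)
 next
  fix n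
  show "\<exists>C. \<forall>i\<in>{(k, l). k \<in> {a..b} \<and> l \<in> {a..b} \<and> k \<noteq> l}. \<forall>y\<in>V. norm (H n i (rc y)) \<le> C"
  proof (intro exI ballI)
   fix i y assume i: "i \<in> {(k, l). k \<in> {a..b} \<and> l \<in> {a..b} \<and> k \<noteq> l}" and y: "y \<in> V"
   obtain k l where kl: "i = (k, l)" "k \<in> {a..b}" "l \<in> {a..b}" "k \<noteq> l" using i by auto
   let ?S = "cor ` {a..b}"
   let ?B = "real n * b ^ (n - 1) * C n + b ^ n * (R * C (Suc n))"
   have cv: "convex ?S" by (intro convex_linear_image) (auto simp: bounded_linear.linear bounded_linear_of_real)
   have "norm (cor k ^ n * A n (cor k * rc y) - cor l ^ n * A n (cor l * rc y))
     \<le> ?B * norm (cor k - cor l)"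
   proof (rule field_differentiable_bound[OF cv, where f="\<lambda>z. z ^ n * A n (z * rc y)" and
      f'="\<lambda>z. of_nat n * z ^ (n - 1) * A n (z * rc y) + z ^ n * (rc y * A (Suc n) (z * rc y))"])
    fix z assume "z \<in> ?S"
    then obtain t where t: "z = cor t" "t \<in> {a..b}" by auto
    have "((\<lambda>z. z ^ n) has_field_derivative of_nat n * z ^ (n - 1)) (at z)"
     by (auto intro!: derivative_eq_intros)
    from DERIV_mult[OF this dA(2)[OF t(2) y, of n, folded t(1)]]
    show "((\<lambda>z. z ^ n * A n (z * rc y)) has_field_derivative of_nat n * z ^ (n - 1) * A n (z * rc y) + z ^ n * (rc y * A (Suc n) (z * rc y))) (at z within ?S)"
     by (rule has_field_derivative_at_within[OF DERIV_cong]) (simp only: mult_ac add_ac t(1))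
    show "norm (of_nat n * z ^ (n - 1) * A n (z * rc y) + z ^ n * (rc y * A (Suc n) (z * rc y))) \<le> ?B"
     unfolding t(1) using Cb[OF t(2) y] t(2) R(2) a
     by (intro norm_triangle_le add_mono)
      (auto simp: norm_mult norm_power rc_def intro!: mult_mono power_mono)
   qed (use kl in auto)
   thus "norm (H n i (rc y)) \<le> ?B"
    using kl by (simp add: H_def F_def norm_divide divide_le_eq flip: of_real_diff)
  qed
 qed
 show ?thesis
  unfolding lipschitz_family_def
  using usmooth_cong[OF V(1) 1, of "\<lambda>k y. A 0 (cor k * rc y)"]
   usmooth_cong[OF V(1) 2, of "\<lambda>(k, l) y. (A 0 (cor k * rc y) - A 0 (cor l * rc y)) / cor (k - l)"]
  by (auto simp: F_def H_def)
qed

end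

section \<open>Amplitudes of the fundamental solution in dimensions two and three\<close>

text \<open>In both cases |2 u t + w| >= t for w > 0, through the real part for u = 1 and the
  imaginary part for u = - i, so \<open>mac_bound\<close> with delta = t yields the decay.\<close>

lemma symbol_tower_mac:
 "symbol_tower (1/2) (\<lambda>n z. c * u ^ n * (\<Prod>j<n. - of_nat (2 * j + 1)) * mac n (u * z))" if u: "u = 1 \<or> u = - \<i>"
 unfolding symbol_tower_def
proof (intro conjI allI impI)
 fix n and t :: real assume t: "0 < t"
 have s: "u * cor t \<in> slit" using u t by (auto simp: slit_iff)
 from DERIV_cmult[OF DERIV_chain2[OF mac_deriv[OF s, of n] DERIV_cmult_Id], of "c * u ^ n * (\<Prod>j<n. - of_nat (2 * j + 1))"]
 show "((\<lambda>z. c * u ^ n * (\<Prod>j<n. - of_nat (2 * j + 1)) * mac n (u * z)) has_field_derivative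
   c * u ^ Suc n * (\<Prod>j<Suc n. - of_nat (2 * j + 1)) * mac (Suc n) (u * cor t)) (at (cor t))"
  by (simp add: mult_ac)
next
 fix n
 have nu: "norm u = 1" using u by auto
 define P where "P = c * u ^ n * (\<Prod>j<n. - of_nat (2 * j + 1))"
 show "\<exists>C. \<forall>t>0. norm (c * u ^ n * (\<Prod>j<n. - of_nat (2 * j + 1)) * mac n (u * cor t)) \<le> C * t powr (- (1/2) - real n)"
 proof (intro exI allI impI)
  fix t :: real assume t: "0 < t"
  have d: "t \<le> norm (2 * (u * cor t) + cor w)" if "0 < w" for w
   using u
  proof (elim disjE)
   assume "u = 1"
   hence "2 * (u * cor t) + cor w = cor (2 * t + w)" by simp
   thus ?thesis using t that by (simp only: norm_of_real)
  next
   assume "u = - \<i>"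
   thus ?thesis using abs_Im_le_cmod[of "2 * (u * cor t) + cor w"] t by simp
  qed
  show "norm (c * u ^ n * (\<Prod>j<n. - of_nat (2 * j + 1)) * mac n (u * cor t)) \<le> (norm P * sqrt pi) * t powr (- (1/2) - real n)"
   unfolding P_def[symmetric] norm_mult[of P] mult.assoc[of "norm P"]
   using mac_bound[OF t d, of n] by (intro mult_left_mono) simp_all
 qed
qed

text \<open>The amplitude for d = 3: multiples of 1 / z and its derivatives, of order - 1 = - (d -
  1) / 2.\<close>

lemma symbol_tower_inverse:
 "symbol_tower 1 (\<lambda>n z. c * (-1) ^ n * fact n * inverse z ^ Suc n)"
 unfolding symbol_tower_def
proof (intro conjI allI impI)
 fix n and t :: real assume t: "0 < t"
 have "((\<lambda>z. inverse z ^ Suc n) has_field_derivative - of_nat (Suc n) * inverse (cor t) ^ Suc (Suc n)) (at (cor t))"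
  using t by (intro DERIV_cong[OF DERIV_power_Suc[OF DERIV_inverse]]) (auto simp: power2_eq_square algebra_simps)
 from DERIV_cmult[OF this, of "c * (-1) ^ n * fact n"]
 show "((\<lambda>z. c * (-1) ^ n * fact n * inverse z ^ Suc n) has_field_derivative c * (-1) ^ Suc n * fact (Suc n) * inverse (cor t) ^ Suc (Suc n)) (at (cor t))"
  by (simp add: algebra_simps)
next
 fix n
 show "\<exists>C. \<forall>t>0. norm (c * (-1) ^ n * fact n * inverse (cor t) ^ Suc n) \<le> C * t powr (- 1 - real n)"
 proof (intro exI allI impI)
  fix t :: real assume t: "0 < t"
  have "t powr (- 1 - real n) = inverse t ^ Suc n"
  proof -
   have "t powr (- 1 - real n) = t powr (- real (Suc n))" by (simp add: algebra_simps)
   thus ?thesis using t powr_realpow[of t "Suc n"] by (simp only: powr_minus power_inverse)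
  qed
  thus "norm (c * (-1) ^ n * fact n * inverse (cor t) ^ Suc n) \<le> (norm c * fact n) * t powr (- 1 - real n)"
   using t by (simp add: norm_mult norm_power norm_inverse)
 qed
qed

text \<open>Multiplying (2 z + w)^(- 1/2) by t^(1/2) leaves (- 2 i + w / t)^(- 1/2), which tends to
  a number of modulus 2^(- 1/2); the remaining integral is Gamma(1/2) = sqrt(pi).\<close>

lemma mac_at_infinity:
 "((\<lambda>t. t powr (1/2) * norm (mac 0 (- \<i> * cor t))) \<longlongrightarrow> sqrt (pi / 2)) at_top"
proof -
 define k where "k t w = indicator {0<..} w *\<^sub>R (cor (w powr (1/2 - 1) * exp (- w)) * (- 2 * \<i> + cor (w / t)) powr mac_exp 0)" for t w :: real
 define k0 where "k0 w = indicator {0<..} w *\<^sub>R (cor (w powr (1/2 - 1) * exp (- w)) * (- 2 * \<i>) powr mac_exp 0)" for w :: real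
 have km: "k t \<in> borel_measurable borel" "k0 \<in> borel_measurable borel" for t
  unfolding k_def[abs_def] k0_def[abs_def] by measurable
 have kt: "cor (t powr (1/2)) * mac 0 (- \<i> * cor t) = (LBINT w. k t w)" if t: "0 < t" for t
 proof -
  have "cor (t powr (1/2)) * mac_ker 0 (- \<i> * cor t) w = k t w" for w
  proof (cases "0 < w")
   case True
   have "2 * (- \<i> * cor t) + cor w = cor t * (- 2 * \<i> + cor (w / t))"
    using t by (simp add: algebra_simps)
   also have "\<dots> powr mac_exp 0 = cor t powr mac_exp 0 * (- 2 * \<i> + cor (w / t)) powr mac_exp 0"
    using t by (intro powr_times_real_left) auto
   also have "cor t powr mac_exp 0 = cor (t powr (- (1/2)))"
    using t powr_of_real[of t "- (1/2)"] by (simp add: mac_exp_def)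
   finally have "cor (t powr (1/2)) * (2 * (- \<i> * cor t) + cor w) powr mac_exp 0 =
    cor (t powr (1/2) * t powr (- (1/2))) * (- 2 * \<i> + cor (w / t)) powr mac_exp 0"
    by simp
   also have "t powr (1/2) * t powr (- (1/2)) = 1" using t by (simp add: powr_minus)
   finally have e: "cor (t powr (1/2)) * (2 * (- \<i> * cor t) + cor w) powr mac_exp 0 =
    (- 2 * \<i> + cor (w / t)) powr mac_exp 0" by simp
   show ?thesis
    using True unfolding mac_ker_def k_def e[symmetric] by (simp add: mult_ac)
  qed (simp add: mac_ker_def k_def)
  thus ?thesis
   unfolding mac_def by (simp flip: integral_mult_right_zero)
 qed
 have "((\<lambda>t. LBINT w. k t w) \<longlongrightarrow> (LBINT w. k0 w)) at_top"
 proof (rule integral_dominated_convergence_at_top[where w="\<lambda>w. 2 powr (- (1/2)) * (indicator {0<..} w * (w powr (1/2 - 1) * exp (- w)))"])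
  show "integrable lborel (\<lambda>w. 2 powr (- (1/2)) * (indicator {0<..} w * (w powr (1/2 - 1) * exp (- w :: real))))"
   by (intro integrable_mult_right gamma_integrable) simp
  have b: "norm (k t w) \<le> 2 powr (- (1/2)) * (indicator {0<..} w * (w powr (1/2 - 1) * exp (- w)))" for t w
  proof (cases "0 < w")
   case True
   have "2 \<le> norm (- 2 * \<i> + cor (w / t))"
    using abs_Im_le_cmod[of "- 2 * \<i> + cor (w / t)"] by simp
   hence "norm ((- 2 * \<i> + cor (w / t)) powr mac_exp 0) \<le> 2 powr (- (1/2))"
    unfolding mac_exp_def by (subst norm_powr_real_powr') (auto intro!: powr_mono2')
   thus ?thesis
    using True by (simp add: k_def norm_mult abs_mult mult_left_mono mult.commute)
  qed (simp add: k_def)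
  show "\<forall>\<^sub>F t in at_top. AE w in lborel. norm (k t w) \<le> 2 powr (- (1/2)) * (indicator {0<..} w * (w powr (1/2 - 1) * exp (- w)))"
   using b by simp
  have "((\<lambda>t. k t w) \<longlongrightarrow> k0 w) at_top" for w
  proof -
   have "((\<lambda>t. - 2 * \<i> + cor (w / t)) \<longlongrightarrow> - 2 * \<i> + cor 0) at_top"
    by (intro tendsto_intros) real_asymp
   hence "((\<lambda>t. (- 2 * \<i> + cor (w / t)) powr mac_exp 0) \<longlongrightarrow> (- 2 * \<i>) powr mac_exp 0) at_top"
    by (intro tendsto_powr_complex tendsto_const) (simp_all add: complex_nonpos_Reals_iff)
   thus ?thesis unfolding k_def k0_def by (intro tendsto_scaleR tendsto_mult tendsto_const)
  qed
  thus "AE w in lborel. ((\<lambda>t. k t w) \<longlongrightarrow> k0 w) at_top" by simp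
 qed (use km in auto)
 hence lim: "((\<lambda>t. norm (LBINT w. k t w)) \<longlongrightarrow> norm (LBINT w. k0 w)) at_top"
  by (rule tendsto_norm)
 have n0: "norm (LBINT w. k0 w) = sqrt (pi / 2)"
 proof -
  have e: "k0 w = cor (indicator {0<..} w * (w powr (1/2 - 1) * exp (- w))) * (- 2 * \<i>) powr mac_exp 0" for w
   by (simp add: k0_def indicator_def)
  have "(LBINT w. k0 w) = cor (Gamma (1/2)) * (- 2 * \<i>) powr mac_exp 0"
   unfolding e integral_mult_left_zero integral_complex_of_real by (subst gamma_integrable(2)) auto
  moreover have "norm ((- 2 * \<i>) powr mac_exp 0) = 2 powr (- (1/2))"
   unfolding mac_exp_def by (subst norm_powr_real_powr') (auto simp: norm_mult)
  moreover have "2 powr (- (1/2)) = inverse (sqrt (2::real))"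
   by (simp add: powr_minus powr_half_sqrt)
  ultimately have "norm (LBINT w. k0 w) = \<bar>sqrt pi\<bar> * inverse (sqrt 2)"
   by (simp only: norm_mult norm_of_real Gamma_one_half_real)
  thus ?thesis
   by (simp only: real_sqrt_mult real_sqrt_inverse divide_inverse abs_of_nonneg real_sqrt_ge_zero pi_ge_zero)
 qed
 have "\<forall>\<^sub>F t in at_top. norm (LBINT w. k t w) = t powr (1/2) * norm (mac 0 (- \<i> * cor t))"
 proof (rule eventually_mono[OF eventually_gt_at_top[of 0]])
  fix t :: real assume "0 < t"
  thus "norm (LBINT w. k t w) = t powr (1/2) * norm (mac 0 (- \<i> * cor t))"
   unfolding kt[OF \<open>0 < t\<close>, symmetric] norm_mult[of "cor _"] norm_of_real by simp
 qed
 from Lim_transform_eventually[OF lim this] show ?thesis unfolding n0 .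
qed

text \<open>Multiplied by k^(4 - d), Phi depends on k and r through k r only. For d = 2 the constant
  - 1 / (4 pi) is - i / 8 times - 2 i / pi, and a also contains sqrt(pi / 2) from
  \<open>mac_at_infinity\<close>; for d = 3 the constant is - 1 / (8 pi).\<close>

lemma fund_sol_towers:
 assumes "DIM('a::euclidean_space) \<in> {2, 3}"
 obtains A B a where "symbol_tower ((real DIM('a) - 1) / 2) A" "symbol_tower ((real DIM('a) - 1) / 2) B"
  "((\<lambda>t. t powr ((real DIM('a) - 1) / 2) * norm (A 0 (cor t))) \<longlongrightarrow> a) at_top"
  "a\<^sup>2 = 1 / (16 * (2 * pi) ^ (DIM('a) - 1))"
  "\<And>k (x::'a) y. 0 < k ==> x \<noteq> y ==> cor (k powr (4 - real DIM('a))) * fund_sol k x y =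
   ei (k * norm (y - x)) * A 0 (cor (k * norm (y - x))) -
   exp (- cor (k * norm (y - x))) * B 0 (cor (k * norm (y - x)))"
proof (cases "DIM('a) = 2")
 case True
 let ?c = "- 1 / cor (4 * pi)"
 let ?A = "\<lambda>n z. ?c * (- \<i>) ^ n * (\<Prod>j<n. - of_nat (2 * j + 1)) * mac n (- \<i> * z)"
 let ?B = "\<lambda>n z. ?c * 1 ^ n * (\<Prod>j<n. - of_nat (2 * j + 1)) * mac n (1 * z)"
 show thesis
 proof (rule that[of ?A ?B "1 / (4 * pi) * sqrt (pi / 2)"])
  show "symbol_tower ((real DIM('a) - 1) / 2) ?A" "symbol_tower ((real DIM('a) - 1) / 2) ?B"
   using symbol_tower_mac[of "- \<i>" ?c] symbol_tower_mac[of 1 ?c] True by simp_all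
  show "((\<lambda>t. t powr ((real DIM('a) - 1) / 2) * norm (?A 0 (cor t))) \<longlongrightarrow> 1 / (4 * pi) * sqrt (pi / 2)) at_top"
   using tendsto_mult[OF tendsto_const[of "1 / (4 * pi)"] mac_at_infinity] True
   by (simp add: norm_mult norm_divide mult_ac)
  show "(1 / (4 * pi) * sqrt (pi / 2))\<^sup>2 = 1 / (16 * (2 * pi) ^ (DIM('a) - 1))"
   using True by (simp add: power_mult_distrib power2_eq_square)
  fix k :: real and x y :: 'a assume k: "0 < k" and xy: "x \<noteq> y"
  hence kr: "0 < k * norm (y - x)" by simp
  have p: "k powr (4 - real DIM('a)) = k\<^sup>2" using k True powr_realpow[of k 2] by simp
  show "cor (k powr (4 - real DIM('a))) * fund_sol k x y =
   ei (k * norm (y - x)) * ?A 0 (cor (k * norm (y - x))) -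
   exp (- cor (k * norm (y - x))) * ?B 0 (cor (k * norm (y - x)))"
   unfolding fund_sol_def Let_def norm_minus_commute[of x y] p if_P[OF True] hankel_real[OF kr] hankel_imag[OF kr]
   using k by (simp add: field_simps power2_eq_square)
 qed
next
 case False
 hence d: "DIM('a) = 3" using assms by auto
 let ?c = "- 1 / cor (8 * pi)"
 let ?A = "\<lambda>n z. ?c * (-1) ^ n * fact n * inverse z ^ Suc n"
 show thesis
 proof (rule that[of ?A ?A "1 / (8 * pi)"])
  show "symbol_tower ((real DIM('a) - 1) / 2) ?A" "symbol_tower ((real DIM('a) - 1) / 2) ?A"
   using symbol_tower_inverse[of ?c] d by simp_all
  show "((\<lambda>t. t powr ((real DIM('a) - 1) / 2) * norm (?A 0 (cor t))) \<longlongrightarrow> 1 / (8 * pi)) at_top"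
  proof (rule tendsto_eventually, rule eventually_mono[OF eventually_gt_at_top[of 0]])
   fix t :: real assume "0 < t"
   thus "t powr ((real DIM('a) - 1) / 2) * norm (?A 0 (cor t)) = 1 / (8 * pi)"
    using d by (simp add: norm_mult norm_divide norm_inverse)
  qed
  show "(1 / (8 * pi))\<^sup>2 = 1 / (16 * (2 * pi) ^ (DIM('a) - 1))"
   using d by (simp add: power2_eq_square)
  fix k :: real and x y :: 'a assume k: "0 < k" and xy: "x \<noteq> y"
  have p: "k powr (4 - real DIM('a)) = k" using k d by simp
  show "cor (k powr (4 - real DIM('a))) * fund_sol k x y =
   ei (k * norm (y - x)) * ?A 0 (cor (k * norm (y - x))) -
   exp (- cor (k * norm (y - x))) * ?A 0 (cor (k * norm (y - x)))"
   unfolding fund_sol_def Let_def norm_minus_commute[of x y] p if_not_P[OF False]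
   using k xy by (simp add: field_simps power2_eq_square)
 qed
qed

subsection \<open>Ergodic averages of Gaussian processes\<close>

text \<open>\<open>gaussian_rv\<close> admits constants, so the degenerate case, in which X is 0
  almost everywhere, is treated apart.\<close>

lemma gaussian_rv_moments:
 assumes "prob_space M" "gaussian_rv M X" "(LINT \<omega>|M. X \<omega>) = 0"
 shows "integrable M (\<lambda>\<omega>. (X \<omega>)\<^sup>2)" "integrable M (\<lambda>\<omega>. (X \<omega>) ^ 4)"
  "(LINT \<omega>|M. (X \<omega>) ^ 4) = 3 * (LINT \<omega>|M. (X \<omega>)\<^sup>2)\<^sup>2"
proof -
 interpret prob_space M by fact
 have Xm [measurable]: "X \<in> borel_measurable M"
  using assms(2) by (simp add: gaussian_rv_def)
 consider (n) c s where "s > 0" "distributed M lborel X (\<lambda>t. ennreal (normal_density c s t))"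
  | (c) c where "AE \<omega> in M. X \<omega> = c"
  using assms(2) unfolding gaussian_rv_def by blast
 hence "integrable M (\<lambda>\<omega>. (X \<omega>)\<^sup>2) \<and> integrable M (\<lambda>\<omega>. (X \<omega>) ^ 4) \<and>
  (LINT \<omega>|M. (X \<omega>) ^ 4) = 3 * (LINT \<omega>|M. (X \<omega>)\<^sup>2)\<^sup>2"
 proof cases
  case n
  have c: "c = 0"
   using normal_distributed_expectation[OF n] assms(3) by simp
  have i: "integrable M (\<lambda>\<omega>. (X \<omega>) ^ (2 * j))" for j
  proof -
   have "integrable lborel (\<lambda>x. normal_density c s x * x ^ (2 * j))"
    using integrable_normal_moment[OF n(1), of c "2 * j"] c by simp
   thus ?thesis
    by (subst distributed_integrable[OF n(2), symmetric]) (auto simp: normal_density_nonneg)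
  qed
  have e: "(LINT \<omega>|M. (X \<omega>) ^ (2 * j)) = fact (2 * j) / ((2 / s\<^sup>2) ^ j * fact j)" for j
  proof -
   have "(LINT \<omega>|M. (X \<omega>) ^ (2 * j)) = (LBINT x. normal_density c s x * x ^ (2 * j))"
    by (rule distributed_integral[OF n(2), symmetric]) (auto simp: normal_density_nonneg)
   thus ?thesis
    using integral_normal_moment_even[OF n(1), of c j] c by simp
  qed
  show ?thesis
   using i[of 1] i[of 2] e[of 1] e[of 2] n(1) by (simp add: fact_numeral field_simps power2_eq_square power4_eq_xxxx)
 next
  case c
  have "(LINT \<omega>|M. X \<omega>) = (LINT \<omega>|M. c)"
   by (rule integral_cong_AE) (use c in auto)
  hence "c = 0" using assms(3) by (simp add: prob_space)
  hence z: "AE \<omega> in M. X \<omega> = 0" using c by simp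
  have "integrable M (\<lambda>\<omega>. (X \<omega>) ^ j) \<and> (LINT \<omega>|M. (X \<omega>) ^ j) = 0" if "j > 0" for j
  proof -
   have "AE \<omega> in M. (X \<omega>) ^ j = 0" using z by eventually_elim (use that in simp)
   thus ?thesis
    using integrable_cong_AE[of "\<lambda>\<omega>. (X \<omega>) ^ j" M "\<lambda>_. 0"] integral_cong_AE[of "\<lambda>\<omega>. (X \<omega>) ^ j" M "\<lambda>_. 0"] by simp
  qed
  from this[of 2] this[of 4] show ?thesis by simp
 qed
 thus "integrable M (\<lambda>\<omega>. (X \<omega>)\<^sup>2)" "integrable M (\<lambda>\<omega>. (X \<omega>) ^ 4)"
  "(LINT \<omega>|M. (X \<omega>) ^ 4) = 3 * (LINT \<omega>|M. (X \<omega>)\<^sup>2)\<^sup>2" by auto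
qed

text \<open>By polarisation: X^2 Y^2 is a combination of the fourth powers of X + Y, X - Y, X and Y,
  each a centered Gaussian whose fourth moment is 3 times its squared variance.\<close>

lemma gaussian_isserlis:
 assumes "prob_space M" and g: "\<And>a b. gaussian_rv M (\<lambda>\<omega>. a * X \<omega> + b * Y \<omega>)"
  and z: "\<And>a b. (LINT \<omega>|M. a * X \<omega> + b * Y \<omega>) = 0"
 shows "integrable M (\<lambda>\<omega>. X \<omega> * Y \<omega>)" "integrable M (\<lambda>\<omega>. (X \<omega>)\<^sup>2 * (Y \<omega>)\<^sup>2)"
  "(LINT \<omega>|M. (X \<omega>)\<^sup>2 * (Y \<omega>)\<^sup>2) = (LINT \<omega>|M. (X \<omega>)\<^sup>2) * (LINT \<omega>|M. (Y \<omega>)\<^sup>2) + 2 * (LINT \<omega>|M. X \<omega> * Y \<omega>)\<^sup>2"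
proof -
 note m = gaussian_rv_moments[OF assms(1) g z]
 have X: "integrable M (\<lambda>\<omega>. (X \<omega>)\<^sup>2)" "integrable M (\<lambda>\<omega>. (X \<omega>) ^ 4)" "(LINT \<omega>|M. (X \<omega>) ^ 4) = 3 * (LINT \<omega>|M. (X \<omega>)\<^sup>2)\<^sup>2"
  using m[of 1 0] by simp_all
 have Y: "integrable M (\<lambda>\<omega>. (Y \<omega>)\<^sup>2)" "integrable M (\<lambda>\<omega>. (Y \<omega>) ^ 4)" "(LINT \<omega>|M. (Y \<omega>) ^ 4) = 3 * (LINT \<omega>|M. (Y \<omega>)\<^sup>2)\<^sup>2"
  using m[of 0 1] by simp_all
 have P: "integrable M (\<lambda>\<omega>. (X \<omega> + Y \<omega>)\<^sup>2)" "integrable M (\<lambda>\<omega>. (X \<omega> + Y \<omega>) ^ 4)"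
  "(LINT \<omega>|M. (X \<omega> + Y \<omega>) ^ 4) = 3 * (LINT \<omega>|M. (X \<omega> + Y \<omega>)\<^sup>2)\<^sup>2"
  using m[of 1 1] by simp_all
 have D: "integrable M (\<lambda>\<omega>. (X \<omega> - Y \<omega>)\<^sup>2)" "integrable M (\<lambda>\<omega>. (X \<omega> - Y \<omega>) ^ 4)"
  "(LINT \<omega>|M. (X \<omega> - Y \<omega>) ^ 4) = 3 * (LINT \<omega>|M. (X \<omega> - Y \<omega>)\<^sup>2)\<^sup>2"
  using m[of 1 "-1"] by simp_all
 have e1: "X \<omega> * Y \<omega> = 1/4 * (X \<omega> + Y \<omega>)\<^sup>2 - 1/4 * (X \<omega> - Y \<omega>)\<^sup>2" for \<omega>
  by (simp add: power2_eq_square algebra_simps)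
 show "integrable M (\<lambda>\<omega>. X \<omega> * Y \<omega>)"
  unfolding e1 using P D by simp
 have e2: "(X \<omega>)\<^sup>2 * (Y \<omega>)\<^sup>2 = 1/12 * (X \<omega> + Y \<omega>) ^ 4 + 1/12 * (X \<omega> - Y \<omega>) ^ 4 - (1/6 * (X \<omega>) ^ 4 + 1/6 * (Y \<omega>) ^ 4)" for \<omega>
  by (simp add: power2_eq_square power4_eq_xxxx algebra_simps)
 show "integrable M (\<lambda>\<omega>. (X \<omega>)\<^sup>2 * (Y \<omega>)\<^sup>2)"
  unfolding e2 using P D X Y by simp
 define vX vY r where "vX = (LINT \<omega>|M. (X \<omega>)\<^sup>2)" and "vY = (LINT \<omega>|M. (Y \<omega>)\<^sup>2)" and "r = (LINT \<omega>|M. X \<omega> * Y \<omega>)"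
 have s: "(X \<omega> + Y \<omega>)\<^sup>2 = (X \<omega>)\<^sup>2 + (Y \<omega>)\<^sup>2 + 2 * (X \<omega> * Y \<omega>)" "(X \<omega> - Y \<omega>)\<^sup>2 = (X \<omega>)\<^sup>2 + (Y \<omega>)\<^sup>2 - 2 * (X \<omega> * Y \<omega>)" for \<omega>
  by (simp_all add: power2_eq_square algebra_simps)
 have vP: "(LINT \<omega>|M. (X \<omega> + Y \<omega>)\<^sup>2) = vX + vY + 2 * r" "(LINT \<omega>|M. (X \<omega> - Y \<omega>)\<^sup>2) = vX + vY - 2 * r"
  unfolding s vX_def vY_def r_def using X(1) Y(1) \<open>integrable M (\<lambda>\<omega>. X \<omega> * Y \<omega>)\<close> by simp_all
 have "(LINT \<omega>|M. (X \<omega>)\<^sup>2 * (Y \<omega>)\<^sup>2) = 1/12 * (3 * (vX + vY + 2 * r)\<^sup>2) + 1/12 * (3 * (vX + vY - 2 * r)\<^sup>2)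
   - (1/6 * (3 * vX\<^sup>2) + 1/6 * (3 * vY\<^sup>2))"
  unfolding e2 using P D X Y by (simp add: vP vX_def[symmetric] vY_def[symmetric])
 also have "\<dots> = vX * vY + 2 * r\<^sup>2"
  by (simp add: power2_eq_square algebra_simps)
 finally show "(LINT \<omega>|M. (X \<omega>)\<^sup>2 * (Y \<omega>)\<^sup>2) = (LINT \<omega>|M. (X \<omega>)\<^sup>2) * (LINT \<omega>|M. (Y \<omega>)\<^sup>2) + 2 * (LINT \<omega>|M. X \<omega> * Y \<omega>)\<^sup>2"
  by (simp add: vX_def vY_def r_def)
qed

section \<open>From the variance estimate to almost sure averages\<close>

text \<open>Rounding k down to a multiple of 1 / (n + 1) leaves countably many values of k, hence a
  jointly measurable function; continuity in k gives convergence as n grows.\<close>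

lemma caratheodory_measurable:
 fixes f :: "real => 'w => real"
 assumes "\<And>k. f k \<in> borel_measurable M" "\<And>\<omega>. \<omega> \<in> space M ==> continuous_on UNIV (\<lambda>k. f k \<omega>)"
 shows "(\<lambda>z. f (fst z) (snd z)) \<in> borel_measurable (borel \<Otimes>\<^sub>M M)"
proof (rule borel_measurable_LIMSEQ_real)
 fix n :: nat
 have [measurable]: "(\<lambda>z. f c (snd z)) \<in> borel_measurable (borel \<Otimes>\<^sub>M M)" for c
  using assms(1)[of c] by measurable
 show "(\<lambda>z. f (real_of_int \<lfloor>fst z * real (Suc n)\<rfloor> / real (Suc n)) (snd z)) \<in> borel_measurable (borel \<Otimes>\<^sub>M M)"
  by (rule measurable_compose_countable[where f="\<lambda>i z. f (real_of_int i / real (Suc n)) (snd z)" and g="\<lambda>z. \<lfloor>fst z * real (Suc n)\<rfloor>"]) measurable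
next
 fix z :: "real \<times> 'w" assume "z \<in> space (borel \<Otimes>\<^sub>M M)"
 hence "snd z \<in> space M" by (auto simp: space_pair_measure)
 hence c: "isCont (\<lambda>k. f k (snd z)) (fst z)"
  using assms(2) continuous_on_eq_continuous_at[OF open_UNIV] by blast
 have "(\<lambda>n. real_of_int \<lfloor>fst z * real (Suc n)\<rfloor> / real (Suc n)) \<longlonglongrightarrow> fst z"
 proof (rule real_tendsto_sandwich[where f="\<lambda>n. fst z - inverse (real (Suc n))" and h="\<lambda>_. fst z"])
  have "(\<lambda>n. fst z - inverse (real (Suc n))) \<longlonglongrightarrow> fst z - 0"
   by (intro tendsto_intros LIMSEQ_inverse_real_of_nat)
  thus "(\<lambda>n. fst z - inverse (real (Suc n))) \<longlonglongrightarrow> fst z" by simp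
  show "\<forall>\<^sub>F n in sequentially. fst z - inverse (real (Suc n)) \<le> real_of_int \<lfloor>fst z * real (Suc n)\<rfloor> / real (Suc n)"
  proof (intro always_eventually allI)
   fix n
   have "fst z * real (Suc n) - 1 \<le> real_of_int \<lfloor>fst z * real (Suc n)\<rfloor>" by linarith
   hence "(fst z * real (Suc n) - 1) / real (Suc n) \<le> real_of_int \<lfloor>fst z * real (Suc n)\<rfloor> / real (Suc n)"
    by (rule divide_right_mono) simp
   thus "fst z - inverse (real (Suc n)) \<le> real_of_int \<lfloor>fst z * real (Suc n)\<rfloor> / real (Suc n)"
    by (simp add: diff_divide_distrib inverse_eq_divide del: of_nat_Suc)
  qed
  show "\<forall>\<^sub>F n in sequentially. real_of_int \<lfloor>fst z * real (Suc n)\<rfloor> / real (Suc n) \<le> fst z"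
   by (intro always_eventually allI) (simp add: field_simps del: of_nat_Suc)
 qed auto
 from isCont_tendsto_compose[OF c this]
 show "(\<lambda>n. f (real_of_int \<lfloor>fst z * real (Suc n)\<rfloor> / real (Suc n)) (snd z)) \<longlonglongrightarrow> f (fst z) (snd z)" .
qed

text \<open>Between consecutive squares m changes by O(n), which is o(T) for T of size n^2, and
  monotonicity traps S T - m T between its values at the two squares up to that change.\<close>

lemma monotone_interpolation:
 fixes S m :: "real => real"
 assumes "\<And>s t. 1 \<le> s ==> s \<le> t ==> S s \<le> S t" "\<And>s t. 1 \<le> s ==> s \<le> t ==> m s \<le> m t \<and> m t \<le> m s + C * (t - s)"
  and lim: "(\<lambda>n. (S ((real (Suc n))\<^sup>2) - m ((real (Suc n))\<^sup>2)) / (real (Suc n))\<^sup>2) \<longlonglongrightarrow> 0"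
 shows "((\<lambda>T. (S T - m T) / T) \<longlongrightarrow> 0) at_top"
proof (rule tendstoI)
 fix e :: real assume e: "e > 0"
 define V where "V n = S ((real (Suc n))\<^sup>2) - m ((real (Suc n))\<^sup>2)" for n
 have "eventually (\<lambda>n. \<bar>V n / (real (Suc n))\<^sup>2\<bar> < e / 8) sequentially"
  using tendstoD[OF lim, of "e / 8"] e by (simp add: V_def dist_real_def)
 then obtain n1 where n1: "\<And>n. n \<ge> n1 ==> \<bar>V n / (real (Suc n))\<^sup>2\<bar> < e / 8"
  unfolding eventually_sequentially by blast
 have "(\<lambda>n. \<bar>C\<bar> * 3 * inverse (real (Suc n))) \<longlonglongrightarrow> \<bar>C\<bar> * 3 * 0"
  by (intro tendsto_intros LIMSEQ_inverse_real_of_nat)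
 hence "eventually (\<lambda>n. \<bar>C\<bar> * 3 * inverse (real (Suc n)) < e / 2) sequentially"
  using e by (intro order_tendstoD(2)[where y="\<bar>C\<bar> * 3 * 0"]) auto
 then obtain n2 where n2: "\<And>n. n \<ge> n2 ==> \<bar>C\<bar> * 3 * inverse (real (Suc n)) < e / 2"
  unfolding eventually_sequentially by blast
 define N where "N = max n1 n2"
 show "eventually (\<lambda>T. dist ((S T - m T) / T) 0 < e) at_top"
  using eventually_ge_at_top[of "(real (Suc N))\<^sup>2"]
 proof eventually_elim
  case (elim T)
  \<comment> \<open>One less than the floor of sqrt T, as the sequence is indexed by
    \<open>Suc n\<close>.\<close>
  define n where "n = nat \<lfloor>sqrt T\<rfloor> - 1"
  have sT: "real (Suc N) \<le> sqrt T"
   using elim real_le_rsqrt by blast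
  have T0: "0 < T" using elim by (smt (verit) of_nat_0_less_iff zero_less_Suc zero_less_power)
  have fl: "1 \<le> \<lfloor>sqrt T\<rfloor>" "int (Suc N) \<le> \<lfloor>sqrt T\<rfloor>"
   using sT by linarith+
  hence rn: "real (Suc n) = real_of_int \<lfloor>sqrt T\<rfloor>" "N \<le> n"
   unfolding n_def by (auto simp: of_nat_diff nat_le_iff)
  have "real (Suc n) \<le> sqrt T" "sqrt T \<le> real (Suc (Suc n))"
   using rn by (auto simp: of_nat_Suc) linarith
  hence "(real (Suc n))\<^sup>2 \<le> (sqrt T)\<^sup>2" "(sqrt T)\<^sup>2 \<le> (real (Suc (Suc n)))\<^sup>2"
   using T0 by (intro power_mono; simp)+
  hence b: "(real (Suc n))\<^sup>2 \<le> T" "T \<le> (real (Suc (Suc n)))\<^sup>2"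
   using T0 by simp_all
  have 1: "1 \<le> (real (Suc n))\<^sup>2" by (rule one_le_power) simp
  have d: "(real (Suc (Suc n)))\<^sup>2 - (real (Suc n))\<^sup>2 = 2 * real (Suc n) + 1"
   by (simp add: power2_eq_square algebra_simps)
  have gap: "C * (2 * real (Suc n) + 1) \<le> \<bar>C\<bar> * (3 * real (Suc n))"
   by (rule order_trans[OF mult_right_mono[OF abs_ge_self]]) (auto intro!: mult_left_mono)
  have m12: "m ((real (Suc (Suc n)))\<^sup>2) \<le> m ((real (Suc n))\<^sup>2) + C * (2 * real (Suc n) + 1)"
   using assms(2)[OF 1 order_trans[OF b]] unfolding d by blast
  have U: "S T - m T \<le> V (Suc n) + C * (2 * real (Suc n) + 1)"
   using assms(1)[of T "(real (Suc (Suc n)))\<^sup>2"] assms(2)[OF 1 b(1)] b 1 m12 by (simp add: V_def)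
  have L: "V n - C * (2 * real (Suc n) + 1) \<le> S T - m T"
   using assms(1)[OF 1 b(1)] assms(2)[of T "(real (Suc (Suc n)))\<^sup>2"] b 1 m12 by (simp add: V_def)
  have v1: "\<bar>V n\<bar> \<le> e / 8 * (real (Suc n))\<^sup>2"
   using n1[of n] rn(2) by (simp add: N_def abs_divide field_simps del: of_nat_Suc)
  have "\<bar>V (Suc n)\<bar> \<le> e / 8 * (real (Suc (Suc n)))\<^sup>2"
   using n1[of "Suc n"] rn(2) by (simp add: N_def abs_divide field_simps del: of_nat_Suc)
  also have "\<dots> \<le> e / 8 * (2 * real (Suc n))\<^sup>2"
   using e by (intro mult_left_mono power_mono) auto
  finally have v2: "\<bar>V (Suc n)\<bar> \<le> e / 2 * (real (Suc n))\<^sup>2"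
   by (simp only: power_mult_distrib) simp
  have "\<bar>C\<bar> * 3 * inverse (real (Suc n)) * (real (Suc n))\<^sup>2 < e / 2 * (real (Suc n))\<^sup>2"
   using n2[of n] rn(2) 1 by (intro mult_strict_right_mono) (auto simp: N_def)
  hence c: "\<bar>C\<bar> * (3 * real (Suc n)) < e / 2 * (real (Suc n))\<^sup>2"
   by (simp add: power2_eq_square mult.assoc del: of_nat_Suc)
  have "e / 8 * (real (Suc n))\<^sup>2 \<le> e / 2 * (real (Suc n))\<^sup>2"
   using e by (intro mult_right_mono) auto
  hence "\<bar>S T - m T\<bar> < e * (real (Suc n))\<^sup>2"
   using U L v1 v2 c gap by linarith
  also have "\<dots> \<le> e * T" using b e by (intro mult_left_mono) auto
  finally show ?case using T0 by (simp add: dist_real_def abs_divide field_simps)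
 qed
qed

lemma running_average_limit:
 fixes g :: "real => real"
 assumes [measurable]: "g \<in> borel_measurable borel" and lim: "(g \<longlongrightarrow> L) at_top"
 shows "((\<lambda>T. 1 / T * (LBINT k:{T..2*T}. g k)) \<longlongrightarrow> L) at_top"
proof (rule tendstoI)
 fix e :: real assume e: "e > 0"
 obtain T0 where T0: "\<And>k. T0 \<le> k ==> \<bar>g k - L\<bar> < e / 2"
  using tendstoD[OF lim, of "e / 2"] e unfolding eventually_at_top_linorder dist_real_def by auto
 show "eventually (\<lambda>T. dist (1 / T * (LBINT k:{T..2*T}. g k)) L < e) at_top"
  using eventually_ge_at_top[of "max 1 T0"]
 proof eventually_elim
  case (elim T)
  have T: "0 < T" "T0 \<le> T" using elim by auto
  have i1: "set_integrable lborel {T..2*T} (\<lambda>k. g k - L)"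
   unfolding set_integrable_def
   by (rule integrableI_bounded_set[where A="{T..2*T}" and B="e/2"])
    (use T0 T in \<open>auto simp: indicator_def less_imp_le intro!: AE_I2\<close>)
  have i2: "set_integrable lborel {T..2*T} (\<lambda>k. c)" for c :: real
   unfolding set_integrable_def
   by (intro integrable_scaleR_left integrable_real_indicator) (use T in auto)
  have "(LBINT k:{T..2*T}. g k) = (LBINT k:{T..2*T}. (g k - L) + L)"
   by simp
  also have "\<dots> = (LBINT k:{T..2*T}. g k - L) + T * L"
   using T by (subst set_integral_add(2)[OF i1 i2]) (simp add: set_lebesgue_integral_def)
  finally have eq: "1 / T * (LBINT k:{T..2*T}. g k) - L = 1 / T * (LBINT k:{T..2*T}. g k - L)"
   using T by (simp add: field_simps)
  have "\<bar>LBINT k:{T..2*T}. g k - L\<bar> \<le> (LBINT k:{T..2*T}. e / 2)"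
   unfolding set_lebesgue_integral_def
   by (rule order_trans[OF integral_abs_bound
      integral_mono[OF integrable_abs[OF i1[unfolded set_integrable_def]] i2[unfolded set_integrable_def]]])
    (use T0 T in \<open>auto simp: indicator_def less_imp_le\<close>)
  also have "\<dots> = T * (e / 2)" using T by (simp add: set_lebesgue_integral_def)
  finally have "\<bar>1 / T * (LBINT k:{T..2*T}. g k - L)\<bar> \<le> e / 2"
   using T by (simp add: abs_mult field_simps)
  thus ?case using e unfolding dist_real_def eq by linarith
 qed
qed

lemma nn_integral_inverse_1_plus_sq_le: "(NN t. ennreal (inverse (1 + t\<^sup>2))) \<le> ennreal 4"
proof -
 have i: "integrable lborel (\<lambda>s::real. inverse (1 + s\<^sup>2))"
  using integrable_inverse_1_plus_square by (simp add: set_integrable_def)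
 have "(LBINT x=-\<infinity>..\<infinity>. inverse (1 + x^2)) = pi"
  by (rule LBINT_inverse_1_plus_square)
 hence "(LBINT s. inverse (1 + s\<^sup>2)) = pi"
  by (simp add: interval_lebesgue_integral_def set_lebesgue_integral_def einterval_def)
 thus ?thesis
  by (subst nn_integral_eq_integral[OF i]) (use ennreal_leI[OF less_imp_le[OF pi_less_4]] in \<open>auto intro!: add_nonneg_nonneg\<close>)
qed

text \<open>The variance of the integrals over \<open>[1, T]\<close> grows at most linearly in \<open>T\<close>.\<close>

lemma decay_square_integral:
 fixes r :: "real => real => real"
 assumes "\<And>k l. 1 \<le> k ==> 1 \<le> l ==> \<bar>r k l\<bar> \<le> C * (1 / (1 + \<bar>k - l\<bar>) + 1 / min k l)" "0 \<le> C" "1 \<le> T"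
 shows "(NN k. indicator {1..T} k * (NN l. indicator {1..T} l * ennreal ((r k l)\<^sup>2))) \<le> ennreal (40 * C\<^sup>2 * T)"
proof -
 define w where "w t = inverse (1 + t\<^sup>2)" for t :: real
 have w: "0 \<le> w t" for t unfolding w_def by (simp add: add_nonneg_nonneg)
 have [measurable]: "w \<in> borel_measurable borel" unfolding w_def[abs_def] by measurable
 \<comment> \<open>Both decay terms are replaced by the integrable weight 1 / (1 + t^2) at k - l, k
   and l, so that each of the double integrals over [1, T]^2 is O(T).\<close>
 have pt: "(r k l)\<^sup>2 \<le> 2 * C\<^sup>2 * (w (k - l) + 2 * w k + 2 * w l)" if "1 \<le> k" "1 \<le> l" for k l
 proof -
  have "(r k l)\<^sup>2 \<le> (C * (1 / (1 + \<bar>k - l\<bar>) + 1 / min k l))\<^sup>2"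
   using power_mono[OF assms(1)[OF that] abs_ge_zero, of 2] by (simp only: power2_abs)
  also have "\<dots> \<le> C\<^sup>2 * (2 * (1 / (1 + \<bar>k - l\<bar>))\<^sup>2 + 2 * (1 / min k l)\<^sup>2)"
  proof -
   have "(a + b)\<^sup>2 \<le> 2 * a\<^sup>2 + 2 * b\<^sup>2" for a b :: real
    using sum_squares_bound[of a b] by (simp add: power2_sum)
   thus ?thesis
    unfolding power_mult_distrib by (rule mult_left_mono) simp
  qed
  also have "\<dots> \<le> C\<^sup>2 * (2 * w (k - l) + 2 * (2 * w k + 2 * w l))"
  proof -
   have "(1 / (1 + \<bar>k - l\<bar>))\<^sup>2 \<le> w (k - l)"
   proof -
    have "1 + (k - l)\<^sup>2 \<le> (1 + \<bar>k - l\<bar>)\<^sup>2" by (simp add: power2_sum)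
    hence "inverse ((1 + \<bar>k - l\<bar>)\<^sup>2) \<le> inverse (1 + (k - l)\<^sup>2)"
     by (rule le_imp_inverse_le) (auto intro: add_pos_nonneg)
    thus ?thesis by (simp add: w_def power_divide inverse_eq_divide)
   qed
   moreover have "(1 / min k l)\<^sup>2 \<le> 2 * w k + 2 * w l"
   proof -
    have "(1 / s)\<^sup>2 \<le> 2 * w s" if "1 \<le> s" for s
    proof -
     have "1 \<le> s\<^sup>2" using that by (rule one_le_power)
     hence "inverse (s\<^sup>2 + s\<^sup>2) \<le> inverse (1 + s\<^sup>2)"
      by (intro le_imp_inverse_le) auto
     moreover have "2 * inverse (s\<^sup>2 + s\<^sup>2) = (1 / s)\<^sup>2"
      using that by (simp add: field_simps power2_eq_square)
     ultimately show ?thesis unfolding w_def by linarith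
    qed
    thus ?thesis
     using that w[of k] w[of l] by (smt (verit) min_def)
   qed
   ultimately show ?thesis by (intro mult_left_mono) auto
  qed
  finally show ?thesis by (simp add: algebra_simps)
 qed
 have shift: "(NN l. ennreal (w (k - l))) = (NN l. ennreal (w l))" for k
  using nn_integral_real_affine[of "\<lambda>l. ennreal (w l)" "-1" k] by simp
 define W where "W = (NN l. ennreal (w l))"
 have W4: "W \<le> 4" using nn_integral_inverse_1_plus_sq_le by (simp add: W_def w_def)
 have IT: "(NN l. indicator {1..T} l) = ennreal (T - 1)"
  using assms(3) by simp
 \<comment> \<open>The integral W of w is at most 4, so w (k - l) and 2 w l contribute at most 12,
   and 2 w k at most 2 T w k. Integration over k then gives 2 C^2 (12 T + 8 T) = 40 C^2 T.\<close>
 have inner: "indicator {1..T} k * (NN l. indicator {1..T} l * ennreal ((r k l)\<^sup>2)) \<le>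
   ennreal (2 * C\<^sup>2) * (indicator {1..T} k * (ennreal 12 + ennreal (2 * T) * ennreal (w k)))" for k
 proof (cases "k \<in> {1..T}")
  case True
  have "(NN l. indicator {1..T} l * ennreal ((r k l)\<^sup>2)) \<le>
    (NN l. ennreal (2 * C\<^sup>2) * (ennreal (w (k - l)) + (ennreal (2 * w k) * indicator {1..T} l + ennreal 2 * ennreal (w l))))"
  proof (rule nn_integral_mono)
   fix l
   show "indicator {1..T} l * ennreal ((r k l)\<^sup>2) \<le>
    ennreal (2 * C\<^sup>2) * (ennreal (w (k - l)) + (ennreal (2 * w k) * indicator {1..T} l + ennreal 2 * ennreal (w l)))"
   proof (cases "l \<in> {1..T}")
    case l: True
    have "ennreal ((r k l)\<^sup>2) \<le> ennreal (2 * C\<^sup>2 * (w (k - l) + (2 * w k + 2 * w l)))"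
     using pt[of k l] True l by (intro ennreal_leI) (simp add: add.assoc)
    also have "\<dots> = ennreal (2 * C\<^sup>2) * (ennreal (w (k - l)) + (ennreal (2 * w k) + ennreal 2 * ennreal (w l)))"
    proof -
     have "ennreal (w (k - l) + (2 * w k + 2 * w l)) = ennreal (w (k - l)) + (ennreal (2 * w k) + ennreal (2 * w l))"
      using w by (simp add: ennreal_plus)
     moreover have "ennreal (2 * w l) = ennreal 2 * ennreal (w l)" by (rule ennreal_mult') simp
     moreover have "ennreal (2 * C\<^sup>2 * (w (k - l) + (2 * w k + 2 * w l))) = ennreal (2 * C\<^sup>2) * ennreal (w (k - l) + (2 * w k + 2 * w l))"
      by (rule ennreal_mult') simp
     ultimately show ?thesis by simp
    qed
    finally show ?thesis using l by simp
   qed simp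
  qed
  also have "\<dots> = ennreal (2 * C\<^sup>2) * (W + (ennreal (2 * w k) * ennreal (T - 1) + ennreal 2 * W))"
   by (simp add: nn_integral_cmult nn_integral_add shift W_def[symmetric] IT[symmetric])
  also have "\<dots> \<le> ennreal (2 * C\<^sup>2) * (4 + (ennreal (2 * w k) * ennreal T + ennreal 2 * 4))"
   by (intro mult_left_mono add_mono W4 ennreal_leI) auto
  also have "\<dots> = ennreal (2 * C\<^sup>2) * (ennreal 12 + ennreal (2 * T) * ennreal (w k))"
   using assms(3) w[of k]
   by (simp add: ennreal_mult'[symmetric] ennreal_mult''[symmetric] ennreal_plus[symmetric] ennreal_numeral[symmetric] mult_ac
     del: ennreal_plus ennreal_numeral)
  finally show ?thesis using True by simp
 qed simp
 have "(NN k. indicator {1..T} k * (NN l. indicator {1..T} l * ennreal ((r k l)\<^sup>2))) \<le>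
  (NN k. ennreal (2 * C\<^sup>2) * (ennreal 12 * indicator {1..T} k + ennreal (2 * T) * ennreal (w k)))"
  by (rule nn_integral_mono, rule order_trans[OF inner])
   (auto simp: indicator_def intro!: mult_left_mono)
 also have "\<dots> = ennreal (2 * C\<^sup>2) * (ennreal 12 * ennreal (T - 1) + ennreal (2 * T) * W)"
  by (simp add: nn_integral_cmult nn_integral_add W_def[symmetric] IT[symmetric])
 also have "\<dots> \<le> ennreal (2 * C\<^sup>2) * (ennreal 12 * ennreal T + ennreal (2 * T) * 4)"
  by (intro mult_left_mono add_mono W4 ennreal_leI) auto
 also have "\<dots> = ennreal (40 * C\<^sup>2 * T)"
  using assms(3)
  by (simp add: ennreal_mult'[symmetric] ennreal_mult''[symmetric] ennreal_plus[symmetric] ennreal_numeral[symmetric] mult_ac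
    del: ennreal_plus ennreal_numeral)
 finally show ?thesis .
qed

theorem gaussian_process_average:
 fixes Y :: "real => 'w => real"
 assumes M: "prob_space M"
  and cont: "\<And>\<omega>. \<omega> \<in> space M ==> continuous_on {1..} (\<lambda>k. Y k \<omega>)"
  and gauss: "\<And>k l a b. 1 \<le> k ==> 1 \<le> l ==> gaussian_rv M (\<lambda>\<omega>. a * Y k \<omega> + b * Y l \<omega>)"
  and cent: "\<And>k l a b. 1 \<le> k ==> 1 \<le> l ==> (LINT \<omega>|M. a * Y k \<omega> + b * Y l \<omega>) = 0"
  and decay: "\<And>k l. 1 \<le> k ==> 1 \<le> l ==> \<bar>LINT \<omega>|M. Y k \<omega> * Y l \<omega>\<bar> \<le> C * (1 / (1 + \<bar>k - l\<bar>) + 1 / min k l)"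
 shows "(\<lambda>k. LINT \<omega>|M. (Y (max 1 k) \<omega>)\<^sup>2) \<in> borel_measurable borel"
  and "AE \<omega> in M. ((\<lambda>T. 1 / T * (LBINT k:{T..2*T}. (Y k \<omega>)\<^sup>2) - 1 / T * (LBINT k:{T..2*T}. (LINT \<omega>|M. (Y (max 1 k) \<omega>)\<^sup>2))) \<longlongrightarrow> 0) at_top"
proof -
 interpret prob_space M by (rule M)
 interpret P: pair_sigma_finite "lborel :: real measure" M ..
 \<comment> \<open>Y is extended to k < 1 by its value at 1, so that paths are continuous and
   variances bounded on the whole line; \<open>max 1 k\<close> in the statement has the same
   origin.\<close>
 define Z where "Z k \<omega> = Y (max 1 k) \<omega>" for k \<omega>
 have Z1: "Z k = Y k" if "1 \<le> k" for k using that by (simp add: Z_def fun_eq_iff)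
 have Zm: "Z k \<in> borel_measurable M" for k
  using gauss[of "max 1 k" "max 1 k" 1 0] by (simp add: gaussian_rv_def Z_def[abs_def])
 have Zc: "continuous_on UNIV (\<lambda>k. Z k \<omega>)" if "\<omega> \<in> space M" for \<omega>
  unfolding Z_def
  by (rule continuous_on_compose2[OF cont[OF that], of UNIV "\<lambda>k. max 1 k"]) (auto intro!: continuous_intros)
 have ZM [measurable]: "(\<lambda>z. Z (fst z) (snd z)) \<in> borel_measurable (borel \<Otimes>\<^sub>M M)"
  by (rule caratheodory_measurable[OF Zm Zc])
 have ZM' [measurable]: "(\<lambda>z. Z (snd z) (fst z)) \<in> borel_measurable (M \<Otimes>\<^sub>M borel)"
  using measurable_compose[OF _ ZM, of "\<lambda>z. (snd z, fst z)" "M \<Otimes>\<^sub>M borel"] by simp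
 define q where "q k = (LINT \<omega>|M. (Z k \<omega>)\<^sup>2)" for k
 show qm: "(\<lambda>k. LINT \<omega>|M. (Y (max 1 k) \<omega>)\<^sup>2) \<in> borel_measurable borel"
  unfolding Z_def[symmetric] by (rule borel_measurable_lebesgue_integral) (simp add: case_prod_unfold)
 hence [measurable]: "q \<in> borel_measurable borel" by (simp add: q_def[abs_def] Z_def)
 define r where "r k l = (LINT \<omega>|M. Z k \<omega> * Z l \<omega>)" for k l
 have isr: "integrable M (\<lambda>\<omega>. (Z k \<omega>)\<^sup>2 * (Z l \<omega>)\<^sup>2)" "(LINT \<omega>|M. (Z k \<omega>)\<^sup>2 * (Z l \<omega>)\<^sup>2) = q k * q l + 2 * (r k l)\<^sup>2" for k l
  using gaussian_isserlis[OF M, of "Z k" "Z l"] gauss[of "max 1 k" "max 1 l"] cent[of "max 1 k" "max 1 l"]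
  by (simp_all add: Z_def[abs_def] q_def r_def)
 have isq: "integrable M (\<lambda>\<omega>. (Z k \<omega>)\<^sup>2)" for k
  using gaussian_rv_moments(1)[OF M gauss[of "max 1 k" "max 1 k" 1 0] cent] by (simp add: Z_def[abs_def])
 have C0: "0 \<le> C"
  using order_trans[OF abs_ge_zero decay[of 1 1]] by simp
 have q0: "0 \<le> q k" for k unfolding q_def by simp
 have rb: "\<bar>r k l\<bar> \<le> C * (1 / (1 + \<bar>k - l\<bar>) + 1 / min k l)" if "1 \<le> k" "1 \<le> l" for k l
  using decay[OF that] that by (simp add: r_def Z1)
 have qb: "q k \<le> 2 * C" for k
 proof -
  have "q k = r (max 1 k) (max 1 k)" by (simp add: q_def r_def Z_def power2_eq_square)
  also have "\<dots> \<le> C * (1 + 1 / max 1 k)" using rb[of "max 1 k" "max 1 k"] by simp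
  also have "\<dots> \<le> C * 2" using C0 by (intro mult_left_mono) auto
  finally show ?thesis by simp
 qed
 have fin: "set_integrable lborel {a..b} (\<lambda>k. (Z k \<omega>)\<^sup>2)" if "\<omega> \<in> space M" for \<omega> and a b :: real
  unfolding set_integrable_def
  by (rule borel_integrable_compact[OF compact_Icc]) (intro continuous_intros continuous_on_subset[OF Zc[OF that]]; simp)
 have finq: "set_integrable lborel {a..b} q" for a b :: real
  unfolding set_integrable_def
  by (rule integrableI_bounded_set[where A="{a..b}" and B="2 * C"])
   (use qb q0 in \<open>auto simp: indicator_def intro!: AE_I2\<close>, simp add: emeasure_lborel_Icc_eq)
 define S where "S T \<omega> = (LBINT k:{1..T}. (Z k \<omega>)\<^sup>2)" for T \<omega>
 define m where "m T = (LBINT k:{1..T}. q k)" for T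
 have S0: "0 \<le> S T \<omega>" for T \<omega>
  unfolding S_def set_lebesgue_integral_def by (intro Bochner_Integration.integral_nonneg) simp
 have m0: "0 \<le> m T" for T
  unfolding m_def set_lebesgue_integral_def using q0 by (intro Bochner_Integration.integral_nonneg) simp
 have [measurable]: "S T \<in> borel_measurable M" for T
  unfolding S_def set_lebesgue_integral_def
  by (rule lborel.borel_measurable_lebesgue_integral) (simp add: case_prod_unfold, measurable)
 have Snn: "ennreal (S T \<omega>) = (NN k. indicator {1..T} k * ennreal ((Z k \<omega>)\<^sup>2))" if "\<omega> \<in> space M" for T \<omega>
  unfolding S_def set_lebesgue_integral_def
  by (subst nn_integral_eq_integral[OF fin[OF that, unfolded set_integrable_def], symmetric])
   (auto intro!: nn_integral_cong simp: indicator_def)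
 have mnn: "ennreal (m T) = (NN k. indicator {1..T} k * ennreal (q k))" for T
  unfolding m_def set_lebesgue_integral_def
  by (subst nn_integral_eq_integral[OF finq[unfolded set_integrable_def], symmetric])
   (use q0 in \<open>auto intro!: nn_integral_cong simp: indicator_def\<close>)
 have ES: "(\<integral>\<^sup>+\<omega>. ennreal (S T \<omega>) \<partial>M) = ennreal (m T)" for T
 proof -
  have "(\<integral>\<^sup>+\<omega>. ennreal (S T \<omega>) \<partial>M) = (\<integral>\<^sup>+\<omega>. (NN k. indicator {1..T} k * ennreal ((Z k \<omega>)\<^sup>2)) \<partial>M)"
   by (rule nn_integral_cong) (rule Snn)
  also have "\<dots> = (NN k. (\<integral>\<^sup>+\<omega>. indicator {1..T} k * ennreal ((Z k \<omega>)\<^sup>2) \<partial>M))"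
   by (rule P.Fubini') (simp add: case_prod_unfold, measurable)
  also have "\<dots> = (NN k. indicator {1..T} k * ennreal (q k))"
   using Zm by (simp add: nn_integral_cmult nn_integral_eq_integral[OF isq] q_def)
  finally show ?thesis by (simp add: mnn)
 qed
 \<comment> \<open>In Isserlis' formula q k q l integrates to (m T)^2, and 2 (r k l)^2 gives 80 = 2
   * 40.\<close>
 have ES2: "(\<integral>\<^sup>+\<omega>. ennreal ((S T \<omega>)\<^sup>2) \<partial>M) \<le> ennreal ((m T)\<^sup>2 + 80 * C\<^sup>2 * T)" if T: "1 \<le> T" for T
 proof -
  have [measurable]: "(\<lambda>z. r (fst z) (snd z)) \<in> borel_measurable (borel \<Otimes>\<^sub>M borel)"
  proof -
   have "(\<lambda>z. LINT \<omega>|M. Z (fst z) \<omega> * Z (snd z) \<omega>) \<in> borel_measurable (borel \<Otimes>\<^sub>M borel :: (real \<times> real) measure)"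
   proof (rule borel_measurable_lebesgue_integral)
    have "(\<lambda>y. Z (fst (fst y)) (snd y)) \<in> borel_measurable ((borel \<Otimes>\<^sub>M borel) \<Otimes>\<^sub>M M)"
     "(\<lambda>y. Z (snd (fst y)) (snd y)) \<in> borel_measurable ((borel \<Otimes>\<^sub>M borel) \<Otimes>\<^sub>M M)"
     using measurable_compose[OF _ ZM, of "\<lambda>y. (fst (fst y), snd y)" "(borel \<Otimes>\<^sub>M borel) \<Otimes>\<^sub>M M"]
      measurable_compose[OF _ ZM, of "\<lambda>y. (snd (fst y), snd y)" "(borel \<Otimes>\<^sub>M borel) \<Otimes>\<^sub>M M"] by simp_all
    thus "(\<lambda>(z, \<omega>). Z (fst z) \<omega> * Z (snd z) \<omega>) \<in> borel_measurable ((borel \<Otimes>\<^sub>M borel) \<Otimes>\<^sub>M M)"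
     unfolding case_prod_unfold by (rule borel_measurable_times)
   qed
   thus ?thesis by (simp add: r_def)
  qed
  have ZS: "(\<integral>\<^sup>+\<omega>. ennreal ((Z k \<omega>)\<^sup>2) * ennreal (S T \<omega>) \<partial>M) =
    (NN l. indicator {1..T} l * ennreal (q k * q l + 2 * (r k l)\<^sup>2))" for k
  proof -
   have "(\<integral>\<^sup>+\<omega>. ennreal ((Z k \<omega>)\<^sup>2) * ennreal (S T \<omega>) \<partial>M) =
     (\<integral>\<^sup>+\<omega>. (NN l. indicator {1..T} l * (ennreal ((Z k \<omega>)\<^sup>2) * ennreal ((Z l \<omega>)\<^sup>2))) \<partial>M)"
   proof (rule nn_integral_cong)
    fix \<omega> assume w: "\<omega> \<in> space M"
    have [measurable]: "(\<lambda>l. Z l \<omega>) \<in> borel_measurable borel"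
     by (rule borel_measurable_continuous_onI[OF Zc[OF w]])
    show "ennreal ((Z k \<omega>)\<^sup>2) * ennreal (S T \<omega>) =
      (NN l. indicator {1..T} l * (ennreal ((Z k \<omega>)\<^sup>2) * ennreal ((Z l \<omega>)\<^sup>2)))"
     unfolding Snn[OF w] by (subst nn_integral_cmult[symmetric]) (auto simp: mult_ac)
   qed
   also have "\<dots> = (NN l. (\<integral>\<^sup>+\<omega>. indicator {1..T} l * (ennreal ((Z k \<omega>)\<^sup>2) * ennreal ((Z l \<omega>)\<^sup>2)) \<partial>M))"
    using Zm[of k] by (intro P.Fubini') (simp add: case_prod_unfold, measurable)
   also have "\<dots> = (NN l. indicator {1..T} l * ennreal (q k * q l + 2 * (r k l)\<^sup>2))"
   proof (rule nn_integral_cong)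
    fix l
    have "(\<integral>\<^sup>+\<omega>. ennreal ((Z k \<omega>)\<^sup>2) * ennreal ((Z l \<omega>)\<^sup>2) \<partial>M) = (\<integral>\<^sup>+\<omega>. ennreal ((Z k \<omega>)\<^sup>2 * (Z l \<omega>)\<^sup>2) \<partial>M)"
     by (intro nn_integral_cong) (simp add: ennreal_mult')
    also have "\<dots> = ennreal (q k * q l + 2 * (r k l)\<^sup>2)"
     by (subst nn_integral_eq_integral[OF isr(1)]) (auto simp: isr(2))
    finally show "(\<integral>\<^sup>+\<omega>. indicator {1..T} l * (ennreal ((Z k \<omega>)\<^sup>2) * ennreal ((Z l \<omega>)\<^sup>2)) \<partial>M) =
      indicator {1..T} l * ennreal (q k * q l + 2 * (r k l)\<^sup>2)"
     using Zm[of k] Zm[of l] by (subst nn_integral_cmult) auto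
   qed
   finally show ?thesis .
  qed
  have "(\<integral>\<^sup>+\<omega>. ennreal ((S T \<omega>)\<^sup>2) \<partial>M) =
    (\<integral>\<^sup>+\<omega>. (NN k. indicator {1..T} k * (ennreal ((Z k \<omega>)\<^sup>2) * ennreal (S T \<omega>))) \<partial>M)"
  proof (rule nn_integral_cong)
   fix \<omega> assume w: "\<omega> \<in> space M"
   have [measurable]: "(\<lambda>l. Z l \<omega>) \<in> borel_measurable borel"
    by (rule borel_measurable_continuous_onI[OF Zc[OF w]])
   have "ennreal ((S T \<omega>)\<^sup>2) = ennreal (S T \<omega>) * ennreal (S T \<omega>)"
    using S0 by (simp add: power2_eq_square ennreal_mult')
   thus "ennreal ((S T \<omega>)\<^sup>2) = (NN k. indicator {1..T} k * (ennreal ((Z k \<omega>)\<^sup>2) * ennreal (S T \<omega>)))"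
    by (simp add: Snn[OF w] nn_integral_multc mult.assoc[symmetric])
  qed
  also have "\<dots> = (NN k. (\<integral>\<^sup>+\<omega>. indicator {1..T} k * (ennreal ((Z k \<omega>)\<^sup>2) * ennreal (S T \<omega>)) \<partial>M))"
   by (rule P.Fubini') (simp add: case_prod_unfold, measurable)
  also have "\<dots> = (NN k. indicator {1..T} k * (NN l. indicator {1..T} l * ennreal (q k * q l + 2 * (r k l)\<^sup>2)))"
   unfolding ZS[symmetric] using Zm by (intro nn_integral_cong nn_integral_cmult) auto
  also have "\<dots> = (NN k. indicator {1..T} k * (ennreal (q k) * ennreal (m T)) +
    2 * (indicator {1..T} k * (NN l. indicator {1..T} l * ennreal ((r k l)\<^sup>2))))"
  proof (rule nn_integral_cong)
   fix k
   have [measurable]: "r k \<in> borel_measurable borel"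
    using measurable_compose[OF _ \<open>(\<lambda>z. r (fst z) (snd z)) \<in> borel_measurable (borel \<Otimes>\<^sub>M borel)\<close>, of "Pair k" borel] by simp
   have "(NN l. indicator {1..T} l * ennreal (q k * q l + 2 * (r k l)\<^sup>2)) =
    (NN l. ennreal (q k) * (indicator {1..T} l * ennreal (q l)) + 2 * (indicator {1..T} l * ennreal ((r k l)\<^sup>2)))"
    using q0 by (intro nn_integral_cong) (simp add: ennreal_mult' ennreal_plus distrib_left mult_ac)
   also have "\<dots> = ennreal (q k) * ennreal (m T) + 2 * (NN l. indicator {1..T} l * ennreal ((r k l)\<^sup>2))"
    unfolding mnn by (simp add: nn_integral_add nn_integral_cmult)
   finally show "indicator {1..T} k * (NN l. indicator {1..T} l * ennreal (q k * q l + 2 * (r k l)\<^sup>2)) =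
     indicator {1..T} k * (ennreal (q k) * ennreal (m T)) + 2 * (indicator {1..T} k * (NN l. indicator {1..T} l * ennreal ((r k l)\<^sup>2)))"
    by (simp add: distrib_left mult_ac)
  qed
  also have "\<dots> = ennreal (m T) * ennreal (m T) +
    2 * (NN k. indicator {1..T} k * (NN l. indicator {1..T} l * ennreal ((r k l)\<^sup>2)))"
  proof -
   have "(\<lambda>k. NN l. indicator {1..T} l * ennreal ((r k l)\<^sup>2)) \<in> borel_measurable borel"
    by (rule lborel.borel_measurable_nn_integral) (simp add: case_prod_unfold, measurable)
   note this[measurable]
   have "(NN k. indicator {1..T} k * (ennreal (q k) * ennreal (m T))) = ennreal (m T) * ennreal (m T)"
    by (simp add: mnn nn_integral_multc mult.assoc[symmetric])
   thus ?thesis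
    by (subst nn_integral_add) (auto simp: nn_integral_cmult)
  qed
  also have "\<dots> \<le> ennreal (m T) * ennreal (m T) + 2 * ennreal (40 * C\<^sup>2 * T)"
   by (intro add_left_mono mult_left_mono decay_square_integral[OF rb C0 T]) auto
  also have "\<dots> = ennreal ((m T)\<^sup>2 + 80 * C\<^sup>2 * T)"
  proof -
   have "ennreal (m T) * ennreal (m T) = ennreal ((m T)\<^sup>2)"
    using m0[of T] by (simp add: power2_eq_square ennreal_mult')
   moreover have "2 * ennreal (40 * C\<^sup>2 * T) = ennreal (80 * C\<^sup>2 * T)"
    using ennreal_mult'[of 2 "40 * C\<^sup>2 * T"] by (simp add: mult.assoc)
   ultimately show ?thesis using T by (simp add: ennreal_plus)
  qed
  finally show ?thesis .
 qed
 have var: "(\<integral>\<^sup>+\<omega>. ennreal ((S T \<omega> - m T)\<^sup>2) \<partial>M) \<le> ennreal (80 * C\<^sup>2 * T)" if T: "1 \<le> T" for T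
 proof -
  have i1: "integrable M (S T)"
   by (rule integrableI_nn_integral_finite[OF _ _ ES]) (use S0 m0 in auto)
  have e1: "(LINT \<omega>|M. S T \<omega>) = m T"
   by (rule integral_eq_nn_integral[THEN trans]) (use S0 ES m0 in auto)
  have i2: "integrable M (\<lambda>\<omega>. (S T \<omega>)\<^sup>2)"
   by (rule integrableI_bounded) (use ES2[OF T] in \<open>auto simp: le_less_trans\<close>)
  have "ennreal (LINT \<omega>|M. (S T \<omega>)\<^sup>2) \<le> ennreal ((m T)\<^sup>2 + 80 * C\<^sup>2 * T)"
   using ES2[OF T] nn_integral_eq_integral[OF i2] by simp
  hence e2: "(LINT \<omega>|M. (S T \<omega>)\<^sup>2) \<le> (m T)\<^sup>2 + 80 * C\<^sup>2 * T"
   using T by (subst (asm) ennreal_le_iff) auto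
  have x: "(S T \<omega> - m T)\<^sup>2 = (S T \<omega>)\<^sup>2 - 2 * m T * S T \<omega> + (m T)\<^sup>2" for \<omega>
   by (simp add: power2_diff mult_ac)
  have i: "integrable M (\<lambda>\<omega>. (S T \<omega> - m T)\<^sup>2)"
   unfolding x using i1 i2 by simp
  have "(LINT \<omega>|M. (S T \<omega> - m T)\<^sup>2) \<le> 80 * C\<^sup>2 * T"
   unfolding x using i1 i2 e1 e2 by (simp add: prob_space power2_eq_square)
  thus ?thesis
   by (subst nn_integral_eq_integral[OF i]) (auto intro: ennreal_leI)
 qed
 \<comment> \<open>The second moments are of size 1 / (n + 1)^2, so the random series converges
   almost surely and its terms tend to 0.\<close>
 have "AE \<omega> in M. (\<Sum>n. ennreal (((S ((real (Suc n))\<^sup>2) \<omega> - m ((real (Suc n))\<^sup>2)) / (real (Suc n))\<^sup>2)\<^sup>2)) \<noteq> \<infinity>"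
 proof (rule nn_integral_noteq_infinite)
  have "(\<integral>\<^sup>+\<omega>. (\<Sum>n. ennreal (((S ((real (Suc n))\<^sup>2) \<omega> - m ((real (Suc n))\<^sup>2)) / (real (Suc n))\<^sup>2)\<^sup>2)) \<partial>M) =
   (\<Sum>n. \<integral>\<^sup>+\<omega>. ennreal (((S ((real (Suc n))\<^sup>2) \<omega> - m ((real (Suc n))\<^sup>2)) / (real (Suc n))\<^sup>2)\<^sup>2) \<partial>M)"
   by (rule nn_integral_suminf) measurable
  also have "\<dots> \<le> (\<Sum>n. ennreal (80 * C\<^sup>2 * inverse ((real (Suc n))\<^sup>2)))"
  proof (rule suminf_le)
   fix n
   define T where "T = (real (Suc n))\<^sup>2"
   have T: "1 \<le> T" unfolding T_def by (rule one_le_power) simp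
   have "(\<integral>\<^sup>+\<omega>. ennreal (((S T \<omega> - m T) / T)\<^sup>2) \<partial>M) = (\<integral>\<^sup>+\<omega>. ennreal (inverse (T\<^sup>2)) * ennreal ((S T \<omega> - m T)\<^sup>2) \<partial>M)"
    using T by (intro nn_integral_cong) (simp add: ennreal_mult'[symmetric] power_divide divide_inverse power_mult_distrib power_inverse mult.commute)
   also have "\<dots> = ennreal (inverse (T\<^sup>2)) * (\<integral>\<^sup>+\<omega>. ennreal ((S T \<omega> - m T)\<^sup>2) \<partial>M)"
    by (rule nn_integral_cmult) measurable
   also have "\<dots> \<le> ennreal (inverse (T\<^sup>2)) * ennreal (80 * C\<^sup>2 * T)"
    by (intro mult_left_mono var T) auto
   also have "\<dots> = ennreal (80 * C\<^sup>2 * inverse T)"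
    using T by (simp add: ennreal_mult'[symmetric] power2_eq_square field_simps)
   finally show "(\<integral>\<^sup>+\<omega>. ennreal (((S ((real (Suc n))\<^sup>2) \<omega> - m ((real (Suc n))\<^sup>2)) / (real (Suc n))\<^sup>2)\<^sup>2) \<partial>M)
     \<le> ennreal (80 * C\<^sup>2 * inverse ((real (Suc n))\<^sup>2))"
    by (simp only: T_def)
  qed auto
  also have "\<dots> = ennreal (\<Sum>n. 80 * C\<^sup>2 * inverse ((real (Suc n))\<^sup>2))"
  proof (rule suminf_ennreal2)
   have "summable (\<lambda>n. inverse ((real (Suc n))\<^sup>2))"
    using inverse_power_summable[of 2, where 'a=real] by (subst summable_Suc_iff) simp
   thus "summable (\<lambda>n. 80 * C\<^sup>2 * inverse ((real (Suc n))\<^sup>2))" by (rule summable_mult)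
  qed auto
  also have "\<dots> < \<infinity>" by simp
  finally show "(\<integral>\<^sup>+\<omega>. (\<Sum>n. ennreal (((S ((real (Suc n))\<^sup>2) \<omega> - m ((real (Suc n))\<^sup>2)) / (real (Suc n))\<^sup>2)\<^sup>2)) \<partial>M) \<noteq> \<infinity>"
   by simp
 qed measurable
 thus "AE \<omega> in M. ((\<lambda>T. 1 / T * (LBINT k:{T..2*T}. (Y k \<omega>)\<^sup>2) - 1 / T * (LBINT k:{T..2*T}. (LINT \<omega>|M. (Y (max 1 k) \<omega>)\<^sup>2))) \<longlongrightarrow> 0) at_top"
  using AE_space
 proof eventually_elim
  case (elim \<omega>)
  define D where "D T = (S T \<omega> - m T) / T" for T
  have "summable (\<lambda>n. ((S ((real (Suc n))\<^sup>2) \<omega> - m ((real (Suc n))\<^sup>2)) / (real (Suc n))\<^sup>2)\<^sup>2)"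
   by (rule summable_suminf_not_top) (use elim(1) in \<open>auto simp: infinity_ennreal_def\<close>)
  from summable_LIMSEQ_zero[OF this]
  have "(\<lambda>n. (S ((real (Suc n))\<^sup>2) \<omega> - m ((real (Suc n))\<^sup>2)) / (real (Suc n))\<^sup>2) \<longlonglongrightarrow> 0"
   using tendsto_real_sqrt by (fastforce simp: tendsto_rabs_zero_iff)
  note lim = this
  have split: "S t \<omega> = S s \<omega> + (LBINT k:{s..t}. (Z k \<omega>)\<^sup>2)" "m t = m s + (LBINT k:{s..t}. q k)" if "1 \<le> s" "s \<le> t" for s t
  proof -
   have 1: "{1..t} = {1..s} \<union> {s..t}" using that by auto
   have ae: "AE x in lborel. \<not> (x \<in> {1..s} \<and> x \<in> {s..t})"
    using AE_lborel_singleton[of s] by eventually_elim auto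
   show "S t \<omega> = S s \<omega> + (LBINT k:{s..t}. (Z k \<omega>)\<^sup>2)"
    unfolding S_def 1 by (rule set_integral_Un_AE[OF ae]) (use fin[OF elim(2)] in auto)
   show "m t = m s + (LBINT k:{s..t}. q k)"
    unfolding m_def 1 by (rule set_integral_Un_AE[OF ae]) (use finq in auto)
  qed
  have Dlim: "(D \<longlongrightarrow> 0) at_top"
   unfolding D_def[abs_def]
  proof (rule monotone_interpolation[OF _ _ lim, where C="2 * C"])
   fix s t :: real assume st: "1 \<le> s" "s \<le> t"
   have "0 \<le> (LBINT k:{s..t}. (Z k \<omega>)\<^sup>2)"
    unfolding set_lebesgue_integral_def by (intro Bochner_Integration.integral_nonneg) simp
   thus "S s \<omega> \<le> S t \<omega>" using split(1)[OF st] by simp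
   have "0 \<le> (LBINT k:{s..t}. q k)"
    unfolding set_lebesgue_integral_def using q0 by (intro Bochner_Integration.integral_nonneg) simp
   moreover have "(LBINT k:{s..t}. q k) \<le> (LBINT k:{s..t}. 2 * C)"
   proof (rule set_integral_mono[OF finq])
    show "set_integrable lborel {s..t} (\<lambda>k. 2 * C)"
     unfolding set_integrable_def by (intro integrable_scaleR_left integrable_real_indicator) (use st in auto)
   qed (rule qb)
   moreover have "(LBINT k:{s..t}. 2 * C) = 2 * C * (t - s)"
    unfolding set_lebesgue_integral_def using st by simp
   ultimately show "m s \<le> m t \<and> m t \<le> m s + 2 * C * (t - s)" using split(2)[OF st] by (intro conjI) linarith+
  qed
  \<comment> \<open>An average over [T, 2 T] is twice the quantity at 2 T minus the one at T, both
    being integrals from 1 divided by the upper end.\<close>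
  have "((\<lambda>T. 2 * D (2 * T) - D T) \<longlongrightarrow> 2 * 0 - 0) at_top"
  proof (intro tendsto_intros Dlim filterlim_compose[OF Dlim])
   show "LIM T at_top. 2 * T :> (at_top :: real filter)"
    by (rule filterlim_tendsto_pos_mult_at_top[OF tendsto_const _ filterlim_ident]) simp
  qed
  moreover have "eventually (\<lambda>T. 2 * D (2 * T) - D T = 1 / T * (LBINT k:{T..2*T}. (Y k \<omega>)\<^sup>2) -
    1 / T * (LBINT k:{T..2*T}. (LINT \<omega>|M. (Y (max 1 k) \<omega>)\<^sup>2))) at_top"
   using eventually_ge_at_top[of 1]
  proof eventually_elim
   case (elim T)
   have "(LBINT k:{T..2*T}. (Z k \<omega>)\<^sup>2) = (LBINT k:{T..2*T}. (Y k \<omega>)\<^sup>2)"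
    by (rule set_lebesgue_integral_cong) (use elim in \<open>auto simp: Z1\<close>)
   thus ?case
    using split[OF elim, of "2 * T"] elim by (simp add: D_def q_def Z_def field_simps)
  qed
  ultimately show ?case
   by (simp add: Lim_transform_eventually)
 qed
qed

subsection \<open>Uniqueness of the strength\<close>

text \<open>Since \<open>\<Delta> |z| powr s = s (s + d - 2) |z| powr (s - 2)\<close> and \<open>s + d - 2 = - 1 - 2 n\<close> never vanishes for
 \<open>s = 1 - d - 2 n\<close>, vanishing of the potential near \<open>x\<close> gives vanishing of all the moments
 with exponents \<open>1 - d - 2 n\<close>.\<close>

definition rpow :: "real => 'a::euclidean_space => real" where
 "rpow s z = (z \<bullet> z) powr (s / 2)"

lemma rpow_line_deriv:
 assumes "(z + t *\<^sub>R b) \<bullet> (z + t *\<^sub>R b) \<noteq> 0"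
 shows "((\<lambda>t. rpow s (z + t *\<^sub>R b)) has_real_derivative s * ((z + t *\<^sub>R b) \<bullet> b) * rpow (s - 2) (z + t *\<^sub>R b)) (at t)"
proof -
 have 1: "((\<lambda>t. (z + t *\<^sub>R b) \<bullet> (z + t *\<^sub>R b)) has_real_derivative 2 * ((z + t *\<^sub>R b) \<bullet> b)) (at t)"
 proof -
  have "(\<lambda>t. (z + t *\<^sub>R b) \<bullet> (z + t *\<^sub>R b)) = (\<lambda>t. z \<bullet> z + 2 * t * (z \<bullet> b) + t * t * (b \<bullet> b))"
   by (simp add: inner_add_left inner_add_right inner_commute algebra_simps)
  thus ?thesis
   by (auto intro!: derivative_eq_intros simp: inner_add_left inner_commute algebra_simps)
 qed
 have p: "0 < (z + t *\<^sub>R b) \<bullet> (z + t *\<^sub>R b)"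
  using assms inner_ge_zero[of "z + t *\<^sub>R b"] by linarith
 have "((\<lambda>t. ((z + t *\<^sub>R b) \<bullet> (z + t *\<^sub>R b)) powr (s / 2)) has_real_derivative
   (s / 2) * ((z + t *\<^sub>R b) \<bullet> (z + t *\<^sub>R b)) powr (s / 2 - 1) * (2 * ((z + t *\<^sub>R b) \<bullet> b))) (at t)"
  by (rule DERIV_chain2[OF has_real_derivative_powr[OF p] 1])
 thus ?thesis
  by (simp add: rpow_def diff_divide_distrib mult_ac)
qed

lemma rpow_line_deriv2:
 assumes "(z + t *\<^sub>R b) \<bullet> (z + t *\<^sub>R b) \<noteq> 0"
 shows "((\<lambda>t. s * ((z + t *\<^sub>R b) \<bullet> b) * rpow (s - 2) (z + t *\<^sub>R b)) has_real_derivative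
  s * (b \<bullet> b) * rpow (s - 2) (z + t *\<^sub>R b) + s * (s - 2) * ((z + t *\<^sub>R b) \<bullet> b)\<^sup>2 * rpow (s - 4) (z + t *\<^sub>R b)) (at t)"
proof -
 have "((\<lambda>t. (z + t *\<^sub>R b) \<bullet> b) has_real_derivative b \<bullet> b) (at t)"
  by (auto intro!: derivative_eq_intros simp: inner_add_left)
 from DERIV_mult[OF DERIV_cmult[OF this] rpow_line_deriv[OF assms, of "s - 2"]]
 show ?thesis by (simp add: power2_eq_square mult_ac)
qed

lemma rpow_continuous:
 "continuous_on {z. z \<noteq> 0} (rpow s)"
 unfolding rpow_def[abs_def] by (intro continuous_intros) auto

lemma integrable_mult_csupp:
 fixes g G :: "'a::euclidean_space => real"
 assumes "continuous_on UNIV g" "compact K" "\<forall>z. z \<notin> K \<longrightarrow> g z = 0" "continuous_on K G"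
 shows "integrable lborel (\<lambda>z. g z * G z)"
proof -
 have "integrable lborel (\<lambda>z. indicator K z *\<^sub>R (g z * G z))"
  by (rule borel_integrable_compact[OF assms(2)])
   (intro continuous_intros continuous_on_subset[OF assms(1)] assms(4); simp)
 moreover have "indicator K z *\<^sub>R (g z * G z) = g z * G z" for z
  using assms(3) by (cases "z \<in> K") auto
 ultimately show ?thesis by (simp only:)
qed

section \<open>Moments of a potential that vanishes on an open set\<close>

text \<open>Continuity of F' on the compact set [-e, e] x K bounds the difference quotients, and g
  cuts everything off outside K.\<close>

lemma integral_param_deriv:
 fixes F F' :: "real => 'a::euclidean_space => real"
 assumes g: "continuous_on UNIV g" "compact K" "\<forall>z. z \<notin> K \<longrightarrow> g z = 0"
  and t0: "\<bar>t0\<bar> < e"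
  and F: "\<And>t z. \<bar>t\<bar> \<le> e ==> z \<in> K ==> ((\<lambda>t. F t z) has_real_derivative F' t z) (at t)"
  and cF: "continuous_on ({-e..e} \<times> K) (\<lambda>(t, z). F t z)" and cF': "continuous_on ({-e..e} \<times> K) (\<lambda>(t, z). F' t z)"
 shows "((\<lambda>t. LBINT z. g z * F t z) has_real_derivative (LBINT z. g z * F' t0 z)) (at t0)"
proof -
 note intK = integrable_mult_csupp[OF g]
 have cFt: "continuous_on K (F t)" "continuous_on K (F' t)" if "\<bar>t\<bar> \<le> e" for t
 proof -
  have t: "t \<in> {-e..e}" using that by auto
  show "continuous_on K (F t)"
   using continuous_on_compose2[OF cF continuous_on_Pair[OF continuous_on_const[of K t] continuous_on_id]] t by (auto simp: image_subset_iff)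
  show "continuous_on K (F' t)"
   using continuous_on_compose2[OF cF' continuous_on_Pair[OF continuous_on_const[of K t] continuous_on_id]] t by (auto simp: image_subset_iff)
 qed
 have "compact ((\<lambda>(t, z). F' t z) ` ({-e..e} \<times> K))"
  by (intro compact_continuous_image cF' compact_Times g(2)) simp
 then obtain B where "\<forall>y\<in>(\<lambda>(t, z). F' t z) ` ({-e..e} \<times> K). norm y \<le> B"
  using compact_imp_bounded bounded_iff by metis
 hence B: "\<bar>F' t z\<bar> \<le> B" if "\<bar>t\<bar> \<le> e" "z \<in> K" for t z
  using that by (force simp: abs_le_iff)
 have "(\<lambda>n. ((LBINT z. g z * F (t0 + h n) z) - (LBINT z. g z * F t0 z)) / h n) \<longlonglongrightarrow> (LBINT z. g z * F' t0 z)"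
  if h: "\<And>n. h n \<noteq> 0" "h \<longlonglongrightarrow> 0" for h :: "nat => real"
 proof -
  have "eventually (\<lambda>n. \<bar>h n\<bar> < e - \<bar>t0\<bar>) sequentially"
   using tendstoD[OF h(2), of "e - \<bar>t0\<bar>"] t0 by (simp add: dist_real_def)
  then obtain n0 where n0: "\<And>n. n \<ge> n0 ==> \<bar>h n\<bar> < e - \<bar>t0\<bar>"
   unfolding eventually_sequentially by blast
  have hn: "\<bar>t0 + h (n + n0)\<bar> \<le> e" for n
   using n0[of "n + n0"] by auto
  have "(\<lambda>n. LBINT z. g z * ((F (t0 + h (n + n0)) z - F t0 z) / h (n + n0))) \<longlonglongrightarrow> (LBINT z. g z * F' t0 z)"
  proof (rule integral_dominated_convergence[where w="\<lambda>z. \<bar>g z * B\<bar>"])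
   show "AE z in lborel. (\<lambda>n. g z * ((F (t0 + h (n + n0)) z - F t0 z) / h (n + n0))) \<longlonglongrightarrow> g z * F' t0 z"
   proof (rule AE_I2)
    fix z
    show "(\<lambda>n. g z * ((F (t0 + h (n + n0)) z - F t0 z) / h (n + n0))) \<longlonglongrightarrow> g z * F' t0 z"
    proof (cases "z \<in> K")
     case True
     have "((\<lambda>d. (F (t0 + d) z - F t0 z) / d) \<longlongrightarrow> F' t0 z) (at 0)"
      using F[of t0 z] t0 True by (simp add: DERIV_def)
     moreover have "filterlim (\<lambda>n. h (n + n0)) (at 0) sequentially"
      using h LIMSEQ_ignore_initial_segment[OF h(2), of n0] by (simp add: filterlim_at)
     ultimately have "(\<lambda>n. (F (t0 + h (n + n0)) z - F t0 z) / h (n + n0)) \<longlonglongrightarrow> F' t0 z"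
      by (rule filterlim_compose)
     thus ?thesis by (intro tendsto_intros)
    qed (simp add: g(3))
   qed
   show "AE z in lborel. norm (g z * ((F (t0 + h (n + n0)) z - F t0 z) / h (n + n0))) \<le> \<bar>g z * B\<bar>" for n
   proof (rule AE_I2)
    fix z
    show "norm (g z * ((F (t0 + h (n + n0)) z - F t0 z) / h (n + n0))) \<le> \<bar>g z * B\<bar>"
    proof (cases "z \<in> K")
     case True
     have "norm (F (t0 + h (n + n0)) z - F t0 z) \<le> B * norm (t0 + h (n + n0) - t0)"
     proof (rule field_differentiable_bound[where S="{-e..e}" and f="\<lambda>t. F t z" and f'="\<lambda>t. F' t z"])
      show "((\<lambda>t. F t z) has_field_derivative F' t z) (at t within {-e..e})" if "t \<in> {-e..e}" for t
       by (rule has_field_derivative_at_within[OF F]) (use that True in auto)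
      show "norm (F' t z) \<le> B" if "t \<in> {-e..e}" for t
       using B[of t z] that True by auto
     qed (use hn[of n] t0 in auto)
     hence "norm ((F (t0 + h (n + n0)) z - F t0 z) / h (n + n0)) \<le> B"
      using h(1)[of "n + n0"] by (simp add: abs_divide field_simps)
     thus ?thesis unfolding abs_mult norm_mult by (intro mult_mono) auto
    qed (simp add: g(3))
   qed
   show "integrable lborel (\<lambda>z. \<bar>g z * B\<bar>)"
    by (intro integrable_abs intK continuous_intros)
   show "(\<lambda>z. g z * F' t0 z) \<in> borel_measurable lborel"
    using borel_measurable_integrable[OF intK[OF cFt(2)]] t0 by auto
   show "(\<lambda>z. g z * ((F (t0 + h (n + n0)) z - F t0 z) / h (n + n0))) \<in> borel_measurable lborel" for n
    by (rule borel_measurable_integrable, rule intK)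
     (intro continuous_intros cFt hn, use h t0 in auto)
  qed
  moreover have "(LBINT z. g z * ((F (t0 + h (n + n0)) z - F t0 z) / h (n + n0))) =
    ((LBINT z. g z * F (t0 + h (n + n0)) z) - (LBINT z. g z * F t0 z)) / h (n + n0)" for n
  proof -
   have "(LBINT z. g z * ((F (t0 + h (n + n0)) z - F t0 z) / h (n + n0))) =
    (LBINT z. (g z * F (t0 + h (n + n0)) z - g z * F t0 z) / h (n + n0))"
    by (intro Bochner_Integration.integral_cong refl) (simp add: field_simps)
   also have "\<dots> = (LBINT z. g z * F (t0 + h (n + n0)) z - g z * F t0 z) / h (n + n0)"
    by (rule integral_divide_zero)
   also have "(LBINT z. g z * F (t0 + h (n + n0)) z - g z * F t0 z) =
    (LBINT z. g z * F (t0 + h (n + n0)) z) - (LBINT z. g z * F t0 z)"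
    by (rule Bochner_Integration.integral_diff; rule intK; rule cFt) (use hn t0 in auto)
   finally show ?thesis .
  qed
  ultimately have "(\<lambda>n. ((LBINT z. g z * F (t0 + h (n + n0)) z) - (LBINT z. g z * F t0 z)) / h (n + n0)) \<longlonglongrightarrow> (LBINT z. g z * F' t0 z)"
   by (simp only:)
  thus ?thesis
   by (rule LIMSEQ_offset[where k=n0])
 qed
 hence "((\<lambda>d. ((LBINT z. g z * F (t0 + d) z) - (LBINT z. g z * F t0 z)) / d) \<longlongrightarrow> (LBINT z. g z * F' t0 z)) (at 0)"
  unfolding tendsto_at_iff_sequentially by (auto simp: o_def)
 thus ?thesis by (simp add: DERIV_def)
qed

text \<open>Vanishing on the open set U passes to all derivatives in x. They are taken along the
  line x + t b, where the kernel is a function of one real variable.\<close>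

lemma potential_second_deriv:
 fixes g :: "'a::euclidean_space => real"
 assumes g: "continuous_on UNIV g" "compact K" "\<forall>z. z \<notin> K \<longrightarrow> g z = 0"
  and U: "open U" "x \<in> U" "U \<inter> K = {}" and b: "b \<in> Basis"
  and van: "\<And>x. x \<in> U ==> (LBINT z. g z * rpow s (x - z)) = 0"
 shows "(LBINT z. g z * (s * rpow (s - 2) (x - z) + s * (s - 2) * ((x - z) \<bullet> b)\<^sup>2 * rpow (s - 4) (x - z))) = 0"
proof -
 obtain e where e: "e > 0" "cball x e \<subseteq> U" using U open_contains_cball by blast
 have nz: "(x + t *\<^sub>R b - z) \<noteq> 0" if "\<bar>t\<bar> \<le> e" "z \<in> K" for t z
 proof -
  have "x + t *\<^sub>R b \<in> cball x e" using that b by (simp add: dist_norm)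
  thus ?thesis using e U that by auto
 qed
 have c_line: "continuous_on ({-e..e} \<times> K) (\<lambda>z. fst z *\<^sub>R b + x - snd z)"
  by (intro continuous_intros)
 define P1 where "P1 t z = s * ((x - z + t *\<^sub>R b) \<bullet> b) * rpow (s - 2) (x - z + t *\<^sub>R b)" for t z
 define P2 where "P2 t z = s * (b \<bullet> b) * rpow (s - 2) (x - z + t *\<^sub>R b) + s * (s - 2) * ((x - z + t *\<^sub>R b) \<bullet> b)\<^sup>2 * rpow (s - 4) (x - z + t *\<^sub>R b)" for t z
 have nz': "x - z + t *\<^sub>R b \<noteq> 0" if "\<bar>t\<bar> \<le> e" "z \<in> K" for t z
  using nz[OF that] by (simp add: algebra_simps)
 have cr: "continuous_on ({-e..e} \<times> K) (\<lambda>z. rpow p (x - snd z + fst z *\<^sub>R b))" for p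
  by (rule continuous_on_compose2[OF rpow_continuous]) (use nz' in \<open>auto intro!: continuous_intros simp: abs_le_iff\<close>)
 have d1: "((\<lambda>t. LBINT z. g z * rpow s (x - z + t *\<^sub>R b)) has_real_derivative (LBINT z. g z * P1 t0 z)) (at t0)" if "\<bar>t0\<bar> < e" for t0
  by (rule integral_param_deriv[OF g that]) (use nz' cr in \<open>auto simp: P1_def case_prod_unfold intro!: rpow_line_deriv continuous_intros\<close>)
 have d2: "((\<lambda>t. LBINT z. g z * P1 t z) has_real_derivative (LBINT z. g z * P2 0 z)) (at 0)"
  by (rule integral_param_deriv[OF g]) (use nz' cr e(1) in \<open>auto simp: P1_def P2_def case_prod_unfold intro!: rpow_line_deriv2 continuous_intros\<close>)
 have z0: "(LBINT z. g z * rpow s (x - z + t *\<^sub>R b)) = 0" if "\<bar>t\<bar> \<le> e" for t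
 proof -
  have "x + t *\<^sub>R b \<in> U" using that b e by (auto simp: dist_norm subset_eq)
  from van[OF this] show ?thesis by (simp add: algebra_simps)
 qed
 have z1: "(LBINT z. g z * P1 t z) = 0" if "\<bar>t\<bar> < e" for t
 proof (rule DERIV_unique[OF d1[OF that]])
  have "((\<lambda>_. 0) has_real_derivative 0) (at t)" by simp
  thus "((\<lambda>t. LBINT z. g z * rpow s (x - z + t *\<^sub>R b)) has_real_derivative 0) (at t)"
   by (rule has_field_derivative_transform_within_open[of _ _ _ "{-e<..<e}"]) (use that z0 in auto)
 qed
 have "(LBINT z. g z * P2 0 z) = 0"
 proof (rule DERIV_unique[OF d2])
  have "((\<lambda>_. 0) has_real_derivative 0) (at 0)" by simp
  thus "((\<lambda>t. LBINT z. g z * P1 t z) has_real_derivative 0) (at 0)"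
   by (rule has_field_derivative_transform_within_open[of _ _ _ "{-e<..<e}"]) (use e(1) z1 in auto)
 qed
 thus ?thesis using b by (simp add: P2_def)
qed

lemma rpow_simps:
 assumes "z \<noteq> 0"
 shows "(z \<bullet> z) * rpow (s - 4) z = rpow (s - 2) z"
proof -
 have "(z \<bullet> z) powr 1 * (z \<bullet> z) powr ((s - 4) / 2) = (z \<bullet> z) powr (1 + (s - 4) / 2)"
  by (rule powr_add[symmetric])
 thus ?thesis using assms by (simp add: rpow_def diff_divide_distrib)
qed

lemma potential_moments:
 fixes g :: "'a::euclidean_space => real"
 assumes g: "continuous_on UNIV g" "compact K" "\<forall>z. z \<notin> K \<longrightarrow> g z = 0"
  and U: "open U" "U \<inter> K = {}" and d: "2 \<le> DIM('a)"
  and van: "\<And>x. x \<in> U ==> (LBINT z. g z * rpow (1 - real DIM('a)) (x - z)) = 0"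
 shows "x \<in> U ==> (LBINT z. g z * rpow (1 - real DIM('a) - 2 * real n) (x - z)) = 0"
proof (induction n arbitrary: x)
 case (Suc n)
 define s where "s = 1 - real DIM('a) - 2 * real n"
 have nz: "x - z \<noteq> 0" if "z \<in> K" for z using U(2) Suc.prems that by auto
 have cr: "continuous_on K (\<lambda>z. rpow p (x - z))" for p
  by (rule continuous_on_compose2[OF rpow_continuous]) (use nz in \<open>auto intro!: continuous_intros\<close>)
 define Q where "Q b z = s * rpow (s - 2) (x - z) + s * (s - 2) * ((x - z) \<bullet> b)\<^sup>2 * rpow (s - 4) (x - z)" for b z
 have "(LBINT z. g z * Q b z) = 0" if "b \<in> Basis" for b
  unfolding Q_def by (rule potential_second_deriv[OF g U(1) Suc.prems U(2) that]) (unfold s_def, rule Suc.IH)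
 hence "0 = (\<Sum>b\<in>Basis. (LBINT z. g z * Q b z))" by simp
 also have "\<dots> = (LBINT z. (\<Sum>b\<in>Basis. g z * Q b z))"
  by (rule Bochner_Integration.integral_sum[symmetric], rule integrable_mult_csupp[OF g])
   (auto simp: Q_def intro!: continuous_intros cr)
 also have "\<dots> = (LBINT z. (s * (real DIM('a) + s - 2)) * (g z * rpow (s - 2) (x - z)))"
 proof (intro Bochner_Integration.integral_cong refl)
  fix z
  show "(\<Sum>b\<in>Basis. g z * Q b z) = (s * (real DIM('a) + s - 2)) * (g z * rpow (s - 2) (x - z))"
  proof (cases "z \<in> K")
   case True
   have "(\<Sum>b\<in>Basis. Q b z) = real DIM('a) * (s * rpow (s - 2) (x - z)) +
     s * (s - 2) * ((\<Sum>b\<in>Basis. ((x - z) \<bullet> b)\<^sup>2) * rpow (s - 4) (x - z))"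
    by (simp add: Q_def sum.distrib sum_distrib_left sum_distrib_right mult.assoc)
   also have "(\<Sum>b\<in>Basis. ((x - z) \<bullet> b)\<^sup>2) = (x - z) \<bullet> (x - z)"
    using euclidean_inner[of "x - z" "x - z"] by (simp only: power2_eq_square)
   also have "((x - z) \<bullet> (x - z)) * rpow (s - 4) (x - z) = rpow (s - 2) (x - z)"
    by (rule rpow_simps[OF nz[OF True]])
   finally have "(\<Sum>b\<in>Basis. Q b z) = s * (real DIM('a) + s - 2) * rpow (s - 2) (x - z)"
    by (simp add: algebra_simps)
   thus ?thesis
    by (simp add: sum_distrib_left[symmetric] mult_ac)
  qed (simp add: g(3))
 qed
 also have "\<dots> = (s * (real DIM('a) + s - 2)) * (LBINT z. g z * rpow (s - 2) (x - z))"
  by (rule integral_mult_right_zero)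
 finally have "(s * (real DIM('a) + s - 2)) * (LBINT z. g z * rpow (s - 2) (x - z)) = 0" by simp
 moreover have "s * (real DIM('a) + s - 2) \<noteq> 0" using d by (auto simp: s_def)
 ultimately have "(LBINT z. g z * rpow (s - 2) (x - z)) = 0" by simp
 moreover have "s - 2 = 1 - real DIM('a) - 2 * real (Suc n)" by (simp add: s_def)
 ultimately show ?case by simp
qed (use van in simp)

text \<open>With v = 1 / |x - z|^2 the moments are integrals of g v^(- c / 2) v^n. By Weierstrass on
  the compact set v(K) the powers may be replaced by any continuous function of v; f is the one with
  v^(- c / 2) f(v) = exp(- 1 / v), the Gaussian in |x - z|.\<close>

lemma potential_gaussian:
 fixes g :: "'a::euclidean_space => real"
 assumes g: "continuous_on UNIV g" "compact K" "\<forall>z. z \<notin> K \<longrightarrow> g z = 0"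
  and x: "x \<notin> K"
  and van: "\<And>n::nat. (LBINT z. g z * rpow (c - 2 * real n) (x - z)) = 0"
 shows "(LBINT z. g z * exp (- ((x - z) \<bullet> (x - z)))) = 0"
proof (cases "K = {}")
 case False
 define \<tau> where "\<tau> z = (x - z) \<bullet> (x - z)" for z
 have \<tau>c: "continuous_on K \<tau>" unfolding \<tau>_def[abs_def] by (intro continuous_intros)
 have \<tau>0: "\<tau> z > 0" if "z \<in> K" for z using that x by (auto simp: \<tau>_def)
 define v where "v z = inverse (\<tau> z)" for z
 have vc: "continuous_on K v"
  unfolding v_def[abs_def] by (intro continuous_intros \<tau>c ballI less_imp_neq[symmetric] \<tau>0)
 have v0: "v z > 0" if "z \<in> K" for z using \<tau>0[OF that] by (simp add: v_def)
 have vK: "compact (v ` K)" by (rule compact_continuous_image[OF vc g(2)])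
 define f where "f u = exp (- inverse u) * u powr (c / 2)" for u :: real
 have fc: "continuous_on (v ` K) f"
  unfolding f_def[abs_def] using less_imp_neq[OF v0] by (intro continuous_intros) auto
 have rp: "rpow (c - 2 * real n) (x - z) = v z powr (- (c / 2)) * v z ^ n" if "z \<in> K" for n z
 proof -
  have "rpow (c - 2 * real n) (x - z) = \<tau> z powr (c / 2 - real n)"
   by (simp add: rpow_def \<tau>_def diff_divide_distrib)
  also have "\<dots> = v z powr (- (c / 2)) * v z ^ n"
  proof -
   have "v z powr (- (c / 2)) = \<tau> z powr (c / 2)"
    using \<tau>0[OF that] by (simp add: v_def powr_minus inverse_powr)
   moreover have "v z ^ n = inverse (\<tau> z powr real n)"
    using \<tau>0[OF that] by (simp add: v_def powr_realpow power_inverse)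
   ultimately show ?thesis by (simp only: powr_diff divide_inverse)
  qed
  finally show ?thesis .
 qed
 have ef: "exp (- \<tau> z) = v z powr (- (c / 2)) * f (v z)" if "z \<in> K" for z
  using v0[OF that] by (simp add: f_def v_def powr_minus field_simps)
 have vpc: "continuous_on K (\<lambda>z. v z powr (- (c / 2)))"
  using less_imp_neq[OF v0] by (intro continuous_intros vc) auto
 have gint: "integrable lborel (\<lambda>z. g z * (v z powr (- (c / 2)) * h (v z)))" if "continuous_on (v ` K) h" for h
  by (rule integrable_mult_csupp[OF g]) (intro continuous_intros vpc continuous_on_compose2[OF that vc]; simp)
 define A where "A = (LBINT z. \<bar>g z * (v z powr (- (c / 2)) * 1)\<bar>)"
 have "\<bar>LBINT z. g z * exp (- \<tau> z)\<bar> \<le> e * A" if e: "e > 0" for e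
 proof -
  obtain p where p: "real_polynomial_function p" "\<And>u. u \<in> v ` K ==> \<bar>f u - p u\<bar> < e"
   using Stone_Weierstrass_real_polynomial_function[OF vK fc e] by auto
  obtain a N where pN: "p = (\<lambda>u. \<Sum>i\<le>N. a i * u ^ i)"
   using p(1) real_polynomial_function_iff_sum by blast
  have pc: "continuous_on (v ` K) p" unfolding pN by (intro continuous_intros)
  have "(LBINT z. g z * (v z powr (- (c / 2)) * p (v z))) =
    (LBINT z. (\<Sum>i\<le>N. a i * (g z * rpow (c - 2 * real i) (x - z))))"
  proof (intro Bochner_Integration.integral_cong refl)
   fix z
   show "g z * (v z powr (- (c / 2)) * p (v z)) = (\<Sum>i\<le>N. a i * (g z * rpow (c - 2 * real i) (x - z)))"
   proof (cases "z \<in> K")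
    case True
    have "(\<Sum>i\<le>N. a i * (g z * rpow (c - 2 * real i) (x - z))) = (\<Sum>i\<le>N. a i * (g z * (v z powr (- (c / 2)) * v z ^ i)))"
     by (simp only: rp[OF True])
    thus ?thesis by (simp add: pN sum_distrib_left mult_ac)
   qed (simp add: g(3))
  qed
  also have "\<dots> = (\<Sum>i\<le>N. a i * (LBINT z. g z * rpow (c - 2 * real i) (x - z)))"
  proof (subst Bochner_Integration.integral_sum)
   fix i
   have "integrable lborel (\<lambda>z. g z * rpow (c - 2 * real i) (x - z))"
    by (rule integrable_mult_csupp[OF g], rule continuous_on_compose2[OF rpow_continuous])
     (use x in \<open>auto intro!: continuous_intros\<close>)
   thus "integrable lborel (\<lambda>z. a i * (g z * rpow (c - 2 * real i) (x - z)))" by simp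
  qed simp
  also have "\<dots> = 0" using van by simp
  finally have z: "(LBINT z. g z * (v z powr (- (c / 2)) * p (v z))) = 0" .
  have "(LBINT z. g z * exp (- \<tau> z)) = (LBINT z. g z * (v z powr (- (c / 2)) * f (v z)))"
   by (intro Bochner_Integration.integral_cong refl) (metis ef g(3) mult_zero_left)
  also have "\<dots> = (LBINT z. g z * (v z powr (- (c / 2)) * f (v z)) - g z * (v z powr (- (c / 2)) * p (v z)))"
   using z by (subst Bochner_Integration.integral_diff[OF gint[OF fc] gint[OF pc]]) simp
  finally have eq: "(LBINT z. g z * exp (- \<tau> z)) =
    (LBINT z. g z * (v z powr (- (c / 2)) * f (v z)) - g z * (v z powr (- (c / 2)) * p (v z)))" .
  have "\<bar>LBINT z. g z * exp (- \<tau> z)\<bar> \<le> (LBINT z. e * \<bar>g z * (v z powr (- (c / 2)) * 1)\<bar>)"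
   unfolding eq
  proof (rule order_trans[OF integral_abs_bound integral_mono])
   show "integrable lborel (\<lambda>z. \<bar>g z * (v z powr (- (c / 2)) * f (v z)) - g z * (v z powr (- (c / 2)) * p (v z))\<bar>)"
    by (intro integrable_abs Bochner_Integration.integrable_diff gint fc pc)
   show "integrable lborel (\<lambda>z. e * \<bar>g z * (v z powr (- (c / 2)) * 1)\<bar>)"
    by (intro integrable_mult_right integrable_abs gint) simp
   fix z
   show "\<bar>g z * (v z powr (- (c / 2)) * f (v z)) - g z * (v z powr (- (c / 2)) * p (v z))\<bar> \<le> e * \<bar>g z * (v z powr (- (c / 2)) * 1)\<bar>"
   proof (cases "z \<in> K")
    case True
    have "\<bar>g z * (v z powr (- (c / 2)) * f (v z)) - g z * (v z powr (- (c / 2)) * p (v z))\<bar> =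
      \<bar>g z * (v z powr (- (c / 2)))\<bar> * \<bar>f (v z) - p (v z)\<bar>"
     by (simp add: abs_mult[symmetric] algebra_simps)
    also have "\<dots> \<le> \<bar>g z * (v z powr (- (c / 2)))\<bar> * e"
     using p(2)[of "v z"] True by (intro mult_left_mono) auto
    finally show ?thesis by (simp add: mult.commute)
   qed (simp add: g(3))
  qed
  also have "\<dots> = e * A" by (simp add: A_def)
  finally show ?thesis .
 qed
 note * = this
 have A0: "0 \<le> A" by (simp add: A_def)
 have "\<bar>LBINT z. g z * exp (- \<tau> z)\<bar> \<le> 0"
 proof (rule field_le_epsilon)
  fix e :: real assume e: "0 < e"
  have "\<bar>LBINT z. g z * exp (- \<tau> z)\<bar> \<le> e / (A + 1) * A"
   by (rule *) (use e A0 in auto)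
  also have "\<dots> \<le> e" using e A0 by (simp add: field_simps)
  finally show "\<bar>LBINT z. g z * exp (- \<tau> z)\<bar> \<le> 0 + e" by simp
 qed
 thus ?thesis by (simp add: \<tau>_def)
qed (use g(3) in simp)

lemma continuous_on_real_polynomial: "real_polynomial_function p ==> continuous_on S p"
 by (intro continuous_at_imp_continuous_on ballI continuous_real_polymonial_function)

text \<open>Differentiating \<open>exp (2 * x \<bullet> z)\<close> in \<open>x\<close> brings down arbitrary polynomials in \<open>z\<close>.\<close>

lemma exponential_moments:
 fixes w :: "'a::euclidean_space => real"
 assumes w: "continuous_on UNIV w" "compact K" "\<forall>z. z \<notin> K \<longrightarrow> w z = 0"
  and U: "open U"
  and p: "real_polynomial_function p"
 shows "continuous_on UNIV q ==> (\<And>x. x \<in> U ==> (LBINT z. w z * (q z * exp (2 * (x \<bullet> z)))) = 0) ==> x \<in> U ==>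
  (LBINT z. w z * (p z * q z * exp (2 * (x \<bullet> z)))) = 0"
 using p
\<comment> \<open>q is generalised because in a product f h the factor h is absorbed into q before f
  is treated.\<close>
proof (induction arbitrary: q x rule: real_polynomial_function.induct)
 case (linear f)
 \<comment> \<open>A linear f is the inner product with some v, and differentiating in x along v
   brings down 2 f z.\<close>
 obtain v where v: "\<And>z. f z = v \<bullet> z"
 proof -
  have "f z = (\<Sum>b\<in>Basis. f b *\<^sub>R b) \<bullet> z" for z
  proof -
   have "f z = f (\<Sum>b\<in>Basis. (z \<bullet> b) *\<^sub>R b)" by (simp add: euclidean_representation)
   also have "\<dots> = (\<Sum>b\<in>Basis. (z \<bullet> b) * f b)"
    using linear.hyps by (simp add: bounded_linear.linear linear_sum linear_scale)
   also have "\<dots> = (\<Sum>b\<in>Basis. f b *\<^sub>R b) \<bullet> z"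
    unfolding inner_sum_left by (intro sum.cong refl) (simp add: inner_commute)
   finally show ?thesis .
  qed
  thus ?thesis using that by blast
 qed
 obtain e0 where e0: "e0 > 0" "cball x e0 \<subseteq> U" using U linear.prems(3) open_contains_cball by blast
 define e where "e = e0 / (norm v + 1)"
 have "0 < norm v + 1" by (simp add: add_nonneg_pos)
 hence e: "e > 0" using e0 by (simp add: e_def)
 have inU: "x + t *\<^sub>R v \<in> U" if "\<bar>t\<bar> \<le> e" for t
 proof -
  have "\<bar>t\<bar> * norm v \<le> e * (norm v + 1)" using that e by (intro mult_mono) auto
  also have "\<dots> = e0" by (simp add: e_def add_nonneg_eq_0_iff)
  finally have "x + t *\<^sub>R v \<in> cball x e0" by (simp add: dist_norm)
  thus ?thesis using e0 by blast
 qed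
 have cq: "continuous_on S q" for S using linear.prems(1) continuous_on_subset by blast
 have cqs: "continuous_on S (\<lambda>z. q (snd z))" for S :: "(real \<times> 'a) set"
  by (rule continuous_on_compose2[OF linear.prems(1)]) (auto intro!: continuous_intros)
 have "((\<lambda>t. LBINT z. w z * (q z * exp (2 * ((x + t *\<^sub>R v) \<bullet> z)))) has_real_derivative
   (LBINT z. w z * (q z * (2 * (v \<bullet> z) * exp (2 * ((x + 0 *\<^sub>R v) \<bullet> z)))))) (at 0)"
  by (rule integral_param_deriv[OF w, of 0 e])
   (use e in \<open>auto simp: inner_add_left case_prod_unfold intro!: derivative_eq_intros continuous_intros cqs\<close>)
 moreover have "((\<lambda>t. LBINT z. w z * (q z * exp (2 * ((x + t *\<^sub>R v) \<bullet> z)))) has_real_derivative 0) (at 0)"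
 proof -
  have "((\<lambda>_. 0) has_real_derivative 0) (at 0)" by simp
  thus ?thesis
   by (rule has_field_derivative_transform_within_open[of _ _ _ "{-e<..<e}"])
    (use e inU linear.prems(2) in auto)
 qed
 ultimately have "(LBINT z. w z * (q z * (2 * (v \<bullet> z) * exp (2 * ((x + 0 *\<^sub>R v) \<bullet> z))))) = 0"
  by (rule DERIV_unique)
 hence "2 * (LBINT z. w z * (f z * q z * exp (2 * (x \<bullet> z)))) = 0"
  by (simp add: v mult_ac flip: integral_mult_right_zero)
 thus ?case by simp
next
 case (const c)
 have "(LBINT z. w z * (c * q z * exp (2 * (x \<bullet> z)))) = c * (LBINT z. w z * (q z * exp (2 * (x \<bullet> z))))"
  by (simp add: mult_ac flip: integral_mult_right_zero)
 thus ?case using const by simp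
next
 case (add f h)
 have c: "continuous_on K f" "continuous_on K h" "continuous_on K q"
  using continuous_on_real_polynomial[OF add.hyps(1)] continuous_on_real_polynomial[OF add.hyps(2)]
   continuous_on_subset[OF add.prems(1)] by simp_all
 have "(LBINT z. w z * ((f z + h z) * q z * exp (2 * (x \<bullet> z)))) =
   (LBINT z. w z * (f z * q z * exp (2 * (x \<bullet> z))) + w z * (h z * q z * exp (2 * (x \<bullet> z))))"
  by (intro Bochner_Integration.integral_cong refl) (simp add: algebra_simps)
 also have "\<dots> = (LBINT z. w z * (f z * q z * exp (2 * (x \<bullet> z)))) + (LBINT z. w z * (h z * q z * exp (2 * (x \<bullet> z))))"
  by (rule Bochner_Integration.integral_add; rule integrable_mult_csupp[OF w]; intro continuous_intros c)
 finally show ?case using add.IH[OF add.prems] by simp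
next
 case (mult f h)
 have c: "continuous_on UNIV h"
  by (rule continuous_on_real_polynomial[OF mult.hyps(2)])
 have "(LBINT z. w z * (f z * (h z * q z) * exp (2 * (x \<bullet> z)))) = 0"
  by (rule mult.IH(1)) (use mult.prems mult.IH(2)[OF mult.prems(1,2)] c in \<open>auto intro!: continuous_intros\<close>)
 thus ?case by (simp add: mult.assoc)
qed

text \<open>exp(- |x - z|^2) = exp(- |x|^2) exp(- |z|^2) exp(2 x.z), so Gaussian moments of g are
  exponential moments of w. At one point x0 these give orthogonality of W to all polynomials, and
  approximating W itself on K makes the integral of W^2 vanish.\<close>

theorem potential_unique:
 fixes g :: "'a::euclidean_space => real"
 assumes g: "continuous_on UNIV g" "compact K" "\<forall>z. z \<notin> K \<longrightarrow> g z = 0"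
  and U: "open U" "U \<noteq> {}" "U \<inter> K = {}" and d: "2 \<le> DIM('a)"
  and van: "\<And>x. x \<in> U ==> (LBINT z. g z * rpow (1 - real DIM('a)) (x - z)) = 0"
 shows "g = (\<lambda>_. 0)"
proof -
 define w where "w z = g z * exp (- (z \<bullet> z))" for z
 have w: "continuous_on UNIV w" "\<forall>z. z \<notin> K \<longrightarrow> w z = 0"
  unfolding w_def[abs_def] using g by (auto intro!: continuous_intros)
 have z: "(LBINT z. w z * (1 * exp (2 * (x \<bullet> z)))) = 0" if x: "x \<in> U" for x
 proof -
  have "x \<notin> K" using x U by blast
  from potential_gaussian[OF g this potential_moments[OF g U(1,3) d van x]]
  have "exp (x \<bullet> x) * (LBINT z. g z * exp (- ((x - z) \<bullet> (x - z)))) = 0" by simp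
  moreover have "exp (x \<bullet> x) * (g z * exp (- ((x - z) \<bullet> (x - z)))) = w z * (1 * exp (2 * (x \<bullet> z)))" for z
  proof -
   have "exp (x \<bullet> x) * exp (- ((x - z) \<bullet> (x - z))) = exp (- (z \<bullet> z)) * exp (2 * (x \<bullet> z))"
    unfolding exp_add[symmetric] by (simp add: inner_diff_left inner_diff_right inner_commute)
   thus ?thesis by (simp add: w_def mult.left_commute mult.assoc)
  qed
  ultimately show ?thesis by (simp only: integral_mult_right_zero[symmetric])
 qed
 obtain x0 where x0: "x0 \<in> U" using U by blast
 define W where "W z = w z * exp (2 * (x0 \<bullet> z))" for z
 have W: "continuous_on UNIV W" "\<forall>z. z \<notin> K \<longrightarrow> W z = 0"
  unfolding W_def[abs_def] using w by (auto intro!: continuous_intros)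
 have WK: "continuous_on K W" using W(1) continuous_on_subset by blast
 have pz: "(LBINT z. W z * p z) = 0" if "real_polynomial_function p" for p
  using exponential_moments[OF w(1) g(2) w(2) U(1) that continuous_on_const z x0] by (simp add: W_def mult_ac)
 define A where "A = (LBINT z. \<bar>W z * 1\<bar>)"
 have A0: "0 \<le> A" by (simp add: A_def)
 have intA: "integrable lborel (\<lambda>z. W z * h z)" if "continuous_on K h" for h
  by (rule integrable_mult_csupp[OF W(1) g(2) W(2) that])
 have "(LBINT z. W z * W z) \<le> 0"
 proof (rule field_le_epsilon)
  fix e :: real assume e: "0 < e"
  define e' where "e' = e / (A + 1)"
  have e': "e' > 0" using e A0 by (simp add: e'_def)
  obtain p where p: "real_polynomial_function p" "\<And>u. u \<in> K ==> \<bar>W u - p u\<bar> < e'"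
   using Stone_Weierstrass_real_polynomial_function[OF g(2) WK e'] by auto
  have pc: "continuous_on K p"
   by (rule continuous_on_real_polynomial[OF p(1)])
  have "(LBINT z. W z * W z) = (LBINT z. W z * W z - W z * p z)"
   using pz[OF p(1)] by (subst Bochner_Integration.integral_diff[OF intA[OF WK] intA[OF pc]]) simp
  also have "\<dots> \<le> (LBINT z. e' * \<bar>W z * 1\<bar>)"
  proof (rule integral_mono)
   show "integrable lborel (\<lambda>z. W z * W z - W z * p z)"
    by (intro Bochner_Integration.integrable_diff intA WK pc)
   show "integrable lborel (\<lambda>z. e' * \<bar>W z * 1\<bar>)"
    by (intro integrable_mult_right integrable_abs intA) simp
   fix z
   show "W z * W z - W z * p z \<le> e' * \<bar>W z * 1\<bar>"
   proof (cases "z \<in> K")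
    case True
    have "W z * W z - W z * p z \<le> \<bar>W z\<bar> * \<bar>W z - p z\<bar>"
     by (metis abs_ge_self abs_mult right_diff_distrib)
    also have "\<dots> \<le> \<bar>W z\<bar> * e'" using p(2)[OF True] by (intro mult_left_mono) auto
    finally show ?thesis by (simp add: mult.commute)
   qed (simp add: W(2))
  qed
  also have "\<dots> = e' * A" by (simp add: A_def)
  also have "\<dots> \<le> e" using e A0 by (simp add: e'_def field_simps)
  finally show "(LBINT z. W z * W z) \<le> 0 + e" by simp
 qed
 hence "(LBINT z. W z * W z) = 0"
  by (intro antisym Bochner_Integration.integral_nonneg) auto
 hence "AE z in lborel. W z * W z = 0"
  using integral_nonneg_eq_0_iff_AE[OF intA[OF WK]] by simp
 hence "AE z in lborel. W z = 0" by simp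
 moreover have "open {z. W z \<noteq> 0}"
  using W(1) by (rule open_Collect_neq) simp
 ultimately have "{z. W z \<noteq> 0} \<in> null_sets lborel"
  using AE_iff_null_sets[of "{z. W z \<noteq> 0}" lborel] by simp
 hence "negligible {z. W z \<noteq> 0}"
  by (simp add: negligible_iff_null_sets null_sets_completionI)
 hence "{z. W z \<noteq> 0} = {}"
  using \<open>open {z. W z \<noteq> 0}\<close> open_not_negligible by blast
 thus ?thesis by (simp add: W_def w_def fun_eq_iff)
qed

subsection \<open>Statistics of the far field\<close>

lemma test_fun_csmooth: "compact K ==> csmooth K \<phi> ==> \<phi> \<in> test_fun UNIV"
 using csmooth_supp[of K \<phi>] compact_supp_subset[of K \<phi>] by (auto simp: test_fun_def csmooth_def)

text \<open>On K the continuity estimate involves finitely many multi-indices, and the sum of their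
  uniform bounds serves for all i.\<close>

lemma distribution_family_bound:
 fixes F :: "('a::euclidean_space => real) => real"
 assumes F: "distribution F" and K: "compact K" and \<phi>: "usmooth UNIV I \<phi>" "\<And>i y. i \<in> I ==> y \<notin> K ==> \<phi> i y = 0"
 obtains C where "C \<ge> 0" "\<And>i. i \<in> I ==> \<bar>F (\<phi> i)\<bar> \<le> C"
proof -
 obtain C N where CN: "\<And>\<psi> B. \<psi> \<in> test_fun UNIV ==> supp \<psi> \<subseteq> K ==>
   (\<And>bs x. set bs \<subseteq> Basis ==> length bs \<le> N ==> \<bar>iter_deriv bs \<psi> x\<bar> \<le> B) ==> norm (F \<psi>) \<le> C * B"
  using F K unfolding distribution_def by metis
 let ?S = "{bs :: 'a list. set bs \<subseteq> Basis \<and> length bs \<le> N}"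
 have fin: "finite ?S" by (rule finite_lists_length_le) simp
 have "\<forall>bs\<in>?S. \<exists>B. B \<ge> 0 \<and> (\<forall>i\<in>I. \<forall>x. \<bar>iter_deriv bs (\<phi> i) x\<bar> \<le> B)"
 proof
  fix bs assume "bs \<in> ?S"
  hence "set bs \<subseteq> Basis" by simp
  obtain B where "B > 0" "\<And>i x. i \<in> I ==> x \<in> UNIV ==> norm (iter_deriv bs (\<phi> i) x) \<le> B"
   using usmooth_bound[OF \<phi>(1) \<open>set bs \<subseteq> Basis\<close>] by metis
  thus "\<exists>B. B \<ge> 0 \<and> (\<forall>i\<in>I. \<forall>x. \<bar>iter_deriv bs (\<phi> i) x\<bar> \<le> B)" by (intro exI[of _ B]) auto
 qed
 from bchoice[OF this] obtain B where "\<forall>bs\<in>?S. B bs \<ge> 0 \<and> (\<forall>i\<in>I. \<forall>x. \<bar>iter_deriv bs (\<phi> i) x\<bar> \<le> B bs)"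
  by blast
 hence B: "\<And>bs. bs \<in> ?S ==> B bs \<ge> 0" "\<And>bs i x. bs \<in> ?S ==> i \<in> I ==> \<bar>iter_deriv bs (\<phi> i) x\<bar> \<le> B bs"
  by blast+
 have "\<bar>F (\<phi> i)\<bar> \<le> \<bar>C * sum B ?S\<bar>" if i: "i \<in> I" for i
 proof -
  have cs: "csmooth K (\<phi> i)"
   using \<phi> i by (simp add: csmooth_def usmooth_def)
  have "norm (F (\<phi> i)) \<le> C * sum B ?S"
  proof (rule CN[OF test_fun_csmooth[OF K cs] csmooth_supp[OF K cs]])
   fix bs :: "'a list" and x assume "set bs \<subseteq> Basis" "length bs \<le> N"
   hence bs: "bs \<in> ?S" by simp
   have "B bs \<le> sum B ?S" by (rule member_le_sum[OF bs _ fin]) (use B(1) in auto)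
   thus "\<bar>iter_deriv bs (\<phi> i) x\<bar> \<le> sum B ?S" using B(2)[OF bs i] by (rule order_trans[rotated])
  qed
  thus ?thesis by (simp add: abs_le_iff)
 qed
 thus thesis by (intro that[of "\<bar>C * sum B ?S\<bar>"]) auto
qed

lemma distribution_linear:
 assumes "distribution F" "\<phi> \<in> test_fun UNIV" "\<psi> \<in> test_fun UNIV"
 shows "F (\<lambda>x. a * \<phi> x + b * \<psi> x) = a *\<^sub>R F \<phi> + b *\<^sub>R F \<psi>"
 using assms by (simp add: distribution_def)

lemma distribution_scale:
 assumes "distribution F" "\<phi> \<in> test_fun UNIV"
 shows "F (\<lambda>x. a * \<phi> x) = a *\<^sub>R F \<phi>"
 using distribution_linear[OF assms assms(2), of a 0] by simp

text \<open>It makes pairings independent of the cutoff, as two cutoffs agree near the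
  support.\<close>

lemma distribution_support_cong:
 fixes F :: "('a::euclidean_space => real) => 'b::real_normed_vector"
 assumes F: "distribution F" "distribution_supported_in E F"
  and \<phi>: "\<phi> \<in> test_fun UNIV" "\<psi> \<in> test_fun UNIV" and O: "open W" "E \<subseteq> W" "\<And>y. y \<in> W ==> \<phi> y = \<psi> y"
 shows "F \<phi> = F \<psi>"
proof -
 have "(\<lambda>x. 1 * \<phi> x + (-1) * \<psi> x) \<in> test_fun UNIV" by (rule test_fun_lincomb[OF \<phi>])
 moreover have "supp (\<lambda>x. 1 * \<phi> x + (-1) * \<psi> x) \<subseteq> - W"
  by (rule supp_minimal) (use O in auto)
 hence "supp (\<lambda>x. 1 * \<phi> x + (-1) * \<psi> x) \<inter> E = {}" using O(2) by blast
 ultimately have "F (\<lambda>x. 1 * \<phi> x + (-1) * \<psi> x) = 0"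
  using F(2) unfolding distribution_supported_in_def by blast
 thus ?thesis by (subst (asm) distribution_linear[OF F(1) \<phi>]) simp
qed

lemma gaussian_rv_cong:
 assumes "gaussian_rv M X" "\<And>\<omega>. \<omega> \<in> space M ==> X \<omega> = Y \<omega>"
 shows "gaussian_rv M Y"
proof -
 have m: "Y \<in> borel_measurable M"
  using assms measurable_cong[of M X Y borel] by (simp add: gaussian_rv_def)
 have d: "distr M lborel X = distr M lborel Y"
  by (rule distr_cong) (use assms in auto)
 have "(AE \<omega> in M. X \<omega> = c) \<longleftrightarrow> (AE \<omega> in M. Y \<omega> = c)" for c
  by (rule AE_cong) (use assms in auto)
 thus ?thesis
  using assms(1) m unfolding gaussian_rv_def distributed_def d by auto
qed

text \<open>For the real and imaginary part of a wave: the operator has real coefficients, so bounds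
  for the complex wave pass to both parts.\<close>

lemma helmholtz_bounded_linear:
 fixes g :: "'a::euclidean_space => complex"
 assumes K: "compact K" "csmooth K g" and T: "bounded_linear T" "\<And>c z. T (cor c * z) = cor c * T z"
 shows "(helmholtz (cor a) ^^ j) (\<lambda>y. T (g y)) = (\<lambda>y. T ((helmholtz (cor a) ^^ j) g y))"
proof (induction j)
 case (Suc j)
 have cs: "smooth_on UNIV ((helmholtz (cor a) ^^ j) g)"
  using csmooth_helmholtz_pow[OF K] by (simp add: csmooth_def)
 have "laplacian (\<lambda>y. T ((helmholtz (cor a) ^^ j) g y)) y = T (laplacian ((helmholtz (cor a) ^^ j) g) y)" for y
  unfolding laplacian_def linear_sum[OF bounded_linear.linear[OF T(1)]]
  by (intro sum.cong refl iter_deriv_bounded_linear[OF open_UNIV T(1) cs]) auto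
 thus ?case
  unfolding funpow.simps o_def Suc helmholtz_def[of "cor a" "\<lambda>y. T ((helmholtz (cor a) ^^ j) g y)"]
   helmholtz_def[of "cor a" "(helmholtz (cor a) ^^ j) g"]
  by (simp add: T(2) linear_add[OF bounded_linear.linear[OF T(1)]])
qed simp

section \<open>The data at one observation point\<close>

text \<open>\<open>\<kappa>\<close> is 1 near the closure of D and supported in V, p is the decay
  exponent of outgoing waves, A and B are the propagating and the evanescent amplitude with their
  derivatives, and a is the modulus of the leading coefficient of A at infinity.\<close>

locale scattering = annulus x V "supp \<kappa>" \<rho>
 for x :: "'a::euclidean_space" and V \<rho> and \<kappa> :: "'a => real" +
 fixes D W :: "'a set" and p m a :: real and A B :: "nat => complex => complex"
  and M :: "'w measure" and f :: "'w => ('a => real) => real" and \<mu> :: "'a => real"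
 assumes \<kappa>: "\<kappa> \<in> test_fun V" and W: "open W" "closure D \<subseteq> W" "\<And>y. y \<in> W ==> \<kappa> y = 1"
  and D: "open D"
  and p: "p = (real DIM('a) - 1) / 2"
  and AB: "symbol_tower p A" "symbol_tower p B"
  and a: "((\<lambda>t. t powr p * norm (A 0 (cor t))) \<longlongrightarrow> a) at_top" "a\<^sup>2 = 1 / (16 * (2 * pi) ^ (DIM('a) - 1))"
  and fs: "\<And>k y. 0 < k ==> x \<noteq> y ==> cor (k powr (4 - real DIM('a))) * fund_sol k x y =
   ei (k * norm (y - x)) * A 0 (cor (k * norm (y - x))) -
   exp (- cor (k * norm (y - x))) * B 0 (cor (k * norm (y - x)))"
  and f: "centered_microlocally_isotropic M D (- m) \<mu> f"
begin

lemma p0: "0 \<le> p" unfolding p using DIM_positive[where 'a='a] by (simp add: Suc_leI)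

lemma V_ne: "y \<in> V ==> x \<noteq> y" using \<rho> by fastforce

lemma \<kappa>_simps: "smooth_on UNIV \<kappa>" "compact (supp \<kappa>)" "supp \<kappa> \<subseteq> V" "y \<notin> V ==> \<kappa> y = 0" "y \<notin> supp \<kappa> ==> \<kappa> y = 0"
 using \<kappa> by (auto simp: test_fun_def intro: supp_zero)

lemma field: "prob_space M" "\<omega> \<in> space M ==> distribution (f \<omega>)" "\<phi> \<in> test_fun UNIV ==> gaussian_rv M (\<lambda>\<omega>. f \<omega> \<phi>)"
 "\<phi> \<in> test_fun UNIV ==> (LINT \<omega>|M. f \<omega> \<phi>) = 0" "\<omega> \<in> space M ==> distribution_supported_in (closure D) (f \<omega>)"
 "\<mu> \<in> test_fun D" "0 \<le> \<mu> y"
 using f by (auto simp: centered_microlocally_isotropic_def gaussian_random_field_def centered_field_def is_strength_def)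

lemma \<mu>_simps: "\<mu> \<in> test_fun UNIV" "y \<notin> D ==> \<mu> y = 0" "D \<subseteq> V" "y \<in> D ==> \<kappa> y = 1"
proof -
 show "\<mu> \<in> test_fun UNIV" using field(6) test_fun_mono by blast
 show "y \<notin> D ==> \<mu> y = 0" using field(6) by (auto simp: test_fun_def intro: supp_zero)
 have DW: "D \<subseteq> W" using closure_subset W(2) by blast
 thus k1: "y \<in> D ==> \<kappa> y = 1" for y using W(3) by blast
 thus "D \<subseteq> V" using \<kappa>_simps(4) by force
qed

text \<open>\<open>osc\<close> is the rescaled fundamental solution; \<open>probe\<close> is the same function cut off and written as a wave.\<close>

definition osc :: "real => 'a => complex" where
 "osc k y = exp (\<i> * (cor k * rc y)) * A 0 (cor k * rc y)
  - exp (- 1 * (cor k * rc y)) * B 0 (cor k * rc y)"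

lemma osc_fund_sol: "0 < k ==> y \<in> V ==> osc k y = cor (k powr (4 - real DIM('a))) * fund_sol k x y"
 using fs[of k y] V_ne[of y] by (simp add: osc_def rc_def)

lemma osc_lipschitz: "0 < c ==> lipschitz_family {c..b} osc"
proof -
 assume c: "0 < c"
 have e: "lipschitz_family {c..b} (\<lambda>k y. exp (u * (cor k * rc y)))" for u
  using lipschitz_family_tower[of c "\<lambda>n z. u ^ n * exp (u * z)", OF c exp_tower] by simp
 show ?thesis
  unfolding osc_def[abs_def]
  by (intro lipschitz_family_diff lipschitz_family_mult e lipschitz_family_tower[OF c]
     symbol_tower_deriv[OF AB(1)] symbol_tower_deriv[OF AB(2)])
qed

lemma smooth_fund_sol: "0 < k ==> smooth_on V (fund_sol k x)"
proof -
 assume k: "0 < k"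
 \<comment> \<open>On a one-point interval the notion reduces to bounded smoothness of the single
   function \<open>osc k\<close>.\<close>
 have "lipschitz_family {k..k} osc" by (rule osc_lipschitz[OF k])
 hence "smooth_on V (osc k)" by (simp add: lipschitz_family_def usmooth_def)
 hence "smooth_on V (\<lambda>y. cor (inverse (k powr (4 - real DIM('a)))) * osc k y)"
  by (intro smooth_on_mult smooth_on_const V)
 thus ?thesis
  by (rule smooth_on_cong[OF V(1)]) (use k in \<open>simp add: osc_fund_sol\<close>)
qed

text \<open>The evanescent wave exp(- k r) is written as exp(i k r) exp(- (1 + i) k r), so that both
  waves share one phase and the second factor is uniformly smooth. The factor k^p compensates the
  decay of A and B.\<close>

definition amp :: "real => 'a => complex" where
 "amp k y = cor (\<kappa> y) * (cor (k powr p) * A 0 (cor k * rc y)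
  - exp (- (1 + \<i>) * (cor k * rc y)) * (cor (k powr p) * B 0 (cor k * rc y)))"

lemma amp: "amplitude {1..} amp"
proof -
 have "usmooth V {1..} (\<lambda>_::real. \<kappa>)"
  using usmooth_subset[OF usmooth_compact_supp[OF \<kappa>_simps(1,2)], of V "{1..}" UNIV] by simp
 hence "usmooth V {1..} amp"
  unfolding amp_def[abs_def]
  by (intro usmooth_mult usmooth_diff_fun usmooth_of_real usmooth_tower usmooth_exp_decay AB p0 V) simp_all
 thus ?thesis
  by (simp add: amplitude_def amp_def \<kappa>_simps)
qed

definition probe :: "real => 'a => complex" where "probe k = wave k (amp k)"

lemma probe_osc: "probe k y = cor (k powr p * \<kappa> y) * osc k y"
 unfolding probe_def wave_def amp_def osc_def
 by (simp add: algebra_simps exp_diff exp_minus exp_add divide_inverse)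

lemma csmooth_probe: "1 \<le> k ==> csmooth (supp \<kappa>) (probe k)"
 unfolding probe_def by (rule csmooth_wave[OF amp]) simp

lemma probe_bound:
 obtains C where "C > 0" "\<And>k y. 1 \<le> k ==> norm (probe k y) \<le> C"
  "\<And>k y. 1 \<le> k ==> norm ((helmholtz (cor (k\<^sup>2)) ^^ j) (probe k) y) \<le> C * k ^ j"
proof -
 obtain C1 where C1: "C1 > 0" "\<And>i y. i \<in> {1..} ==> norm (amp i y) \<le> C1" using amplitude_bound[OF amp] by metis
 obtain C2 where C2: "C2 > 0" "\<And>k y. 1 \<le> k ==> norm ((helmholtz (cor (k\<^sup>2)) ^^ j) (probe k) y) \<le> C2 * k ^ j"
  using helmholtz_wave_bound[OF amp, of j] unfolding probe_def by metis
 show thesis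
 proof (rule that[of "max C1 C2"])
  fix k :: real and y assume k: "1 \<le> k"
  show "norm (probe k y) \<le> max C1 C2"
   using C1(2)[of k y] k by (simp add: probe_def norm_wave)
  have "C2 * k ^ j \<le> max C1 C2 * k ^ j" using k by (intro mult_right_mono) auto
  thus "norm ((helmholtz (cor (k\<^sup>2)) ^^ j) (probe k) y) \<le> max C1 C2 * k ^ j"
   using C2(2)[OF k, of y] by linarith
 qed (use C1 in auto)
qed

text \<open>Lets Re and Im be treated at once: the field and Isserlis' formula are real, the
  fundamental solution is complex.\<close>

definition part :: "(complex => real) => bool" where "part L \<longleftrightarrow> L = Re \<or> L = Im"

lemma part: "part L ==> bounded_linear L" "part L ==> L (cor c * z) = c * L z" "part L ==> \<bar>L z\<bar> \<le> norm z"
 by (auto simp: part_def bounded_linear_Re bounded_linear_Im abs_Re_le_cmod abs_Im_le_cmod)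

lemma csmooth_part: "part L ==> 1 \<le> k ==> csmooth (supp \<kappa>) (\<lambda>y. L (probe k y))"
 using csmooth_probe[of k] part(1)[of L] unfolding csmooth_def
 by (simp add: smooth_on_bounded_linear linear_0[OF bounded_linear.linear])

lemma test_fun_part: "part L ==> 1 \<le> k ==> (\<lambda>y. L (probe k y)) \<in> test_fun UNIV"
 by (rule test_fun_csmooth[OF \<kappa>_simps(2) csmooth_part])

text \<open>The factor k^(m / 2) offsets the size k^(- m) of the variance. The sum of the squares
  for Re and Im is the integrand of the theorem, by \<open>pairing_datum\<close>.\<close>

definition datum :: "(complex => real) => real => 'w => real" where
 "datum L k \<omega> = k powr (m / 2) * f \<omega> (\<lambda>y. L (probe k y))"

lemma datum_lincomb:
 assumes "part L" "1 \<le> k" "1 \<le> l"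
 shows "\<exists>\<phi>\<in>test_fun UNIV. \<forall>\<omega>\<in>space M. f \<omega> \<phi> = c * datum L k \<omega> + d * datum L l \<omega>"
proof (intro bexI ballI)
 show "(\<lambda>y. (c * k powr (m / 2)) * L (probe k y) + (d * l powr (m / 2)) * L (probe l y)) \<in> test_fun UNIV"
  by (intro test_fun_lincomb test_fun_part assms)
 fix \<omega> assume "\<omega> \<in> space M"
 thus "f \<omega> (\<lambda>y. (c * k powr (m / 2)) * L (probe k y) + (d * l powr (m / 2)) * L (probe l y)) = c * datum L k \<omega> + d * datum L l \<omega>"
  by (subst distribution_linear[OF field(2)]) (use assms in \<open>simp_all add: datum_def test_fun_part\<close>)
qed

lemma datum_gaussian:
 assumes "part L" "1 \<le> k" "1 \<le> l"
 shows "gaussian_rv M (\<lambda>\<omega>. c * datum L k \<omega> + d * datum L l \<omega>)" "(LINT \<omega>|M. c * datum L k \<omega> + d * datum L l \<omega>) = 0"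
proof -
 obtain \<phi> where \<phi>: "\<phi> \<in> test_fun UNIV" "\<And>\<omega>. \<omega> \<in> space M ==> f \<omega> \<phi> = c * datum L k \<omega> + d * datum L l \<omega>"
  using datum_lincomb[OF assms] by metis
 show "gaussian_rv M (\<lambda>\<omega>. c * datum L k \<omega> + d * datum L l \<omega>)"
  by (rule gaussian_rv_cong[OF field(3)[OF \<phi>(1)] \<phi>(2)])
 have "(LINT \<omega>|M. c * datum L k \<omega> + d * datum L l \<omega>) = (LINT \<omega>|M. f \<omega> \<phi>)"
  by (rule Bochner_Integration.integral_cong) (use \<phi> in auto)
 thus "(LINT \<omega>|M. c * datum L k \<omega> + d * datum L l \<omega>) = 0" using field(4)[OF \<phi>(1)] by simp
qed

text \<open>Difference quotients of the test functions in k are bounded in all seminorms, so each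
  realization, being a distribution, is Lipschitz in k on every interval {1..b}. Here g is the probe
  without the factor k^p.\<close>

lemma datum_continuous:
 assumes L: "part L" and \<omega>: "\<omega> \<in> space M"
 shows "continuous_on {1..} (\<lambda>k. datum L k \<omega>)"
proof -
 have F: "distribution (f \<omega>)" by (rule field(2)[OF \<omega>])
 define g where "g k y = \<kappa> y * L (osc k y)" for k y
 have uv: "usmooth UNIV {1..b} g"
   "usmooth UNIV {(k, l). k \<in> {1..b} \<and> l \<in> {1..b} \<and> k \<noteq> l} (\<lambda>i y. \<kappa> y * L (case i of (k, l) => (osc k y - osc l y) / cor (k - l)))" for b
 proof -
  have "usmooth V {1..b} osc" and s: "usmooth V {(k, l). k \<in> {1..b} \<and> l \<in> {1..b} \<and> k \<noteq> l} (\<lambda>(k, l) y. (osc k y - osc l y) / cor (k - l))"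
   using osc_lipschitz[of 1 b] by (auto simp: lipschitz_family_def)
  thus "usmooth UNIV {1..b} g"
   unfolding g_def[abs_def] by (intro usmooth_cutoff[OF \<kappa>_simps(1-3) V(1)] usmooth_bounded_linear[OF V(1) part(1)[OF L]])
  have "usmooth UNIV {(k, l). k \<in> {1..b} \<and> l \<in> {1..b} \<and> k \<noteq> l} (\<lambda>i y. \<kappa> y * L ((\<lambda>(k, l) y. (osc k y - osc l y) / cor (k - l)) i y))"
   by (intro usmooth_cutoff[OF \<kappa>_simps(1-3) V(1)] usmooth_bounded_linear[OF V(1) part(1)[OF L] s])
  thus "usmooth UNIV {(k, l). k \<in> {1..b} \<and> l \<in> {1..b} \<and> k \<noteq> l} (\<lambda>i y. \<kappa> y * L (case i of (k, l) => (osc k y - osc l y) / cor (k - l)))"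
   by (rule usmooth_cong[OF open_UNIV]) auto
 qed
 have gt: "g k \<in> test_fun UNIV" if "1 \<le> k" for k
  using usmooth_smooth[OF uv(1)[of k], of k] that
  by (intro test_fun_csmooth[OF \<kappa>_simps(2)]) (simp add: csmooth_def, simp add: g_def \<kappa>_simps)
 have "continuous_on {1..b} (\<lambda>k. f \<omega> (g k))" for b
 proof -
  obtain C where C: "C \<ge> 0" "\<And>i. i \<in> {(k, l). k \<in> {1..b} \<and> l \<in> {1..b} \<and> k \<noteq> l} ==>
    \<bar>f \<omega> (\<lambda>y. \<kappa> y * L (case i of (k, l) => (osc k y - osc l y) / cor (k - l)))\<bar> \<le> C"
   by (rule distribution_family_bound[OF F \<kappa>_simps(2) uv(2)[of b]]) (auto simp: \<kappa>_simps(5))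
  have "C-lipschitz_on {1..b} (\<lambda>k. f \<omega> (g k))"
  proof (rule lipschitz_onI[OF _ C(1)])
   fix k l assume kl: "k \<in> {1..b}" "l \<in> {1..b}"
   show "dist (f \<omega> (g k)) (f \<omega> (g l)) \<le> C * dist k l"
   proof (cases "k = l")
    case False
    have e: "(\<lambda>y. \<kappa> y * L ((osc k y - osc l y) / cor (k - l))) = (\<lambda>y. inverse (k - l) * g k y + (- inverse (k - l)) * g l y)"
    proof
     fix y
     have "(osc k y - osc l y) / cor (k - l) = cor (inverse (k - l)) * (osc k y - osc l y)"
      by (simp add: divide_inverse mult.commute)
     thus "\<kappa> y * L ((osc k y - osc l y) / cor (k - l)) = inverse (k - l) * g k y + (- inverse (k - l)) * g l y"
      by (simp only: part(2)[OF L] linear_diff[OF bounded_linear.linear[OF part(1)[OF L]]] g_def) (simp add: algebra_simps)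
    qed
    have "\<bar>f \<omega> (\<lambda>y. \<kappa> y * L ((osc k y - osc l y) / cor (k - l)))\<bar> \<le> C"
     using C(2)[of "(k, l)"] kl False by simp
    moreover have "1 \<le> k" "1 \<le> l" using kl by auto
    ultimately have "\<bar>inverse (k - l) *\<^sub>R f \<omega> (g k) + (- inverse (k - l)) *\<^sub>R f \<omega> (g l)\<bar> \<le> C"
     unfolding e by (simp only: distribution_linear[OF F gt gt])
    hence "\<bar>inverse (k - l) * (f \<omega> (g k) - f \<omega> (g l))\<bar> \<le> C"
     by (simp add: right_diff_distrib)
    thus ?thesis
     using False by (simp add: abs_mult dist_real_def field_simps)
   qed simp
  qed
  thus ?thesis by (rule lipschitz_on_continuous_on)
 qed
 hence cont: "continuous_on {1..} (\<lambda>k. f \<omega> (g k))"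
 proof (subst continuous_on_eq_continuous_within, intro ballI)
  fix k :: real assume c: "\<And>b. continuous_on {1..b} (\<lambda>k. f \<omega> (g k))" and k: "k \<in> {1..}"
  have "continuous (at k within {1..k + 1}) (\<lambda>k. f \<omega> (g k))"
   using c[of "k + 1"] k by (auto simp: continuous_on_eq_continuous_within)
  moreover have "at k within {1..k + 1} = at k within {1..}"
   by (rule at_within_nhd[of k "{..<k + 1}"]) auto
  ultimately show "continuous (at k within {1..}) (\<lambda>k. f \<omega> (g k))" by (simp add: continuous_within)
 qed
 have "continuous_on {1..} (\<lambda>k. k powr (m / 2) * (k powr p * f \<omega> (g k)))"
  by (intro continuous_intros cont) auto
 thus ?thesis
 proof (rule continuous_on_eq)
  fix k :: real assume k: "k \<in> {1..}"
  have e: "(\<lambda>y. L (probe k y)) = (\<lambda>y. k powr p * g k y)"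
   unfolding probe_osc part(2)[OF L] g_def by (simp add: mult.assoc)
  show "k powr (m / 2) * (k powr p * f \<omega> (g k)) = datum L k \<omega>"
   unfolding datum_def e using distribution_scale[OF F gt, of k "k powr p"] k by simp
 qed
qed


section \<open>Covariances of the data and the limit of the variances\<close>

text \<open>Only the first probe has to be localised near the sphere of radius k; the second may
  have any wave number l. Hence one estimate covers all pairs, with an error measured in k
  alone.\<close>

lemma covariance_asymptotic:
 obtains C where "C \<ge> 0" "\<And>L k l. part L ==> 1 \<le> k ==> 1 \<le> l ==>
  \<bar>(LINT \<omega>|M. f \<omega> (\<lambda>y. L (probe k y)) * f \<omega> (\<lambda>y. L (probe l y))) - k powr (- m) * (LBINT y. \<mu> y * L (probe k y) * L (probe l y))\<bar>
   \<le> C * k powr (- m - 1)"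
proof -
 obtain \<sigma> where \<sigma>: "classical_symbol (- m) (\<lambda>(x, \<xi>). cor (\<mu> x * norm \<xi> powr (- m))) \<sigma>"
  and cov: "\<And>\<phi> \<psi>. \<phi> \<in> test_fun UNIV ==> \<psi> \<in> test_fun UNIV ==>
   cor (LINT \<omega>|M. f \<omega> \<phi> * f \<omega> \<psi>) = (LBINT x. psido \<sigma> \<phi> x * cor (\<psi> x))"
  using f unfolding centered_microlocally_isotropic_def by blast
 define J where "J = nat \<lceil>\<bar>m\<bar> + 2\<rceil>"
 have J: "\<bar>- m\<bar> + 2 \<le> real J" unfolding J_def by (simp add: real_nat_ceiling_ge)
 obtain C where C: "\<And>k B \<phi> \<psi>. 1 \<le> k ==> csmooth (supp \<kappa>) \<phi> ==> csmooth (supp \<kappa>) \<psi> ==> (\<And>y. \<bar>\<phi> y\<bar> \<le> B) ==> (\<And>y. \<bar>\<psi> y\<bar> \<le> B) ==>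
   (\<And>y. norm ((helmholtz (cor (k\<^sup>2)) ^^ J) (\<lambda>y. cor (\<phi> y)) y) \<le> B * k ^ J) ==>
   norm ((LBINT x. psido \<sigma> \<phi> x * cor (\<psi> x)) - cor (k powr (- m) * (LBINT x. \<mu> x * \<phi> x * \<psi> x)))
    \<le> C * B\<^sup>2 * k powr (- m - 1)"
  using psido_pairing_asymptotic[OF \<sigma> \<mu>_simps(1) J \<kappa>_simps(2)] by blast
 obtain B where B: "B > 0" "\<And>k y. 1 \<le> k ==> norm (probe k y) \<le> B"
  "\<And>k y. 1 \<le> k ==> norm ((helmholtz (cor (k\<^sup>2)) ^^ J) (probe k) y) \<le> B * k ^ J"
  using probe_bound[of J] by metis
 show thesis
 proof (rule that[of "\<bar>C * B\<^sup>2\<bar>"])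
  fix L and k l :: real assume L: "part L" and k: "1 \<le> k" and l: "1 \<le> l"
  have T: "bounded_linear (\<lambda>z. cor (L z))"
   by (rule bounded_linear_compose[OF bounded_linear_of_real part(1)[OF L]])
  have h: "(helmholtz (cor (k\<^sup>2)) ^^ J) (\<lambda>y. cor (L (probe k y))) =
    (\<lambda>y. cor (L ((helmholtz (cor (k\<^sup>2)) ^^ J) (probe k) y)))"
   by (rule helmholtz_bounded_linear[OF \<kappa>_simps(2) csmooth_probe[OF k] T]) (simp add: part(2)[OF L])
  have "norm ((LBINT y. psido \<sigma> (\<lambda>y. L (probe k y)) y * cor (L (probe l y)))
    - cor (k powr (- m) * (LBINT y. \<mu> y * L (probe k y) * L (probe l y)))) \<le> C * B\<^sup>2 * k powr (- m - 1)"
  proof (rule C[OF k csmooth_part[OF L k] csmooth_part[OF L l]])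
   show "\<bar>L (probe k y)\<bar> \<le> B" "\<bar>L (probe l y)\<bar> \<le> B" for y
    using part(3)[OF L] B(2)[OF k] B(2)[OF l] order_trans by blast+
   show "norm ((helmholtz (cor (k\<^sup>2)) ^^ J) (\<lambda>y. cor (L (probe k y))) y) \<le> B * k ^ J" for y
    unfolding h norm_of_real by (rule order_trans[OF part(3)[OF L] B(3)[OF k]])
  qed
  also have "\<dots> \<le> \<bar>C * B\<^sup>2\<bar> * k powr (- m - 1)" by (intro mult_right_mono) auto
  finally show "\<bar>(LINT \<omega>|M. f \<omega> (\<lambda>y. L (probe k y)) * f \<omega> (\<lambda>y. L (probe l y))) - k powr (- m) * (LBINT y. \<mu> y * L (probe k y) * L (probe l y))\<bar>
   \<le> \<bar>C * B\<^sup>2\<bar> * k powr (- m - 1)"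
   unfolding cov[OF test_fun_part[OF L k] test_fun_part[OF L l], symmetric] of_real_diff[symmetric] norm_of_real .
 qed simp
qed

lemma \<mu>_smooth: "usmooth V I (\<lambda>_. \<mu>)" "smooth_on UNIV \<mu>" "compact (supp \<mu>)"
proof -
 show s: "smooth_on UNIV \<mu>" "compact (supp \<mu>)" using \<mu>_simps(1) by (auto simp: test_fun_def)
 show "usmooth V I (\<lambda>_. \<mu>)"
  using usmooth_subset[OF usmooth_compact_supp[OF s, where I=I], of V I] by simp
qed

text \<open>Re z Re w and Im z Im w are half the real part of z cnj(w) plus or minus z w. The phases
  are therefore k - l and k + l, and k + l >= |k - l|.\<close>

lemma cross_term_decay:
 obtains C where "C \<ge> 0" "\<And>L k l. part L ==> 1 \<le> k ==> 1 \<le> l ==>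
  \<bar>LBINT y. \<mu> y * L (probe k y) * L (probe l y)\<bar> \<le> C / (1 + \<bar>k - l\<bar>)"
proof -
 let ?I = "{1..} \<times> {1::real..}"
 define c1 where "c1 i y = cor (\<mu> y) * (amp (fst i) y * amp (snd i) y)" for i y
 define c2 where "c2 i y = cor (\<mu> y) * (amp (fst i) y * cnj (amp (snd i) y))" for i y
 have u: "usmooth V ?I (\<lambda>i. amp (fst i))" "usmooth V ?I (\<lambda>i. amp (snd i))"
  by (rule usmooth_reindex[where I="{1..}" and g=amp], use amp in \<open>auto simp: amplitude_def\<close>)+
 have c: "amplitude ?I c1" "amplitude ?I c2"
  unfolding amplitude_def
  using usmooth_mult[OF V(1) usmooth_of_real[OF V(1) \<mu>_smooth(1)] usmooth_mult[OF V(1) u]]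
   usmooth_mult[OF V(1) usmooth_of_real[OF V(1) \<mu>_smooth(1)] usmooth_mult[OF V(1) u(1) usmooth_bounded_linear[OF V(1) bounded_linear_cnj u(2)]]]
  by (auto simp: c1_def[abs_def] c2_def[abs_def] amp_def \<kappa>_simps)
 obtain C1 where C1: "C1 > 0" "\<And>i t. i \<in> ?I ==> (1 + \<bar>t\<bar>) * norm (LBINT y. wave t (c1 i) y) \<le> C1"
  using oscillatory_decay[OF c(1)] by metis
 obtain C2 where C2: "C2 > 0" "\<And>i t. i \<in> ?I ==> (1 + \<bar>t\<bar>) * norm (LBINT y. wave t (c2 i) y) \<le> C2"
  using oscillatory_decay[OF c(2)] by metis
 show thesis
 proof (rule that[of "C1 + C2"])
  fix L and k l :: real assume L: "part L" and k: "1 \<le> k" and l: "1 \<le> l"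
  have i: "(k, l) \<in> ?I" using k l by simp
  have int: "integrable lborel (wave t (c1 (k, l)))" "integrable lborel (wave t (c2 (k, l)))" for t
   by (intro integrable_csmooth[OF \<kappa>_simps(2) csmooth_wave[OF c(1) i]] integrable_csmooth[OF \<kappa>_simps(2) csmooth_wave[OF c(2) i]])+
  have e: "wave (k + l) (c1 (k, l)) y = cor (\<mu> y) * (probe k y * probe l y)"
   "wave (k - l) (c2 (k, l)) y = cor (\<mu> y) * (probe k y * cnj (probe l y))" for y
   unfolding wave_def c1_def c2_def probe_def
   by (simp_all add: rc_def exp_add[symmetric] exp_cnj algebra_simps flip: exp_add)
  define s where "s = (if L = Re then 1 else - 1 :: real)"
  have s: "\<bar>s\<bar> = 1" by (simp add: s_def)
  have "\<mu> y * L (probe k y) * L (probe l y) = 1/2 * (s * Re (wave (k + l) (c1 (k, l)) y) + Re (wave (k - l) (c2 (k, l)) y))" for y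
   using L unfolding e by (auto simp: part_def s_def algebra_simps fun_eq_iff)
  hence "(LBINT y. \<mu> y * L (probe k y) * L (probe l y)) =
    (LBINT y. 1/2 * (s * Re (wave (k + l) (c1 (k, l)) y) + Re (wave (k - l) (c2 (k, l)) y)))"
   by (simp only:)
  also have "\<dots> = 1/2 * (s * Re (LBINT y. wave (k + l) (c1 (k, l)) y) + Re (LBINT y. wave (k - l) (c2 (k, l)) y))"
   unfolding integral_mult_right_zero integral_Re[OF int(1), symmetric] integral_Re[OF int(2), symmetric]
   by (subst Bochner_Integration.integral_add) (use int in \<open>auto intro!: integrable_Re\<close>)
  finally have "(LBINT y. \<mu> y * L (probe k y) * L (probe l y)) =
    1/2 * (s * Re (LBINT y. wave (k + l) (c1 (k, l)) y) + Re (LBINT y. wave (k - l) (c2 (k, l)) y))" .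
  hence "\<bar>LBINT y. \<mu> y * L (probe k y) * L (probe l y)\<bar> \<le>
   norm (LBINT y. wave (k + l) (c1 (k, l)) y) + norm (LBINT y. wave (k - l) (c2 (k, l)) y)"
   using abs_Re_le_cmod[of "LBINT y. wave (k + l) (c1 (k, l)) y"] abs_Re_le_cmod[of "LBINT y. wave (k - l) (c2 (k, l)) y"] s
   by (auto simp: s_def split: if_splits)
  also have "\<dots> \<le> C1 / (1 + \<bar>k - l\<bar>) + C2 / (1 + \<bar>k - l\<bar>)"
  proof (rule add_mono)
   have "(1 + \<bar>k - l\<bar>) * norm (LBINT y. wave (k + l) (c1 (k, l)) y) \<le> (1 + \<bar>k + l\<bar>) * norm (LBINT y. wave (k + l) (c1 (k, l)) y)"
    using k l by (intro mult_right_mono) auto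
   also have "\<dots> \<le> C1" by (rule C1(2)[OF i])
   finally show "norm (LBINT y. wave (k + l) (c1 (k, l)) y) \<le> C1 / (1 + \<bar>k - l\<bar>)"
    by (simp add: pos_le_divide_eq mult.commute add_pos_nonneg)
   show "norm (LBINT y. wave (k - l) (c2 (k, l)) y) \<le> C2 / (1 + \<bar>k - l\<bar>)"
    using C2(2)[OF i, of "k - l"] by (simp add: pos_le_divide_eq mult.commute add_pos_nonneg)
  qed
  finally show "\<bar>LBINT y. \<mu> y * L (probe k y) * L (probe l y)\<bar> \<le> (C1 + C2) / (1 + \<bar>k - l\<bar>)"
   by (simp add: add_divide_distrib)
 qed (use C1 C2 in simp)
qed

lemma datum_product: "(LINT \<omega>|M. datum L k \<omega> * datum L l \<omega>) =
 k powr (m / 2) * l powr (m / 2) * (LINT \<omega>|M. f \<omega> (\<lambda>y. L (probe k y)) * f \<omega> (\<lambda>y. L (probe l y)))"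
 unfolding datum_def by (subst integral_mult_right_zero[symmetric]) (simp add: mult_ac)

text \<open>Expanding the covariance at k, the normalising powers leave (l / k)^(m / 2). This is at
  most 1 for at least one of the two orders of k and l, and the claim is symmetric in them.\<close>

lemma datum_decay:
 obtains C where "C \<ge> 0" "\<And>L k l. part L ==> 1 \<le> k ==> 1 \<le> l ==>
  \<bar>LINT \<omega>|M. datum L k \<omega> * datum L l \<omega>\<bar> \<le> C * (1 / (1 + \<bar>k - l\<bar>) + 1 / min k l)"
proof -
 obtain C1 where C1: "C1 \<ge> 0" "\<And>L k l. part L ==> 1 \<le> k ==> 1 \<le> l ==>
  \<bar>(LINT \<omega>|M. f \<omega> (\<lambda>y. L (probe k y)) * f \<omega> (\<lambda>y. L (probe l y))) - k powr (- m) * (LBINT y. \<mu> y * L (probe k y) * L (probe l y))\<bar>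
   \<le> C1 * k powr (- m - 1)"
  by (rule covariance_asymptotic) blast
 obtain C2 where C2: "C2 \<ge> 0" "\<And>L k l. part L ==> 1 \<le> k ==> 1 \<le> l ==>
  \<bar>LBINT y. \<mu> y * L (probe k y) * L (probe l y)\<bar> \<le> C2 / (1 + \<bar>k - l\<bar>)"
  by (rule cross_term_decay) blast
 have one: "\<bar>LINT \<omega>|M. datum L k \<omega> * datum L l \<omega>\<bar> \<le> (C1 + C2) * (1 / (1 + \<bar>k - l\<bar>) + 1 / min k l)"
  if L: "part L" and k: "1 \<le> k" and l: "1 \<le> l" and kl: "(l / k) powr (m / 2) \<le> 1" for L k l
 proof -
  define X where "X = (LINT \<omega>|M. f \<omega> (\<lambda>y. L (probe k y)) * f \<omega> (\<lambda>y. L (probe l y)))"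
  define Z where "Z = (LBINT y. \<mu> y * L (probe k y) * L (probe l y))"
  have "\<bar>X\<bar> \<le> k powr (- m) * \<bar>Z\<bar> + C1 * k powr (- m - 1)"
   using C1(2)[OF L k l] unfolding X_def[symmetric] Z_def[symmetric]
   using abs_triangle_ineq2[of X "k powr (- m) * Z"] by (simp add: abs_mult)
  also have "k powr (- m - 1) = k powr (- m) / k" using k by (simp add: powr_diff)
  finally have X: "\<bar>X\<bar> \<le> k powr (- m) * (\<bar>Z\<bar> + C1 / k)" by (simp add: algebra_simps)
  have kk: "k powr (m / 2) * l powr (m / 2) * k powr (- m) = (l / k) powr (m / 2)"
  proof -
   have "k powr (- m) = inverse (k powr (m / 2)) * inverse (k powr (m / 2))"
    using k by (simp add: powr_minus[symmetric] powr_add[symmetric])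
   thus ?thesis using k l by (simp add: powr_divide field_simps)
  qed
  have "\<bar>LINT \<omega>|M. datum L k \<omega> * datum L l \<omega>\<bar> = k powr (m / 2) * l powr (m / 2) * \<bar>X\<bar>"
   unfolding datum_product X_def by (simp add: abs_mult)
  also have "\<dots> \<le> k powr (m / 2) * l powr (m / 2) * (k powr (- m) * (\<bar>Z\<bar> + C1 / k))"
   by (intro mult_left_mono X) auto
  also have "\<dots> = (l / k) powr (m / 2) * (\<bar>Z\<bar> + C1 / k)"
   by (simp only: kk[symmetric] mult.assoc)
  also have "\<dots> \<le> 1 * (\<bar>Z\<bar> + C1 / k)"
   using kl k C1(1) by (intro mult_right_mono) auto
  also have "\<dots> \<le> C2 * (1 / (1 + \<bar>k - l\<bar>)) + C1 * (1 / min k l)"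
  proof -
   have "C1 / k \<le> C1 * (1 / min k l)" using C1(1) k l by (simp add: divide_left_mono)
   thus ?thesis using C2(2)[OF L k l] by (simp add: Z_def)
  qed
  also have "\<dots> \<le> (C1 + C2) * (1 / (1 + \<bar>k - l\<bar>)) + (C1 + C2) * (1 / min k l)"
   using C1(1) C2(1) k l by (intro add_mono mult_right_mono) auto
  finally show ?thesis by (simp add: algebra_simps)
 qed
 show thesis
 proof (rule that[of "C1 + C2"])
  fix L and k l :: real assume L: "part L" and k: "1 \<le> k" and l: "1 \<le> l"
  show "\<bar>LINT \<omega>|M. datum L k \<omega> * datum L l \<omega>\<bar> \<le> (C1 + C2) * (1 / (1 + \<bar>k - l\<bar>) + 1 / min k l)"
  proof (cases "(l / k) powr (m / 2) \<le> 1")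
   case False
   have "(l / k) powr (m / 2) * (k / l) powr (m / 2) = 1"
    using k l by (simp add: powr_mult[symmetric])
   hence "(k / l) powr (m / 2) \<le> 1"
    using False mult_mono[of 1 "(l / k) powr (m / 2)" 1 "(k / l) powr (m / 2)"]
    by (smt (verit) mult_le_cancel_right1 powr_ge_zero)
   from one[OF L l k this] show ?thesis
    by (simp add: mult.commute min.commute abs_minus_commute)
  qed (rule one[OF L k l])
 qed (use C1 C2 in simp)
qed

text \<open>The propagating part tends to a r^(- p) in modulus by the asymptotics of A, and the
  evanescent part is exponentially small.\<close>

lemma amp_limit:
 assumes "y \<in> V"
 shows "((\<lambda>k. norm (amp k y)) \<longlongrightarrow> \<bar>\<kappa> y\<bar> * (a * norm (y - x) powr (- p))) at_top"
proof -
 define r where "r = norm (y - x)"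
 have r: "r > 0" using \<rho> assms by (force simp: r_def)
 have kr: "filterlim (\<lambda>k. k * r) at_top at_top"
  using r by real_asymp
 have A1: "((\<lambda>k. norm (cor (k powr p) * A 0 (cor k * rc y))) \<longlongrightarrow> r powr (- p) * a) at_top"
 proof (rule Lim_transform_eventually)
  show "((\<lambda>k. r powr (- p) * ((k * r) powr p * norm (A 0 (cor (k * r))))) \<longlongrightarrow> r powr (- p) * a) at_top"
   by (intro tendsto_intros filterlim_compose[OF a(1) kr])
  show "\<forall>\<^sub>F k in at_top. r powr (- p) * ((k * r) powr p * norm (A 0 (cor (k * r)))) =
    norm (cor (k powr p) * A 0 (cor k * rc y))"
  proof (rule eventually_mono[OF eventually_gt_at_top[of 0]])
   fix k :: real assume "0 < k"
   hence "r powr (- p) * (k * r) powr p = k powr p"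
    using r by (simp add: powr_mult powr_minus)
   thus "r powr (- p) * ((k * r) powr p * norm (A 0 (cor (k * r)))) =
    norm (cor (k powr p) * A 0 (cor k * rc y))"
    unfolding mult.assoc[symmetric] by (simp add: norm_mult rc_def r_def)
  qed
 qed
 obtain C where C: "\<And>k. 1 \<le> k ==> norm (cor (k powr p) * B 0 (cor k * rc y)) \<le> C"
  using usmooth_bound0[OF usmooth_tower[OF AB(2) p0]] assms by (metis atLeast_iff)
 have B1: "((\<lambda>k. exp (- (1 + \<i>) * (cor k * rc y)) * (cor (k powr p) * B 0 (cor k * rc y))) \<longlongrightarrow> 0) at_top"
 proof (rule Lim_null_comparison)
  show "\<forall>\<^sub>F k in at_top. norm (exp (- (1 + \<i>) * (cor k * rc y)) * (cor (k powr p) * B 0 (cor k * rc y))) \<le> exp (- (k * r)) * C"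
   by (rule eventually_mono[OF eventually_ge_at_top[of 1]])
    (use C in \<open>auto simp: norm_mult norm_exp_eq_Re rc_def r_def intro!: mult_left_mono\<close>)
  have "((\<lambda>k. exp (- (k * r))) \<longlongrightarrow> 0) at_top"
   using filterlim_compose[OF exp_at_bot filterlim_compose[OF filterlim_uminus_at_bot_at_top kr]] by simp
  from tendsto_mult_left_zero[OF this, of C] show "((\<lambda>k. exp (- (k * r)) * C) \<longlongrightarrow> 0) at_top" .
 qed
 have "((\<lambda>k. norm (cor (k powr p) * A 0 (cor k * rc y)
  - exp (- (1 + \<i>) * (cor k * rc y)) * (cor (k powr p) * B 0 (cor k * rc y)))
  - norm (cor (k powr p) * A 0 (cor k * rc y))) \<longlongrightarrow> 0) at_top"
  (is "((\<lambda>k. norm (?X k - ?Y k) - norm (?X k)) \<longlongrightarrow> 0) at_top")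
 proof (rule Lim_null_comparison[where g="\<lambda>k. norm (?Y k)"])
  show "\<forall>\<^sub>F k in at_top. norm (norm (?X k - ?Y k) - norm (?X k)) \<le> norm (?Y k)"
  proof (intro always_eventually allI)
   fix k show "norm (norm (?X k - ?Y k) - norm (?X k)) \<le> norm (?Y k)"
    using norm_triangle_ineq3[of "?X k - ?Y k" "?X k"] by simp
  qed
  show "((\<lambda>k. norm (?Y k)) \<longlongrightarrow> 0) at_top" by (rule tendsto_norm_zero[OF B1])
 qed
 from tendsto_add[OF this A1] have "((\<lambda>k. norm (?X k - ?Y k)) \<longlongrightarrow> r powr (- p) * a) at_top" by simp
 from tendsto_mult[OF tendsto_const[of "\<bar>\<kappa> y\<bar>"] this] show ?thesis
  by (simp add: amp_def norm_mult r_def mult.commute)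
qed

text \<open>Adding the two parts produces |probe|^2 = |amp|^2, from which the phase has disappeared,
  so dominated convergence applies directly.\<close>

lemma variance_limit:
 "((\<lambda>k. (LINT \<omega>|M. (datum Re k \<omega>)\<^sup>2) + (LINT \<omega>|M. (datum Im k \<omega>)\<^sup>2)) \<longlongrightarrow> T_data D \<mu> x) at_top"
proof -
 obtain C1 where C1: "C1 \<ge> 0" "\<And>L k l. part L ==> 1 \<le> k ==> 1 \<le> l ==>
  \<bar>(LINT \<omega>|M. f \<omega> (\<lambda>y. L (probe k y)) * f \<omega> (\<lambda>y. L (probe l y))) - k powr (- m) * (LBINT y. \<mu> y * L (probe k y) * L (probe l y))\<bar>
   \<le> C1 * k powr (- m - 1)"
  by (rule covariance_asymptotic) blast
 have var: "\<bar>(LINT \<omega>|M. (datum L k \<omega>)\<^sup>2) - (LBINT y. \<mu> y * L (probe k y) * L (probe k y))\<bar> \<le> C1 / k"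
  if L: "part L" and k: "1 \<le> k" for L k
 proof -
  define X where "X = (LINT \<omega>|M. f \<omega> (\<lambda>y. L (probe k y)) * f \<omega> (\<lambda>y. L (probe k y)))"
  define Z where "Z = (LBINT y. \<mu> y * L (probe k y) * L (probe k y))"
  have kp: "k powr (m / 2) * k powr (m / 2) = k powr m" "k powr m * k powr (- m) = 1" "k powr m * k powr (- m - 1) = 1 / k"
   using k by (simp_all add: powr_add[symmetric] powr_neg_one)
  have "(LINT \<omega>|M. (datum L k \<omega>)\<^sup>2) = k powr m * X"
   unfolding power2_eq_square datum_product X_def kp ..
  hence "\<bar>(LINT \<omega>|M. (datum L k \<omega>)\<^sup>2) - Z\<bar> = \<bar>k powr m * (X - k powr (- m) * Z)\<bar>"
   using kp(2) by (simp add: right_diff_distrib mult.assoc[symmetric])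
  also have "\<dots> \<le> k powr m * (C1 * k powr (- m - 1))"
   unfolding abs_mult using C1(2)[OF L k k] by (simp add: X_def Z_def mult_left_mono)
  also have "\<dots> = C1 / k" using kp(3) by (simp add: mult.left_commute)
  finally show ?thesis by (simp add: Z_def)
 qed
 have int: "integrable lborel (\<lambda>y. \<mu> y * L (probe k y) * L (probe k y))" if L: "part L" and k: "1 \<le> k" for L k
 proof (rule integrable_csupp[OF \<kappa>_simps(2)])
  have "continuous_on UNIV (\<lambda>y. L (probe k y))" by (rule csmooth_continuous[OF csmooth_part[OF L k]])
  thus "continuous_on UNIV (\<lambda>y. \<mu> y * L (probe k y) * L (probe k y))"
   using smooth_on_continuous[OF \<mu>_smooth(2)] by (intro continuous_intros)
  show "\<mu> y * L (probe k y) * L (probe k y) = 0" if "y \<notin> supp \<kappa>" for y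
   using that csmooth_part[OF L k] by (simp add: csmooth_def)
 qed
 define G where "G k = (LBINT y. \<mu> y * (norm (probe k y))\<^sup>2)" for k
 have G: "G k = (LBINT y. \<mu> y * Re (probe k y) * Re (probe k y)) + (LBINT y. \<mu> y * Im (probe k y) * Im (probe k y))" if "1 \<le> k" for k
  unfolding G_def cmod_power2
  by (subst Bochner_Integration.integral_add[symmetric]) (use int[of Re] int[of Im] that in \<open>auto simp: part_def power2_eq_square algebra_simps\<close>)
 have d: "((\<lambda>k. (LINT \<omega>|M. (datum Re k \<omega>)\<^sup>2) + (LINT \<omega>|M. (datum Im k \<omega>)\<^sup>2) - G k) \<longlongrightarrow> 0) at_top"
 proof (rule Lim_null_comparison[where g="\<lambda>k. 2 * C1 / k"])
  show "\<forall>\<^sub>F k in at_top. norm ((LINT \<omega>|M. (datum Re k \<omega>)\<^sup>2) + (LINT \<omega>|M. (datum Im k \<omega>)\<^sup>2) - G k) \<le> 2 * C1 / k"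
  proof (rule eventually_mono[OF eventually_ge_at_top[of 1]])
   fix k :: real assume k: "1 \<le> k"
   show "norm ((LINT \<omega>|M. (datum Re k \<omega>)\<^sup>2) + (LINT \<omega>|M. (datum Im k \<omega>)\<^sup>2) - G k) \<le> 2 * C1 / k"
    using var[of Re, OF _ k] var[of Im, OF _ k] unfolding G[OF k] real_norm_def by (simp add: part_def)
  qed
  show "((\<lambda>k. 2 * C1 / k) \<longlongrightarrow> 0) at_top" by real_asymp
 qed
 have "(G \<longlongrightarrow> (LBINT y. \<mu> y * (\<bar>\<kappa> y\<bar> * (a * norm (y - x) powr (- p)))\<^sup>2)) at_top"
  unfolding G_def
 proof -
  obtain C where C: "C > 0" "\<And>k y. 1 \<le> k ==> norm (probe k y) \<le> C" using probe_bound[of 0] by metis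
  have \<mu>c: "continuous_on UNIV \<mu>" by (rule smooth_on_continuous[OF \<mu>_smooth(2)])
  have \<kappa>c: "continuous_on UNIV \<kappa>" by (rule smooth_on_continuous[OF \<kappa>_simps(1)])
  have [measurable]: "\<mu> \<in> borel_measurable borel" "\<kappa> \<in> borel_measurable borel"
   using borel_measurable_continuous_onI \<mu>c \<kappa>c by blast+
  have pm: "(\<lambda>y. \<mu> y * (norm (probe (max 1 k) y))\<^sup>2) \<in> borel_measurable lborel" for k
   using csmooth_measurable[OF csmooth_probe[of "max 1 k"]] by measurable
  have "((\<lambda>k. LBINT y. \<mu> y * (norm (probe (max 1 k) y))\<^sup>2) \<longlongrightarrow> (LBINT y. \<mu> y * (\<bar>\<kappa> y\<bar> * (a * norm (y - x) powr (- p)))\<^sup>2)) at_top"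
  proof (rule integral_dominated_convergence_at_top[where w="\<lambda>y. \<bar>\<mu> y\<bar> * C\<^sup>2"])
   show "integrable lborel (\<lambda>y. \<bar>\<mu> y\<bar> * C\<^sup>2)"
    by (intro integrable_mult_left integrable_abs integrable_csupp[OF \<mu>_smooth(3) \<mu>c] supp_zero)
   show "\<forall>\<^sub>F k in at_top. AE y in lborel. norm (\<mu> y * (norm (probe (max 1 k) y))\<^sup>2) \<le> \<bar>\<mu> y\<bar> * C\<^sup>2"
   proof (intro always_eventually allI AE_I2)
    fix k y
    have "(norm (probe (max 1 k) y))\<^sup>2 \<le> C\<^sup>2" by (intro power_mono C) auto
    thus "norm (\<mu> y * (norm (probe (max 1 k) y))\<^sup>2) \<le> \<bar>\<mu> y\<bar> * C\<^sup>2"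
     by (simp add: abs_mult mult_left_mono)
   qed
   show "AE y in lborel. ((\<lambda>k. \<mu> y * (norm (probe (max 1 k) y))\<^sup>2) \<longlongrightarrow> \<mu> y * (\<bar>\<kappa> y\<bar> * (a * norm (y - x) powr (- p)))\<^sup>2) at_top"
   proof (rule AE_I2)
    fix y :: 'a
    show "((\<lambda>k. \<mu> y * (norm (probe (max 1 k) y))\<^sup>2) \<longlongrightarrow> \<mu> y * (\<bar>\<kappa> y\<bar> * (a * norm (y - x) powr (- p)))\<^sup>2) at_top"
    proof (cases "y \<in> V")
     case True
     have "((\<lambda>k. norm (amp (max 1 k) y)) \<longlongrightarrow> \<bar>\<kappa> y\<bar> * (a * norm (y - x) powr (- p))) at_top"
      by (rule Lim_transform_eventually[OF amp_limit[OF True]])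
       (auto intro!: eventually_mono[OF eventually_ge_at_top[of 1]] simp: max_def)
     thus ?thesis unfolding probe_def norm_wave by (intro tendsto_intros)
    next
     case False
     hence "\<mu> y = 0" using \<mu>_simps(2,3) by blast
     thus ?thesis by simp
    qed
   qed
   show "(\<lambda>y. \<mu> y * (\<bar>\<kappa> y\<bar> * (a * norm (y - x) powr (- p)))\<^sup>2) \<in> borel_measurable lborel" by measurable
  qed (use pm in auto)
  thus "((\<lambda>k. LBINT y. \<mu> y * (norm (probe k y))\<^sup>2) \<longlongrightarrow> (LBINT y. \<mu> y * (\<bar>\<kappa> y\<bar> * (a * norm (y - x) powr (- p)))\<^sup>2)) at_top"
   by (rule Lim_transform_eventually) (auto intro!: eventually_mono[OF eventually_ge_at_top[of 1]] simp: max_def)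
 qed
 moreover have "(LBINT y. \<mu> y * (\<bar>\<kappa> y\<bar> * (a * norm (y - x) powr (- p)))\<^sup>2) = T_data D \<mu> x"
 proof -
  \<comment> \<open>Since 2 p = d - 1, the square of r^(- p) is the kernel of \<open>T_data\<close>,
    and a^2 is its constant.\<close>
  have e: "\<mu> y * (\<bar>\<kappa> y\<bar> * (a * norm (y - x) powr (- p)))\<^sup>2 = a\<^sup>2 * (indicator D y *\<^sub>R (1 / norm (x - y) ^ (DIM('a) - 1) * \<mu> y))" for y
  proof (cases "y \<in> D")
   case True
   hence r: "0 < norm (y - x)" using V_ne \<mu>_simps(3) by fastforce
   have "(norm (y - x) powr (- p))\<^sup>2 = norm (y - x) powr (- (p + p))"
    by (simp add: power2_eq_square powr_add[symmetric])
   also have "p + p = real (DIM('a) - 1)" unfolding p using DIM_positive[where 'a='a] by (simp add: of_nat_diff Suc_leI)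
   also have "norm (y - x) powr (- real (DIM('a) - 1)) = 1 / norm (x - y) ^ (DIM('a) - 1)"
    unfolding powr_minus powr_realpow[OF r] by (simp add: norm_minus_commute divide_inverse)
   finally show ?thesis using True \<mu>_simps(4)[OF True] by (simp add: power_mult_distrib)
  qed (simp add: \<mu>_simps)
  show ?thesis
   unfolding e T_data_def set_lebesgue_integral_def a(2)[symmetric] by (rule integral_mult_right_zero)
 qed
 ultimately have "(G \<longlongrightarrow> T_data D \<mu> x) at_top" by simp
 from tendsto_add[OF d this] show ?thesis by simp
qed


lemma datum_average:
 "AE \<omega> in M. ((\<lambda>T. 1 / T * (LBINT k:{T..2*T}. (datum Re k \<omega>)\<^sup>2 + (datum Im k \<omega>)\<^sup>2)) \<longlongrightarrow> T_data D \<mu> x) at_top"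
proof -
 obtain C where C: "C \<ge> 0" "\<And>L k l. part L ==> 1 \<le> k ==> 1 \<le> l ==>
  \<bar>LINT \<omega>|M. datum L k \<omega> * datum L l \<omega>\<bar> \<le> C * (1 / (1 + \<bar>k - l\<bar>) + 1 / min k l)"
  by (rule datum_decay) blast
 define v where "v L k = (LINT \<omega>|M. (datum L (max 1 k) \<omega>)\<^sup>2)" for L and k :: real
 have vm: "v L \<in> borel_measurable borel"
  and av: "AE \<omega> in M. ((\<lambda>T. 1 / T * (LBINT k:{T..2*T}. (datum L k \<omega>)\<^sup>2) - 1 / T * (LBINT k:{T..2*T}. v L k)) \<longlongrightarrow> 0) at_top"
  if L: "part L" for L
  using gaussian_process_average[OF field(1) datum_continuous[OF L] datum_gaussian[OF L] C(2)[OF L]] unfolding v_def by blast+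
 have vb: "\<bar>v L k\<bar> \<le> 2 * C" if L: "part L" for L k
 proof -
  have "\<bar>v L k\<bar> \<le> C * (1 / (1 + \<bar>max 1 k - max 1 k\<bar>) + 1 / min (max 1 k) (max 1 k))"
   unfolding v_def power2_eq_square by (rule C(2)[OF L]) auto
  also have "\<dots> \<le> C * (1 + 1)" using C(1) by (intro mult_left_mono add_mono) auto
  finally show ?thesis by simp
 qed
 have vi: "set_integrable lborel {T..2*T} (v L)" if L: "part L" for L T
  unfolding set_integrable_def
 proof (rule Bochner_Integration.integrable_bound)
  show "integrable lborel (\<lambda>k. 2 * C * indicator {T..2*T} k)" by (intro integrable_mult_right integrable_real_indicator) (simp_all add: emeasure_lborel_Icc_eq)
  show "(\<lambda>k. indicator {T..2*T} k *\<^sub>R v L k) \<in> borel_measurable lborel" using vm[OF L] by measurable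
  show "AE k in lborel. norm (indicator {T..2*T} k *\<^sub>R v L k) \<le> norm (2 * C * indicator {T..2*T} k)"
   using vb[OF L] C(1) by (auto simp: indicator_def)
 qed
 have g: "((\<lambda>T. 1 / T * (LBINT k:{T..2*T}. v Re k + v Im k)) \<longlongrightarrow> T_data D \<mu> x) at_top"
 proof (rule running_average_limit)
  show "(\<lambda>k. v Re k + v Im k) \<in> borel_measurable borel"
   using vm[of Re] vm[of Im] by (simp add: part_def)
  show "((\<lambda>k. v Re k + v Im k) \<longlongrightarrow> T_data D \<mu> x) at_top"
   by (rule Lim_transform_eventually[OF variance_limit])
    (auto intro!: eventually_mono[OF eventually_ge_at_top[of 1]] simp: v_def max_def)
 qed
 have pR: "part Re" and pI: "part Im" by (simp_all add: part_def)
 have sp: "AE \<omega> in M. \<omega> \<in> space M" by (rule AE_space)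
 show ?thesis
  using av[OF pR] av[OF pI] sp
 proof eventually_elim
  fix \<omega> assume 1: "((\<lambda>T. 1 / T * (LBINT k:{T..2*T}. (datum Re k \<omega>)\<^sup>2) - 1 / T * (LBINT k:{T..2*T}. v Re k)) \<longlongrightarrow> 0) at_top"
   and 2: "((\<lambda>T. 1 / T * (LBINT k:{T..2*T}. (datum Im k \<omega>)\<^sup>2) - 1 / T * (LBINT k:{T..2*T}. v Im k)) \<longlongrightarrow> 0) at_top"
   and \<omega>: "\<omega> \<in> space M"
  have di: "set_integrable lborel {T..2*T} (\<lambda>k. (datum L k \<omega>)\<^sup>2)" if "part L" "1 \<le> T" for L T
  proof (rule borel_integrable_atLeastAtMost')
   have "continuous_on {T..2*T} (\<lambda>k. datum L k \<omega>)"
    by (rule continuous_on_subset[OF datum_continuous[OF that(1) \<omega>]]) (use that in auto)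
   thus "continuous_on {T..2*T} (\<lambda>k. (datum L k \<omega>)\<^sup>2)" by (intro continuous_intros)
  qed
  have "((\<lambda>T. (1 / T * (LBINT k:{T..2*T}. (datum Re k \<omega>)\<^sup>2) - 1 / T * (LBINT k:{T..2*T}. v Re k))
   + (1 / T * (LBINT k:{T..2*T}. (datum Im k \<omega>)\<^sup>2) - 1 / T * (LBINT k:{T..2*T}. v Im k))
   + 1 / T * (LBINT k:{T..2*T}. v Re k + v Im k)) \<longlongrightarrow> 0 + 0 + T_data D \<mu> x) at_top"
   by (intro tendsto_add 1 2 g)
  hence "((\<lambda>T. (1 / T * (LBINT k:{T..2*T}. (datum Re k \<omega>)\<^sup>2) - 1 / T * (LBINT k:{T..2*T}. v Re k))
   + (1 / T * (LBINT k:{T..2*T}. (datum Im k \<omega>)\<^sup>2) - 1 / T * (LBINT k:{T..2*T}. v Im k))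
   + 1 / T * (LBINT k:{T..2*T}. v Re k + v Im k)) \<longlongrightarrow> T_data D \<mu> x) at_top" by simp
  thus "((\<lambda>T. 1 / T * (LBINT k:{T..2*T}. (datum Re k \<omega>)\<^sup>2 + (datum Im k \<omega>)\<^sup>2)) \<longlongrightarrow> T_data D \<mu> x) at_top"
  proof (rule Lim_transform_eventually, intro eventually_mono[OF eventually_ge_at_top[of 1]])
   fix T :: real assume T: "1 \<le> T"
   show "(1 / T * (LBINT k:{T..2*T}. (datum Re k \<omega>)\<^sup>2) - 1 / T * (LBINT k:{T..2*T}. v Re k))
   + (1 / T * (LBINT k:{T..2*T}. (datum Im k \<omega>)\<^sup>2) - 1 / T * (LBINT k:{T..2*T}. v Im k))
   + 1 / T * (LBINT k:{T..2*T}. v Re k + v Im k) = 1 / T * (LBINT k:{T..2*T}. (datum Re k \<omega>)\<^sup>2 + (datum Im k \<omega>)\<^sup>2)"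
    unfolding set_integral_add(2)[OF vi[OF pR] vi[OF pI]] set_integral_add(2)[OF di[OF pR T] di[OF pI T]]
    by (simp add: algebra_simps)
  qed
 qed
qed

text \<open>\<open>pairing\<close> uses an arbitrarily chosen cutoff h, the probe uses
  \<open>\<kappa>\<close>. Both are 1 near the closure of D, where the realization is supported, so
  the values agree.\<close>

lemma pairing_datum:
 assumes k: "1 \<le> k" and \<omega>: "\<omega> \<in> space M"
 shows "k powr (m + 7 - real DIM('a)) * (cmod (pairing (closure D) (f \<omega>) (fund_sol k x)))\<^sup>2 = (datum Re k \<omega>)\<^sup>2 + (datum Im k \<omega>)\<^sup>2"
proof -
 have k0: "0 < k" using k by simp
 have F: "distribution (f \<omega>)" "distribution_supported_in (closure D) (f \<omega>)" using field \<omega> by auto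
 define h where "h = (SOME h. is_cutoff (closure D) (fund_sol k x) h)"
 have "is_cutoff (closure D) (fund_sol k x) \<kappa>"
  unfolding is_cutoff_def using V(1) smooth_fund_sol[OF k0] \<kappa> W by blast
 hence "is_cutoff (closure D) (fund_sol k x) h" unfolding h_def by (rule someI[where P="is_cutoff (closure D) (fund_sol k x)"])
 then obtain S V' where S: "open S" "smooth_on S (fund_sol k x)" "h \<in> test_fun S"
  and V': "open V'" "closure D \<subseteq> V'" "\<And>y. y \<in> V' ==> h y = 1"
  unfolding is_cutoff_def by blast
 have DV: "closure D \<subseteq> V"
 proof
  fix y assume "y \<in> closure D"
  hence "\<kappa> y = 1" using W by blast
  thus "y \<in> V" using \<kappa>_simps(4)[of y] by force
 qed
 define q where "q = k powr (p + (4 - real DIM('a)))"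
 have dat: "datum L k \<omega> = k powr (m / 2) * (q * f \<omega> (\<lambda>y. h y * L (fund_sol k x y)))" if L: "part L" for L
 proof -
  have t: "(\<lambda>y. h y * L (fund_sol k x y)) \<in> test_fun UNIV"
   by (rule test_fun_mono[OF test_fun_cutoff[OF S(3,1) smooth_on_bounded_linear[OF S(1) part(1)[OF L] S(2)]] subset_UNIV])
  have "f \<omega> (\<lambda>y. L (probe k y)) = f \<omega> (\<lambda>y. q * (h y * L (fund_sol k x y)))"
  proof (rule distribution_support_cong[OF F test_fun_part[OF L k]])
   show "(\<lambda>y. q * (h y * L (fund_sol k x y))) \<in> test_fun UNIV"
    using test_fun_lincomb[OF t t, of q 0] by simp
   show "open (V' \<inter> W \<inter> V)" "closure D \<subseteq> V' \<inter> W \<inter> V" using V' W V DV by auto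
   fix y assume y: "y \<in> V' \<inter> W \<inter> V"
   have "probe k y = cor q * fund_sol k x y"
    using y W(3) by (simp add: probe_osc osc_fund_sol[OF k0] q_def powr_add)
   thus "L (probe k y) = q * (h y * L (fund_sol k x y))"
    using y V'(3) by (simp add: part(2)[OF L])
  qed
  also have "\<dots> = q * f \<omega> (\<lambda>y. h y * L (fund_sol k x y))"
   using distribution_scale[OF F(1) t, of q] by simp
  finally show ?thesis by (simp add: datum_def)
 qed
 have "k powr (m + 7 - real DIM('a)) = (k powr (m / 2) * q)\<^sup>2"
 proof -
  \<comment> \<open>The origin of the exponent: m / 2 from the normalisation of the data and p + 4 -
    d from the passage from Phi to the probe, doubled by squaring, with 2 p = d - 1.\<close>
  have "m / 2 + (p + (4 - real DIM('a))) + (m / 2 + (p + (4 - real DIM('a)))) = m + 7 - real DIM('a)"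
   by (simp add: p field_simps)
  thus ?thesis unfolding q_def power2_eq_square powr_add[symmetric] by (simp only:)
 qed
 moreover have "(cmod (pairing (closure D) (f \<omega>) (fund_sol k x)))\<^sup>2 =
   (f \<omega> (\<lambda>y. h y * Re (fund_sol k x y)))\<^sup>2 + (f \<omega> (\<lambda>y. h y * Im (fund_sol k x y)))\<^sup>2"
  unfolding pairing_def Let_def h_def[symmetric] cmod_power2 by simp
 ultimately show ?thesis
  using dat[of Re] dat[of Im] by (simp add: part_def power_mult_distrib algebra_simps)
qed

end

section \<open>From the set-up at one point to the theorem\<close>

lemma scattering_exists:
 fixes D :: "'a::euclidean_space set"
 assumes d: "DIM('a) \<in> {2, 3}" and D: "open D" "bounded D" and x: "x \<notin> closure D"
  and f: "centered_microlocally_isotropic M D (- m) \<mu> f"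
 obtains V \<rho> \<kappa> W p a A B where "scattering x V \<rho> \<kappa> D W p m a A B M f \<mu>"
proof -
 have "\<exists>e>0. ball x e \<subseteq> - closure D"
  using x open_contains_ball_eq[of "- closure D" x] by (simp add: open_Compl)
 then obtain e where e: "e > 0" "ball x e \<inter> closure D = {}" by blast
 have cD: "compact (closure D)" using D(2) by (simp add: compact_closure)
 then obtain R where R: "closure D \<subseteq> ball 0 R"
  using bounded_subset_ballD[OF compact_imp_bounded] by blast
 \<comment> \<open>Removing only radius e / 2 around x, while D keeps distance e, leaves room for a
   cutoff that is 1 near the closure of D, and bounds |y - x| below on V.\<close>
 define V where "V = ball 0 R - cball x (e / 2)"
 have "closure D \<subseteq> V"
 proof
  fix y assume y: "y \<in> closure D"
  hence "e \<le> dist x y" using e(2) by (auto simp: disjoint_iff not_less)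
  thus "y \<in> V" using R y e(1) by (auto simp: V_def)
 qed
 moreover have oV: "open V" by (simp add: V_def open_Diff)
 ultimately obtain \<kappa> W where \<kappa>: "\<kappa> \<in> test_fun V" "open W" "closure D \<subseteq> W" "\<And>y. y \<in> W ==> \<kappa> y = 1"
  using cutoff_exists[OF cD] by metis
 have "annulus x V (supp \<kappa>) (e / 2)"
 proof
  show "bounded V" unfolding V_def by (rule bounded_subset[OF bounded_ball]) blast
  show "e / 2 \<le> norm (y - x)" if "y \<in> V" for y
   using that by (simp add: V_def dist_norm norm_minus_commute)
 qed (use \<kappa>(1) e oV in \<open>auto simp: test_fun_def\<close>)
 moreover obtain A B a where "symbol_tower ((real DIM('a) - 1) / 2) A" "symbol_tower ((real DIM('a) - 1) / 2) B"
  "((\<lambda>t. t powr ((real DIM('a) - 1) / 2) * norm (A 0 (cor t))) \<longlongrightarrow> a) at_top"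
  "a\<^sup>2 = 1 / (16 * (2 * pi) ^ (DIM('a) - 1))"
  "\<And>k (x::'a) y. 0 < k ==> x \<noteq> y ==> cor (k powr (4 - real DIM('a))) * fund_sol k x y =
   ei (k * norm (y - x)) * A 0 (cor (k * norm (y - x))) -
   exp (- cor (k * norm (y - x))) * B 0 (cor (k * norm (y - x)))"
  by (rule fund_sol_towers[OF d]) blast
 ultimately have "scattering x V (e / 2) \<kappa> D W ((real DIM('a) - 1) / 2) m a A B M f \<mu>"
  unfolding scattering_def scattering_axioms_def using \<kappa> D(1) f by simp
 thus thesis by (rule that)
qed

lemma strength_unique:
 fixes D U :: "'a::euclidean_space set"
 assumes d: "2 \<le> DIM('a)" and D: "D \<inter> U = {}" and U: "open U" "U \<noteq> {}"
  and \<mu>: "\<mu>1 \<in> test_fun D" "\<mu>2 \<in> test_fun D" and eq: "\<And>x. x \<in> U ==> T_data D \<mu>1 x = T_data D \<mu>2 x"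
 shows "\<mu>1 = \<mu>2"
proof -
 define g where "g = (\<lambda>y. 1 * \<mu>1 y + (-1) * \<mu>2 y)"
 define K where "K = supp \<mu>1 \<union> supp \<mu>2"
 have c: "continuous_on UNIV \<mu>1" "continuous_on UNIV \<mu>2"
  using \<mu> smooth_on_continuous by (auto simp: test_fun_def)
 have z: "\<mu>1 y = 0" "\<mu>2 y = 0" if "y \<notin> D" for y
  using \<mu> that supp_zero[of y \<mu>1] supp_zero[of y \<mu>2] by (auto simp: test_fun_def)
 have K: "compact K" "K \<subseteq> D" "\<forall>y. y \<notin> K \<longrightarrow> g y = 0"
  using \<mu> by (auto simp: K_def test_fun_def g_def supp_zero)
 have "g = (\<lambda>_. 0)"
 proof (rule potential_unique[OF _ K(1,3) U _ d])
  show "continuous_on UNIV g" unfolding g_def using c by (intro continuous_intros)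
  show "U \<inter> K = {}" using K(2) D by blast
  fix x assume x: "x \<in> U"
  have r: "rpow (1 - real DIM('a)) (x - y) = 1 / norm (x - y) ^ (DIM('a) - 1)" if "y \<in> D" for y
  proof -
   have n: "0 < norm (x - y)" using x that D by auto
   have "rpow (1 - real DIM('a)) (x - y) = (norm (x - y) powr 2) powr ((1 - real DIM('a)) / 2)"
    unfolding rpow_def using n by (simp add: power2_norm_eq_inner)
   also have "\<dots> = norm (x - y) powr - real (DIM('a) - 1)"
   proof -
    have "2 * ((1 - real DIM('a)) / 2) = - real (DIM('a) - 1)" using d by (simp add: of_nat_diff)
    thus ?thesis unfolding powr_powr by (simp only:)
   qed
   also have "\<dots> = 1 / norm (x - y) ^ (DIM('a) - 1)"
    unfolding powr_minus powr_realpow[OF n] by (simp add: divide_inverse)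
   finally show ?thesis .
  qed
  have i: "set_integrable lborel D (\<lambda>y. 1 / norm (x - y) ^ (DIM('a) - 1) * \<nu> y)" if \<nu>: "\<nu> \<in> test_fun D" for \<nu>
  proof -
   have \<nu>c: "continuous_on UNIV \<nu>" and \<nu>K: "compact (supp \<nu>)" "supp \<nu> \<subseteq> D"
    using \<nu> smooth_on_continuous by (auto simp: test_fun_def)
   have "integrable lborel (\<lambda>y. indicator (supp \<nu>) y *\<^sub>R (1 / norm (x - y) ^ (DIM('a) - 1) * \<nu> y))"
   proof (rule borel_integrable_compact[OF \<nu>K(1)])
    show "continuous_on (supp \<nu>) (\<lambda>y. 1 / norm (x - y) ^ (DIM('a) - 1) * \<nu> y)"
     using \<nu>K(2) x D by (intro continuous_intros continuous_on_subset[OF \<nu>c]) auto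
   qed
   moreover have "indicator (supp \<nu>) y *\<^sub>R (1 / norm (x - y) ^ (DIM('a) - 1) * \<nu> y) = indicator D y *\<^sub>R (1 / norm (x - y) ^ (DIM('a) - 1) * \<nu> y)" for y
    using \<nu>K(2) supp_zero[of y \<nu>] by (auto simp: indicator_def)
   ultimately show ?thesis by (simp only: set_integrable_def)
  qed
  have "(LBINT y. g y * rpow (1 - real DIM('a)) (x - y)) =
    (LBINT y:D. 1 / norm (x - y) ^ (DIM('a) - 1) * \<mu>1 y - 1 / norm (x - y) ^ (DIM('a) - 1) * \<mu>2 y)"
   unfolding set_lebesgue_integral_def
  proof (rule Bochner_Integration.integral_cong[OF refl])
   fix y
   show "g y * rpow (1 - real DIM('a)) (x - y) = indicator D y *\<^sub>R (1 / norm (x - y) ^ (DIM('a) - 1) * \<mu>1 y - 1 / norm (x - y) ^ (DIM('a) - 1) * \<mu>2 y)"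
    by (cases "y \<in> D") (simp_all add: r g_def z diff_divide_distrib)
  qed
  also have "\<dots> = 0"
   unfolding set_integral_diff(2)[OF i[OF \<mu>(1)] i[OF \<mu>(2)]] using eq[OF x] by (simp add: T_data_def)
  finally show "(LBINT y. g y * rpow (1 - real DIM('a)) (x - y)) = 0" .
 qed
 thus ?thesis by (simp add: g_def fun_eq_iff)
qed

theorem theorem1p1:
  fixes D U :: "'a::euclidean_space set"
    and m r0 :: real
    and M :: "'w measure"
    and f :: "'w \<Rightarrow> ('a \<Rightarrow> real) \<Rightarrow> real"
    and \<mu> :: "'a \<Rightarrow> real"
    and udist :: "'w \<Rightarrow> real \<Rightarrow> ('a \<Rightarrow> real) \<Rightarrow> complex"
    and u :: "'w \<Rightarrow> real \<Rightarrow> 'a \<Rightarrow> complex"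
  assumes "DIM('a) \<in> {2, 3}"
    and "real DIM('a) - 6 < m" and "m \<le> real DIM('a)"
    and "bounded_domain D"
    and "centered_microlocally_isotropic M D (- m) \<mu> f"
    and "bounded_domain U"
    and "setdist D U = r0" and "r0 > 0"
    and "\<And>\<omega> k. \<omega> \<in> space M \<Longrightarrow> k > 0 \<Longrightarrow> outgoing_solution D (f \<omega>) k (udist \<omega> k) (u \<omega> k)"
  shows "(\<forall>x\<in>U. AE \<omega> in M.
            ((\<lambda>T. 1 / T * (LINT k:{T..2*T}|lborel.
                 k powr (m + 7 - real DIM('a)) * (cmod (u \<omega> k x))\<^sup>2))
               \<longlongrightarrow> T_data D \<mu> x) at_top) \<and>
         (\<forall>\<mu>1 \<mu>2. is_strength D \<mu>1 \<and> is_strength D \<mu>2 \<and>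
            (\<forall>x\<in>U. T_data D \<mu>1 x = T_data D \<mu>2 x) \<longrightarrow> \<mu>1 = \<mu>2)"
proof (intro conjI ballI allI impI)
 have sd: "0 < setdist D U" using assms(7,8) by simp
 have D: "open D" "bounded D" and U: "open U" "U \<noteq> {}"
  using assms(4,6) by (auto simp: bounded_domain_def)
 fix x assume x: "x \<in> U"
 \<comment> \<open>The positive distance keeps even the closure of D away from x, where the
   pointwise formula for u is available.\<close>
 have xD: "x \<notin> closure D"
 proof
  assume "x \<in> closure D"
  hence "setdist {x} D = 0" by (auto simp: setdist_eq_0_sing_1)
  thus False using setdist_subset_left[of "{x}" U D] x sd by (simp add: setdist_sym[of D U])
 qed
 obtain V \<rho> \<kappa> W p a A B where "scattering x V \<rho> \<kappa> D W p m a A B M f \<mu>"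
  using scattering_exists[OF assms(1) D xD assms(5)] by blast
 then interpret scattering x V \<rho> \<kappa> D W p m a A B M f \<mu> .
 show "AE \<omega> in M. ((\<lambda>T. 1 / T * (LBINT k:{T..2*T}. k powr (m + 7 - real DIM('a)) * (cmod (u \<omega> k x))\<^sup>2)) \<longlongrightarrow> T_data D \<mu> x) at_top"
  using datum_average AE_space
 proof eventually_elim
  fix \<omega> assume lim: "((\<lambda>T. 1 / T * (LBINT k:{T..2*T}. (datum Re k \<omega>)\<^sup>2 + (datum Im k \<omega>)\<^sup>2)) \<longlongrightarrow> T_data D \<mu> x) at_top"
   and \<omega>: "\<omega> \<in> space M"
  show "((\<lambda>T. 1 / T * (LBINT k:{T..2*T}. k powr (m + 7 - real DIM('a)) * (cmod (u \<omega> k x))\<^sup>2)) \<longlongrightarrow> T_data D \<mu> x) at_top"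
  proof (rule Lim_transform_eventually[OF lim], rule eventually_mono[OF eventually_ge_at_top[of 1]])
   \<comment> \<open>The limit sees only T >= 1, and then every k in [T, 2 T] is at least 1, the
     range in which the data were analysed.\<close>
   fix T :: real assume T: "1 \<le> T"
   have "(datum Re k \<omega>)\<^sup>2 + (datum Im k \<omega>)\<^sup>2 = k powr (m + 7 - real DIM('a)) * (cmod (u \<omega> k x))\<^sup>2" if "k \<in> {T..2*T}" for k
   proof -
    have k: "1 \<le> k" using that T by simp
    have "u \<omega> k x = - pairing (closure D) (f \<omega>) (\<lambda>y. fund_sol k x y)"
     using assms(9)[OF \<omega>, of k] k xD by (simp add: outgoing_solution_def)
    thus ?thesis using pairing_datum[OF k \<omega>] by simp
   qed
   thus "1 / T * (LBINT k:{T..2*T}. (datum Re k \<omega>)\<^sup>2 + (datum Im k \<omega>)\<^sup>2) =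
     1 / T * (LBINT k:{T..2*T}. k powr (m + 7 - real DIM('a)) * (cmod (u \<omega> k x))\<^sup>2)"
    by (intro arg_cong[where f="\<lambda>z. 1 / T * z"] set_lebesgue_integral_cong) auto
  qed
 qed
next
 fix \<mu>1 \<mu>2 assume s: "is_strength D \<mu>1 \<and> is_strength D \<mu>2 \<and> (\<forall>x\<in>U. T_data D \<mu>1 x = T_data D \<mu>2 x)"
 have "D \<inter> U = {}"
 proof (rule ccontr)
  assume "D \<inter> U \<noteq> {}"
  then obtain y where "y \<in> D" "y \<in> U" by blast
  hence "setdist D U \<le> dist y y" by (rule setdist_le_dist)
  thus False using assms(7,8) by simp
 qed
 thus "\<mu>1 = \<mu>2"
  using strength_unique[of D U \<mu>1 \<mu>2] assms(1,6) s by (auto simp: bounded_domain_def is_strength_def)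
qed

end
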